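(* Let $G$ be a group with a ramification data $\mathfrak{r}=\sum_{C\in\mathcal{C}}\mathfrak{r}_C C$ and let $K$ be an arbitrary field. Then $$\mathrm{sr}(L_K(\Gamma_{G,\mathfrak{r}}))=\begin{cases}1 & \text{if } S_{G,\mathfrak{r}} \text{ is not a submonoid of } G;\\ \infty & \text{if } \sum_{C\in\mathcal{C}}\mathfrak{r}_C|C|\ge 2 \text{ and } S_{G,\mathfrak{r}} \text{ is a finite subgroup of } G;\\ 2 & \text{otherwise.}\end{cases}$$
   Context: Leavitt path algebra. A (directed) graph $E=(E^0,E^1,r,s)$ consists of disjoint sets $E^0$ (vertices) and $E^1$ (edges) and maps $r,s:E^1\to E^0$ (range, source). For a field $K$, $L_K(E)$ is the (not necessarily unital) associative $K$-algebra generated by $E^0\cup E^1\cup\{e^*: e\in E^1\}$ subject to, for all $v,w\in E^0$ and $e,f\in E^1$: (i) $vw=\delta_{v,w}w$; (ii) $s(e)e=e=e\,r(e)$ and $r(e)e^*=e^*=e^*s(e)$; (iii) $e^*f=\delta_{e,f}r(e)$; (iv) $v=\sum_{e\in s^{-1}(v)}ee^*$ for every vertex $v$ with $0<|s^{-1}(v)|<\infty$. Hopf graphs. Let $G$ be a group and $\mathcal{C}$ its set of conjugacy classes. A ramification data of $G$ is a function $\mathfrak{r}:\mathcal{C}\to\mathbb{N}=\{0,1,2,\dots\}$, written $\mathfrak{r}=\sum_{C\in\mathcal{C}}\mathfrak{r}_C C$ with $\mathfrak{r}_C=\mathfrak{r}(C)$; $\mathrm{supp}(\mathfrak{r})=\{C:\mathfrak{r}_C>0\}$.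 The Hopf graph $\Gamma_{G,\mathfrak{r}}$ has vertex set $G$ and, for each $x\in G$, $C\in\mathcal{C}$ and $c\in C$, exactly $\mathfrak{r}_C$ edges from $x$ to $xc$. $S_{G,\mathfrak{r}}$ is the subsemigroup of $G$ generated by $\bigcup_{C\in\mathrm{supp}(\mathfrak{r})}C$ (empty if $\mathfrak{r}=0$); it is a submonoid of $G$ if it contains $1_G$. The sum $\sum_{C}\mathfrak{r}_C|C|$ is a cardinal, possibly infinite. Stable rank (Vaserstein). Let $R$ be an associative ring and $S$ a unital ring containing $R$ as a two-sided ideal. A vector $(a_i)_{i=1}^n$ in $S$ is $R$-unimodular if $a_1-1\in R$, $a_i\in R$ for $i>1$, and there exist $b_1,\dots,b_n\in S$ with $b_1-1\in R$, $b_i\in R$ for $i>1$, such that $\sum_{i=1}^n a_ib_i=1$. The stable rank $\mathrm{sr}(R)$ is the least integer $m\ge 1$ such that for every $R$-unimodular vector $(a_i)_{i=1}^{m+1}$ there exist $r_1,\dots,r_m\in R$ such that $(a_i+a_{m+1}r_i)_{i=1}^m$ is $R$-unimodular; if no such $m$ exists, $\mathrm{sr}(R)=\infty$. (It does not depend on the choice of $S$.) *)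

theory Defs
  imports
    "HOL-Algebra.QuotRing"
    "HOL-Library.Extended_Nat"
    "Graph_Theory.Digraph"
begin

unbundle cardinal_syntax

section \<open>Stable rank of a ring without unit\<close>

definition unimodular :: "('a, 'm) ring_scheme \<Rightarrow> 'a set \<Rightarrow> nat \<Rightarrow> (nat \<Rightarrow> 'a) \<Rightarrow> bool"
  where "unimodular S R n a \<longleftrightarrow>
    a \<in> {1..n} \<rightarrow> carrier S \<and> a 1 \<ominus>\<^bsub>S\<^esub> \<one>\<^bsub>S\<^esub> \<in> R \<and> (\<forall>i\<in>{2..n}. a i \<in> R) \<and>
    (\<exists>b \<in> {1..n} \<rightarrow> carrier S. b 1 \<ominus>\<^bsub>S\<^esub> \<one>\<^bsub>S\<^esub> \<in> R \<and> (\<forall>i\<in>{2..n}. b i \<in> R) \<and>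
       (\<Oplus>\<^bsub>S\<^esub>i\<in>{1..n}. a i \<otimes>\<^bsub>S\<^esub> b i) = \<one>\<^bsub>S\<^esub>)"

definition stable_range :: "('a, 'm) ring_scheme \<Rightarrow> 'a set \<Rightarrow> nat \<Rightarrow> bool"
  where "stable_range S R m \<longleftrightarrow>
    (\<forall>a. unimodular S R (m + 1) a \<longrightarrow>
       (\<exists>r \<in> {1..m} \<rightarrow> R. unimodular S R m (\<lambda>i. a i \<oplus>\<^bsub>S\<^esub> a (m + 1) \<otimes>\<^bsub>S\<^esub> r i)))"

text \<open>
  The stable rank of a two-sided ideal \<open>R\<close> of a unital ring \<open>S\<close>, where \<open>R\<close> is regarded as an
  associative ring in its own right.  By \<open>stable_rank_independent\<close> below it depends only on the
  ring \<open>R\<close>.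
\<close>
definition stable_rank :: "('a, 'm) ring_scheme \<Rightarrow> 'a set \<Rightarrow> enat"
  where "stable_rank S R =
    (if \<exists>m\<ge>1. stable_range S R m then enat (LEAST m. m \<ge> 1 \<and> stable_range S R m) else \<infinity>)"


section \<open>Leavitt path algebras\<close>

text \<open>
  The free unital algebra \<open>K\<langle>X\<rangle>\<close>: finitely supported functions from words over \<open>X\<close> to \<open>K\<close>, with
  convolution along the factorisations of a word into a prefix and a suffix.
\<close>
definition free_algebra :: "('k, 'm) ring_scheme \<Rightarrow> 'x set \<Rightarrow> ('x list \<Rightarrow> 'k) ring"
  where "free_algebra K X =
   \<lparr>carrier = {f. range f \<subseteq> carrier K \<and> finite {w. f w \<noteq> \<zero>\<^bsub>K\<^esub>} \<and> {w. f w \<noteq> \<zero>\<^bsub>K\<^esub>} \<subseteq> lists X},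
    mult = (\<lambda>f g w. \<Oplus>\<^bsub>K\<^esub>i\<in>{..length w}. f (take i w) \<otimes>\<^bsub>K\<^esub> g (drop i w)),
    one = (\<lambda>w. if w = [] then \<one>\<^bsub>K\<^esub> else \<zero>\<^bsub>K\<^esub>),
    zero = (\<lambda>w. \<zero>\<^bsub>K\<^esub>),
    add = (\<lambda>f g w. f w \<oplus>\<^bsub>K\<^esub> g w)\<rparr>"

definition free_gen :: "('k, 'm) ring_scheme \<Rightarrow> 'x \<Rightarrow> 'x list \<Rightarrow> 'k"
  where "free_gen K x = (\<lambda>w. if w = [x] then \<one>\<^bsub>K\<^esub> else \<zero>\<^bsub>K\<^esub>)"

datatype ('v, 'e) leavitt_gen = Vert 'v | Edge 'e | Ghost 'e

text \<open>
  A graph is a \<^typ>\<open>('v, 'e) pre_digraph\<close> whose edge maps send \<^const>\<open>arcs\<close> to \<^const>\<open>verts\<close>;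
  \<^const>\<open>tail\<close> is the source map and \<^const>\<open>head\<close> the range map.
\<close>
definition leavitt_gens :: "('v, 'e) pre_digraph \<Rightarrow> ('v, 'e) leavitt_gen set"
  where "leavitt_gens E = Vert ` verts E \<union> Edge ` arcs E \<union> Ghost ` arcs E"

abbreviation leavitt_free ::
  "('k, 'm) ring_scheme \<Rightarrow> ('v, 'e) pre_digraph \<Rightarrow> (('v, 'e) leavitt_gen list \<Rightarrow> 'k) ring"
  where "leavitt_free K E \<equiv> free_algebra K (leavitt_gens E)"

text \<open>A relation \<open>p = q\<close> is encoded as the element \<open>p - q\<close> of the free algebra.\<close>
definition leavitt_relations ::
  "('k, 'm) ring_scheme \<Rightarrow> ('v, 'e) pre_digraph \<Rightarrow> (('v, 'e) leavitt_gen list \<Rightarrow> 'k) set"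
  where "leavitt_relations K E =
   (let F = leavitt_free K E;
        V = (\<lambda>v. free_gen K (Vert v));
        X = (\<lambda>e. free_gen K (Edge e));
        Y = (\<lambda>e. free_gen K (Ghost e))
    in {V v \<otimes>\<^bsub>F\<^esub> V w \<ominus>\<^bsub>F\<^esub> (if v = w then V w else \<zero>\<^bsub>F\<^esub>) | v w. v \<in> verts E \<and> w \<in> verts E} \<union>
       {V (tail E e) \<otimes>\<^bsub>F\<^esub> X e \<ominus>\<^bsub>F\<^esub> X e | e. e \<in> arcs E} \<union>
       {X e \<otimes>\<^bsub>F\<^esub> V (head E e) \<ominus>\<^bsub>F\<^esub> X e | e. e \<in> arcs E} \<union>
       {V (head E e) \<otimes>\<^bsub>F\<^esub> Y e \<ominus>\<^bsub>F\<^esub> Y e | e. e \<in> arcs E} \<union>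
       {Y e \<otimes>\<^bsub>F\<^esub> V (tail E e) \<ominus>\<^bsub>F\<^esub> Y e | e. e \<in> arcs E} \<union>
       {Y e \<otimes>\<^bsub>F\<^esub> X f \<ominus>\<^bsub>F\<^esub> (if e = f then V (head E e) else \<zero>\<^bsub>F\<^esub>) | e f. e \<in> arcs E \<and> f \<in> arcs E} \<union>
       {V v \<ominus>\<^bsub>F\<^esub> (\<Oplus>\<^bsub>F\<^esub>e\<in>out_arcs E v. X e \<otimes>\<^bsub>F\<^esub> Y e) | v.
          v \<in> verts E \<and> out_arcs E v \<noteq> {} \<and> finite (out_arcs E v)})"

abbreviation leavitt_ideal ::
  "('k, 'm) ring_scheme \<Rightarrow> ('v, 'e) pre_digraph \<Rightarrow> (('v, 'e) leavitt_gen list \<Rightarrow> 'k) set"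
  where "leavitt_ideal K E \<equiv> Idl\<^bsub>leavitt_free K E\<^esub> (leavitt_relations K E)"

text \<open>
  The non-unital free algebra on the generators is the set of elements of \<^const>\<open>leavitt_free\<close>
  without constant term.  It contains the relations, and the ideal they generate in it is the ideal
  they generate in the unital free algebra.  So \<open>L\<^sub>K(E)\<close> is the image of the non-unital free
  algebra in the quotient of the unital one; that quotient \<open>K \<oplus> L\<^sub>K(E)\<close> is a unital ring
  containing \<open>L\<^sub>K(E)\<close> as a two-sided ideal.
\<close>
definition leavitt_unitization ::
  "('k, 'm) ring_scheme \<Rightarrow> ('v, 'e) pre_digraph \<Rightarrow> (('v, 'e) leavitt_gen list \<Rightarrow> 'k) set ring"
  where "leavitt_unitization K E = leavitt_free K E Quot leavitt_ideal K E"

definition leavitt_path_algebra ::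
  "('k, 'm) ring_scheme \<Rightarrow> ('v, 'e) pre_digraph \<Rightarrow> (('v, 'e) leavitt_gen list \<Rightarrow> 'k) set set"
  where "leavitt_path_algebra K E =
    {leavitt_ideal K E +>\<^bsub>leavitt_free K E\<^esub> f | f. f \<in> carrier (leavitt_free K E) \<and> f [] = \<zero>\<^bsub>K\<^esub>}"


section \<open>Hopf graphs\<close>

definition conj_classes :: "('g, 'm) monoid_scheme \<Rightarrow> 'g set set"
  where "conj_classes G =
    (\<lambda>c. {g \<otimes>\<^bsub>G\<^esub> c \<otimes>\<^bsub>G\<^esub> inv\<^bsub>G\<^esub> g | g. g \<in> carrier G}) ` carrier G"

text \<open>
  Ramification data are functions \<open>r\<close> on sets of group elements, of which only the values on
  conjugacy classes are ever used.  The arc \<open>(x, c, i)\<close> is the \<open>i\<close>-th edge from \<open>x\<close> to \<open>xc\<close>.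
\<close>
definition hopf_graph ::
  "('g, 'm) monoid_scheme \<Rightarrow> ('g set \<Rightarrow> nat) \<Rightarrow> ('g, 'g \<times> 'g \<times> nat) pre_digraph"
  where "hopf_graph G r =
   \<lparr>verts = carrier G,
    arcs = {(x, c, i). x \<in> carrier G \<and> (\<exists>C \<in> conj_classes G. c \<in> C \<and> i < r C)},
    tail = (\<lambda>(x, c, i). x),
    head = (\<lambda>(x, c, i). x \<otimes>\<^bsub>G\<^esub> c)\<rparr>"

definition ram_supp :: "('g, 'm) monoid_scheme \<Rightarrow> ('g set \<Rightarrow> nat) \<Rightarrow> 'g set set"
  where "ram_supp G r = {C \<in> conj_classes G. r C > 0}"

inductive_set subsemigroup_generated :: "('g, 'm) monoid_scheme \<Rightarrow> 'g set \<Rightarrow> 'g set"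
  for G A
  where
    incl: "a \<in> A \<Longrightarrow> a \<in> subsemigroup_generated G A"
  | mult: "\<lbrakk>a \<in> subsemigroup_generated G A; b \<in> subsemigroup_generated G A\<rbrakk> \<Longrightarrow>
           a \<otimes>\<^bsub>G\<^esub> b \<in> subsemigroup_generated G A"

definition ram_semigroup :: "('g, 'm) monoid_scheme \<Rightarrow> ('g set \<Rightarrow> nat) \<Rightarrow> 'g set"
  where "ram_semigroup G r = subsemigroup_generated G (\<Union>(ram_supp G r))"

text \<open>
  The sum of the cardinals \<open>r C \<cdot> |C|\<close> over all conjugacy classes \<open>C\<close>; a sum of cardinals is the
  cardinality of a disjoint union.
\<close>
definition ram_total :: "('g, 'm) monoid_scheme \<Rightarrow> ('g set \<Rightarrow> nat) \<Rightarrow> ('g set \<times> nat \<times> 'g) rel"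
  where "ram_total G r = |SIGMA C : conj_classes G. {..<r C} \<times> C|"


section \<open>Well-definedness\<close>

subsection \<open>The free algebra is a ring\<close>

context ring
begin

abbreviation (input) conv :: "('x list \<Rightarrow> 'a) \<Rightarrow> ('x list \<Rightarrow> 'a) \<Rightarrow> 'x list \<Rightarrow> 'a"
  where "conv f g \<equiv> (\<lambda>w. \<Oplus>i\<in>{..length w}. f (take i w) \<otimes> g (drop i w))"

lemma conv_closed:
  assumes "range f \<subseteq> carrier R" "range g \<subseteq> carrier R"
  shows "conv f g w \<in> carrier R"
proof -
  have "f u \<in> carrier R" "g u \<in> carrier R" for u using assms by auto
  then show ?thesis by (intro finsum_closed) auto
qed

lemma conv_range:
  assumes "range f \<subseteq> carrier R" "range g \<subseteq> carrier R"
  shows "range (conv f g) \<subseteq> carrier R"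
  using conv_closed[OF assms] by auto

lemma conv_Nil:
  assumes "range f \<subseteq> carrier R" "range g \<subseteq> carrier R"
  shows "conv f g [] = f [] \<otimes> g []"
proof -
  have "f [] \<in> carrier R" "g [] \<in> carrier R" using assms by auto
  then show ?thesis by simp
qed

lemma conv_Cons:
  assumes "range f \<subseteq> carrier R" "range g \<subseteq> carrier R"
  shows "conv f g (x # w) = f [] \<otimes> g (x # w) \<oplus> conv (\<lambda>u. f (x # u)) g w"
proof -
  have *: "f u \<in> carrier R" "g u \<in> carrier R" for u using assms by auto
  have "conv f g (x # w) =
      (\<Oplus>i\<in>{..Suc (length w)}. f (take i (x # w)) \<otimes> g (drop i (x # w)))" by simp
  also have "\<dots> = (\<Oplus>i\<in>{..length w}. f (take (Suc i) (x # w)) \<otimes> g (drop (Suc i) (x # w)))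
      \<oplus> f (take 0 (x # w)) \<otimes> g (drop 0 (x # w))"
    using * by (intro finsum_Suc2) auto
  also have "\<dots> = conv (\<lambda>u. f (x # u)) g w \<oplus> f [] \<otimes> g (x # w)" by simp
  finally show ?thesis using * by (simp add: a_comm)
qed

lemma conv_add_left:
  assumes "range f \<subseteq> carrier R" "range g \<subseteq> carrier R" "range h \<subseteq> carrier R"
  shows "conv (\<lambda>u. f u \<oplus> g u) h w = conv f h w \<oplus> conv g h w"
proof -
  have *: "f u \<in> carrier R" "g u \<in> carrier R" "h u \<in> carrier R" for u using assms by auto
  have "conv (\<lambda>u. f u \<oplus> g u) h w =
      (\<Oplus>i\<in>{..length w}. f (take i w) \<otimes> h (drop i w) \<oplus> g (take i w) \<otimes> h (drop i w))"
    using * by (simp add: l_distr)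
  then show ?thesis using * by (simp add: finsum_addf)
qed

lemma conv_add_right:
  assumes "range f \<subseteq> carrier R" "range g \<subseteq> carrier R" "range h \<subseteq> carrier R"
  shows "conv h (\<lambda>u. f u \<oplus> g u) w = conv h f w \<oplus> conv h g w"
proof -
  have *: "f u \<in> carrier R" "g u \<in> carrier R" "h u \<in> carrier R" for u using assms by auto
  have "conv h (\<lambda>u. f u \<oplus> g u) w =
      (\<Oplus>i\<in>{..length w}. h (take i w) \<otimes> f (drop i w) \<oplus> h (take i w) \<otimes> g (drop i w))"
    using * by (simp add: r_distr)
  then show ?thesis using * by (simp add: finsum_addf)
qed

lemma conv_scale_left:
  assumes "c \<in> carrier R" "range f \<subseteq> carrier R" "range g \<subseteq> carrier R"
  shows "conv (\<lambda>u. c \<otimes> f u) g w = c \<otimes> conv f g w"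
proof -
  have *: "f u \<in> carrier R" "g u \<in> carrier R" for u using assms by auto
  have "c \<otimes> conv f g w = (\<Oplus>i\<in>{..length w}. c \<otimes> (f (take i w) \<otimes> g (drop i w)))"
    using * assms(1) by (intro finsum_rdistr) auto
  then show ?thesis using * assms(1) by (simp add: m_assoc)
qed

lemma conv_assoc:
  assumes "range f \<subseteq> carrier R" "range g \<subseteq> carrier R" "range h \<subseteq> carrier R"
  shows "conv (conv f g) h w = conv f (conv g h) w"
  using assms(1)
proof (induction w arbitrary: f)
  case Nil
  have *: "f u \<in> carrier R" "g u \<in> carrier R" "h u \<in> carrier R" for u using assms Nil by auto
  then show ?case by (simp add: m_assoc)
next
  case (Cons x w)
  have *: "f u \<in> carrier R" "g u \<in> carrier R" "h u \<in> carrier R" for u using assms Cons by auto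
  have fx: "range (\<lambda>u. f (x # u)) \<subseteq> carrier R" and gx: "range (\<lambda>u. g (x # u)) \<subseteq> carrier R"
    using * by auto
  note fg = conv_range
  have fgx: "range (\<lambda>u. f [] \<otimes> g (x # u)) \<subseteq> carrier R" using * by auto
  have "conv (conv f g) h (x # w) =
      f [] \<otimes> g [] \<otimes> h (x # w) \<oplus> conv (\<lambda>u. conv f g (x # u)) h w"
    using conv_Cons[OF fg[OF Cons.prems assms(2)] assms(3)] * by simp
  also have "(\<lambda>u. conv f g (x # u)) = (\<lambda>u. f [] \<otimes> g (x # u) \<oplus> conv (\<lambda>u. f (x # u)) g u)"
    using conv_Cons[OF Cons.prems assms(2)] by (intro ext)
  also have "conv \<dots> h w = f [] \<otimes> conv (\<lambda>u. g (x # u)) h w \<oplus> conv (conv (\<lambda>u. f (x # u)) g) h w"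
    using conv_add_left[OF fgx fg[OF fx assms(2)] assms(3)]
      conv_scale_left[OF *(1) gx assms(3)] by simp
  also have "conv (conv (\<lambda>u. f (x # u)) g) h w = conv (\<lambda>u. f (x # u)) (conv g h) w"
    by (rule Cons.IH[OF fx])
  finally have "conv (conv f g) h (x # w) = f [] \<otimes> g [] \<otimes> h (x # w) \<oplus>
      (f [] \<otimes> conv (\<lambda>u. g (x # u)) h w \<oplus> conv (\<lambda>u. f (x # u)) (conv g h) w)" .
  also have "\<dots> = f [] \<otimes> (g [] \<otimes> h (x # w) \<oplus> conv (\<lambda>u. g (x # u)) h w)
      \<oplus> conv (\<lambda>u. f (x # u)) (conv g h) w"
    using * conv_closed[OF gx assms(3)] conv_closed[OF fx fg[OF assms(2,3)]]
    by (simp only: r_distr m_assoc a_assoc m_closed)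
  also have "\<dots> = conv f (conv g h) (x # w)"
    using conv_Cons[OF Cons.prems fg[OF assms(2,3)]] conv_Cons[OF assms(2,3)] by simp
  finally show ?case .
qed

lemma conv_one_left:
  assumes "range f \<subseteq> carrier R"
  shows "conv (\<lambda>w. if w = [] then \<one> else \<zero>) f w = f w"
proof -
  have *: "f u \<in> carrier R" for u using assms by auto
  have o: "range (\<lambda>w. if w = [] then \<one> else \<zero>) \<subseteq> carrier R" by auto
  show ?thesis
  proof (cases w)
    case Nil then show ?thesis using * by simp
  next
    case (Cons x v)
    show ?thesis unfolding Cons conv_Cons[OF o assms] using * by simp
  qed
qed

lemma conv_one_right:
  assumes "range f \<subseteq> carrier R"
  shows "conv f (\<lambda>w. if w = [] then \<one> else \<zero>) w = f w"
  using assms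
proof (induction w arbitrary: f)
  case Nil
  then have "f [] \<in> carrier R" by auto
  then show ?case by simp
next
  case (Cons x w)
  have *: "f u \<in> carrier R" for u using Cons by auto
  have o: "range (\<lambda>w. if w = [] then \<one> else \<zero>) \<subseteq> carrier R" by auto
  have fx: "range (\<lambda>u. f (x # u)) \<subseteq> carrier R" using * by auto
  show ?case unfolding conv_Cons[OF Cons.prems o] Cons.IH[OF fx] using * by simp
qed

lemma conv_support:
  assumes "range f \<subseteq> carrier R" "range g \<subseteq> carrier R"
  shows "{w. conv f g w \<noteq> \<zero>} \<subseteq> (\<lambda>(u, v). u @ v) ` ({w. f w \<noteq> \<zero>} \<times> {w. g w \<noteq> \<zero>})"
proof
  fix w assume "w \<in> {w. conv f g w \<noteq> \<zero>}"
  then have ne: "conv f g w \<noteq> \<zero>" by simp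
  have *: "f u \<in> carrier R" "g u \<in> carrier R" for u using assms by auto
  have "\<exists>i. f (take i w) \<otimes> g (drop i w) \<noteq> \<zero>"
  proof (rule ccontr)
    assume "\<not> ?thesis"
    then have "conv f g w = \<zero>" by simp
    with ne show False by simp
  qed
  then obtain i where "f (take i w) \<otimes> g (drop i w) \<noteq> \<zero>" ..
  then have "f (take i w) \<noteq> \<zero>" "g (drop i w) \<noteq> \<zero>" using * by auto
  then show "w \<in> (\<lambda>(u, v). u @ v) ` ({w. f w \<noteq> \<zero>} \<times> {w. g w \<noteq> \<zero>})"
    by (intro image_eqI[of _ _ "(take i w, drop i w)"]) auto
qed

lemma free_algebra_carrierI:
  assumes "\<And>w. f w \<in> carrier R" "{w. f w \<noteq> \<zero>} \<subseteq> A" "finite A" "A \<subseteq> lists X"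
  shows "f \<in> carrier (free_algebra R X)"
proof -
  have "finite {w. f w \<noteq> \<zero>}" using assms(2,3) by (rule finite_subset)
  then show ?thesis using assms unfolding free_algebra_def by (simp add: image_subset_iff)
qed

lemma free_algebra_carrierD:
  assumes "f \<in> carrier (free_algebra R X)"
  shows "range f \<subseteq> carrier R" "f w \<in> carrier R" "finite {w. f w \<noteq> \<zero>}" "{w. f w \<noteq> \<zero>} \<subseteq> lists X"
  using assms unfolding free_algebra_def by auto

lemma free_algebra_simps:
  "f \<otimes>\<^bsub>free_algebra R X\<^esub> g = conv f g"
  "f \<oplus>\<^bsub>free_algebra R X\<^esub> g = (\<lambda>w. f w \<oplus> g w)"
  "\<one>\<^bsub>free_algebra R X\<^esub> = (\<lambda>w. if w = [] then \<one> else \<zero>)"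
  "\<zero>\<^bsub>free_algebra R X\<^esub> = (\<lambda>w. \<zero>)"
  by (simp_all add: free_algebra_def)

theorem free_algebra_ring: "ring (free_algebra R X)"
proof (rule ringI)
  let ?F = "free_algebra R X"
  note D = free_algebra_carrierD
  have add: "f \<oplus>\<^bsub>?F\<^esub> g \<in> carrier ?F" if "f \<in> carrier ?F" "g \<in> carrier ?F" for f g
    unfolding free_algebra_simps
    by (rule free_algebra_carrierI[where A = "{w. f w \<noteq> \<zero>} \<union> {w. g w \<noteq> \<zero>}"])
      (use D[OF that(1)] D[OF that(2)] in auto)
  show "abelian_group ?F"
  proof (rule abelian_groupI)
    show "\<zero>\<^bsub>?F\<^esub> \<in> carrier ?F"
      unfolding free_algebra_simps by (rule free_algebra_carrierI[where A = "{}"]) auto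
  next
    fix f assume f: "f \<in> carrier ?F"
    show "\<exists>g\<in>carrier ?F. g \<oplus>\<^bsub>?F\<^esub> f = \<zero>\<^bsub>?F\<^esub>"
    proof
      show "(\<lambda>w. \<ominus> f w) \<in> carrier ?F"
        by (rule free_algebra_carrierI[where A = "{w. f w \<noteq> \<zero>}"]) (use D[OF f] in auto)
      show "(\<lambda>w. \<ominus> f w) \<oplus>\<^bsub>?F\<^esub> f = \<zero>\<^bsub>?F\<^esub>"
        unfolding free_algebra_simps using D(2)[OF f] by (simp add: l_neg)
    qed
  next
    fix f g assume "f \<in> carrier ?F" "g \<in> carrier ?F"
    then show "f \<oplus>\<^bsub>?F\<^esub> g \<in> carrier ?F" by (rule add)
  next
    fix f g h assume "f \<in> carrier ?F" "g \<in> carrier ?F" "h \<in> carrier ?F"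
    from this[THEN D(2)] show "f \<oplus>\<^bsub>?F\<^esub> g \<oplus>\<^bsub>?F\<^esub> h = f \<oplus>\<^bsub>?F\<^esub> (g \<oplus>\<^bsub>?F\<^esub> h)"
      unfolding free_algebra_simps by (intro ext a_assoc)
  next
    fix f g assume "f \<in> carrier ?F" "g \<in> carrier ?F"
    from this[THEN D(2)] show "f \<oplus>\<^bsub>?F\<^esub> g = g \<oplus>\<^bsub>?F\<^esub> f"
      unfolding free_algebra_simps by (intro ext a_comm)
  next
    fix f assume "f \<in> carrier ?F"
    from D(2)[OF this] show "\<zero>\<^bsub>?F\<^esub> \<oplus>\<^bsub>?F\<^esub> f = f"
      unfolding free_algebra_simps by (intro ext l_zero)
  qed
  show "Group.monoid ?F"
  proof (rule monoidI)
    fix f g assume fg: "f \<in> carrier ?F" "g \<in> carrier ?F"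
    show "f \<otimes>\<^bsub>?F\<^esub> g \<in> carrier ?F"
      unfolding free_algebra_simps
    proof (rule free_algebra_carrierI)
      show "conv f g w \<in> carrier R" for w using fg by (intro conv_closed D)
      show "{w. conv f g w \<noteq> \<zero>} \<subseteq> (\<lambda>(u, v). u @ v) ` ({w. f w \<noteq> \<zero>} \<times> {w. g w \<noteq> \<zero>})"
        by (rule conv_support[OF D(1)[OF fg(1)] D(1)[OF fg(2)]])
      show "finite ((\<lambda>(u, v). u @ v) ` ({w. f w \<noteq> \<zero>} \<times> {w. g w \<noteq> \<zero>}))"
        using D(3)[OF fg(1)] D(3)[OF fg(2)] by simp
      show "(\<lambda>(u, v). u @ v) ` ({w. f w \<noteq> \<zero>} \<times> {w. g w \<noteq> \<zero>}) \<subseteq> lists X"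
        using D(4)[OF fg(1)] D(4)[OF fg(2)] by (auto simp: subset_iff in_lists_conv_set)
    qed
  next
    show "\<one>\<^bsub>?F\<^esub> \<in> carrier ?F"
      unfolding free_algebra_simps by (rule free_algebra_carrierI[where A = "{[]}"]) auto
  next
    fix f g h assume "f \<in> carrier ?F" "g \<in> carrier ?F" "h \<in> carrier ?F"
    then show "f \<otimes>\<^bsub>?F\<^esub> g \<otimes>\<^bsub>?F\<^esub> h = f \<otimes>\<^bsub>?F\<^esub> (g \<otimes>\<^bsub>?F\<^esub> h)"
      unfolding free_algebra_simps by (intro ext conv_assoc D(1))
  next
    fix f assume "f \<in> carrier ?F"
    from D(1)[OF this] have "conv (\<lambda>w. if w = [] then \<one> else \<zero>) f w = f w"
      "conv f (\<lambda>w. if w = [] then \<one> else \<zero>) w = f w" for w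
      by (rule conv_one_left, rule conv_one_right)
    then show "\<one>\<^bsub>?F\<^esub> \<otimes>\<^bsub>?F\<^esub> f = f" "f \<otimes>\<^bsub>?F\<^esub> \<one>\<^bsub>?F\<^esub> = f"
      unfolding free_algebra_simps by auto
  qed
  fix f g h assume "f \<in> carrier ?F" "g \<in> carrier ?F" "h \<in> carrier ?F"
  then show "(f \<oplus>\<^bsub>?F\<^esub> g) \<otimes>\<^bsub>?F\<^esub> h = f \<otimes>\<^bsub>?F\<^esub> h \<oplus>\<^bsub>?F\<^esub> g \<otimes>\<^bsub>?F\<^esub> h"
    "h \<otimes>\<^bsub>?F\<^esub> (f \<oplus>\<^bsub>?F\<^esub> g) = h \<otimes>\<^bsub>?F\<^esub> f \<oplus>\<^bsub>?F\<^esub> h \<otimes>\<^bsub>?F\<^esub> g"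
    unfolding free_algebra_simps by (auto intro!: ext conv_add_left conv_add_right dest!: D(1))
qed

end


subsection \<open>The Leavitt path algebra is an ideal of its unitization\<close>

context ring
begin

lemma free_gen_closed: "x \<in> X \<Longrightarrow> free_gen R x \<in> carrier (free_algebra R X)"
  by (rule free_algebra_carrierI[where A = "{[x]}"]) (auto simp: free_gen_def)

definition augmentation_ideal :: "'x set \<Rightarrow> ('x list \<Rightarrow> 'a) set"
  where "augmentation_ideal X = {f \<in> carrier (free_algebra R X). f [] = \<zero>}"

lemma ideal_augmentation_ideal: "ideal (augmentation_ideal X) (free_algebra R X)"
proof -
  interpret F: ring "free_algebra R X" by (rule free_algebra_ring)
  have Nil: "(f \<otimes>\<^bsub>free_algebra R X\<^esub> g) [] = f [] \<otimes> g []"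
    if "f \<in> carrier (free_algebra R X)" "g \<in> carrier (free_algebra R X)" for f g
    unfolding free_algebra_simps
    by (rule conv_Nil[OF free_algebra_carrierD(1)[OF that(1)] free_algebra_carrierD(1)[OF that(2)]])
  have inv: "(\<ominus>\<^bsub>free_algebra R X\<^esub> f) [] = \<zero>"
    if f: "f \<in> carrier (free_algebra R X)" "f [] = \<zero>" for f
  proof -
    have "(\<ominus>\<^bsub>free_algebra R X\<^esub> f \<oplus>\<^bsub>free_algebra R X\<^esub> f) [] = \<zero>\<^bsub>free_algebra R X\<^esub> []"
      using F.l_neg[OF f(1)] by simp
    then show ?thesis
      using f(2) free_algebra_carrierD(2)[OF F.a_inv_closed[OF f(1)], of "[]"]
      by (simp add: free_algebra_simps)
  qed
  show ?thesis
  proof (rule idealI)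
    show "ring (free_algebra R X)" by (rule free_algebra_ring)
    show "subgroup (augmentation_ideal X) (add_monoid (free_algebra R X))"
    proof (rule F.add.subgroupI)
      show "augmentation_ideal X \<noteq> {}"
        using F.zero_closed by (auto simp: augmentation_ideal_def free_algebra_simps)
    next
      fix f assume "f \<in> augmentation_ideal X"
      then show "\<ominus>\<^bsub>free_algebra R X\<^esub> f \<in> augmentation_ideal X"
        by (auto simp: augmentation_ideal_def inv)
    next
      fix f g assume "f \<in> augmentation_ideal X" "g \<in> augmentation_ideal X"
      moreover from this have "f \<oplus>\<^bsub>free_algebra R X\<^esub> g \<in> carrier (free_algebra R X)"
        by (auto simp: augmentation_ideal_def)
      ultimately show "f \<oplus>\<^bsub>free_algebra R X\<^esub> g \<in> augmentation_ideal X"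
        by (auto simp: augmentation_ideal_def free_algebra_simps)
    qed (auto simp: augmentation_ideal_def)
  qed (auto simp: augmentation_ideal_def Nil free_algebra_carrierD)
qed

lemma free_gen_augmentation_ideal: "x \<in> X \<Longrightarrow> free_gen R x \<in> augmentation_ideal X"
  using free_gen_closed by (auto simp: augmentation_ideal_def free_gen_def)

lemma leavitt_relations_augmentation_ideal:
  fixes E :: "('v, 'e) pre_digraph"
  assumes "wf_digraph E"
  shows "leavitt_relations R E \<subseteq> augmentation_ideal (leavitt_gens E)"
proof -
  interpret wf_digraph E by fact
  interpret A: ideal "augmentation_ideal (leavitt_gens E)" "leavitt_free R E"
    by (rule ideal_augmentation_ideal)
  have V: "free_gen R (Vert v) \<in> augmentation_ideal (leavitt_gens E)" if "v \<in> verts E" for v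
    by (rule free_gen_augmentation_ideal) (use that in \<open>auto simp: leavitt_gens_def\<close>)
  have X: "free_gen R (Edge e) \<in> augmentation_ideal (leavitt_gens E)" if "e \<in> arcs E" for e
    by (rule free_gen_augmentation_ideal) (use that in \<open>auto simp: leavitt_gens_def\<close>)
  have Y: "free_gen R (Ghost e) \<in> augmentation_ideal (leavitt_gens E)" if "e \<in> arcs E" for e
    by (rule free_gen_augmentation_ideal) (use that in \<open>auto simp: leavitt_gens_def\<close>)
  have minus: "f \<ominus>\<^bsub>leavitt_free R E\<^esub> g \<in> augmentation_ideal (leavitt_gens E)"
    if "f \<in> augmentation_ideal (leavitt_gens E)" "g \<in> augmentation_ideal (leavitt_gens E)" for f g
    using that by (simp add: a_minus_def)
  have mult: "f \<otimes>\<^bsub>leavitt_free R E\<^esub> g \<in> augmentation_ideal (leavitt_gens E)"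
    if "f \<in> augmentation_ideal (leavitt_gens E)" "g \<in> augmentation_ideal (leavitt_gens E)" for f g
    using that A.I_l_closed A.a_subset by blast
  have sum: "(\<Oplus>\<^bsub>leavitt_free R E\<^esub>e\<in>I. h e) \<in> augmentation_ideal (leavitt_gens E)"
    if "finite I" "\<And>e. e \<in> I \<Longrightarrow> h e \<in> augmentation_ideal (leavitt_gens E)" for h and I :: "'e set"
    using that
  proof (induction I)
    case (insert e I)
    then have "h \<in> I \<rightarrow> carrier (leavitt_free R E)" "h e \<in> carrier (leavitt_free R E)"
      using A.a_subset by auto
    with insert show ?case by simp
  qed simp
  show ?thesis
    unfolding leavitt_relations_def Let_def
    by (auto intro!: minus mult sum V X Y simp: in_out_arcs_conv)
qed

theorem leavitt_path_algebra_ideal: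
  assumes "wf_digraph E"
  shows "ideal (leavitt_path_algebra R E) (leavitt_unitization R E)"
proof -
  interpret F: ring "leavitt_free R E" by (rule free_algebra_ring)
  interpret A: ideal "augmentation_ideal (leavitt_gens E)" "leavitt_free R E"
    by (rule ideal_augmentation_ideal)
  interpret I: ideal "leavitt_ideal R E" "leavitt_free R E"
    using leavitt_relations_augmentation_ideal[OF assms] A.a_subset by (intro F.genideal_ideal) blast
  interpret h: ring_hom_ring "leavitt_free R E" "leavitt_unitization R E"
    "(+>\<^bsub>leavitt_free R E\<^esub>) (leavitt_ideal R E)"
    unfolding leavitt_unitization_def by (rule I.rcos_ring_hom_ring)
  have L: "leavitt_path_algebra R E =
      (+>\<^bsub>leavitt_free R E\<^esub>) (leavitt_ideal R E) ` augmentation_ideal (leavitt_gens E)"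
    unfolding leavitt_path_algebra_def augmentation_ideal_def image_def by blast
  have surj: "\<exists>f\<in>carrier (leavitt_free R E). x = leavitt_ideal R E +>\<^bsub>leavitt_free R E\<^esub> f"
    if "x \<in> carrier (leavitt_unitization R E)" for x
    using that unfolding leavitt_unitization_def FactRing_def A_RCOSETS_def' by simp
  show ?thesis
  proof (rule idealI)
    show "ring (leavitt_unitization R E)" by (rule h.S.ring_axioms)
    show "subgroup (leavitt_path_algebra R E) (add_monoid (leavitt_unitization R E))"
      unfolding L by (rule h.img_is_add_subgroup[OF A.a_subgroup])
  next
    fix a x assume "a \<in> leavitt_path_algebra R E" "x \<in> carrier (leavitt_unitization R E)"
    then obtain f g where fg: "f \<in> augmentation_ideal (leavitt_gens E)"
      "a = leavitt_ideal R E +>\<^bsub>leavitt_free R E\<^esub> f" "g \<in> carrier (leavitt_free R E)"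
      "x = leavitt_ideal R E +>\<^bsub>leavitt_free R E\<^esub> g"
      using surj unfolding L by blast
    have "f \<in> carrier (leavitt_free R E)" using fg(1) A.a_subset by auto
    show "x \<otimes>\<^bsub>leavitt_unitization R E\<^esub> a \<in> leavitt_path_algebra R E"
      "a \<otimes>\<^bsub>leavitt_unitization R E\<^esub> x \<in> leavitt_path_algebra R E"
      unfolding L fg(2,4) h.hom_mult[OF fg(3) \<open>f \<in> carrier _\<close>, symmetric]
        h.hom_mult[OF \<open>f \<in> carrier _\<close> fg(3), symmetric]
      by (rule imageI[OF A.I_l_closed[OF fg(1,3)]], rule imageI[OF A.I_r_closed[OF fg(1,3)]])
  qed
qed

end

lemma (in group) wf_digraph_hopf_graph: "wf_digraph (hopf_graph G r)"
  by unfold_locales (auto simp: hopf_graph_def conj_classes_def)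


subsection \<open>Independence of the ambient unital ring\<close>

definition quasi_unimodular :: "('a, 'm) ring_scheme \<Rightarrow> 'a set \<Rightarrow> nat \<Rightarrow> (nat \<Rightarrow> 'a) \<Rightarrow> bool"
  where "quasi_unimodular S R n x \<longleftrightarrow> x \<in> {1..n} \<rightarrow> R \<and>
    (\<exists>y \<in> {1..n} \<rightarrow> R.
       x 1 \<oplus>\<^bsub>S\<^esub> y 1 \<oplus>\<^bsub>S\<^esub> x 1 \<otimes>\<^bsub>S\<^esub> y 1 \<oplus>\<^bsub>S\<^esub> (\<Oplus>\<^bsub>S\<^esub>i\<in>{2..n}. x i \<otimes>\<^bsub>S\<^esub> y i) = \<zero>\<^bsub>S\<^esub>)"

context ideal
begin

definition shift :: "(nat \<Rightarrow> 'a) \<Rightarrow> nat \<Rightarrow> 'a"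
  where "shift x = x(1 := \<one> \<oplus> x 1)"

lemma one_plus_minus:
  assumes "b \<in> carrier R"
  shows "\<one> \<oplus> (b \<ominus> \<one>) = b"
proof -
  have "\<one> \<oplus> (b \<oplus> \<ominus> \<one>) = b \<oplus> (\<one> \<oplus> \<ominus> \<one>)"
    using assms by (intro a_lcomm) auto
  then show ?thesis using assms by (simp add: a_minus_def r_neg)
qed

lemma shift_minus:
  assumes "x 1 \<in> carrier R"
  shows "shift x 1 \<ominus> \<one> = x 1"
proof -
  have "\<one> \<oplus> x 1 \<oplus> \<ominus> \<one> = x 1 \<oplus> (\<one> \<oplus> \<ominus> \<one>)"
    using assms by (simp only: a_assoc a_comm a_lcomm one_closed a_inv_closed a_closed)
  then show ?thesis using assms by (simp add: shift_def a_minus_def r_neg)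
qed

lemma shift_sum:
  assumes "n \<ge> 1" "x \<in> {1..n} \<rightarrow> I" "y \<in> {1..n} \<rightarrow> I"
  shows "(\<Oplus>i\<in>{1..n}. shift x i \<otimes> shift y i) =
    \<one> \<oplus> (x 1 \<oplus> y 1 \<oplus> x 1 \<otimes> y 1 \<oplus> (\<Oplus>i\<in>{2..n}. x i \<otimes> y i))"
proof -
  have I: "x i \<in> carrier R" "y i \<in> carrier R" if "i \<in> {1..n}" for i
    using assms that a_subset by auto
  have 1: "x 1 \<in> carrier R" "y 1 \<in> carrier R" using I[of 1] assms(1) by auto
  have T: "(\<Oplus>i\<in>{2..n}. x i \<otimes> y i) \<in> carrier R" using I by (intro finsum_closed) auto
  have split: "{1..n} = insert 1 {2..n}" using assms(1) by auto
  have "(\<Oplus>i\<in>{1..n}. shift x i \<otimes> shift y i) =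
      shift x 1 \<otimes> shift y 1 \<oplus> (\<Oplus>i\<in>{2..n}. shift x i \<otimes> shift y i)"
    unfolding split using I 1 by (intro finsum_insert) (auto simp: shift_def)
  also have "(\<Oplus>i\<in>{2..n}. shift x i \<otimes> shift y i) = (\<Oplus>i\<in>{2..n}. x i \<otimes> y i)"
    using I by (intro finsum_cong') (auto simp: shift_def)
  also have "shift x 1 \<otimes> shift y 1 = \<one> \<oplus> (x 1 \<oplus> y 1 \<oplus> x 1 \<otimes> y 1)"
    using 1 by (simp add: shift_def l_distr r_distr a_ac)
  finally show ?thesis using 1 T by (simp add: a_assoc)
qed

lemma unimodular_shift_iff:
  assumes "n \<ge> 1" "x \<in> {1..n} \<rightarrow> I"
  shows "unimodular R I n (shift x) \<longleftrightarrow> quasi_unimodular R I n x"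
proof -
  have sub: "i \<in> carrier R" if "i \<in> I" for i using that a_subset by auto
  have x1: "x 1 \<in> I" using assms by auto
  have eq: "(\<one> \<oplus> z = \<one>) = (z = \<zero>)" if "z \<in> carrier R" for z
    using that by (metis add.r_cancel_one' one_closed a_comm)
  have closed: "x 1 \<oplus> y 1 \<oplus> x 1 \<otimes> y 1 \<oplus> (\<Oplus>i\<in>{2..n}. x i \<otimes> y i) \<in> carrier R"
    if "y \<in> {1..n} \<rightarrow> I" for y
  proof -
    have "x i \<in> carrier R" "y i \<in> carrier R" if "i \<in> {1..n}" for i
      using that \<open>y \<in> _\<close> assms(2) a_subset by auto
    then show ?thesis using assms(1) by (intro a_closed m_closed finsum_closed) auto
  qed
  have pre: "shift y \<in> {1..n} \<rightarrow> carrier R \<and> shift y 1 \<ominus> \<one> \<in> I \<and> (\<forall>i\<in>{2..n}. shift y i \<in> I)"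
    if "y \<in> {1..n} \<rightarrow> I" for y
  proof -
    have "y 1 \<in> I" using that assms(1) by auto
    then show ?thesis using that shift_minus[of y] sub by (auto simp: shift_def Pi_iff)
  qed
  show ?thesis
  proof
    assume "unimodular R I n (shift x)"
    then obtain b where b: "b \<in> {1..n} \<rightarrow> carrier R" "b 1 \<ominus> \<one> \<in> I" "\<forall>i\<in>{2..n}. b i \<in> I"
      "(\<Oplus>i\<in>{1..n}. shift x i \<otimes> b i) = \<one>"
      unfolding unimodular_def by blast
    define y where "y = b(1 := b 1 \<ominus> \<one>)"
    have y: "y \<in> {1..n} \<rightarrow> I" using b by (auto simp: y_def)
    have "b 1 \<in> carrier R" using b(1) assms(1) by auto
    then have "\<one> \<oplus> (b 1 \<ominus> \<one>) = b 1" by (rule one_plus_minus)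
    then have b_eq: "b = shift y" by (auto simp: shift_def y_def)
    have "x 1 \<oplus> y 1 \<oplus> x 1 \<otimes> y 1 \<oplus> (\<Oplus>i\<in>{2..n}. x i \<otimes> y i) = \<zero>"
      using b(4) unfolding b_eq shift_sum[OF assms y] eq[OF closed[OF y]] .
    then show "quasi_unimodular R I n x"
      using y assms(2) unfolding quasi_unimodular_def by blast
  next
    assume "quasi_unimodular R I n x"
    then obtain y where y: "y \<in> {1..n} \<rightarrow> I"
      "x 1 \<oplus> y 1 \<oplus> x 1 \<otimes> y 1 \<oplus> (\<Oplus>i\<in>{2..n}. x i \<otimes> y i) = \<zero>"
      unfolding quasi_unimodular_def by blast
    have "(\<Oplus>i\<in>{1..n}. shift x i \<otimes> shift y i) = \<one>"
      unfolding shift_sum[OF assms y(1)] y(2) by simp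
    then show "unimodular R I n (shift x)"
      using pre[OF y(1)] pre[OF assms(2)] unfolding unimodular_def by blast
  qed
qed

lemma unimodular_obtains:
  assumes "n \<ge> 1" "unimodular R I n a"
  obtains x where "x \<in> {1..n} \<rightarrow> I" "a = shift x"
proof
  have a: "a \<in> {1..n} \<rightarrow> carrier R" "a 1 \<ominus> \<one> \<in> I" "\<forall>i\<in>{2..n}. a i \<in> I"
    using assms(2) unfolding unimodular_def by auto
  then show "a(1 := a 1 \<ominus> \<one>) \<in> {1..n} \<rightarrow> I" by auto
  have "a 1 \<in> carrier R" using a(1) assms(1) by auto
  then have "\<one> \<oplus> (a 1 \<ominus> \<one>) = a 1" by (rule one_plus_minus)
  then show "a = shift (a(1 := a 1 \<ominus> \<one>))" by (auto simp: shift_def)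
qed

lemma quasi_step_closed:
  fixes m :: nat
  assumes "x \<in> {1..m + 1} \<rightarrow> I" "r \<in> {1..m} \<rightarrow> I"
  shows "(\<lambda>i. x i \<oplus> x (m + 1) \<otimes> r i) \<in> {1..m} \<rightarrow> I"
proof
  fix i assume i: "i \<in> {1..m}"
  then have "i \<in> {1..m + 1}" "m + 1 \<in> {1..m + 1}" by auto
  then have "x i \<in> I" "x (m + 1) \<in> I" "r i \<in> I"
    using Pi_mem[OF assms(1)] Pi_mem[OF assms(2) i] by blast+
  moreover from this have "x (m + 1) \<otimes> r i \<in> I" using I_l_closed a_subset by blast
  ultimately show "x i \<oplus> x (m + 1) \<otimes> r i \<in> I" by simp
qed

lemma stable_range_iff:
  assumes "m \<ge> 1"
  shows "stable_range R I m \<longleftrightarrow>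
    (\<forall>x. quasi_unimodular R I (m + 1) x \<longrightarrow>
       (\<exists>r \<in> {1..m} \<rightarrow> I. quasi_unimodular R I m (\<lambda>i. x i \<oplus> x (m + 1) \<otimes> r i)))"
    (is "_ \<longleftrightarrow> ?rhs")
proof -
  have key: "unimodular R I m (\<lambda>i. shift x i \<oplus> shift x (m + 1) \<otimes> r i) \<longleftrightarrow>
      quasi_unimodular R I m (\<lambda>i. x i \<oplus> x (m + 1) \<otimes> r i)"
    if x: "x \<in> {1..m + 1} \<rightarrow> I" and r: "r \<in> {1..m} \<rightarrow> I" for x r
  proof -
    have "x 1 \<in> I" "x (m + 1) \<in> I" "r 1 \<in> I" using x r assms by auto
    then have "x 1 \<in> carrier R" "x (m + 1) \<in> carrier R" "r 1 \<in> carrier R" using a_subset by auto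
    then have "(\<lambda>i. shift x i \<oplus> shift x (m + 1) \<otimes> r i) = shift (\<lambda>i. x i \<oplus> x (m + 1) \<otimes> r i)"
      using assms by (intro ext) (auto simp: shift_def a_assoc)
    then show ?thesis using unimodular_shift_iff[OF assms quasi_step_closed[OF x r]] by simp
  qed
  have m1: "1 \<le> m + 1" by simp
  show ?thesis
  proof
    assume *: "stable_range R I m"
    show ?rhs
    proof (intro allI impI)
      fix x assume q: "quasi_unimodular R I (m + 1) x"
      then have x: "x \<in> {1..m + 1} \<rightarrow> I" by (simp add: quasi_unimodular_def)
      from * q[folded unimodular_shift_iff[OF m1 x]] obtain r where
        "r \<in> {1..m} \<rightarrow> I" "unimodular R I m (\<lambda>i. shift x i \<oplus> shift x (m + 1) \<otimes> r i)"
        unfolding stable_range_def by blast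
      with key[OF x] show "\<exists>r \<in> {1..m} \<rightarrow> I. quasi_unimodular R I m (\<lambda>i. x i \<oplus> x (m + 1) \<otimes> r i)"
        by blast
    qed
  next
    assume *: ?rhs
    show "stable_range R I m"
      unfolding stable_range_def
    proof (intro allI impI)
      fix a assume u: "unimodular R I (m + 1) a"
      then obtain x where x: "x \<in> {1..m + 1} \<rightarrow> I" "a = shift x"
        using unimodular_obtains[OF m1] by blast
      from * u[unfolded x(2) unimodular_shift_iff[OF m1 x(1)]] obtain r where
        "r \<in> {1..m} \<rightarrow> I" "quasi_unimodular R I m (\<lambda>i. x i \<oplus> x (m + 1) \<otimes> r i)" by blast
      with key[OF x(1)] show "\<exists>r \<in> {1..m} \<rightarrow> I. unimodular R I m (\<lambda>i. a i \<oplus> a (m + 1) \<otimes> r i)"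
        unfolding x(2) by blast
    qed
  qed
qed

end

lemma quasi_unimodular_cong:
  assumes "\<And>i. i \<in> {1..n} \<Longrightarrow> x i = x' i" "n \<ge> 1" "quasi_unimodular S R n x" "ideal R S"
  shows "quasi_unimodular S R n x'"
proof -
  interpret ideal R S by fact
  obtain y where x: "x \<in> {1..n} \<rightarrow> R" and y: "y \<in> {1..n} \<rightarrow> R"
    and eq: "x 1 \<oplus>\<^bsub>S\<^esub> y 1 \<oplus>\<^bsub>S\<^esub> x 1 \<otimes>\<^bsub>S\<^esub> y 1 \<oplus>\<^bsub>S\<^esub> (\<Oplus>\<^bsub>S\<^esub>i\<in>{2..n}. x i \<otimes>\<^bsub>S\<^esub> y i) = \<zero>\<^bsub>S\<^esub>"
    using assms(3) unfolding quasi_unimodular_def by blast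
  have c: "x i \<in> carrier S" "y i \<in> carrier S" if "i \<in> {1..n}" for i using that x y a_subset by auto
  have "(\<Oplus>\<^bsub>S\<^esub>i\<in>{2..n}. x' i \<otimes>\<^bsub>S\<^esub> y i) = (\<Oplus>\<^bsub>S\<^esub>i\<in>{2..n}. x i \<otimes>\<^bsub>S\<^esub> y i)"
    using c assms(1) by (intro finsum_cong') auto
  moreover have "x' 1 = x 1" using assms(1)[of 1] assms(2) by auto
  moreover have "x' \<in> {1..n} \<rightarrow> R" using x assms(1) by (auto simp: Pi_iff)
  ultimately show ?thesis
    using y eq unfolding quasi_unimodular_def by (intro conjI bexI[of _ y]) simp_all
qed

lemma quasi_unimodular_transfer:
  assumes "ideal R S" "ideal R' S'" "\<phi> \<in> R \<rightarrow> R'" "n \<ge> 1"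
    and add: "\<And>x y. x \<in> R \<Longrightarrow> y \<in> R \<Longrightarrow> \<phi> (x \<oplus>\<^bsub>S\<^esub> y) = \<phi> x \<oplus>\<^bsub>S'\<^esub> \<phi> y"
    and mult: "\<And>x y. x \<in> R \<Longrightarrow> y \<in> R \<Longrightarrow> \<phi> (x \<otimes>\<^bsub>S\<^esub> y) = \<phi> x \<otimes>\<^bsub>S'\<^esub> \<phi> y"
    and q: "quasi_unimodular S R n x"
  shows "quasi_unimodular S' R' n (\<lambda>i. \<phi> (x i))"
proof -
  interpret A: ideal R S by fact
  interpret B: ideal R' S' by fact
  have sub: "a \<in> carrier S" if "a \<in> R" for a using that A.a_subset by auto
  have sub': "a \<in> carrier S'" if "a \<in> R'" for a using that B.a_subset by auto
  have \<phi>: "\<phi> a \<in> R'" if "a \<in> R" for a using that assms(3) by auto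
  have zero: "\<phi> \<zero>\<^bsub>S\<^esub> = \<zero>\<^bsub>S'\<^esub>"
  proof -
    have z: "\<zero>\<^bsub>S\<^esub> \<in> R" by simp
    have "\<phi> \<zero>\<^bsub>S\<^esub> \<oplus>\<^bsub>S'\<^esub> \<phi> \<zero>\<^bsub>S\<^esub> = \<phi> \<zero>\<^bsub>S\<^esub>" using add[OF z z] by simp
    then show ?thesis using sub'[OF \<phi>[OF z]] by (metis B.add.l_cancel_one)
  qed
  have mem: "a \<otimes>\<^bsub>S\<^esub> b \<in> R" if "a \<in> R" "b \<in> R" for a b using that sub A.I_l_closed by auto
  have sum: "(\<Oplus>\<^bsub>S\<^esub>i\<in>J. h i) \<in> R \<and> \<phi> (\<Oplus>\<^bsub>S\<^esub>i\<in>J. h i) = (\<Oplus>\<^bsub>S'\<^esub>i\<in>J. \<phi> (h i))"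
    if "finite J" "h \<in> J \<rightarrow> R" for h :: "nat \<Rightarrow> _" and J
    using that
  proof (induction J)
    case empty
    then show ?case by (simp add: zero)
  next
    case (insert j J)
    then have J: "(\<Oplus>\<^bsub>S\<^esub>i\<in>J. h i) \<in> R" "\<phi> (\<Oplus>\<^bsub>S\<^esub>i\<in>J. h i) = (\<Oplus>\<^bsub>S'\<^esub>i\<in>J. \<phi> (h i))" "h j \<in> R"
      by auto
    have "(\<Oplus>\<^bsub>S\<^esub>i\<in>insert j J. h i) = h j \<oplus>\<^bsub>S\<^esub> (\<Oplus>\<^bsub>S\<^esub>i\<in>J. h i)"
      using insert sub by (intro A.finsum_insert) (auto simp: Pi_iff)
    moreover have "(\<Oplus>\<^bsub>S'\<^esub>i\<in>insert j J. \<phi> (h i)) = \<phi> (h j) \<oplus>\<^bsub>S'\<^esub> (\<Oplus>\<^bsub>S'\<^esub>i\<in>J. \<phi> (h i))"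
      using insert sub' \<phi> by (intro B.finsum_insert) (auto simp: Pi_iff)
    ultimately show ?case using J add by simp
  qed
  obtain y where x: "x \<in> {1..n} \<rightarrow> R" and y: "y \<in> {1..n} \<rightarrow> R"
    and eq: "x 1 \<oplus>\<^bsub>S\<^esub> y 1 \<oplus>\<^bsub>S\<^esub> x 1 \<otimes>\<^bsub>S\<^esub> y 1 \<oplus>\<^bsub>S\<^esub> (\<Oplus>\<^bsub>S\<^esub>i\<in>{2..n}. x i \<otimes>\<^bsub>S\<^esub> y i) = \<zero>\<^bsub>S\<^esub>"
    using q unfolding quasi_unimodular_def by blast
  have x1: "x 1 \<in> R" "y 1 \<in> R" using x y assms(4) by auto
  have xy: "x i \<otimes>\<^bsub>S\<^esub> y i \<in> R" "\<phi> (x i \<otimes>\<^bsub>S\<^esub> y i) = \<phi> (x i) \<otimes>\<^bsub>S'\<^esub> \<phi> (y i)"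
    "\<phi> (x i) \<in> carrier S'" "\<phi> (y i) \<in> carrier S'" if "i \<in> {2..n}" for i
  proof -
    have "x i \<in> R" "y i \<in> R" using that x y by auto
    then show "x i \<otimes>\<^bsub>S\<^esub> y i \<in> R" "\<phi> (x i \<otimes>\<^bsub>S\<^esub> y i) = \<phi> (x i) \<otimes>\<^bsub>S'\<^esub> \<phi> (y i)"
      "\<phi> (x i) \<in> carrier S'" "\<phi> (y i) \<in> carrier S'"
      using mem mult \<phi> sub' by auto
  qed
  have s: "(\<Oplus>\<^bsub>S\<^esub>i\<in>{2..n}. x i \<otimes>\<^bsub>S\<^esub> y i) \<in> R"
    "\<phi> (\<Oplus>\<^bsub>S\<^esub>i\<in>{2..n}. x i \<otimes>\<^bsub>S\<^esub> y i) = (\<Oplus>\<^bsub>S'\<^esub>i\<in>{2..n}. \<phi> (x i \<otimes>\<^bsub>S\<^esub> y i))"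
    using sum[of "{2..n}" "\<lambda>i. x i \<otimes>\<^bsub>S\<^esub> y i"] xy(1) by auto
  have "(\<Oplus>\<^bsub>S'\<^esub>i\<in>{2..n}. \<phi> (x i \<otimes>\<^bsub>S\<^esub> y i)) = (\<Oplus>\<^bsub>S'\<^esub>i\<in>{2..n}. \<phi> (x i) \<otimes>\<^bsub>S'\<^esub> \<phi> (y i))"
    using xy by (intro B.finsum_cong') auto
  then have "\<phi> (x 1) \<oplus>\<^bsub>S'\<^esub> \<phi> (y 1) \<oplus>\<^bsub>S'\<^esub> \<phi> (x 1) \<otimes>\<^bsub>S'\<^esub> \<phi> (y 1) \<oplus>\<^bsub>S'\<^esub>
      (\<Oplus>\<^bsub>S'\<^esub>i\<in>{2..n}. \<phi> (x i) \<otimes>\<^bsub>S'\<^esub> \<phi> (y i)) = \<phi> \<zero>\<^bsub>S\<^esub>"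
    using s x1 mem A.a_closed by (simp flip: eq add: add mult)
  moreover have "(\<lambda>i. \<phi> (x i)) \<in> {1..n} \<rightarrow> R'" "(\<lambda>i. \<phi> (y i)) \<in> {1..n} \<rightarrow> R'"
    using x y \<phi> by auto
  ultimately show ?thesis 
    unfolding quasi_unimodular_def zero by (intro conjI bexI[of _ "\<lambda>i. \<phi> (y i)"])
qed

lemma stable_range_transfer:
  assumes "ideal R S" "ideal R' S'" "bij_betw \<phi> R R'" "m \<ge> 1"
    and add: "\<And>x y. x \<in> R \<Longrightarrow> y \<in> R \<Longrightarrow> \<phi> (x \<oplus>\<^bsub>S\<^esub> y) = \<phi> x \<oplus>\<^bsub>S'\<^esub> \<phi> y"
    and mult: "\<And>x y. x \<in> R \<Longrightarrow> y \<in> R \<Longrightarrow> \<phi> (x \<otimes>\<^bsub>S\<^esub> y) = \<phi> x \<otimes>\<^bsub>S'\<^esub> \<phi> y"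
    and inv_add: "\<And>x y. x \<in> R' \<Longrightarrow> y \<in> R' \<Longrightarrow>
      inv_into R \<phi> (x \<oplus>\<^bsub>S'\<^esub> y) = inv_into R \<phi> x \<oplus>\<^bsub>S\<^esub> inv_into R \<phi> y"
    and inv_mult: "\<And>x y. x \<in> R' \<Longrightarrow> y \<in> R' \<Longrightarrow>
      inv_into R \<phi> (x \<otimes>\<^bsub>S'\<^esub> y) = inv_into R \<phi> x \<otimes>\<^bsub>S\<^esub> inv_into R \<phi> y"
    and sr: "stable_range S R m"
  shows "stable_range S' R' m"
  unfolding ideal.stable_range_iff[OF assms(2,4)]
proof (intro allI impI)
  interpret A: ideal R S by fact
  let ?\<psi> = "inv_into R \<phi>"
  have \<phi>: "\<phi> \<in> R \<rightarrow> R'" using assms(3) by (auto simp: bij_betw_def)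
  have \<psi>: "?\<psi> \<in> R' \<rightarrow> R" using assms(3) by (auto simp: bij_betw_def inv_into_into)
  have \<phi>\<psi>: "\<phi> (?\<psi> a) = a" if "a \<in> R'" for a using that assms(3) by (simp add: bij_betw_inv_into_right)
  fix x assume q: "quasi_unimodular S' R' (m + 1) x"
  then have x: "x \<in> {1..m + 1} \<rightarrow> R'" by (simp add: quasi_unimodular_def)
  have "quasi_unimodular S R (m + 1) (\<lambda>i. ?\<psi> (x i))"
    by (rule quasi_unimodular_transfer[OF assms(2,1) \<psi> _ inv_add inv_mult q]) auto
  with sr[unfolded ideal.stable_range_iff[OF assms(1,4)]] obtain r where r: "r \<in> {1..m} \<rightarrow> R"
    and q': "quasi_unimodular S R m (\<lambda>i. ?\<psi> (x i) \<oplus>\<^bsub>S\<^esub> ?\<psi> (x (m + 1)) \<otimes>\<^bsub>S\<^esub> r i)"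
    by blast
  have *: "quasi_unimodular S' R' m (\<lambda>i. \<phi> (?\<psi> (x i) \<oplus>\<^bsub>S\<^esub> ?\<psi> (x (m + 1)) \<otimes>\<^bsub>S\<^esub> r i))"
    by (rule quasi_unimodular_transfer[OF assms(1,2) \<phi> assms(4) add mult q'])
  have "\<phi> (?\<psi> (x i) \<oplus>\<^bsub>S\<^esub> ?\<psi> (x (m + 1)) \<otimes>\<^bsub>S\<^esub> r i) = x i \<oplus>\<^bsub>S'\<^esub> x (m + 1) \<otimes>\<^bsub>S'\<^esub> \<phi> (r i)"
    if "i \<in> {1..m}" for i
  proof -
    have i: "x i \<in> R'" "x (m + 1) \<in> R'" "r i \<in> R" using that x r by auto
    then have p: "?\<psi> (x i) \<in> R" "?\<psi> (x (m + 1)) \<in> R" using \<psi> by auto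
    then have "?\<psi> (x (m + 1)) \<otimes>\<^bsub>S\<^esub> r i \<in> R" using i A.I_l_closed A.a_subset by auto
    then show ?thesis using add[OF p(1)] mult[OF p(2) i(3)] \<phi>\<psi> i by simp
  qed
  then have "quasi_unimodular S' R' m (\<lambda>i. x i \<oplus>\<^bsub>S'\<^esub> x (m + 1) \<otimes>\<^bsub>S'\<^esub> \<phi> (r i))"
    by (rule quasi_unimodular_cong[OF _ assms(4) * assms(2)])
  moreover have "(\<lambda>i. \<phi> (r i)) \<in> {1..m} \<rightarrow> R'" using r \<phi> by auto
  ultimately show "\<exists>r \<in> {1..m} \<rightarrow> R'. quasi_unimodular S' R' m (\<lambda>i. x i \<oplus>\<^bsub>S'\<^esub> x (m + 1) \<otimes>\<^bsub>S'\<^esub> r i)"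
    by (rule rev_bexI[rotated])
qed

theorem stable_rank_independent:
  assumes "ideal R S" "ideal R' S'" "bij_betw \<phi> R R'"
    and add: "\<And>x y. x \<in> R \<Longrightarrow> y \<in> R \<Longrightarrow> \<phi> (x \<oplus>\<^bsub>S\<^esub> y) = \<phi> x \<oplus>\<^bsub>S'\<^esub> \<phi> y"
    and mult: "\<And>x y. x \<in> R \<Longrightarrow> y \<in> R \<Longrightarrow> \<phi> (x \<otimes>\<^bsub>S\<^esub> y) = \<phi> x \<otimes>\<^bsub>S'\<^esub> \<phi> y"
  shows "stable_rank S R = stable_rank S' R'"
proof -
  interpret A: ideal R S by fact
  interpret B: ideal R' S' by fact
  let ?\<psi> = "inv_into R \<phi>"
  have bij: "bij_betw ?\<psi> R' R" by (rule bij_betw_inv_into[OF assms(3)])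
  have inj: "inj_on \<phi> R" using assms(3) by (simp add: bij_betw_def)
  have \<psi>: "?\<psi> a \<in> R" "\<phi> (?\<psi> a) = a" if "a \<in> R'" for a
    using that assms(3) by (auto simp: bij_betw_def inv_into_into f_inv_into_f)
  have \<psi>\<phi>: "?\<psi> (\<phi> a) = a" if "a \<in> R" for a using that inj by simp
  have inv_add: "?\<psi> (x \<oplus>\<^bsub>S'\<^esub> y) = ?\<psi> x \<oplus>\<^bsub>S\<^esub> ?\<psi> y" if "x \<in> R'" "y \<in> R'" for x y
  proof -
    have "?\<psi> x \<oplus>\<^bsub>S\<^esub> ?\<psi> y \<in> R" 
      using \<psi>(1)[OF that(1)] \<psi>(1)[OF that(2)] by simp
    from \<psi>\<phi>[OF this] show ?thesis using add[of "?\<psi> x" "?\<psi> y"] that \<psi> by simp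
  qed
  have inv_mult: "?\<psi> (x \<otimes>\<^bsub>S'\<^esub> y) = ?\<psi> x \<otimes>\<^bsub>S\<^esub> ?\<psi> y" if "x \<in> R'" "y \<in> R'" for x y
  proof -
    have "?\<psi> x \<otimes>\<^bsub>S\<^esub> ?\<psi> y \<in> R" using that \<psi>(1) A.a_subset by (intro A.I_l_closed) auto
    from \<psi>\<phi>[OF this] show ?thesis using mult[of "?\<psi> x" "?\<psi> y"] that \<psi> by simp
  qed
  have inv_inv: "inv_into R' ?\<psi> a = \<phi> a" if "a \<in> R" for a
    using inv_into_inv_into_eq[OF assms(3) that] .
  have "stable_range S R m \<longleftrightarrow> stable_range S' R' m" if m: "m \<ge> 1" for m
  proof
    assume *: "stable_range S R m"
    show "stable_range S' R' m"
      by (rule stable_range_transfer[OF assms(1-3) m add mult inv_add inv_mult *])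
  next
    assume *: "stable_range S' R' m"
    show "stable_range S R m"
    proof (rule stable_range_transfer[OF assms(2,1) bij m inv_add inv_mult _ _ *])
      fix x y assume xy: "x \<in> R" "y \<in> R"
      show "inv_into R' ?\<psi> (x \<oplus>\<^bsub>S\<^esub> y) = inv_into R' ?\<psi> x \<oplus>\<^bsub>S'\<^esub> inv_into R' ?\<psi> y"
        using xy add by (simp add: inv_inv)
      have "x \<otimes>\<^bsub>S\<^esub> y \<in> R" using xy A.a_subset by (intro A.I_l_closed) auto
      then show "inv_into R' ?\<psi> (x \<otimes>\<^bsub>S\<^esub> y) = inv_into R' ?\<psi> x \<otimes>\<^bsub>S'\<^esub> inv_into R' ?\<psi> y"
        using xy mult by (simp add: inv_inv)
    qed
  qed
  then have "(m \<ge> 1 \<and> stable_range S R m) \<longleftrightarrow> (m \<ge> 1 \<and> stable_range S' R' m)" for m by blast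
  then show ?thesis unfolding stable_rank_def by simp
qed

end

(* Unimodular rows are reduced inside an explicit description of the algebra L, with U its unitization.
   A word in vertices, edges and ghost edges is a path times a reversed path.  If the identity of G is not in the
   semigroup S, the graph is acyclic and finitely many elements generate a finite-dimensional algebra, where
   Fitting's lemma gives stable rank 1.  If S is a finite group and there are at least two edge labels, the sum of
   the vertices in S is a central idempotent whose corner contains two isometries with orthogonal ranges, and
   Cuntz-type rows x_1, ..., x_m, p - x_1 y_1 - ... - x_m y_m cannot be shortened.  If S is infinite, every finite
   set of vertices can be moved off itself by isometries along paths, which shortens rows of length 3, while a
   cycle with an exit obstructs stable rank 1.  With a single label c of finite order, central corners are
   finitely generated modules over Laurent polynomials in z = (sum of edges)^n; stable rank at most 2 follows by
   reduction modulo 1 - z and Nakayama, and stable rank 1 fails for the row (1 + z, 1 + z + ... + z^4), because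
   units of the vertex corner are monomials. *)

theory Submission
  imports Defs "HOL-Algebra.Subrings" "HOL-Algebra.Generated_Rings"
begin

text \<open>The relations of \<open>L\<close> do not show that an element is nonzero, and every
  lower bound depends on such elements. This is settled once by an action on infinite paths, handled
  through linear functionals on the free algebra so that no module has to be built.

  Two choices shape the one-label case. The modulus \<open>1 - z\<close> is taken because its root
  \<open>1\<close> lies in every field: a Nakayama multiplier \<open>1 - (1 - z) c\<close> has the
  value \<open>1\<close> there, so with denominators cleared it is a nonzero polynomial. It lies in
  the right ideal of the corrected first entry and serves as a second modulus, now for the second
  entry.

  The row that refutes stable rank 1 has to be unimodular over every field. With an even number of
  terms \<open>1 + z + z^2 + ...\<close> is divisible by \<open>1 + z\<close>, so the pair is not
  unimodular; with three terms \<open>1 + z\<close> is congruent to the unit \<open>- z^2\<close>,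
  so the pair can be shortened. Five is the least number of terms that works.\<close>

context ideal
begin

section \<open>Criteria for stable range 1 and 2, and a row that cannot be shortened\<close>

lemma one_plus_ideal_closed:
  assumes "a \<in> carrier R" "a \<ominus> \<one> \<in> I" "s \<in> I"
  shows "a \<oplus> s \<ominus> \<one> \<in> I"
proof -
  have "s \<in> carrier R" using assms(3) a_subset by blast
  then have "a \<oplus> s \<ominus> \<one> = (a \<ominus> \<one>) \<oplus> s"
    using assms(1) by algebra
  then show ?thesis using assms a_closed by simp
qed

lemma right_inverse_minus_one:
  assumes "a \<in> carrier R" "w \<in> carrier R" "a \<ominus> \<one> \<in> I" "s \<in> I" "a \<otimes> w \<oplus> s = \<one>"
  shows "w \<ominus> \<one> \<in> I"
proof -
  have s: "s \<in> carrier R" using assms(4) a_subset by blast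
  have "w \<ominus> \<one> = w \<ominus> (a \<otimes> w \<oplus> s)" using assms(5) by simp
  also have "\<dots> = \<ominus> ((a \<ominus> \<one>) \<otimes> w \<oplus> s)" using assms(1,2) s by algebra
  finally show ?thesis using assms I_r_closed[OF assms(3,2)] by simp
qed

lemma finsum_atLeastAtMost_2:
  assumes "f \<in> {1..2} \<rightarrow> carrier R"
  shows "(\<Oplus>i\<in>{1..2::nat}. f i) = f 1 \<oplus> f 2"
proof -
  have "{1..2::nat} = {1, 2}" by auto
  then show ?thesis using assms by simp
qed

lemma finsum_atLeastAtMost_3:
  assumes "f \<in> {1..3} \<rightarrow> carrier R"
  shows "(\<Oplus>i\<in>{1..3::nat}. f i) = f 1 \<oplus> f 2 \<oplus> f 3"
proof -
  have "{1..3::nat} = {1, 2, 3}" by auto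
  then show ?thesis using assms by (simp add: a_assoc)
qed

text \<open>Only a right inverse \<open>w\<close> in the ambient ring has to be found: since
  \<open>a + b r\<close> is congruent to \<open>1\<close> modulo \<open>I\<close>, so is
  \<open>w\<close>, by \<open>right_inverse_minus_one\<close>.\<close>

lemma stable_range_1I:
  assumes "\<And>a b x y. \<lbrakk>a \<in> carrier R; a \<ominus> \<one> \<in> I; b \<in> I; x \<in> carrier R; x \<ominus> \<one> \<in> I; y \<in> I;
      a \<otimes> x \<oplus> b \<otimes> y = \<one>\<rbrakk> \<Longrightarrow> \<exists>r\<in>I. \<exists>w\<in>carrier R. (a \<oplus> b \<otimes> r) \<otimes> w = \<one>"
  shows "stable_range R I 1"
  unfolding stable_range_def
proof (intro allI impI)
  fix a assume "unimodular R I (1 + 1) a"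
  then obtain b where a: "a \<in> {1..2} \<rightarrow> carrier R" "a 1 \<ominus> \<one> \<in> I" "a 2 \<in> I"
    and b: "b \<in> {1..2} \<rightarrow> carrier R" "b 1 \<ominus> \<one> \<in> I" "b 2 \<in> I"
    and eq: "(\<Oplus>i\<in>{1..2::nat}. a i \<otimes> b i) = \<one>"
    unfolding unimodular_def by (auto simp: numeral_2_eq_2)
  have c: "a 1 \<in> carrier R" "a 2 \<in> carrier R" "b 1 \<in> carrier R" "b 2 \<in> carrier R"
    using a(1) b(1) by auto
  have "a 1 \<otimes> b 1 \<oplus> a 2 \<otimes> b 2 = \<one>"
    using eq a(1) b(1) by (subst (asm) finsum_atLeastAtMost_2) auto
  from assms[OF c(1) a(2,3) c(3) b(2,3) this] obtain r w where
    rw: "r \<in> I" "w \<in> carrier R" "(a 1 \<oplus> a 2 \<otimes> r) \<otimes> w = \<one>" by blast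
  have r: "r \<in> carrier R" using rw(1) a_subset by blast
  have ar: "a 1 \<oplus> a 2 \<otimes> r \<in> carrier R" using c r by simp
  have arI: "a 1 \<oplus> a 2 \<otimes> r \<ominus> \<one> \<in> I"
    using one_plus_ideal_closed[OF c(1) a(2)] I_r_closed[OF a(3) r] by simp
  have "w \<ominus> \<one> \<in> I"
    using right_inverse_minus_one[OF ar rw(2) arI, of \<zero>] rw ar by simp
  then have "unimodular R I 1 (\<lambda>i. a i \<oplus> a 2 \<otimes> r)"
    unfolding unimodular_def using ar arI rw by (auto intro!: bexI[of _ "\<lambda>i. w"])
  then show "\<exists>s\<in>{1..1} \<rightarrow> I. unimodular R I 1 (\<lambda>i. a i \<oplus> a (1 + 1) \<otimes> s i)"
    using rw(1) by (intro bexI[of _ "\<lambda>i. r"]) (auto simp: numeral_2_eq_2)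
qed

lemma stable_range_1D:
  assumes "stable_range R I 1" "a \<in> carrier R" "a \<ominus> \<one> \<in> I" "b \<in> I"
    "x \<in> carrier R" "x \<ominus> \<one> \<in> I" "y \<in> I" "a \<otimes> x \<oplus> b \<otimes> y = \<one>"
  shows "\<exists>r\<in>I. \<exists>w\<in>carrier R. (a \<oplus> b \<otimes> r) \<otimes> w = \<one>"
proof -
  have c: "b \<in> carrier R" "y \<in> carrier R" using assms(4,7) a_subset by auto
  define v where "v i = (if i = (1::nat) then a else b)" for i
  define u where "u i = (if i = (1::nat) then x else y)" for i
  have "(\<Oplus>i\<in>{1..2::nat}. v i \<otimes> u i) = \<one>"
    using assms c by (subst finsum_atLeastAtMost_2) (auto simp: u_def v_def)
  then have "unimodular R I (1 + 1) v"
    unfolding unimodular_def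
    using assms c by (auto simp: u_def v_def numeral_2_eq_2 intro!: bexI[of _ u])
  with assms(1) obtain r where r: "r \<in> {1..1} \<rightarrow> I" "unimodular R I 1 (\<lambda>i. v i \<oplus> v (1 + 1) \<otimes> r i)"
    unfolding stable_range_def by blast
  have r1: "r 1 \<in> I" using r(1) by auto
  then have "r 1 \<in> carrier R" using a_subset by auto
  then show ?thesis using r(2) r1 assms c unfolding unimodular_def
    by (auto simp: v_def)
qed

text \<open>The constructions below give \<open>w1\<close> and \<open>w2\<close> without control of
  their classes modulo \<open>I\<close>. The criterion restores it: the second coefficient is
  multiplied into \<open>I\<close>, and the first is then congruent to \<open>1\<close> by
  \<open>right_inverse_minus_one\<close>.\<close>

lemma stable_range_2I:
  assumes "\<And>a1 a2 a3 x1 x2 x3. \<lbrakk>a1 \<in> carrier R; a1 \<ominus> \<one> \<in> I; a2 \<in> I; a3 \<in> I;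
      x1 \<in> carrier R; x1 \<ominus> \<one> \<in> I; x2 \<in> I; x3 \<in> I;
      a1 \<otimes> x1 \<oplus> a2 \<otimes> x2 \<oplus> a3 \<otimes> x3 = \<one>\<rbrakk> \<Longrightarrow>
      \<exists>r1\<in>I. \<exists>r2\<in>I. \<exists>w1\<in>carrier R. \<exists>w2\<in>carrier R.
        (a1 \<oplus> a3 \<otimes> r1) \<otimes> w1 \<oplus> (a2 \<oplus> a3 \<otimes> r2) \<otimes> w2 = \<one>"
  shows "stable_range R I 2"
  unfolding stable_range_def
proof (intro allI impI)
  fix a assume "unimodular R I (2 + 1) a"
  then obtain b where a: "a \<in> {1..3} \<rightarrow> carrier R" "a 1 \<ominus> \<one> \<in> I" "a 2 \<in> I" "a 3 \<in> I"
    and b: "b \<in> {1..3} \<rightarrow> carrier R" "b 1 \<ominus> \<one> \<in> I" "b 2 \<in> I" "b 3 \<in> I"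
    and eq: "(\<Oplus>i\<in>{1..3::nat}. a i \<otimes> b i) = \<one>"
    unfolding unimodular_def by (auto simp: numeral_3_eq_3)
  have c: "a 1 \<in> carrier R" "a 2 \<in> carrier R" "a 3 \<in> carrier R"
    "b 1 \<in> carrier R" "b 2 \<in> carrier R" "b 3 \<in> carrier R"
    using a(1) b(1) by auto
  have "a 1 \<otimes> b 1 \<oplus> a 2 \<otimes> b 2 \<oplus> a 3 \<otimes> b 3 = \<one>"
    using eq a(1) b(1) by (subst (asm) finsum_atLeastAtMost_3) auto
  from assms[OF c(1) a(2-4) c(4) b(2-4) this] obtain r1 r2 w1 w2 where
    r: "r1 \<in> I" "r2 \<in> I" and w: "w1 \<in> carrier R" "w2 \<in> carrier R"
    and eq': "(a 1 \<oplus> a 3 \<otimes> r1) \<otimes> w1 \<oplus> (a 2 \<oplus> a 3 \<otimes> r2) \<otimes> w2 = \<one>" by blast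
  have rc: "r1 \<in> carrier R" "r2 \<in> carrier R" using r a_subset by blast+
  define A where "A = a 1 \<oplus> a 3 \<otimes> r1"
  define B where "B = a 2 \<oplus> a 3 \<otimes> r2"
  have AB: "A \<in> carrier R" "B \<in> carrier R" using c rc by (auto simp: A_def B_def)
  have AI: "A \<ominus> \<one> \<in> I"
    unfolding A_def using one_plus_ideal_closed[OF c(1) a(2)] I_r_closed[OF a(4) rc(1)] by simp
  have BI: "B \<in> I" unfolding B_def using a(3) I_r_closed[OF a(4) rc(2)] by simp
  have eqAB: "A \<otimes> w1 \<oplus> B \<otimes> w2 = \<one>" using eq' by (simp add: A_def B_def)
  \<comment> \<open>The second coefficient is moved into the ideal by inserting \<open>s = B w2\<close> into \<open>s = s 1\<close>.\<close>
  define s where "s = B \<otimes> w2"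
  have s: "s \<in> I" "s \<in> carrier R" using I_r_closed[OF BI w(2)] AB w by (auto simp: s_def)
  define u1 where "u1 = w1 \<oplus> w1 \<otimes> s"
  define u2 where "u2 = w2 \<otimes> s"
  have u: "u1 \<in> carrier R" "u2 \<in> carrier R" "u2 \<in> I"
    using w s I_l_closed[OF s(1) w(2)] by (auto simp: u1_def u2_def)
  have "A \<otimes> u1 \<oplus> B \<otimes> u2 = A \<otimes> w1 \<oplus> (A \<otimes> w1 \<oplus> B \<otimes> w2) \<otimes> s"
    using AB w s(2) unfolding u1_def u2_def by algebra
  also have "\<dots> = \<one>" using eqAB s(2) by (simp add: s_def)
  finally have eqU: "A \<otimes> u1 \<oplus> B \<otimes> u2 = \<one>" .
  have Bu: "B \<otimes> u2 \<in> I" using I_r_closed[OF BI u(2)] .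
  have u1I: "u1 \<ominus> \<one> \<in> I"
    using right_inverse_minus_one[OF AB(1) u(1) AI Bu eqU] .
  define v where "v i = (if i = (1::nat) then u1 else u2)" for i
  define r where "r i = (if i = (1::nat) then r1 else r2)" for i
  have 12: "i = 1 \<or> i = 2" if "i \<in> {1..2}" for i :: nat using that by auto
  have 1: "a 1 \<oplus> a 3 \<otimes> r 1 = A" and 2: "a 2 \<oplus> a 3 \<otimes> r 2 = B" by (auto simp: r_def A_def B_def)
  have "(\<Oplus>i\<in>{1..2::nat}. (a i \<oplus> a 3 \<otimes> r i) \<otimes> v i) = \<one>"
  proof (subst finsum_atLeastAtMost_2)
    show "(\<lambda>i. (a i \<oplus> a 3 \<otimes> r i) \<otimes> v i) \<in> {1..2} \<rightarrow> carrier R"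
      using AB u 1 2 12 by (metis (no_types, lifting) Pi_I m_closed v_def)
  qed (use eqU 1 2 in \<open>simp add: v_def\<close>)
  moreover have "(\<lambda>i. a i \<oplus> a 3 \<otimes> r i) \<in> {1..2} \<rightarrow> carrier R"
    using AB 1 2 12 by (metis (no_types, lifting) Pi_I)
  moreover have "\<forall>i\<in>{2..2}. a i \<oplus> a 3 \<otimes> r i \<in> I" using BI 2 by auto
  moreover have "v \<in> {1..2} \<rightarrow> carrier R" "v 1 \<ominus> \<one> \<in> I" "\<forall>i\<in>{2..2}. v i \<in> I"
    using u u1I by (auto simp: v_def)
  ultimately have "unimodular R I 2 (\<lambda>i. a i \<oplus> a 3 \<otimes> r i)"
    unfolding unimodular_def using AI 1 by auto
  moreover have "r \<in> {1..2} \<rightarrow> I" using \<open>r1 \<in> I\<close> \<open>r2 \<in> I\<close> by (auto simp: r_def)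
  ultimately show "\<exists>s\<in>{1..2} \<rightarrow> I. unimodular R I 2 (\<lambda>i. a i \<oplus> a (2 + 1) \<otimes> s i)"
    by (intro bexI[of _ r]) auto
qed

text \<open>The \<open>x i\<close> are isometries with orthogonal ranges in the corner of
  \<open>p\<close>, and \<open>q\<close>, the complement of the sum of these ranges, is the entry to
  be removed. Every \<open>y j\<close> kills \<open>q\<close> from the left, so multiplying a
  shortened equation by the \<open>y j\<close> determines its coefficients \<open>b j\<close> well
  enough to see \<open>b j q = 0\<close>. Then \<open>q = 1 q = 0\<close>, against
  \<open>ne\<close>.\<close>

lemma not_stable_range_isometries:
  fixes x y :: "nat \<Rightarrow> 'a" and m :: nat
  assumes m: "m \<ge> 1" and p: "p \<in> I" "p \<otimes> p = p"
    and x: "\<And>i. i \<in> {1..m} \<Longrightarrow> x i \<in> I" "\<And>i. i \<in> {1..m} \<Longrightarrow> p \<otimes> x i = x i"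
      "\<And>i. i \<in> {1..m} \<Longrightarrow> x i \<otimes> p = x i"
    and y: "\<And>i. i \<in> {1..m} \<Longrightarrow> y i \<in> I" "\<And>i. i \<in> {1..m} \<Longrightarrow> p \<otimes> y i = y i"
      "\<And>i. i \<in> {1..m} \<Longrightarrow> y i \<otimes> p = y i"
    and yx: "\<And>i j. i \<in> {1..m} \<Longrightarrow> j \<in> {1..m} \<Longrightarrow> y i \<otimes> x j = (if i = j then p else \<zero>)"
    and central: "m = 1 \<or> (\<forall>u\<in>carrier R. p \<otimes> u = u \<otimes> p)"
    and ne: "(\<Oplus>i\<in>{1..m}. x i \<otimes> y i) \<noteq> p"
  shows "\<not> stable_range R I m"
proof
  assume sr: "stable_range R I m"
  have pc: "p \<in> carrier R" using p a_subset by blast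
  have xc: "x i \<in> carrier R" and yc: "y i \<in> carrier R" if "i \<in> {1..m}" for i
    using x(1)[OF that] y(1)[OF that] a_subset by auto
  have x1c: "x 1 \<in> carrier R" and y1c: "y 1 \<in> carrier R" using xc yc m by auto
  define S where "S = (\<Oplus>i\<in>{1..m}. x i \<otimes> y i)"
  define q where "q = p \<ominus> S"
  define g where "g = \<one> \<ominus> p"
  have Sc: "S \<in> carrier R" unfolding S_def using xc yc by (intro finsum_closed) auto
  have SI: "S \<in> I"
  proof -
    have "(\<Oplus>i\<in>J. x i \<otimes> y i) \<in> I" if "J \<subseteq> {1..m}" for J
      using finite_subset[OF that finite_atLeastAtMost] that
    proof (induction J)
      case (insert j J)
      then have "x j \<otimes> y j \<in> I" using x(1) yc I_r_closed by auto
      moreover have "(\<Oplus>i\<in>insert j J. x i \<otimes> y i) = x j \<otimes> y j \<oplus> (\<Oplus>i\<in>J. x i \<otimes> y i)"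
        using insert xc yc by (intro finsum_insert) auto
      ultimately show ?case using insert by simp
    qed simp
    then show ?thesis unfolding S_def by blast
  qed
  have qI: "q \<in> I" unfolding q_def using p(1) SI by (simp add: a_minus_def)
  have qc: "q \<in> carrier R" using pc Sc by (simp add: q_def)
  have gc: "g \<in> carrier R" using pc by (simp add: g_def)
  have gp: "g \<otimes> p = \<zero>" "p \<otimes> g = \<zero>" "g \<otimes> g = g"
  proof -
    have "g \<otimes> p = p \<ominus> p \<otimes> p" "p \<otimes> g = p \<ominus> p \<otimes> p" unfolding g_def using pc by (simp_all add: a_minus_def l_distr r_distr l_minus r_minus)
    then show 1: "g \<otimes> p = \<zero>" "p \<otimes> g = \<zero>" using p(2) pc by (simp_all add: r_neg a_minus_def)
    have "g \<otimes> g = g \<otimes> (\<one> \<ominus> p)" by (simp add: g_def)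
    also have "\<dots> = g \<ominus> g \<otimes> p" using pc gc by (simp add: a_minus_def r_distr r_minus)
    finally show "g \<otimes> g = g" using 1 gc by (simp add: a_minus_def)
  qed
  have gx: "g \<otimes> x i = \<zero>" "g \<otimes> y i = \<zero>" "x i \<otimes> g = \<zero>" "y i \<otimes> g = \<zero>"
    if i: "i \<in> {1..m}" for i
  proof -
    have "g \<otimes> (p \<otimes> x i) = \<zero>" "g \<otimes> (p \<otimes> y i) = \<zero>"
      using gp(1) gc pc xc[OF i] yc[OF i] by (simp_all add: m_assoc[symmetric])
    moreover have "(x i \<otimes> p) \<otimes> g = \<zero>" "(y i \<otimes> p) \<otimes> g = \<zero>"
      using gp(2) gc pc xc[OF i] yc[OF i] by (simp_all add: m_assoc)
    ultimately show "g \<otimes> x i = \<zero>" "g \<otimes> y i = \<zero>" "x i \<otimes> g = \<zero>" "y i \<otimes> g = \<zero>"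
      using x y i by simp_all
  qed
  have yS: "y j \<otimes> S = y j" if j: "j \<in> {1..m}" for j
  proof -
    have "y j \<otimes> S = (\<Oplus>i\<in>{1..m}. y j \<otimes> (x i \<otimes> y i))"
      unfolding S_def using xc yc j by (intro finsum_rdistr) auto
    also have "\<dots> = (\<Oplus>i\<in>{1..m}. if j = i then y i else \<zero>)"
      using xc yc j yx y pc by (intro finsum_cong') (auto simp: m_assoc[symmetric])
    also have "\<dots> = y j" using j yc by (intro finsum_singleton) auto
    finally show ?thesis .
  qed
  have Sp: "S \<otimes> p = S" "p \<otimes> S = S"
  proof -
    have "S \<otimes> p = (\<Oplus>i\<in>{1..m}. x i \<otimes> y i \<otimes> p)"
      unfolding S_def using xc yc pc by (intro finsum_ldistr) auto
    also have "\<dots> = S" unfolding S_def using xc yc pc y by (intro finsum_cong') (auto simp: m_assoc)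
    finally show "S \<otimes> p = S" .
    have "p \<otimes> S = (\<Oplus>i\<in>{1..m}. p \<otimes> (x i \<otimes> y i))"
      unfolding S_def using xc yc pc by (intro finsum_rdistr) auto
    also have "\<dots> = S" unfolding S_def using xc yc pc x
      by (intro finsum_cong') (auto simp: m_assoc[symmetric])
    finally show "p \<otimes> S = S" .
  qed
  have qp: "q \<otimes> p = q" "p \<otimes> q = q" "g \<otimes> q = \<zero>"
  proof -
    have "q \<otimes> p = p \<otimes> p \<ominus> S \<otimes> p" "p \<otimes> q = p \<otimes> p \<ominus> p \<otimes> S"
      unfolding q_def using pc Sc by algebra+
    then show "q \<otimes> p = q" "p \<otimes> q = q" using p(2) Sp by (simp_all add: q_def)
    then have "g \<otimes> q = g \<otimes> p \<otimes> q" using gc pc qc by (simp add: m_assoc)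
    then show "g \<otimes> q = \<zero>" using gp qc by simp
  qed
  have yq: "y j \<otimes> q = \<zero>" if j: "j \<in> {1..m}" for j
  proof -
    have "y j \<otimes> q = y j \<otimes> p \<ominus> y j \<otimes> S" unfolding q_def using pc Sc yc[OF j] by algebra
    then show ?thesis using y(3)[OF j] yS[OF j] yc[OF j] by (simp add: r_neg a_minus_def)
  qed
  \<comment> \<open>The summand \<open>g = 1 - p\<close> makes the first entry congruent to
    \<open>1\<close> modulo \<open>I\<close>. It is orthogonal to all \<open>x i\<close>,
    \<open>y i\<close> and \<open>q\<close>, and \<open>g\<close>, \<open>S\<close> and
    \<open>q\<close> add up to \<open>1\<close>.\<close>
  define X where "X i = (if i = m + 1 then q else if i = 1 then g \<oplus> x 1 else x i)" for i
  define Y where "Y i = (if i = m + 1 then p else if i = 1 then g \<oplus> y 1 else y i)" for i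
  have X_last: "X (Suc m) = q" by (simp add: X_def)
  have Xc: "X i \<in> carrier R" "Y i \<in> carrier R" if "i \<in> {1..m+1}" for i
    using that xc[of i] yc[of i] x1c y1c gc pc qc by (auto simp: X_def Y_def)
  have "(\<Oplus>i\<in>{1..m+1}. X i \<otimes> Y i) = \<one>"
  proof -
    have "{1..m+1} = insert (m+1) (insert 1 {2..m})" using m by auto
    then have "(\<Oplus>i\<in>{1..m+1}. X i \<otimes> Y i) = (\<Oplus>i\<in>insert (m+1) (insert 1 {2..m}). X i \<otimes> Y i)" by simp
    also have "\<dots> = X (m+1) \<otimes> Y (m+1) \<oplus> (X 1 \<otimes> Y 1 \<oplus> (\<Oplus>i\<in>{2..m}. X i \<otimes> Y i))"
      using Xc m by (subst finsum_insert, force, force, force, force, subst finsum_insert) auto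
    also have "(\<Oplus>i\<in>{2..m}. X i \<otimes> Y i) = (\<Oplus>i\<in>{2..m}. x i \<otimes> y i)"
      using xc yc by (intro finsum_cong') (auto simp: X_def Y_def)
    also have "X (m+1) \<otimes> Y (m+1) = q" using qp by (simp add: X_def Y_def)
    also have "X 1 \<otimes> Y 1 = g \<otimes> g \<oplus> g \<otimes> y 1 \<oplus> x 1 \<otimes> g \<oplus> x 1 \<otimes> y 1"
      using m gc x1c y1c unfolding X_def Y_def by (simp, algebra)
    also have "\<dots> = g \<oplus> x 1 \<otimes> y 1" using gx[of 1] gp m gc x1c y1c by simp
    also have "q \<oplus> (g \<oplus> x 1 \<otimes> y 1 \<oplus> (\<Oplus>i\<in>{2..m}. x i \<otimes> y i)) =
        q \<oplus> g \<oplus> (x 1 \<otimes> y 1 \<oplus> (\<Oplus>i\<in>{2..m}. x i \<otimes> y i))"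
      using qc gc x1c y1c xc yc by (simp add: a_assoc)
    also have "x 1 \<otimes> y 1 \<oplus> (\<Oplus>i\<in>{2..m}. x i \<otimes> y i) = (\<Oplus>i\<in>insert 1 {2..m}. x i \<otimes> y i)"
      using m xc yc by (subst finsum_insert) auto
    also have "insert 1 {2..m} = {1..m}" using m by auto
    also have "(\<Oplus>i\<in>{1..m}. x i \<otimes> y i) = S" by (simp add: S_def)
    also have "q \<oplus> g \<oplus> S = \<one>" unfolding q_def g_def using pc Sc by algebra
    finally show ?thesis .
  qed
  moreover have "X 1 \<ominus> \<one> \<in> I" "Y 1 \<ominus> \<one> \<in> I"
  proof -
    have "X 1 \<ominus> \<one> = x 1 \<ominus> p" "Y 1 \<ominus> \<one> = y 1 \<ominus> p"
      using m x1c y1c pc unfolding X_def Y_def g_def by (simp, algebra)+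
    then show "X 1 \<ominus> \<one> \<in> I" "Y 1 \<ominus> \<one> \<in> I" using x(1)[of 1] y(1)[of 1] m p by (auto simp: a_minus_def)
  qed
  moreover have "\<forall>i\<in>{2..m+1}. X i \<in> I" "\<forall>i\<in>{2..m+1}. Y i \<in> I"
    using x y p qI by (auto simp: X_def Y_def)
  ultimately have "unimodular R I (m + 1) X"
    unfolding unimodular_def using Xc by (intro conjI bexI[of _ Y]) auto
  with sr obtain r where r: "r \<in> {1..m} \<rightarrow> I" and
    "unimodular R I m (\<lambda>i. X i \<oplus> X (m + 1) \<otimes> r i)"
    unfolding stable_range_def by blast
  then obtain b where b: "b \<in> {1..m} \<rightarrow> carrier R"
    and eq: "(\<Oplus>i\<in>{1..m}. (X i \<oplus> X (m + 1) \<otimes> r i) \<otimes> b i) = \<one>"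
    unfolding unimodular_def by blast
  have rc: "r i \<in> carrier R" if "i \<in> {1..m}" for i using r a_subset that by auto
  have bc: "b i \<in> carrier R" if "i \<in> {1..m}" for i using b that by auto
  have Yq: "Y j \<otimes> q = \<zero>" if j: "j \<in> {1..m}" for j
    using yq[OF j] j qp(3) gc y1c qc by (auto simp: Y_def l_distr)
  have YX: "Y j \<otimes> X i = (if j = i then (if j = 1 then \<one> else p) else \<zero>)"
    if i: "i \<in> {1..m}" and j: "j \<in> {1..m}" for i j
  proof -
    have 1: "1 \<in> {1..m}" using m by auto
    have gp1: "g \<oplus> p = \<one>" unfolding g_def using pc by algebra
    show ?thesis using i j gx[OF i] gx[OF j] gx[OF 1] gp yx[OF j i] yx[OF 1 i] yx[OF j 1] yx[OF 1 1]
        xc[OF i] yc[OF j] x1c y1c gc gp1 by (auto simp: X_def Y_def l_distr r_distr)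
  qed
  \<comment> \<open>Left multiplication of the shortened equation by \<open>Y j\<close>: the
    translations by multiples of \<open>q\<close> vanish, and orthogonality leaves the single
    coefficient \<open>b j\<close>.\<close>
  have Yb: "Y j = (if j = 1 then \<one> else p) \<otimes> b j" if j: "j \<in> {1..m}" for j
  proof -
    have Yj: "Y j \<in> carrier R" using Xc j by auto
    have summand: "Y j \<otimes> ((X i \<oplus> X (m + 1) \<otimes> r i) \<otimes> b i) =
        (if j = i then (if i = 1 then \<one> else p) \<otimes> b i else \<zero>)" if i: "i \<in> {1..m}" for i
    proof -
      have Xi: "X i \<in> carrier R" using Xc i by auto
      have "Y j \<otimes> ((X i \<oplus> q \<otimes> r i) \<otimes> b i) = (Y j \<otimes> X i) \<otimes> b i \<oplus> (Y j \<otimes> q) \<otimes> r i \<otimes> b i"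
        using Yj Xi qc rc[OF i] bc[OF i] by algebra
      then show ?thesis
        using YX[OF i j] Yq[OF j] rc[OF i] bc[OF i] pc by (auto simp: X_last)
    qed
    have "Y j = Y j \<otimes> (\<Oplus>i\<in>{1..m}. (X i \<oplus> X (m + 1) \<otimes> r i) \<otimes> b i)" using eq Yj by simp
    also have "\<dots> = (\<Oplus>i\<in>{1..m}. Y j \<otimes> ((X i \<oplus> X (m + 1) \<otimes> r i) \<otimes> b i))"
      using Yj Xc rc bc by (intro finsum_rdistr) auto
    also have "\<dots> = (\<Oplus>i\<in>{1..m}. if j = i then (if i = 1 then \<one> else p) \<otimes> b i else \<zero>)"
      using bc pc summand by (intro finsum_cong') auto
    also have "\<dots> = (if j = 1 then \<one> else p) \<otimes> b j"
      using j bc pc by (intro finsum_singleton[where f = "\<lambda>i. (if i = 1 then \<one> else p) \<otimes> b i"]) auto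
    finally show ?thesis .
  qed
  \<comment> \<open>For \<open>j = 1\<close> the previous equation reads \<open>Y 1 = b 1\<close>.
    For \<open>j > 1\<close> it determines \<open>p b j\<close> only, and
    \<open>b j q = b j p q = p b j q\<close> uses that \<open>p\<close> is central; hence the
    exemption of \<open>m = 1\<close> in \<open>central\<close>.\<close>
  have bq: "b j \<otimes> q = \<zero>" if j: "j \<in> {1..m}" for j
  proof (cases "j = 1")
    case True
    then show ?thesis using Yb[OF j] Yq[OF j] bc[OF j] by simp
  next
    case False
    then have "\<forall>u\<in>carrier R. p \<otimes> u = u \<otimes> p" using central j by auto
    then have "b j \<otimes> q = p \<otimes> b j \<otimes> q" using qp bc[OF j] pc qc by (metis m_assoc)
    then show ?thesis using Yb[OF j] Yq[OF j] False by simp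
  qed
  have "q = (\<Oplus>i\<in>{1..m}. (X i \<oplus> X (m + 1) \<otimes> r i) \<otimes> b i) \<otimes> q" using eq qc by simp
  also have "\<dots> = (\<Oplus>i\<in>{1..m}. (X i \<oplus> X (m + 1) \<otimes> r i) \<otimes> b i \<otimes> q)"
    using Xc rc bc qc by (intro finsum_ldistr) auto
  also have "\<dots> = (\<Oplus>i\<in>{1..m}. \<zero>)"
    using Xc rc bc qc bq by (intro finsum_cong') (auto simp: m_assoc)
  also have "\<dots> = \<zero>" by simp
  finally have "q = \<zero>" .
  moreover have "p = q \<oplus> S" unfolding q_def using pc Sc by algebra
  ultimately have "p = S" using Sc by simp
  then show False using ne by (simp add: S_def)
qed

lemma stable_rank_eq_1: "stable_range R I 1 \<Longrightarrow> stable_rank R I = 1"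
  unfolding stable_rank_def by (auto simp: one_enat_def intro!: Least_equality)

lemma stable_rank_eq_2:
  assumes "\<not> stable_range R I 1" "stable_range R I 2"
  shows "stable_rank R I = 2"
proof -
  have "(LEAST m. m \<ge> 1 \<and> stable_range R I m) = 2"
  proof (rule Least_equality)
    fix k :: nat assume k: "1 \<le> k \<and> stable_range R I k"
    then have "k \<noteq> 1" using assms(1) by blast
    then show "2 \<le> k" using k by simp
  qed (use assms in simp)
  then show ?thesis unfolding stable_rank_def using assms(2)
    by (auto simp: numeral_eq_enat intro: exI[of _ 2])
qed

end

section \<open>Spans, pivots and Fitting idempotents\<close>

context ring
begin

lemma add_minus_cancel:
  assumes "u \<in> carrier R" "v \<in> carrier R"
  shows "(u \<oplus> v) \<ominus> u = v" "(u \<oplus> v) \<ominus> v = u" "(u \<ominus> v) \<oplus> v = u" "u \<oplus> (v \<ominus> u) = v"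
proof -
  show 1: "(u \<oplus> v) \<ominus> v = u" and "(u \<ominus> v) \<oplus> v = u"
    using assms by (simp_all add: a_minus_def a_assoc r_neg l_neg)
  show "(u \<oplus> v) \<ominus> u = v"
    using assms unfolding a_comm[OF assms] by (simp add: a_minus_def a_assoc r_neg)
  show "u \<oplus> (v \<ominus> u) = v"
    unfolding a_minus_def using assms by (subst a_lcomm) (simp_all add: r_neg)
qed

lemma add_add_minus_cancel:
  assumes "u \<in> carrier R" "v \<in> carrier R" "w \<in> carrier R"
  shows "(u \<oplus> v) \<ominus> (u \<oplus> w) = v \<ominus> w"
  unfolding a_comm[OF assms(1,2)] using assms by (simp add: a_minus_def minus_add a_assoc r_neg2)

text \<open>The coefficients act from the left and come from a subset of the ring itself:
  \<open>D\<close> is the field of scalars in some places and the ring of Laurent polynomials in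
  others. Recursion on the list turns the elimination of generators into an induction.\<close>

primrec lspan :: "'a set \<Rightarrow> 'a list \<Rightarrow> 'a set"
  where
    "lspan D [] = {\<zero>}"
  | "lspan D (v # vs) = {d \<otimes> v \<oplus> u | d u. d \<in> D \<and> u \<in> lspan D vs}"

lemma lspan_ConsI: "d \<in> D \<Longrightarrow> u \<in> lspan D vs \<Longrightarrow> d \<otimes> v \<oplus> u \<in> lspan D (v # vs)"
  by auto

context
  fixes D :: "'a set"
  assumes D: "subring D R"
begin

lemma lspan_closed:
  assumes "set vs \<subseteq> carrier R" "u \<in> lspan D vs"
  shows "u \<in> carrier R"
  using assms subringE(1)[OF D] by (induction vs arbitrary: u) auto

lemma lspan_zero: "set vs \<subseteq> carrier R \<Longrightarrow> \<zero> \<in> lspan D vs"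
proof (induction vs)
  case (Cons v vs)
  have "\<zero> \<otimes> v \<oplus> \<zero> \<in> lspan D (v # vs)"
    by (rule lspan_ConsI) (use Cons subringE(2)[OF D] in auto)
  then show ?case using Cons.prems by simp
qed simp

lemma lspan_add:
  assumes "set vs \<subseteq> carrier R" "u \<in> lspan D vs" "w \<in> lspan D vs"
  shows "u \<oplus> w \<in> lspan D vs"
  using assms
proof (induction vs arbitrary: u w)
  case (Cons v vs)
  then obtain d e u' w' where *: "u = d \<otimes> v \<oplus> u'" "w = e \<otimes> v \<oplus> w'" "d \<in> D" "e \<in> D"
    "u' \<in> lspan D vs" "w' \<in> lspan D vs" by auto
  have c: "u' \<in> carrier R" "w' \<in> carrier R" "d \<in> carrier R" "e \<in> carrier R" "v \<in> carrier R"
    using * Cons.prems subringE(1)[OF D] lspan_closed by auto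
  have "u \<oplus> w = (d \<oplus> e) \<otimes> v \<oplus> (u' \<oplus> w')"
    unfolding * using c by (simp add: l_distr a_ac)
  moreover have "(d \<oplus> e) \<otimes> v \<oplus> (u' \<oplus> w') \<in> lspan D (v # vs)"
    by (rule lspan_ConsI) (use * Cons subringE(7)[OF D] in auto)
  ultimately show ?case by simp
qed simp

lemma lspan_smult:
  assumes "set vs \<subseteq> carrier R" "d \<in> D" "u \<in> lspan D vs"
  shows "d \<otimes> u \<in> lspan D vs"
  using assms
proof (induction vs arbitrary: u)
  case Nil
  then show ?case using subringE(1)[OF D] by auto
next
  case (Cons v vs)
  then obtain e u' where *: "u = e \<otimes> v \<oplus> u'" "e \<in> D" "u' \<in> lspan D vs" by auto
  have c: "u' \<in> carrier R" "d \<in> carrier R" "e \<in> carrier R" "v \<in> carrier R"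
    using * Cons.prems subringE(1)[OF D] lspan_closed by auto
  have "d \<otimes> u = (d \<otimes> e) \<otimes> v \<oplus> d \<otimes> u'"
    unfolding * using c by (simp add: r_distr m_assoc)
  moreover have "(d \<otimes> e) \<otimes> v \<oplus> d \<otimes> u' \<in> lspan D (v # vs)"
    by (rule lspan_ConsI) (use * Cons subringE(6)[OF D] in auto)
  ultimately show ?case by simp
qed

lemma lspan_incl:
  assumes "set vs \<subseteq> carrier R" "v \<in> set vs"
  shows "v \<in> lspan D vs"
  using assms
proof (induction vs)
  case (Cons w vs)
  show ?case
  proof (cases "v = w")
    case True
    have "\<one> \<otimes> w \<oplus> \<zero> \<in> lspan D (w # vs)"
      by (rule lspan_ConsI) (use Cons.prems lspan_zero subringE(3)[OF D] in auto)
    moreover have "\<one> \<otimes> w \<oplus> \<zero> = v" using True Cons.prems by simp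
    ultimately show ?thesis by (simp only:)
  next
    case False
    have "\<zero> \<otimes> w \<oplus> v \<in> lspan D (w # vs)"
      by (rule lspan_ConsI) (use False Cons subringE(2)[OF D] in auto)
    moreover have "\<zero> \<otimes> w \<oplus> v = v" using Cons.prems by (auto simp: subset_iff)
    ultimately show ?thesis by (simp only:)
  qed
qed simp

lemma lspan_minus:
  assumes "set vs \<subseteq> carrier R" "u \<in> lspan D vs"
  shows "\<ominus> u \<in> lspan D vs"
proof -
  have "\<ominus> \<one> \<in> D" using subringE(3,5)[OF D] by auto
  from lspan_smult[OF assms(1) this assms(2)] show ?thesis
    using lspan_closed[OF assms] by (simp add: l_minus)
qed

definition submod :: "'a set \<Rightarrow> bool"
  where "submod W \<longleftrightarrow> W \<subseteq> carrier R \<and> \<zero> \<in> W \<and> (\<forall>u\<in>W. \<forall>w\<in>W. u \<oplus> w \<in> W) \<and>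
    (\<forall>d\<in>D. \<forall>u\<in>W. d \<otimes> u \<in> W)"

end

text \<open>
  The number of pivots of a subspace \<open>W\<close> relative to a list of vectors replaces the dimension of \<open>W\<close>:
  it is bounded by the length of the list and strictly monotone on subspaces of the span.
\<close>
primrec pivots :: "'a set \<Rightarrow> 'a set \<Rightarrow> 'a list \<Rightarrow> nat"
  where
    "pivots D W [] = 0"
  | "pivots D W (v # vs) = (if \<exists>u\<in>lspan D vs. v \<oplus> u \<in> W then 1 else 0) + pivots D W vs"

lemma pivots_le_length: "pivots D W vs \<le> length vs"
  by (induction vs) auto

lemma pivots_mono: "W \<subseteq> W' \<Longrightarrow> pivots D W vs \<le> pivots D W' vs"
  by (induction vs) auto

text \<open>Gaussian elimination. Equal counts force equal pivots at every position, so a vector of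
  \<open>W'\<close> with leading term \<open>d v\<close> can be reduced by a vector of
  \<open>W\<close> with leading term \<open>v\<close>, and the remainder lies in the span of the
  shorter list.\<close>

lemma pivots_eq_imp_subset:
  assumes K: "subring K R" and inv: "\<And>k. k \<in> K \<Longrightarrow> k \<noteq> \<zero> \<Longrightarrow> \<exists>k'\<in>K. k' \<otimes> k = \<one>"
    and W: "submod K W" and W': "submod K W'" and "W \<subseteq> W'"
    and "pivots K W vs = pivots K W' vs" "set vs \<subseteq> carrier R" "w \<in> W'" "w \<in> lspan K vs"
  shows "w \<in> W"
  using assms(6-)
proof (induction vs arbitrary: w)
  case Nil
  then show ?case using W by (auto simp: submod_def[OF K])
next
  case (Cons v vs)
  note sub = submod_def[OF K]
  let ?P = "\<lambda>W. \<exists>u\<in>lspan K vs. v \<oplus> u \<in> W"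
  have vc: "v \<in> carrier R" "set vs \<subseteq> carrier R" using Cons.prems by auto
  have "pivots K W vs \<le> pivots K W' vs" by (rule pivots_mono) fact
  moreover have "?P W \<longrightarrow> ?P W'" using \<open>W \<subseteq> W'\<close> by blast
  ultimately have eq: "pivots K W vs = pivots K W' vs" and P: "?P W \<longleftrightarrow> ?P W'"
    using Cons.prems(1) by (auto split: if_splits)
  note IH = Cons.IH[OF eq vc(2)]
  obtain d u where w: "w = d \<otimes> v \<oplus> u" "d \<in> K" "u \<in> lspan K vs" using Cons.prems by auto
  have c: "d \<in> carrier R" "u \<in> carrier R" using w subringE(1)[OF K] lspan_closed[OF K vc(2)] by auto
  show ?case
  proof (cases "d = \<zero>")
    case True
    then show ?thesis using w vc c Cons.prems IH by auto
  next
    case False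
    then obtain d' where d': "d' \<in> K" "d' \<otimes> d = \<one>" using inv w by blast
    have d'c: "d' \<in> carrier R" using d' subringE(1)[OF K] by auto
    have "d' \<otimes> w = (d' \<otimes> d) \<otimes> v \<oplus> d' \<otimes> u" using w c d'c vc by (simp add: r_distr m_assoc)
    then have "v \<oplus> d' \<otimes> u = d' \<otimes> w" using d' vc by simp
    moreover have "d' \<otimes> w \<in> W'" using W' d' Cons.prems by (auto simp: sub)
    ultimately have "?P W'" using lspan_smult[OF K vc(2) d'(1) w(3)] by metis
    then obtain u0 where u0: "u0 \<in> lspan K vs" "v \<oplus> u0 \<in> W" using P by blast
    have u0c: "u0 \<in> carrier R" using u0 lspan_closed[OF K vc(2)] by auto
    \<comment> \<open>Subtracting \<open>d (v + u0)\<close> from \<open>w\<close> removes the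
      leading term \<open>d v\<close>.\<close>
    have dW: "d \<otimes> (v \<oplus> u0) \<in> W" using W w u0 by (auto simp: sub)
    have m1: "\<ominus> \<one> \<in> K" using subringE(3,5)[OF K] by auto
    have "\<ominus> \<one> \<otimes> (d \<otimes> (v \<oplus> u0)) \<in> W'" using W' \<open>W \<subseteq> W'\<close> m1 dW by (auto simp: sub)
    then have "w \<oplus> \<ominus> \<one> \<otimes> (d \<otimes> (v \<oplus> u0)) \<in> W'" using W' Cons.prems by (auto simp: sub)
    moreover have "w \<oplus> \<ominus> \<one> \<otimes> (d \<otimes> (v \<oplus> u0)) = u \<ominus> d \<otimes> u0"
      using add_add_minus_cancel[of "d \<otimes> v" u "d \<otimes> u0"] w c u0c vc
      by (simp add: l_minus r_distr a_minus_def minus_add)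
    moreover have "u \<ominus> d \<otimes> u0 \<in> lspan K vs"
      unfolding a_minus_def using w u0 by (intro lspan_add[OF K] lspan_minus[OF K] lspan_smult[OF K]) (use vc in auto)
    ultimately have "u \<ominus> d \<otimes> u0 \<in> W" using IH by simp
    then have "(u \<ominus> d \<otimes> u0) \<oplus> d \<otimes> (v \<oplus> u0) \<in> W" using W dW by (auto simp: sub)
    moreover have "(u \<ominus> d \<otimes> u0) \<oplus> d \<otimes> (v \<oplus> u0) = w"
      unfolding w using c u0c vc by algebra
    ultimately show ?thesis by simp
  qed
qed

text \<open>The equations for \<open>c^k\<close> say that \<open>c\<close> is strongly pi-regular.
  Then \<open>e\<close> is the projection of Fitting's lemma: \<open>c\<close> is invertible on its
  range and nilpotent on its complement. Asking for both \<open>c^k s\<close> and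
  \<open>t c^k\<close> as expressions of \<open>e\<close> makes \<open>e\<close> commute with
  \<open>c\<close>.\<close>

definition fitting :: "'a \<Rightarrow> 'a \<Rightarrow> bool"
  where "fitting c e \<longleftrightarrow> (\<exists>k\<ge>1. \<exists>s\<in>carrier R. \<exists>t\<in>carrier R. c [^] (k::nat) = c [^] k \<otimes> c [^] k \<otimes> s \<and>
    c [^] k = t \<otimes> c [^] k \<otimes> c [^] k \<and> e = c [^] k \<otimes> s \<and> e = t \<otimes> c [^] k)"

lemma fittingE:
  assumes "fitting c e" "c \<in> carrier R"
  obtains k s where "k \<ge> (1::nat)" "s \<in> carrier R" "e \<in> carrier R" "e \<otimes> e = e" "c \<otimes> e = e \<otimes> c"
    "e \<otimes> c [^] k = c [^] k" "c [^] k \<otimes> e = c [^] k" "e = c [^] k \<otimes> s"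
proof -
  obtain k :: nat and s t where k: "k \<ge> 1" and st: "s \<in> carrier R" "t \<in> carrier R"
    and g: "c [^] k = c [^] k \<otimes> c [^] k \<otimes> s" "c [^] k = t \<otimes> c [^] k \<otimes> c [^] k"
      "e = c [^] k \<otimes> s" "e = t \<otimes> c [^] k"
    using assms unfolding fitting_def by blast
  define h where "h = c [^] k"
  have hc: "h \<in> carrier R" using assms by (simp add: h_def)
  have ec: "e \<in> carrier R" using g st hc by (simp add: h_def)
  have h: "h \<otimes> h \<otimes> s = h" "t \<otimes> h \<otimes> h = h" "h \<otimes> s = e" "t \<otimes> h = e" using g by (simp_all add: h_def)
  have eh: "e \<otimes> h = h" "h \<otimes> e = h" using h st hc by (auto simp: m_assoc)
  have ee: "e \<otimes> e = e" using eh h st hc ec by (metis m_assoc)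
  have ch: "c \<otimes> h = h \<otimes> c" using assms(2) unfolding h_def by (metis nat_pow_Suc nat_pow_Suc2)
  \<comment> \<open>Both \<open>c e\<close> and \<open>e c\<close> are brought to the form
    \<open>e c e\<close>, the first through \<open>e = h s\<close> and the second through
    \<open>e = t h\<close>.\<close>
  have "c \<otimes> e = c \<otimes> h \<otimes> s" using h st hc assms by (metis m_assoc)
  also have "\<dots> = e \<otimes> (h \<otimes> c \<otimes> s)" using eh ch ec hc assms st by (metis m_assoc m_closed)
  also have "\<dots> = e \<otimes> c \<otimes> e" using ch h(3) ec hc assms st by (metis m_assoc m_closed)
  finally have 1: "c \<otimes> e = e \<otimes> c \<otimes> e" .
  have "e \<otimes> c = t \<otimes> (c \<otimes> h)" using h(4) ch st hc assms by (metis m_assoc)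
  also have "\<dots> = t \<otimes> (c \<otimes> h) \<otimes> e" using eh st hc assms ec by (metis m_assoc m_closed)
  also have "\<dots> = e \<otimes> c \<otimes> e" using h(4) ch st hc assms by (metis m_assoc)
  finally have 2: "e \<otimes> c = e \<otimes> c \<otimes> e" .
  show ?thesis
    by (rule that[OF k st(1) ec ee _ eh[unfolded h_def] g(3)]) (use 1 2 in simp)
qed

text \<open>Adding \<open>(1 - c x) (1 - e)\<close> does not change \<open>c\<close> on the range of
  \<open>e\<close>, so this range is contained in that of \<open>e'\<close>. If nothing is gained,
  then \<open>f = 1 - e\<close> satisfies \<open>f c'^k' = 0\<close>. Together with
  \<open>f c' = f + f c w\<close> this puts \<open>f\<close> into \<open>c f R\<close>, hence into
  \<open>c^k f R\<close>, which is zero.\<close>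

lemma fitting_perturb:
  assumes c: "fitting c e" "c \<in> carrier R" and c': "fitting c' e'" "c' \<in> carrier R"
    and x: "x \<in> carrier R" and c'_eq: "c' = c \<oplus> (\<one> \<ominus> c \<otimes> x) \<otimes> (\<one> \<ominus> e)"
  shows "e' \<otimes> e = e" "e \<otimes> e' = e' \<Longrightarrow> e = \<one>"
proof -
  obtain k s where k: "s \<in> carrier R" "e \<in> carrier R" "e \<otimes> e = e" "c \<otimes> e = e \<otimes> c"
    "c [^] k \<otimes> e = c [^] k" "e = c [^] k \<otimes> s" "e \<otimes> c [^] k = c [^] k" "k \<ge> (1::nat)"
    using fittingE[OF c] by metis
  obtain k' s' where k': "s' \<in> carrier R" "e' \<in> carrier R" "e' \<otimes> c' [^] k' = c' [^] (k'::nat)"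
    using fittingE[OF c'] by metis
  note [simp] = c(2) c'(2) x k(1,2) k'(1,2)
  define f where "f = \<one> \<ominus> e"
  have fc [simp]: "f \<in> carrier R" by (simp add: f_def)
  have fe: "f \<otimes> e = \<zero>" "f \<otimes> f = f" "c \<otimes> f = f \<otimes> c"
  proof -
    show *: "f \<otimes> e = \<zero>" unfolding f_def using k(3) by (simp add: a_minus_def l_distr l_minus r_neg)
    have "f \<otimes> f = f \<otimes> (\<one> \<ominus> e)" by (simp add: f_def)
    also have "\<dots> = f" using * by (simp add: a_minus_def r_distr r_minus)
    finally show "f \<otimes> f = f" .
    show "c \<otimes> f = f \<otimes> c" unfolding f_def using k(4) by (simp add: a_minus_def r_distr l_distr r_minus l_minus)
  qed
  have ef: "f \<otimes> e = \<zero>" "e \<oplus> f = \<one>"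
    using fe(1) unfolding f_def by (simp_all add: add_minus_cancel)
  have c'e: "c' \<otimes> e = c \<otimes> e"
    unfolding c'_eq f_def[symmetric] using ef(1) by (simp add: l_distr m_assoc)
  have pow: "c' [^] j \<otimes> e = c [^] j \<otimes> e" for j :: nat
  proof (induction j)
    case (Suc j)
    have "c' [^] Suc j \<otimes> e = c' [^] j \<otimes> (e \<otimes> c)" using c'e k(4) by (simp add: m_assoc)
    also have "\<dots> = c [^] j \<otimes> e \<otimes> c" using Suc by (simp add: m_assoc[symmetric])
    also have "\<dots> = c [^] Suc j \<otimes> e" using k(4) by (simp add: m_assoc)
    finally show ?case .
  qed simp
  \<comment> \<open>As \<open>k >= 1\<close>, the idempotent \<open>e\<close> equals
    \<open>c (e h1)\<close>. Iteration makes \<open>e\<close> a right multiple of every power of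
    \<open>c\<close>, in particular of \<open>c^k'\<close>; on \<open>e\<close> this power agrees
    with \<open>c'^k'\<close>, which \<open>e'\<close> fixes from the left.\<close>
  obtain h1 where h1: "h1 \<in> carrier R" "e = c \<otimes> (e \<otimes> h1)"
  proof -
    obtain j where j: "k = Suc j" using k(8) by (cases k) auto
    have "e = e \<otimes> (c [^] k \<otimes> s)" using k(3,6) by simp
    also have "\<dots> = e \<otimes> c \<otimes> (c [^] j \<otimes> s)" unfolding j nat_pow_Suc2[OF c(2)] by (simp add: m_assoc)
    also have "\<dots> = c \<otimes> (e \<otimes> (c [^] j \<otimes> s))" using k(4)[symmetric] by (simp add: m_assoc)
    finally show ?thesis by (intro that[of "c [^] j \<otimes> s"]) auto
  qed
  have ej: "\<exists>h\<in>carrier R. e = c [^] j \<otimes> (e \<otimes> h)" for j :: nat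
  proof (induction j)
    case 0
    then show ?case using k(3) by (intro bexI[of _ e]) auto
  next
    case (Suc j)
    then obtain h where h: "h \<in> carrier R" "e = c [^] j \<otimes> (e \<otimes> h)" by blast
    have "e = c [^] j \<otimes> (c \<otimes> (e \<otimes> h1) \<otimes> h)" using h h1 by simp
    also have "\<dots> = c [^] Suc j \<otimes> (e \<otimes> (h1 \<otimes> h))" using h(1) h1(1) by (simp add: m_assoc)
    finally show ?case using h(1) h1(1) by (intro bexI[of _ "h1 \<otimes> h"]) auto
  qed
  then obtain h where h: "h \<in> carrier R" "e = c [^] k' \<otimes> (e \<otimes> h)" by blast
  then have h': "e = c' [^] k' \<otimes> (e \<otimes> h)" using pow[of k'] by (simp add: m_assoc[symmetric])
  show "e' \<otimes> e = e"
  proof -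
    have "e' \<otimes> e = e' \<otimes> c' [^] k' \<otimes> (e \<otimes> h)" using h'  h(1) by (metis m_assoc m_closed k(2) k'(2) nat_pow_closed c'(2))
    then show ?thesis using k'(3) h' by simp
  qed
  assume ee': "e \<otimes> e' = e'"
  have fe': "f \<otimes> e' = \<zero>" using ee' fe(1) by (metis m_assoc fc k(2) k'(2) l_null)
  have fk': "f \<otimes> c' [^] k' = \<zero>" using fe' k'(3) by (metis m_assoc fc k'(2) l_null nat_pow_closed c'(2))
  define w where "w = \<one> \<ominus> x \<otimes> f"
  have w [simp]: "w \<in> carrier R" by (simp add: w_def)
  have fc': "f \<otimes> c' = f \<oplus> f \<otimes> c \<otimes> w"
  proof -
    have "f \<otimes> c' = f \<otimes> c \<oplus> f \<otimes> f \<ominus> f \<otimes> c \<otimes> (x \<otimes> f)"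
      unfolding c'_eq f_def[symmetric]
      by (simp add: a_minus_def r_distr l_distr r_minus l_minus m_assoc a_ac)
    then show ?thesis unfolding w_def using fe(2)
      by (simp add: a_minus_def r_distr r_minus a_ac)
  qed
  \<comment> \<open>Modulo \<open>f c R\<close>, right multiplication by \<open>c'\<close> fixes
    \<open>f\<close>, because \<open>f c' = f + f c w\<close>. At \<open>j = k'\<close> the power of
    \<open>c'\<close> is killed by \<open>f\<close>, so \<open>f\<close> itself lies in
    \<open>f c R\<close>.\<close>
  have fj: "\<exists>h\<in>carrier R. f = f \<otimes> c' [^] j \<oplus> f \<otimes> c \<otimes> h" for j :: nat
  proof (induction j)
    case 0
    then show ?case by (intro bexI[of _ \<zero>]) auto
  next
    case (Suc j)
    then obtain h where h: "h \<in> carrier R" "f = f \<otimes> c' [^] j \<oplus> f \<otimes> c \<otimes> h" by blast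
    have "f \<otimes> c' [^] Suc j = f \<otimes> c' [^] j \<oplus> f \<otimes> c \<otimes> (w \<otimes> c' [^] j)"
      unfolding nat_pow_Suc2[OF c'(2)] by (simp add: m_assoc[symmetric] fc' l_distr)
    then have "f \<otimes> c' [^] Suc j \<oplus> f \<otimes> c \<otimes> (h \<ominus> w \<otimes> c' [^] j) = f \<otimes> c' [^] j \<oplus> f \<otimes> c \<otimes> h"
      using h(1) by (simp add: a_minus_def r_distr r_minus a_ac r_neg1 r_neg2 r_neg)
    then show ?case using h by (intro bexI[of _ "h \<ominus> w \<otimes> c' [^] j"]) auto
  qed
  obtain h2 where h2: "h2 \<in> carrier R" "f = c \<otimes> (f \<otimes> h2)"
    using fj[of k'] fk' fe(3) by (auto simp: m_assoc[symmetric])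
  have "\<exists>h\<in>carrier R. f = c [^] j \<otimes> (f \<otimes> h)" for j :: nat
  proof (induction j)
    case 0
    then show ?case by (intro bexI[of _ \<one>]) auto
  next
    case (Suc j)
    then obtain h where h: "h \<in> carrier R" "f = c [^] j \<otimes> (f \<otimes> h)" by blast
    have "f = c [^] j \<otimes> (c \<otimes> (f \<otimes> h2) \<otimes> h)" using h h2 by simp
    also have "\<dots> = c [^] Suc j \<otimes> (f \<otimes> (h2 \<otimes> h))" using h(1) h2(1) by (simp add: m_assoc)
    finally show ?case using h(1) h2(1) by (intro bexI[of _ "h2 \<otimes> h"]) auto
  qed
  then obtain h3 where h3: "h3 \<in> carrier R" "f = c [^] k \<otimes> (f \<otimes> h3)" by blast
  have "c [^] k \<otimes> f = \<zero>"
    unfolding f_def using k(5) by (simp add: a_minus_def r_distr r_minus r_neg)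
  then have "f = \<zero>" using h3 by (metis m_assoc fc l_null c(2) nat_pow_closed)
  then show "e = \<one>" using ef(2) by simp
qed

end

section \<open>Finite-dimensional algebras have stable rank 1\<close>

locale finite_dim_algebra = ring R for R (structure) +
  fixes K :: "'a set" and vs :: "'a list"
  assumes K: "subring K R" and K_inv: "\<And>k. k \<in> K \<Longrightarrow> k \<noteq> \<zero> \<Longrightarrow> \<exists>k'\<in>K. k' \<otimes> k = \<one>"
    and K_central: "\<And>k u. k \<in> K \<Longrightarrow> u \<in> carrier R \<Longrightarrow> k \<otimes> u = u \<otimes> k"
    and vs: "set vs \<subseteq> carrier R" and span: "carrier R \<subseteq> lspan K vs"
begin

lemma submod_ideals:
  assumes c: "c \<in> carrier R"
  shows "submod K ((\<lambda>u. c \<otimes> u) ` carrier R)" "submod K ((\<lambda>u. u \<otimes> c) ` carrier R)"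
proof -
  have Kc: "k \<in> carrier R" if "k \<in> K" for k using that subringE(1)[OF K] by auto
  show "submod K ((\<lambda>u. c \<otimes> u) ` carrier R)"
    unfolding submod_def[OF K]
  proof (intro conjI ballI)
    show "\<zero> \<in> (\<lambda>u. c \<otimes> u) ` carrier R" using c by (auto intro!: image_eqI[of _ _ \<zero>])
  next
    fix u w assume "u \<in> (\<lambda>u. c \<otimes> u) ` carrier R" "w \<in> (\<lambda>u. c \<otimes> u) ` carrier R"
    then obtain u' w' where "u' \<in> carrier R" "w' \<in> carrier R" "u = c \<otimes> u'" "w = c \<otimes> w'" by auto
    then show "u \<oplus> w \<in> (\<lambda>u. c \<otimes> u) ` carrier R"
      using c by (intro image_eqI[of _ _ "u' \<oplus> w'"]) (auto simp: r_distr)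
  next
    fix k u assume "k \<in> K" "u \<in> (\<lambda>u. c \<otimes> u) ` carrier R"
    then obtain u' where "k \<in> K" "u' \<in> carrier R" "u = c \<otimes> u'" by auto
    then show "k \<otimes> u \<in> (\<lambda>u. c \<otimes> u) ` carrier R"
      using c Kc K_central[of k c] by (intro image_eqI[of _ _ "k \<otimes> u'"]) (auto simp: m_assoc[symmetric])
  qed (use c in auto)
  show "submod K ((\<lambda>u. u \<otimes> c) ` carrier R)"
    unfolding submod_def[OF K]
  proof (intro conjI ballI)
    show "\<zero> \<in> (\<lambda>u. u \<otimes> c) ` carrier R" using c by (auto intro!: image_eqI[of _ _ \<zero>])
  next
    fix u w assume "u \<in> (\<lambda>u. u \<otimes> c) ` carrier R" "w \<in> (\<lambda>u. u \<otimes> c) ` carrier R"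
    then obtain u' w' where "u' \<in> carrier R" "w' \<in> carrier R" "u = u' \<otimes> c" "w = w' \<otimes> c" by auto
    then show "u \<oplus> w \<in> (\<lambda>u. u \<otimes> c) ` carrier R"
      using c by (intro image_eqI[of _ _ "u' \<oplus> w'"]) (auto simp: l_distr)
  next
    fix k u assume "k \<in> K" "u \<in> (\<lambda>u. u \<otimes> c) ` carrier R"
    then obtain u' where "k \<in> K" "u' \<in> carrier R" "u = u' \<otimes> c" by auto
    then show "k \<otimes> u \<in> (\<lambda>u. u \<otimes> c) ` carrier R"
      using c Kc by (intro image_eqI[of _ _ "k \<otimes> u'"]) (auto simp: m_assoc)
  qed (use c in auto)
qed

lemma pivots_subset:
  assumes "submod K W" "submod K W'" "W \<subseteq> W'" "pivots K W vs \<ge> pivots K W' vs"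
  shows "W' \<subseteq> W"
proof
  fix w assume w: "w \<in> W'"
  then have "w \<in> lspan K vs" using assms(2) span by (auto simp: submod_def[OF K])
  moreover have "pivots K W vs = pivots K W' vs" using pivots_mono[OF assms(3)] assms(4) by (simp add: le_antisym)
  ultimately show "w \<in> W" using pivots_eq_imp_subset[OF K K_inv assms(1-3) _ vs w] by blast
qed

text \<open>The chains \<open>c^k R\<close> and \<open>R c^k\<close> descend, and a \<open>k\<close>
  that minimises the sum of their pivot numbers makes both stationary at once. Then
  \<open>c^k\<close> is a multiple of \<open>c^(k+1)\<close> on either side, and iteration gives
  \<open>g = g g s = t g g\<close> for \<open>g = c^(k+1)\<close>.\<close>

lemma fitting_exists:
  assumes c: "c \<in> carrier R"
  shows "\<exists>e. fitting c e"
proof -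
  define A where "A k = (\<lambda>u. c [^] k \<otimes> u) ` carrier R" for k :: nat
  define B where "B k = (\<lambda>u. u \<otimes> c [^] k) ` carrier R" for k :: nat
  define \<mu> where "\<mu> k = pivots K (A k) vs + pivots K (B k) vs" for k
  obtain k where k: "\<And>j. \<mu> k \<le> \<mu> j" using ex_has_least_nat[of "\<lambda>_. True" 0 \<mu>] by blast
  have AS: "A (Suc k) \<subseteq> A k"
  proof
    fix u assume "u \<in> A (Suc k)"
    then obtain u' where "u' \<in> carrier R" "u = c [^] k \<otimes> c \<otimes> u'" by (auto simp: A_def)
    then show "u \<in> A k" unfolding A_def using c by (intro image_eqI[of _ _ "c \<otimes> u'"]) (auto simp: m_assoc)
  qed
  have BS: "B (Suc k) \<subseteq> B k"
  proof
    fix u assume "u \<in> B (Suc k)"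
    then obtain u' where "u' \<in> carrier R" "u = u' \<otimes> (c \<otimes> c [^] k)"
      unfolding B_def using c nat_pow_Suc2[OF c] by auto
    then show "u \<in> B k" unfolding B_def using c by (intro image_eqI[of _ _ "u' \<otimes> c"]) (auto simp: m_assoc)
  qed
  have "pivots K (A (Suc k)) vs \<le> pivots K (A k) vs" "pivots K (B (Suc k)) vs \<le> pivots K (B k) vs"
    using AS BS by (auto intro: pivots_mono)
  then have "pivots K (A (Suc k)) vs \<ge> pivots K (A k) vs" "pivots K (B (Suc k)) vs \<ge> pivots K (B k) vs"
    using k[of "Suc k"] by (auto simp: \<mu>_def)
  then have "A k \<subseteq> A (Suc k)" "B k \<subseteq> B (Suc k)"
    using pivots_subset[OF _ _ AS] pivots_subset[OF _ _ BS] submod_ideals[OF nat_pow_closed[OF c]]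
    unfolding A_def B_def by blast+
  moreover have "c [^] k \<in> A k" "c [^] k \<in> B k" unfolding A_def B_def using c
    by (auto intro!: image_eqI[of _ _ \<one>])
  ultimately have "c [^] k \<in> A (Suc k)" "c [^] k \<in> B (Suc k)" by auto
  then obtain p q where pq: "p \<in> carrier R" "q \<in> carrier R"
    "c [^] k = c [^] Suc k \<otimes> p" "c [^] k = q \<otimes> c [^] Suc k" unfolding A_def B_def by blast
  have p': "c [^] (k + i) = c [^] (k + i) \<otimes> c \<otimes> p" and q': "c [^] (k + i) = q \<otimes> (c \<otimes> c [^] (k + i))" for i
  proof -
    have "c [^] (k + i) = c [^] i \<otimes> c [^] k" "c [^] (k + i) = c [^] k \<otimes> c [^] i"
      using c by (simp_all add: nat_pow_mult add.commute)
    moreover have "c [^] i \<otimes> c [^] k = c [^] i \<otimes> c [^] k \<otimes> c \<otimes> p"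
      by (subst pq(3)) (use c pq(1,2) in \<open>simp add: m_assoc\<close>)
    moreover have "c [^] k \<otimes> c [^] i = q \<otimes> (c \<otimes> (c [^] k \<otimes> c [^] i))"
      by (subst pq(4)) (use c pq(1,2) nat_pow_Suc2[OF c] in \<open>simp add: m_assoc[symmetric]\<close>)
    ultimately show "c [^] (k + i) = c [^] (k + i) \<otimes> c \<otimes> p" "c [^] (k + i) = q \<otimes> (c \<otimes> c [^] (k + i))" by simp_all
  qed
  have kj: "c [^] Suc k \<otimes> c [^] j = c [^] (k + Suc j)" "c [^] j \<otimes> c [^] Suc k = c [^] (k + Suc j)" for j :: nat
    using nat_pow_mult[OF c, of "Suc k" j] nat_pow_mult[OF c, of j "Suc k"]
    by (simp_all only: add_Suc add_Suc_right add.commute)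
  have pp: "c [^] Suc k = c [^] Suc k \<otimes> c [^] j \<otimes> p [^] j" and qq: "c [^] Suc k = q [^] j \<otimes> (c [^] j \<otimes> c [^] Suc k)" for j :: nat
  proof (induction j)
    case (Suc j)
    have "c [^] Suc k \<otimes> c [^] Suc j \<otimes> p [^] Suc j = (c [^] Suc k \<otimes> c [^] j) \<otimes> c \<otimes> p \<otimes> p [^] j"
      unfolding nat_pow_Suc2[OF pq(1)] nat_pow_Suc[of c j] using c pq(1,2) by (simp add: m_assoc)
    also have "c [^] Suc k \<otimes> c [^] j = c [^] (k + (Suc j))" by (simp only: kj(1))
    also have "c [^] (k + (Suc j)) \<otimes> c \<otimes> p = c [^] (k + (Suc j))" by (rule p'[symmetric])
    also have "\<dots> = c [^] Suc k \<otimes> c [^] j" by (simp only: kj(1))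
    also have "\<dots> \<otimes> p [^] j = c [^] Suc k" using Suc.IH(1) by simp
    finally show "c [^] Suc k = c [^] Suc k \<otimes> c [^] Suc j \<otimes> p [^] Suc j" by simp
    have "q [^] Suc j \<otimes> (c [^] Suc j \<otimes> c [^] Suc k) = q [^] j \<otimes> (q \<otimes> (c \<otimes> (c [^] j \<otimes> c [^] Suc k)))"
      unfolding nat_pow_Suc2[OF c, of j] nat_pow_Suc[of q j] using c pq(1,2) by (simp add: m_assoc)
    also have "c [^] j \<otimes> c [^] Suc k = c [^] (k + (Suc j))" by (simp only: kj(2))
    also have "q \<otimes> (c \<otimes> c [^] (k + (Suc j))) = c [^] (k + (Suc j))" by (rule q'[symmetric])
    also have "\<dots> = c [^] j \<otimes> c [^] Suc k" by (simp only: kj(2))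
    also have "q [^] j \<otimes> \<dots> = c [^] Suc k" using Suc.IH(2) by simp
    finally show "c [^] Suc k = q [^] Suc j \<otimes> (c [^] Suc j \<otimes> c [^] Suc k)" by simp
  qed (use c in simp_all)
  \<comment> \<open>The exponent \<open>k + 1\<close> is used because \<open>fitting\<close> asks
    for a positive one. The two expressions of the idempotent agree:
    \<open>t g = t g g s = g s\<close>.\<close>
  define g where "g = c [^] Suc k"
  define s where "s = p [^] Suc k"
  define t where "t = q [^] Suc k"
  have gc: "g \<in> carrier R" "s \<in> carrier R" "t \<in> carrier R" using c pq(1,2) by (auto simp: g_def s_def t_def)
  have g: "g = g \<otimes> g \<otimes> s" "g = t \<otimes> (g \<otimes> g)" unfolding g_def s_def t_def by (rule pp, rule qq)
  have "t \<otimes> g = t \<otimes> (g \<otimes> g) \<otimes> s" using g(1) gc by (metis m_assoc m_closed)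
  then have "t \<otimes> g = g \<otimes> s" by (simp only: g(2)[symmetric])
  then have "fitting c (g \<otimes> s)"
    unfolding fitting_def using g gc m_assoc[OF gc(3,1,1)]
    by (intro exI[of _ "Suc k"] conjI bexI[of _ s] bexI[of _ t]) (simp_all only: g_def[symmetric])
  then show ?thesis by blast
qed

text \<open>Among all translates \<open>C z = a + b y z\<close> one is taken whose Fitting
  idempotent has the largest range; \<open>fitting_perturb\<close> would enlarge this range unless
  the idempotent is \<open>1\<close>, which makes \<open>C z\<close> right invertible. The
  translation is sought in \<open>b y R\<close> and not merely in \<open>b R\<close>, so that
  \<open>y z\<close> stays in any ideal that contains \<open>y\<close>.\<close>

theorem right_invertible_translate:
  assumes c: "a \<in> carrier R" "b \<in> carrier R" "x \<in> carrier R" "y \<in> carrier R"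
    and eq: "a \<otimes> x \<oplus> b \<otimes> y = \<one>"
  shows "\<exists>z\<in>carrier R. \<exists>w\<in>carrier R. (a \<oplus> b \<otimes> (y \<otimes> z)) \<otimes> w = \<one>"
proof -
  define C where "C z = a \<oplus> b \<otimes> (y \<otimes> z)" for z
  have Cc: "C z \<in> carrier R" if "z \<in> carrier R" for z using that c by (simp add: C_def)
  define P where "P ze \<longleftrightarrow> fst ze \<in> carrier R \<and> fitting (C (fst ze)) (snd ze)" for ze
  define \<mu> where "\<mu> ze = pivots K ((\<lambda>u. snd ze \<otimes> u) ` carrier R) vs" for ze :: "'a \<times> 'a"
  obtain e0 where "fitting (C \<zero>) e0" using fitting_exists[OF Cc[OF zero_closed]] by blast
  then have "P (\<zero>, e0)" by (simp add: P_def)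
  moreover have "\<forall>ze. P ze \<longrightarrow> \<mu> ze < Suc (length vs)" by (auto simp: \<mu>_def pivots_le_length less_Suc_eq_le)
  ultimately have "\<exists>ze. P ze \<and> (\<forall>y. P y \<longrightarrow> \<mu> y \<le> \<mu> ze)" by (rule Lattices_Big.ex_has_greatest_nat)
  then obtain ze where "P ze" and ze: "\<And>y. P y \<Longrightarrow> \<mu> y \<le> \<mu> ze"
    by blast
  obtain z e where [simp]: "ze = (z, e)" by (cases ze)
  have z: "z \<in> carrier R" and fit: "fitting (C z) e" using \<open>P ze\<close> by (auto simp: P_def)
  obtain k s where e: "k \<ge> (1::nat)" "s \<in> carrier R" "e \<in> carrier R" and ee: "e \<otimes> e = e"
    and "C z \<otimes> e = e \<otimes> C z" "e \<otimes> C z [^] k = C z [^] k" "C z [^] k \<otimes> e = C z [^] k"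
    and es: "e = C z [^] k \<otimes> s"
    by (rule fittingE[OF fit Cc[OF z]])
  \<comment> \<open>Chosen so that \<open>C z' = C z + (1 - C z x) (1 - e)\<close>, the perturbation
    of \<open>fitting_perturb\<close>; this rests on
    \<open>b y (1 - z x) = 1 - C z x\<close>.\<close>
  define z' where "z' = z \<oplus> (\<one> \<ominus> z \<otimes> x) \<otimes> (\<one> \<ominus> e)"
  have z': "z' \<in> carrier R" using z c e by (simp add: z'_def)
  have by_eq: "b \<otimes> y = \<one> \<ominus> a \<otimes> x" 
  proof -
    have "b \<otimes> y = (a \<otimes> x \<oplus> b \<otimes> y) \<ominus> a \<otimes> x" using c by (simp add: add_minus_cancel)
    then show ?thesis by (simp only: eq)
  qed
  have "b \<otimes> (y \<otimes> (\<one> \<ominus> z \<otimes> x)) = b \<otimes> y \<ominus> b \<otimes> (y \<otimes> z) \<otimes> x"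
    using c z by (simp add: a_minus_def r_distr r_minus m_assoc)
  also have "\<dots> = \<one> \<ominus> C z \<otimes> x"
    unfolding by_eq C_def using c z by (simp add: a_minus_def l_distr minus_add a_assoc m_assoc)
  finally have bz: "b \<otimes> (y \<otimes> (\<one> \<ominus> z \<otimes> x)) = \<one> \<ominus> C z \<otimes> x" .
  have "C z' = C z \<oplus> b \<otimes> (y \<otimes> (\<one> \<ominus> z \<otimes> x)) \<otimes> (\<one> \<ominus> e)"
    unfolding C_def z'_def using c z e by (simp add: r_distr m_assoc a_assoc)
  then have Cz': "C z' = C z \<oplus> (\<one> \<ominus> C z \<otimes> x) \<otimes> (\<one> \<ominus> e)" using bz by simp
  obtain e' where fit': "fitting (C z') e'" using fitting_exists[OF Cc[OF z']] by blast
  obtain e'c: "e' \<in> carrier R" and e'e': "e' \<otimes> e' = e'" by (rule fittingE[OF fit' Cc[OF z']])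
  note pert = fitting_perturb[OF fit Cc[OF z] fit' Cc[OF z'] c(3) Cz']
  have sub: "(\<lambda>u. e \<otimes> u) ` carrier R \<subseteq> (\<lambda>u. e' \<otimes> u) ` carrier R"
  proof
    fix u assume "u \<in> (\<lambda>u. e \<otimes> u) ` carrier R"
    then obtain v where "v \<in> carrier R" "u = e \<otimes> v" by auto
    then have "u = e' \<otimes> (e \<otimes> v)" using pert(1) e e'c by (simp add: m_assoc[symmetric])
    then show "u \<in> (\<lambda>u. e' \<otimes> u) ` carrier R" using \<open>v \<in> carrier R\<close> e by auto
  qed
  have "P (z', e')" using z' fit' by (simp add: P_def)
  from ze[OF this] have "pivots K ((\<lambda>u. e' \<otimes> u) ` carrier R) vs \<le> pivots K ((\<lambda>u. e \<otimes> u) ` carrier R) vs"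
    by (simp add: \<mu>_def)
  then have "(\<lambda>u. e' \<otimes> u) ` carrier R \<subseteq> (\<lambda>u. e \<otimes> u) ` carrier R"
    using pivots_subset[OF submod_ideals(1)[OF e(3)] submod_ideals(1)[OF e'c] sub] by simp
  moreover have "e' \<in> (\<lambda>u. e' \<otimes> u) ` carrier R" using e'e' e'c by (intro image_eqI[of _ _ e']) auto
  ultimately obtain v where v: "v \<in> carrier R" "e' = e \<otimes> v" by auto
  have "e \<otimes> e' = e'" using ee v e by (simp add: m_assoc[symmetric])
  then have e1: "e = \<one>" by (rule pert(2))
  obtain j where j: "k = Suc j" using e(1) by (cases k) auto
  have "C z \<otimes> (C z [^] j \<otimes> s) = \<one>"
    using es e1 e(2) Cc[OF z] unfolding j nat_pow_Suc2[OF Cc[OF z]] by (simp add: m_assoc)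
  then show ?thesis using z e(2) Cc[OF z] unfolding C_def by (intro bexI[of _ z] bexI[of _ "(a \<oplus> b \<otimes> (y \<otimes> z)) [^] j \<otimes> s"]) auto
qed

end

text \<open>The quotient by \<open>J\<close> is finite-dimensional over the image of
  \<open>K\<close>. Lifting a solution from the quotient costs the error term
  \<open>j\<close>.\<close>

lemma (in ring) right_invertible_translate_mod:
  assumes J: "ideal J R" and K: "subring K R"
    and K_inv: "\<And>k. k \<in> K \<Longrightarrow> k \<noteq> \<zero> \<Longrightarrow> \<exists>k'\<in>K. k' \<otimes> k = \<one>"
    and K_central: "\<And>k u. k \<in> K \<Longrightarrow> u \<in> carrier R \<Longrightarrow> k \<otimes> u = u \<otimes> k"
    and vs: "set vs \<subseteq> carrier R"
    and span: "\<And>u. u \<in> carrier R \<Longrightarrow> \<exists>l\<in>lspan K vs. \<exists>j\<in>J. u = l \<oplus> j"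
    and c: "a \<in> carrier R" "b \<in> carrier R" "x \<in> carrier R" "y \<in> carrier R"
    and eq: "a \<otimes> x \<oplus> b \<otimes> y = \<one>"
  shows "\<exists>z\<in>carrier R. \<exists>w\<in>carrier R. \<exists>j\<in>J. (a \<oplus> b \<otimes> (y \<otimes> z)) \<otimes> w \<oplus> j = \<one>"
proof -
  interpret J: ideal J R by fact
  let ?Q = "R Quot J" and ?h = "(+>) J"
  have zeroQ: "\<zero>\<^bsub>?Q\<^esub> = J" by (simp add: FactRing_def)
  interpret h: ring_hom_ring R ?Q ?h by (rule J.rcos_ring_hom_ring)
  have surj: "\<exists>u\<in>carrier R. v = ?h u" if "v \<in> carrier ?Q" for v
    using that unfolding FactRing_def A_RCOSETS_def' by simp
  have hj: "?h j = \<zero>\<^bsub>?Q\<^esub>" if "j \<in> J" for j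
    using J.a_rcos_const[OF that] zeroQ by (simp only:)
  have Kc: "k \<in> carrier R" if "k \<in> K" for k using that subringE(1)[OF K] by auto
  have lspan_h: "?h l \<in> h.S.lspan (?h ` K) (map ?h us)" if "set us \<subseteq> carrier R" "l \<in> lspan K us" for l us
    using that
  proof (induction us arbitrary: l)
    case Nil
    then show ?case using h.hom_zero by simp
  next
    case (Cons v us)
    then obtain d u where l: "l = d \<otimes> v \<oplus> u" "d \<in> K" "u \<in> lspan K us" by auto
    then have "u \<in> carrier R" using lspan_closed[OF K] Cons.prems by auto
    then have "?h l = ?h d \<otimes>\<^bsub>?Q\<^esub> ?h v \<oplus>\<^bsub>?Q\<^esub> ?h u" using l Cons.prems Kc by simp
    moreover have "?h u \<in> h.S.lspan (?h ` K) (map ?h us)" using Cons l by auto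
    ultimately show ?case using l(2) by auto
  qed
  interpret Q: finite_dim_algebra ?Q "?h ` K" "map ?h vs"
  proof (intro finite_dim_algebra.intro finite_dim_algebra_axioms.intro)
    show "ring ?Q" by (rule h.S.ring_axioms)
    show "subring (?h ` K) ?Q" by (rule h.img_is_subring[OF K])
  next
    fix k assume k: "k \<in> ?h ` K" "k \<noteq> \<zero>\<^bsub>?Q\<^esub>"
    then obtain l where l: "l \<in> K" "k = ?h l" by auto
    then have "l \<noteq> \<zero>" using k(2) h.hom_zero by auto
    then obtain l' where l': "l' \<in> K" "l' \<otimes> l = \<one>" using K_inv l by blast
    then have "?h l' \<otimes>\<^bsub>?Q\<^esub> k = \<one>\<^bsub>?Q\<^esub>" using l Kc by (metis h.hom_mult h.hom_one)
    then show "\<exists>k'\<in>?h ` K. k' \<otimes>\<^bsub>?Q\<^esub> k = \<one>\<^bsub>?Q\<^esub>" using l' by auto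
  next
    fix k u assume "k \<in> ?h ` K" "u \<in> carrier ?Q"
    then obtain l v where "l \<in> K" "k = ?h l" "v \<in> carrier R" "u = ?h v" using surj by blast
    then show "k \<otimes>\<^bsub>?Q\<^esub> u = u \<otimes>\<^bsub>?Q\<^esub> k" using K_central Kc by (metis h.hom_mult)
  next
    show "set (map ?h vs) \<subseteq> carrier ?Q" using vs by (auto intro!: h.hom_closed)
  next
    show "carrier ?Q \<subseteq> h.S.lspan (?h ` K) (map ?h vs)"
    proof
      fix v assume "v \<in> carrier ?Q"
      then obtain u where u: "u \<in> carrier R" "v = ?h u" using surj by blast
      then obtain l j where lj: "l \<in> lspan K vs" "j \<in> J" "u = l \<oplus> j" using span by blast
      have "l \<in> carrier R" using lspan_closed[OF K vs lj(1)] .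
      then have "v = ?h l"
        unfolding u lj(3) using lj(2) hj[OF lj(2)] J.Icarr \<open>l \<in> carrier R\<close> by simp
      then show "v \<in> h.S.lspan (?h ` K) (map ?h vs)" using lspan_h[OF vs lj(1)] by simp
    qed
  qed
  have "?h a \<otimes>\<^bsub>?Q\<^esub> ?h x \<oplus>\<^bsub>?Q\<^esub> ?h b \<otimes>\<^bsub>?Q\<^esub> ?h y = \<one>\<^bsub>?Q\<^esub>"
    using c eq by (metis h.hom_add h.hom_mult h.hom_one m_closed)
  from Q.right_invertible_translate[OF h.hom_closed[OF c(1)] h.hom_closed[OF c(2)]
      h.hom_closed[OF c(3)] h.hom_closed[OF c(4)] this] obtain z' w' where
    "z' \<in> carrier ?Q" "w' \<in> carrier ?Q" 
    and e: "(?h a \<oplus>\<^bsub>?Q\<^esub> ?h b \<otimes>\<^bsub>?Q\<^esub> (?h y \<otimes>\<^bsub>?Q\<^esub> z')) \<otimes>\<^bsub>?Q\<^esub> w' = \<one>\<^bsub>?Q\<^esub>"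
    by blast
  obtain z where "z \<in> carrier R" "z' = ?h z" using surj[OF \<open>z' \<in> carrier ?Q\<close>] by blast
  moreover obtain w where "w \<in> carrier R" "w' = ?h w" using surj[OF \<open>w' \<in> carrier ?Q\<close>] by blast
  ultimately have zw: "z \<in> carrier R" "w \<in> carrier R" "z' = ?h z" "w' = ?h w" by simp_all
  define m where "m = (a \<oplus> b \<otimes> (y \<otimes> z)) \<otimes> w"
  have mc: "m \<in> carrier R" using c zw by (simp add: m_def)
  have "?h m = ?h \<one>" using e c zw unfolding m_def zw(3,4) by simp
  then have "\<one> \<in> J +> m" using J.a_rcos_self[OF one_closed] by simp
  then have "\<one> \<ominus> m \<in> J" unfolding a_minus_def by (rule J.a_rcos_module_imp[OF mc])
  moreover have "m \<oplus> (\<one> \<ominus> m) = \<one>" using mc by (simp add: add_minus_cancel)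
  ultimately show ?thesis using zw unfolding m_def by blast
qed

section \<open>Polynomials as coefficient lists, and further facts about spans\<close>

context ring
begin

text \<open>Polynomials are kept as coefficient lists, constant term first, because one and the same
  list is later evaluated both at \<open>z\<close> and at \<open>1\<close>. A list with a nonzero
  entry counts as a nonzero polynomial whatever its value at \<open>z\<close> is.\<close>

primrec horner :: "'a \<Rightarrow> 'a list \<Rightarrow> 'a"
  where
    "horner u [] = \<zero>"
  | "horner u (a # as) = a \<oplus> u \<otimes> horner u as"

fun padd :: "'a list \<Rightarrow> 'a list \<Rightarrow> 'a list"
  where
    "padd [] bs = bs"
  | "padd as [] = as"
  | "padd (a # as) (b # bs) = (a \<oplus> b) # padd as bs"

fun pmult :: "'a list \<Rightarrow> 'a list \<Rightarrow> 'a list"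
  where
    "pmult [] bs = []"
  | "pmult (a # as) bs = padd (map (\<lambda>b. a \<otimes> b) bs) (\<zero> # pmult as bs)"

lemma horner_closed: "u \<in> carrier R \<Longrightarrow> set as \<subseteq> carrier R \<Longrightarrow> horner u as \<in> carrier R"
  by (induction as) auto

lemma padd_set: "subring K R \<Longrightarrow> set as \<subseteq> K \<Longrightarrow> set bs \<subseteq> K \<Longrightarrow> set (padd as bs) \<subseteq> K"
  by (induction as bs rule: padd.induct) (auto simp: subringE(7))

lemma pmult_set: "subring K R \<Longrightarrow> set as \<subseteq> K \<Longrightarrow> set bs \<subseteq> K \<Longrightarrow> set (pmult as bs) \<subseteq> K"
proof (induction as)
  case (Cons a as)
  have "set (\<zero> # pmult as bs) \<subseteq> K" using Cons by (auto simp: subringE(2))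
  moreover have "set (map (\<lambda>b. a \<otimes> b) bs) \<subseteq> K" using Cons.prems by (auto simp: subringE(6))
  ultimately show ?case using padd_set[OF Cons.prems(1)] by simp
qed simp

lemma horner_padd:
  assumes "u \<in> carrier R" "set as \<subseteq> carrier R" "set bs \<subseteq> carrier R"
  shows "horner u (padd as bs) = horner u as \<oplus> horner u bs"
  using assms
proof (induction as bs rule: padd.induct)
  case (3 a as b bs)
  then have "horner u as \<in> carrier R" "horner u bs \<in> carrier R" by (auto intro: horner_closed)
  then show ?case using 3 by (simp add: r_distr a_ac)
qed (auto simp: horner_closed)

lemma horner_smult:
  assumes "u \<in> carrier R" "set as \<subseteq> carrier R" "a \<in> carrier R" "a \<otimes> u = u \<otimes> a"
  shows "horner u (map (\<lambda>b. a \<otimes> b) as) = a \<otimes> horner u as"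
  using assms
proof (induction as)
  case (Cons b as)
  then have "horner u as \<in> carrier R" by (auto intro: horner_closed)
  then have "u \<otimes> (a \<otimes> horner u as) = a \<otimes> (u \<otimes> horner u as)"
    using Cons.prems by (simp add: m_assoc[symmetric])
  then show ?case using Cons \<open>horner u as \<in> carrier R\<close> by (simp add: r_distr)
qed simp

lemma horner_pmult:
  assumes "u \<in> carrier R" "set as \<subseteq> carrier R" "set bs \<subseteq> carrier R"
    "\<And>a. a \<in> set as \<Longrightarrow> a \<otimes> u = u \<otimes> a"
  shows "set (pmult as bs) \<subseteq> carrier R \<and> horner u (pmult as bs) = horner u as \<otimes> horner u bs"
  using assms
proof (induction as)
  case (Cons a as)
  then have *: "horner u as \<in> carrier R" "horner u bs \<in> carrier R" by (auto intro: horner_closed)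
  have IH: "set (pmult as bs) \<subseteq> carrier R" "horner u (pmult as bs) = horner u as \<otimes> horner u bs"
    using Cons by auto
  have s: "set (\<zero> # pmult as bs) \<subseteq> carrier R" "set (map (\<lambda>b. a \<otimes> b) bs) \<subseteq> carrier R"
    using IH Cons.prems by auto
  have "horner u (pmult (a # as) bs) = a \<otimes> horner u bs \<oplus> u \<otimes> (horner u as \<otimes> horner u bs)"
    using horner_padd[OF Cons.prems(1) s(2,1)] horner_smult[of u bs a] Cons.prems IH * by simp
  then show ?case
    using * Cons.prems padd_set[OF carrier_is_subring s(2,1)] by (simp add: l_distr m_assoc)
qed (auto simp: horner_closed)

lemma horner_append:
  assumes "u \<in> carrier R" "set as \<subseteq> carrier R" "set bs \<subseteq> carrier R"
  shows "horner u (as @ bs) = horner u as \<oplus> u [^] length as \<otimes> horner u bs"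
  using assms
proof (induction as)
  case (Cons a as)
  then have "horner u as \<in> carrier R" "horner u bs \<in> carrier R" by (auto intro: horner_closed)
  then show ?case using Cons nat_pow_Suc2[of u "length as"] by (simp add: r_distr m_assoc a_assoc del: nat_pow_Suc)
qed (simp add: horner_closed)

lemma horner_monomial:
  "u \<in> carrier R \<Longrightarrow> horner u (replicate n \<zero> @ [\<one>]) = u [^] n"
  by (induction n) (simp, metis append_Cons horner.simps(2) l_zero m_closed nat_pow_Suc2 nat_pow_closed replicate_Suc)

lemma horner_zeros: "u \<in> carrier R \<Longrightarrow> \<forall>a\<in>set as. a = \<zero> \<Longrightarrow> horner u as = \<zero>"
  by (induction as) auto

lemma lspan_mono:
  assumes "subring K R" "set vs \<subseteq> carrier R" "set us \<subseteq> set vs" "w \<in> lspan K us"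
  shows "w \<in> lspan K vs"
  using assms(3,4)
proof (induction us arbitrary: w)
  case Nil
  then show ?case using lspan_zero[OF assms(1,2)] by simp
next
  case (Cons v us)
  then obtain d u where "w = d \<otimes> v \<oplus> u" "d \<in> K" "u \<in> lspan K us" by auto
  then show ?case
    using Cons lspan_add[OF assms(1,2)] lspan_smult[OF assms(1,2)] lspan_incl[OF assms(1,2)] by auto
qed

lemma lspan_induct_submod:
  assumes "subring K R" "set vs \<subseteq> carrier R" "submod K W" "set vs \<subseteq> W" "w \<in> lspan K vs"
  shows "w \<in> W"
  using assms(2-)
proof (induction vs arbitrary: w)
  case Nil
  then show ?case by (auto simp: submod_def[OF assms(1)])
next
  case (Cons v vs)
  then obtain d u where *: "w = d \<otimes> v \<oplus> u" "d \<in> K" "u \<in> lspan K vs" by auto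
  have "u \<in> W" by (rule Cons.IH) (use Cons.prems * in auto)
  moreover have "v \<in> W" using Cons.prems by simp
  ultimately show ?case using * Cons.prems(2) by (simp add: submod_def[OF assms(1)])
qed

lemma lspan_image_right:
  assumes "subring K R" "set vs \<subseteq> carrier R" "v \<in> carrier R" "w \<in> lspan K vs"
  shows "w \<otimes> v \<in> lspan K (map (\<lambda>u. u \<otimes> v) vs)"
  using assms(2-)
proof (induction vs arbitrary: w)
  case (Cons u vs)
  then obtain d t where w: "w = d \<otimes> u \<oplus> t" "d \<in> K" "t \<in> lspan K vs" by auto
  have "d \<in> carrier R" "t \<in> carrier R" "u \<in> carrier R"
    using w subringE(1)[OF assms(1)] lspan_closed[OF assms(1) _ w(3)] Cons.prems by auto
  then have "w \<otimes> v = d \<otimes> (u \<otimes> v) \<oplus> t \<otimes> v" using w Cons.prems by (simp add: l_distr m_assoc)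
  then show ?case using w Cons by auto
qed simp

end

section \<open>Finitely generated modules over Laurent polynomials\<close>

locale laurent_algebra = ring R for R (structure) +
  fixes K :: "'a set" and z z' :: 'a and vs :: "'a list"
  assumes K: "subring K R" and K_inv: "\<And>k. k \<in> K \<Longrightarrow> k \<noteq> \<zero> \<Longrightarrow> \<exists>k'\<in>K. k' \<otimes> k = \<one>"
    and K_central: "\<And>k u. k \<in> K \<Longrightarrow> u \<in> carrier R \<Longrightarrow> k \<otimes> u = u \<otimes> k"
    and z: "z \<in> carrier R" "z' \<in> carrier R" "z \<otimes> z' = \<one>"
    and z_central: "\<And>u. u \<in> carrier R \<Longrightarrow> z \<otimes> u = u \<otimes> z"
    and vs: "set vs \<subseteq> carrier R"
    and span: "carrier R \<subseteq> lspan (generate_ring R (insert z (insert z' K))) vs"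
begin

text \<open>An image of the Laurent polynomial ring over \<open>K\<close>. Nothing asserts that
  \<open>z\<close> is transcendental, so the statements about polynomials below refer to coefficient
  lists.\<close>

abbreviation D where "D \<equiv> generate_ring R (insert z (insert z' K))"

lemma Kc: "k \<in> K \<Longrightarrow> k \<in> carrier R"
  using subringE(1)[OF K] by auto

lemma z'z: "z' \<otimes> z = \<one>"
  using z z_central by metis

lemma z'_central: "u \<in> carrier R \<Longrightarrow> z' \<otimes> u = u \<otimes> z'"
proof -
  assume u: "u \<in> carrier R"
  have "z' \<otimes> u = z' \<otimes> (u \<otimes> z) \<otimes> z'" using u z by (simp add: m_assoc)
  also have "\<dots> = z' \<otimes> z \<otimes> u \<otimes> z'" using u z z_central[OF u] by (simp add: m_assoc)
  finally show ?thesis using u z z'z by simp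
qed

lemma z_cancel: "v \<in> carrier R \<Longrightarrow> z \<otimes> (z' \<otimes> v) = v" "v \<in> carrier R \<Longrightarrow> z' \<otimes> (z \<otimes> v) = v"
  using z z'z by (simp_all add: m_assoc[symmetric])

lemma D_subring: "subring D R"
  by (rule generate_ring_is_subring) (use Kc z in auto)

lemma Dc: "d \<in> D \<Longrightarrow> d \<in> carrier R"
  using subringE(1)[OF D_subring] by auto

lemma D_central:
  assumes "d \<in> D" "u \<in> carrier R"
  shows "d \<otimes> u = u \<otimes> d"
  using assms
proof (induction rule: generate_ring.induct)
  case (incl h)
  then show ?case using K_central z_central z'_central by auto
next
  case (a_inv h)
  then show ?case using Dc by (simp add: l_minus r_minus)
next
  case (eng_add h1 h2)
  then show ?case using Dc by (simp add: l_distr r_distr)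
next
  case (eng_mult h1 h2)
  then show ?case using Dc by (metis m_assoc)
qed simp

text \<open>Denominators are cleared by a power of \<open>z\<close>. For a sum, the two powers are
  made equal by monomial factors; for a product they are multiplied.\<close>

lemma laurent_normal_form:
  assumes "d \<in> D"
  shows "\<exists>m cs. set cs \<subseteq> K \<and> z [^] (m::nat) \<otimes> d = horner z cs"
  using assms
proof (induction rule: generate_ring.induct)
  case one
  show ?case
    by (rule exI[of _ 0], rule exI[of _ "[\<one>]"]) (use z subringE(3)[OF K] in auto)
next
  case (incl h)
  then consider "h = z" | "h = z'" | "h \<in> K" by auto
  then show ?case
  proof cases
    case 1
    then show ?thesis
      by (intro exI[of _ 0] exI[of _ "[\<zero>, \<one>]"]) (use z subringE(2,3)[OF K] in auto)
  next
    case 2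
    then show ?thesis
      by (intro exI[of _ 1] exI[of _ "[\<one>]"]) (use z subringE(2,3)[OF K] in auto)
  next
    case 3
    then show ?thesis
      by (intro exI[of _ 0] exI[of _ "[h]"]) (use z Kc in auto)
  qed
next
  case (a_inv h)
  then obtain m cs where *: "set cs \<subseteq> K" "z [^] (m::nat) \<otimes> h = horner z cs" by blast
  have m1: "\<ominus> \<one> \<in> K" using subringE(3,5)[OF K] by auto
  have "horner z (map (\<lambda>b. \<ominus> \<one> \<otimes> b) cs) = \<ominus> \<one> \<otimes> horner z cs"
    by (rule horner_smult) (use * Kc z m1 K_central in auto)
  also have "\<dots> = z [^] m \<otimes> \<ominus> h"
    using *(2)[symmetric] Dc[OF a_inv.hyps] z by (simp add: l_minus r_minus)
  finally show ?case using *(1) m1 subringE(6)[OF K]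
    by (intro exI[of _ m] exI[of _ "map (\<lambda>b. \<ominus> \<one> \<otimes> b) cs"]) auto
next
  case (eng_add h1 h2)
  then obtain m cs k ds where *: "set cs \<subseteq> K" "z [^] (m::nat) \<otimes> h1 = horner z cs"
    "set ds \<subseteq> K" "z [^] (k::nat) \<otimes> h2 = horner z ds" by blast
  let ?m = "\<lambda>n. replicate n \<zero> @ [\<one>]"
  have mon: "set (?m n) \<subseteq> K" for n using subringE(2,3)[OF K] by (auto simp: set_replicate_conv_if)
  have Kl: "set as \<subseteq> carrier R" if "set as \<subseteq> K" for as using that Kc by auto
  have h: "h1 \<in> carrier R" "h2 \<in> carrier R" using eng_add Dc by auto
  have zc: "a \<otimes> z = z \<otimes> a" if "a \<in> K" for a using that K_central z by auto
  define es where "es = padd (pmult (?m k) cs) (pmult (?m m) ds)"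
  have es: "set es \<subseteq> K" unfolding es_def by (intro padd_set pmult_set K mon *)
  have "horner z es = z [^] k \<otimes> horner z cs \<oplus> z [^] m \<otimes> horner z ds"
    unfolding es_def using horner_pmult[OF z(1) Kl[OF mon[of k]] Kl[OF *(1)]] horner_pmult[OF z(1) Kl[OF mon[of m]] Kl[OF *(3)]]
      zc mon[THEN subsetD] horner_monomial[OF z(1)] by (subst horner_padd) (use z in auto)
  also have "\<dots> = z [^] k \<otimes> (z [^] m \<otimes> h1) \<oplus> z [^] m \<otimes> (z [^] k \<otimes> h2)" using * by simp
  also have "\<dots> = z [^] (m + k) \<otimes> (h1 \<oplus> h2)"
    using h z by (simp add: r_distr m_assoc[symmetric] nat_pow_mult add.commute)
  finally show ?case using es by metis
next
  case (eng_mult h1 h2)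
  then obtain m cs k ds where *: "set cs \<subseteq> K" "z [^] (m::nat) \<otimes> h1 = horner z cs"
    "set ds \<subseteq> K" "z [^] (k::nat) \<otimes> h2 = horner z ds" by blast
  have Kl: "set as \<subseteq> carrier R" if "set as \<subseteq> K" for as using that Kc by auto
  have h: "h1 \<in> carrier R" "h2 \<in> carrier R" using eng_mult Dc by auto
  have zc: "a \<otimes> z = z \<otimes> a" if "a \<in> K" for a using that K_central z by auto
  have "horner z (pmult cs ds) = horner z cs \<otimes> horner z ds"
    using horner_pmult[OF z(1) Kl[OF *(1)] Kl[OF *(3)]] zc *(1) by auto
  also have "\<dots> = z [^] m \<otimes> (h1 \<otimes> z [^] k) \<otimes> h2" using *(2,4)[symmetric] h z by (simp add: m_assoc)
  also have "h1 \<otimes> z [^] k = z [^] k \<otimes> h1"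
    using D_central[OF eng_mult.hyps(1), of "z [^] k"] z by simp
  also have "z [^] m \<otimes> (z [^] k \<otimes> h1) \<otimes> h2 = z [^] (m + k) \<otimes> (h1 \<otimes> h2)"
    using h z by (simp add: m_assoc nat_pow_mult[symmetric])
  finally show ?case using pmult_set[OF K *(1,3)] by metis
qed

lemma horner_central:
  assumes "set as \<subseteq> K" "u \<in> carrier R"
  shows "horner z as \<otimes> u = u \<otimes> horner z as"
  using assms
proof (induction as)
  case (Cons a as)
  have hc: "horner z as \<in> carrier R" using Cons Kc z by (intro horner_closed) auto
  have "z \<otimes> horner z as \<otimes> u = u \<otimes> (z \<otimes> horner z as)"
    using Cons hc z z_central[OF Cons.prems(2)] by (simp add: m_assoc) (simp add: m_assoc[symmetric])
  then show ?case using Cons hc z Kc K_central[of a u] by (simp add: l_distr r_distr)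
qed simp

text \<open>Zero coefficients are first removed at both ends, at the constant end because
  \<open>z\<close> is a unit. Then \<open>1, z, ..., z^(n-1)\<close> span modulo
  \<open>f = horner z as\<close>: the top coefficient reduces \<open>z^n\<close>, the constant one
  reduces the inverse of \<open>z\<close>, and both together make the span stable under
  \<open>D\<close>.\<close>

lemma D_finite_mod:
  assumes "set as \<subseteq> K" "\<exists>a\<in>set as. a \<noteq> \<zero>"
  shows "\<exists>zs. set zs \<subseteq> carrier R \<and> (\<forall>d\<in>D. \<exists>l\<in>lspan K zs. \<exists>v\<in>carrier R. d = l \<oplus> horner z as \<otimes> v)"
  using assms
proof (induction "length as" arbitrary: as rule: less_induct)
  case less
  have asc: "set as \<subseteq> carrier R" using less Kc by auto
  obtain a as' where as: "as = a # as'" using less.prems by (cases as) auto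
  show ?case
  proof (cases "a = \<zero>")
    case True
    have "length as' < length as" "set as' \<subseteq> K" "\<exists>a\<in>set as'. a \<noteq> \<zero>" using as less.prems True by auto
    from less.hyps[OF this] obtain zs where zs: "set zs \<subseteq> carrier R"
      "\<forall>d\<in>D. \<exists>l\<in>lspan K zs. \<exists>v\<in>carrier R. d = l \<oplus> horner z as' \<otimes> v" by blast
    have hc: "horner z as' \<in> carrier R" using as asc z by (intro horner_closed) auto
    have "horner z as' \<otimes> v = horner z as \<otimes> (z' \<otimes> v)" if v: "v \<in> carrier R" for v
    proof -
      have "horner z as \<otimes> (z' \<otimes> v) = horner z as' \<otimes> (z \<otimes> z') \<otimes> v"
        using as True hc z v z_central[OF hc] by (simp add: m_assoc z_cancel)
      then show ?thesis using z hc by simp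
    qed
    moreover have "z' \<otimes> v \<in> carrier R" if "v \<in> carrier R" for v using z that by simp
    ultimately show ?thesis using zs by metis
  next
    case a: False
    obtain bs b where bs: "as = bs @ [b]" using as by (metis append_butlast_last_id list.distinct(1))
    have bsc: "set bs \<subseteq> carrier R" "b \<in> carrier R" "b \<in> K" "set bs \<subseteq> K" using bs asc less.prems by auto
    have hbs: "horner z bs \<in> carrier R" using bsc z by (intro horner_closed) auto
    have hc: "horner z as \<in> carrier R" using asc z by (intro horner_closed) auto
    have has: "horner z as = horner z bs \<oplus> z [^] length bs \<otimes> b"
      using bs bsc z horner_append[of z bs "[b]"] by simp
    show ?thesis
    proof (cases "b = \<zero>")
      case True
      have "length bs < length as" "set bs \<subseteq> K" "\<exists>a\<in>set bs. a \<noteq> \<zero>" using bs less.prems True by auto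
      from less.hyps[OF this] show ?thesis using has True hbs z by simp
    next
      case b: False
      define n where "n = length bs"
      define zs where "zs = map (\<lambda>i. z [^] i) [0..<n]"
      have zs: "set zs \<subseteq> carrier R" using z by (auto simp: zs_def)
      note sp = lspan_add[OF K zs] lspan_smult[OF K zs] lspan_zero[OF K zs] lspan_incl[OF K zs] lspan_closed[OF K zs]
        lspan_minus[OF K zs]
      \<comment> \<open>The low powers of \<open>z\<close> together with all multiples of
        \<open>f\<close>. It remains to see that \<open>W\<close> contains \<open>1\<close> and is
        stable under \<open>D\<close>.\<close>
      define W where "W = {l \<oplus> horner z as \<otimes> v | l v. l \<in> lspan K zs \<and> v \<in> carrier R}"
      have WI: "l \<oplus> horner z as \<otimes> v \<in> W" if "l \<in> lspan K zs" "v \<in> carrier R" for l v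
        using that by (auto simp: W_def)
      have lW: "l \<in> W" if "l \<in> lspan K zs" for l
        using WI[OF that zero_closed] hc sp(5)[OF that] by simp
      have Wc: "W \<subseteq> carrier R" using hc sp(5) by (auto simp: W_def)
      have Wadd: "u \<oplus> w \<in> W" if uw: "u \<in> W" "w \<in> W" for u w
      proof -
        obtain l v l' v' where *: "u = l \<oplus> horner z as \<otimes> v" "w = l' \<oplus> horner z as \<otimes> v'"
          "l \<in> lspan K zs" "v \<in> carrier R" "l' \<in> lspan K zs" "v' \<in> carrier R"
          using uw unfolding W_def by blast
        have "u \<oplus> w = (l \<oplus> l') \<oplus> horner z as \<otimes> (v \<oplus> v')"
          unfolding * using *(3-) hc sp(5) by (simp add: r_distr a_ac)
        then show ?thesis using WI * sp(1) by simp
      qed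
      have WK: "k \<otimes> u \<in> W" if k: "k \<in> K" and u: "u \<in> W" for k u
      proof -
        obtain l v where *: "u = l \<oplus> horner z as \<otimes> v" "l \<in> lspan K zs" "v \<in> carrier R"
          using u unfolding W_def by blast
        have "k \<otimes> u = k \<otimes> l \<oplus> horner z as \<otimes> (k \<otimes> v)"
          unfolding * using *(2-) hc sp(5) Kc[OF k] horner_central[OF less.prems(1) Kc[OF k]]
          by (simp add: r_distr) (simp add: m_assoc[symmetric])
        then show ?thesis using WI * sp(2) Kc k by simp
      qed
      have W: "submod K W" unfolding submod_def[OF K] using Wc lW[OF sp(3)] Wadd WK by auto
      have Wh: "u \<oplus> horner z as \<otimes> v \<in> W" if "u \<in> W" "v \<in> carrier R" for u v
      proof -
        have "horner z as \<otimes> v \<in> W" using WI[OF sp(3) that(2)] that(2) hc by simp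
        then show ?thesis using Wadd that by simp
      qed
      have horner_lspan: "horner z cs \<in> lspan K zs" if "length cs \<le> n" "set cs \<subseteq> K" for cs
        using that
      proof (induction cs rule: rev_induct)
        case Nil
        then show ?case using sp(3) by simp
      next
        case (snoc d cs)
        have "z [^] length cs \<in> set zs" using snoc.prems by (auto simp: zs_def)
        then have "d \<otimes> z [^] length cs \<in> lspan K zs" using snoc.prems sp(2,4) by auto
        moreover have "d \<otimes> z [^] length cs = z [^] length cs \<otimes> d" by (rule K_central) (use snoc.prems z in auto)
        moreover have "horner z (cs @ [d]) = horner z cs \<oplus> z [^] length cs \<otimes> d"
          using horner_append[of z cs "[d]"] z snoc.prems Kc by auto
        ultimately show ?case using snoc sp(1) by simp
      qed
      \<comment> \<open>The equation \<open>f = bs(z) + z^n b\<close> is solved for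
        \<open>z^n\<close>; this is where \<open>b\<close> has to be invertible.\<close>
      have zn: "z [^] n \<in> W"
      proof -
        obtain b' where b': "b' \<in> K" "b' \<otimes> b = \<one>" using K_inv[OF bsc(3) b] by blast
        have "b \<otimes> b' = \<one>" using b' K_central Kc bsc by metis
        then have "z [^] n = z [^] n \<otimes> b \<otimes> b'" using z bsc b' Kc by (simp add: m_assoc)
        also have "z [^] n \<otimes> b = horner z as \<ominus> horner z bs"
          unfolding has n_def using hbs z bsc by (simp add: add_minus_cancel)
        also have "(horner z as \<ominus> horner z bs) \<otimes> b' = \<ominus> (b' \<otimes> horner z bs) \<oplus> horner z as \<otimes> b'"
          using hc hbs b' Kc horner_central[OF bsc(4) Kc[OF b'(1)]]
          by (simp add: a_minus_def l_distr l_minus a_comm)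
        also have "\<dots> \<in> W"
          using WI[OF sp(6)[OF sp(2)[OF b'(1) horner_lspan[OF _ bsc(4)]]] Kc[OF b'(1)]] by (simp add: n_def)
        finally show ?thesis .
      qed
      \<comment> \<open>Multiplying \<open>f = a + z as'(z)\<close> by \<open>z' a'\<close>, with
        \<open>a'\<close> inverse to \<open>a\<close>, expresses \<open>z'\<close> by low powers and
        a multiple of \<open>f\<close>.\<close>
      have z'W: "z' \<in> W"
      proof -
        have "length as = Suc n" using bs by (simp add: n_def)
        then have aK: "a \<in> K" "set as' \<subseteq> K" "length as' = n" using as less.prems by auto
        obtain a' where a': "a' \<in> K" "a' \<otimes> a = \<one>" using K_inv[OF aK(1) a] by blast
        have c: "a \<in> carrier R" "a' \<in> carrier R" "horner z as' \<in> carrier R"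
          using aK a' Kc z by (auto intro!: horner_closed)
        have "horner z as \<otimes> (z' \<otimes> a') = a \<otimes> z' \<otimes> a' \<oplus> horner z as' \<otimes> (z \<otimes> z') \<otimes> a'"
          using as c z z_central[OF c(3)] by (simp add: l_distr m_assoc z_cancel)
        also have "a \<otimes> z' \<otimes> a' = z' \<otimes> (a' \<otimes> a)"
          using z'_central[OF c(1)] K_central[OF a'(1) c(1)] c z by (simp add: m_assoc[symmetric])
        also have "\<dots> = z'" using a'(2) z by simp
        also have "horner z as' \<otimes> (z \<otimes> z') \<otimes> a' = a' \<otimes> horner z as'"
          using z c horner_central[OF aK(2) c(2)] by simp
        finally have "z' = \<ominus> (a' \<otimes> horner z as') \<oplus> horner z as \<otimes> (z' \<otimes> a')"
          using z c by (simp add: a_assoc a_lcomm r_neg l_neg a_comm)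
        also have "\<dots> \<in> W"
          by (rule WI[OF sp(6)[OF sp(2)[OF a'(1) horner_lspan[OF _ aK(2)]]]]) (use aK z c in auto)
        finally show ?thesis .
      qed
      \<comment> \<open>A central \<open>y\<close> that sends the spanning powers into
        \<open>W\<close> preserves \<open>W\<close>, since it commutes with \<open>f\<close> and
        with \<open>K\<close>. It is applied to \<open>z\<close> and to \<open>z'\<close>.\<close>
      have stab: "y \<otimes> u \<in> W" if y: "y \<in> carrier R" "\<And>u. u \<in> carrier R \<Longrightarrow> y \<otimes> u = u \<otimes> y"
        and yz: "\<And>i. i < n \<Longrightarrow> y \<otimes> z [^] i \<in> W" and u: "u \<in> W" for y u
      proof -
        obtain l v where *: "u = l \<oplus> horner z as \<otimes> v" "l \<in> lspan K zs" "v \<in> carrier R"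
          using u unfolding W_def by blast
        define W' where "W' = {l \<in> carrier R. y \<otimes> l \<in> W}"
        have "submod K W'"
          unfolding submod_def[OF K] W'_def using lW[OF sp(3)] Wadd WK y Kc Wc
          by (auto simp: r_distr m_assoc[symmetric] K_central[OF _ y(1), symmetric])
            (auto simp: m_assoc)
        moreover have "set zs \<subseteq> W'" using yz z by (auto simp: W'_def zs_def)
        ultimately have "l \<in> W'" using lspan_induct_submod[OF K zs] *(2) by blast
        then have "y \<otimes> l \<in> W" by (simp add: W'_def)
        moreover have "y \<otimes> u = y \<otimes> l \<oplus> horner z as \<otimes> (y \<otimes> v)"
          unfolding * using *(2-) hc y y(2)[OF hc] sp(5) by (simp add: r_distr) (simp add: m_assoc[symmetric])
        ultimately show ?thesis using Wh y * by simp
      qed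
      have powW: "z [^] i \<in> W" if "i < n" for i
        using that by (intro lW sp(4)) (auto simp: zs_def)
      have zW: "z \<otimes> u \<in> W" if "u \<in> W" for u
      proof (rule stab[OF z(1) z_central _ that])
        fix i assume "i < n"
        then have "z [^] Suc i \<in> W" using powW[of "Suc i"] zn by (cases "Suc i = n") auto
        then show "z \<otimes> z [^] i \<in> W" using nat_pow_Suc2[OF z(1), of i] by simp
      qed
      have z'W': "z' \<otimes> u \<in> W" if "u \<in> W" for u
      proof (rule stab[OF z(2) z'_central _ that])
        fix i assume i: "i < n"
        show "z' \<otimes> z [^] i \<in> W"
        proof (cases i)
          case 0
          then show ?thesis using z'W z by simp
        next
          case (Suc j)
          have "z' \<otimes> z [^] i = z' \<otimes> z \<otimes> z [^] j" unfolding Suc nat_pow_Suc2[OF z(1)] using z by (simp add: m_assoc)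
          then show ?thesis using powW[of j] i Suc z z'z by simp
        qed
      qed
      have 1: "\<one> \<in> W" using powW[of 0] zn by (cases "n = 0") auto
      have "\<forall>w\<in>W. d \<otimes> w \<in> W" if "d \<in> D" for d
        using that
      proof (induction rule: generate_ring.induct)
        case one
        then show ?case using Wc by auto
      next
        case (incl h)
        then show ?case using WK zW z'W' by auto
      next
        case (a_inv h)
        have "\<ominus> \<one> \<in> K" using subringE(3,5)[OF K] by auto
        then have "\<ominus> \<one> \<otimes> (h \<otimes> w) \<in> W" if "w \<in> W" for w using WK a_inv that by auto
        moreover have "\<ominus> \<one> \<otimes> (h \<otimes> w) = \<ominus> h \<otimes> w" if "w \<in> W" for w
          using that Wc Dc[OF a_inv.hyps] by (auto simp: l_minus)
        ultimately show ?case by metis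
      next
        case (eng_add h1 h2)
        then show ?case using Wadd Wc Dc by (auto simp: l_distr)
      next
        case (eng_mult h1 h2)
        then show ?case using Wc Dc by (auto simp: m_assoc)
      qed
      then have "d \<in> W" if "d \<in> D" for d using that 1 Dc by force
      then show ?thesis using zs unfolding W_def by blast
    qed
  qed
qed

lemma horner_multiples_ideal:
  assumes as: "set as \<subseteq> K"
  shows "ideal ((\<lambda>u. horner z as \<otimes> u) ` carrier R) R"
proof (rule idealI)
  have hc: "horner z as \<in> carrier R" using as Kc z by (intro horner_closed) auto
  show "subgroup ((\<lambda>u. horner z as \<otimes> u) ` carrier R) (add_monoid R)"
  proof (rule add.subgroupI)
    fix u assume "u \<in> (\<lambda>u. horner z as \<otimes> u) ` carrier R"
    then obtain v where "v \<in> carrier R" "u = horner z as \<otimes> v" by auto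
    then show "\<ominus> u \<in> (\<lambda>u. horner z as \<otimes> u) ` carrier R"
      using hc by (intro image_eqI[of _ _ "\<ominus> v"]) (auto simp: r_minus)
  next
    fix u w assume "u \<in> (\<lambda>u. horner z as \<otimes> u) ` carrier R" "w \<in> (\<lambda>u. horner z as \<otimes> u) ` carrier R"
    then obtain v v' where "v \<in> carrier R" "u = horner z as \<otimes> v" "v' \<in> carrier R" "w = horner z as \<otimes> v'" by auto
    then show "u \<oplus> w \<in> (\<lambda>u. horner z as \<otimes> u) ` carrier R"
      using hc by (intro image_eqI[of _ _ "v \<oplus> v'"]) (auto simp: r_distr)
  qed (use hc in auto)
next
  fix a x assume ax: "a \<in> (\<lambda>u. horner z as \<otimes> u) ` carrier R" "x \<in> carrier R"
  have hc: "horner z as \<in> carrier R" using as Kc z by (intro horner_closed) auto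
  obtain v where v: "v \<in> carrier R" "a = horner z as \<otimes> v" using ax by auto
  show "a \<otimes> x \<in> (\<lambda>u. horner z as \<otimes> u) ` carrier R"
    using v ax hc by (intro image_eqI[of _ _ "v \<otimes> x"]) (auto simp: m_assoc)
  have "x \<otimes> a = horner z as \<otimes> (x \<otimes> v)"
    using v ax hc horner_central[OF as ax(2)] by (simp add: m_assoc[symmetric])
  then show "x \<otimes> a \<in> (\<lambda>u. horner z as \<otimes> u) ` carrier R"
    using v ax by (intro image_eqI[of _ _ "x \<otimes> v"]) auto
qed (rule ring_axioms)

text \<open>Tower argument: \<open>vs\<close> spans over \<open>D\<close>, and \<open>D\<close> is
  spanned over \<open>K\<close> modulo \<open>f\<close> by finitely many elements, so the products
  span over \<open>K\<close> modulo \<open>f R\<close>.\<close>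

lemma finite_dim_mod_horner:
  assumes as: "set as \<subseteq> K" "\<exists>a\<in>set as. a \<noteq> \<zero>"
  shows "\<exists>us. set us \<subseteq> carrier R \<and>
    (\<forall>u\<in>carrier R. \<exists>l\<in>lspan K us. \<exists>j\<in>(\<lambda>u. horner z as \<otimes> u) ` carrier R. u = l \<oplus> j)"
proof -
  let ?f = "horner z as"
  have hc: "?f \<in> carrier R" using as Kc z by (intro horner_closed) auto
  obtain zs where zs: "set zs \<subseteq> carrier R"
    "\<And>d. d \<in> D \<Longrightarrow> \<exists>l\<in>lspan K zs. \<exists>v\<in>carrier R. d = l \<oplus> ?f \<otimes> v"
    using D_finite_mod[OF as] by blast
  have ex: "\<exists>us. set us \<subseteq> carrier R \<and> (\<forall>u\<in>lspan D ws. \<exists>l\<in>lspan K us. \<exists>v\<in>carrier R. u = l \<oplus> ?f \<otimes> v)"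
    if "set ws \<subseteq> carrier R" for ws
    using that
  proof (induction ws)
    case Nil
    show ?case
      by (rule exI[of _ "[]"]) (use hc in \<open>auto intro!: bexI[of _ \<zero>]\<close>)
  next
    case (Cons w ws)
    then obtain us where us: "set us \<subseteq> carrier R"
      "\<And>u. u \<in> lspan D ws \<Longrightarrow> \<exists>l\<in>lspan K us. \<exists>v\<in>carrier R. u = l \<oplus> ?f \<otimes> v" by auto
    define us' where "us' = map (\<lambda>x. x \<otimes> w) zs @ us"
    have us': "set us' \<subseteq> carrier R" using us zs Cons.prems by (auto simp: us'_def)
    have "\<exists>l\<in>lspan K us'. \<exists>v\<in>carrier R. u = l \<oplus> ?f \<otimes> v" if u: "u \<in> lspan D (w # ws)" for u
    proof -
      obtain d u' where *: "u = d \<otimes> w \<oplus> u'" "d \<in> D" "u' \<in> lspan D ws" using u by auto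
      obtain l v where lv: "l \<in> lspan K zs" "v \<in> carrier R" "d = l \<oplus> ?f \<otimes> v" using zs(2)[OF *(2)] by blast
      obtain l' v' where lv': "l' \<in> lspan K us" "v' \<in> carrier R" "u' = l' \<oplus> ?f \<otimes> v'" using us(2)[OF *(3)] by blast
      have c: "l \<in> carrier R" "l' \<in> carrier R" "w \<in> carrier R"
        using lspan_closed[OF K] zs us lv lv' Cons.prems by auto
      have "u = (l \<otimes> w \<oplus> l') \<oplus> ?f \<otimes> (v \<otimes> w \<oplus> v')"
        unfolding * lv(3) lv'(3) using c lv(2) lv'(2) hc by (simp add: l_distr r_distr m_assoc a_ac)
      moreover have "l \<otimes> w \<in> lspan K us'"
        by (rule lspan_mono[OF K us' _ lspan_image_right[OF K zs(1) c(3) lv(1)]]) (simp add: us'_def)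
      moreover have "l' \<in> lspan K us'" by (rule lspan_mono[OF K us' _ lv'(1)]) (simp add: us'_def)
      ultimately show ?thesis using lspan_add[OF K us'] lv lv' c by blast
    qed
    then show ?case using us' by blast
  qed
  obtain us where us: "set us \<subseteq> carrier R"
    "\<forall>u\<in>lspan D vs. \<exists>l\<in>lspan K us. \<exists>v\<in>carrier R. u = l \<oplus> ?f \<otimes> v" using ex[OF vs] by blast
  have "\<exists>l\<in>lspan K us. \<exists>j\<in>(\<lambda>u. ?f \<otimes> u) ` carrier R. u = l \<oplus> j" if "u \<in> carrier R" for u
    using us(2) that span by blast
  then show ?thesis using us(1) by blast
qed

text \<open>\<open>f R\<close> is a two-sided ideal because \<open>f\<close> is central, and the
  quotient is finite-dimensional. The result on quotients is applied with the last coefficient equal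
  to \<open>1\<close>, so \<open>q\<close> is not confined to a smaller ideal.\<close>

lemma translate_mod_horner:
  assumes as: "set as \<subseteq> K" "\<exists>a\<in>set as. a \<noteq> \<zero>"
    and c: "a \<in> carrier R" "b \<in> carrier R" "x \<in> carrier R"
    and eq: "a \<otimes> x \<oplus> b = \<one>"
  shows "\<exists>q\<in>carrier R. \<exists>w\<in>carrier R. \<exists>u\<in>carrier R. (a \<oplus> b \<otimes> q) \<otimes> w \<oplus> horner z as \<otimes> u = \<one>"
proof -
  obtain us where us: "set us \<subseteq> carrier R"
    "\<And>u. u \<in> carrier R \<Longrightarrow> \<exists>l\<in>lspan K us. \<exists>j\<in>(\<lambda>u. horner z as \<otimes> u) ` carrier R. u = l \<oplus> j"
    using finite_dim_mod_horner[OF as] by blast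
  have "a \<otimes> x \<oplus> b \<otimes> \<one> = \<one>" using eq c by simp
  from right_invertible_translate_mod[OF horner_multiples_ideal[OF as(1)] K K_inv K_central us c(1,2,3) one_closed this]
  obtain q w j where *: "q \<in> carrier R" "w \<in> carrier R" "j \<in> (\<lambda>u. horner z as \<otimes> u) ` carrier R"
    "(a \<oplus> b \<otimes> (\<one> \<otimes> q)) \<otimes> w \<oplus> j = \<one>" by blast
  then obtain u where "u \<in> carrier R" "j = horner z as \<otimes> u" by auto
  then show ?thesis using * by (intro bexI[of _ q] bexI[of _ w] bexI[of _ u]) simp_all
qed

text \<open>
  Nakayama's lemma by eliminating generators: the cyclic module \<open>R / a R\<close> equals its multiple by
  \<open>1 - z\<close>, so it is annihilated by some \<open>1 - (1 - z) c\<close>.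
\<close>
lemma nakayama:
  assumes c: "a \<in> carrier R" "x \<in> carrier R" "y \<in> carrier R"
    and eq: "a \<otimes> x \<oplus> (\<one> \<ominus> z) \<otimes> y = \<one>"
  shows "\<exists>c\<in>D. \<exists>s\<in>carrier R. \<one> \<ominus> (\<one> \<ominus> z) \<otimes> c = a \<otimes> s"
proof -
  define t where "t = \<one> \<ominus> z"
  have tD: "t \<in> D" unfolding t_def a_minus_def
    using generate_ring.one generate_ring.incl[OF insertI1, of z] by (auto intro!: generate_ring.eng_add generate_ring.a_inv)
  have tc: "t \<in> carrier R" using Dc[OF tD] .
  have tz: "t \<otimes> u = u \<otimes> t" if "u \<in> carrier R" for u using D_central[OF tD that] .
  \<comment> \<open>The multipliers range over \<open>1 - t D\<close>. By \<open>\<Delta>m\<close>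
    this set is preserved by the passage from \<open>\<delta>\<close> to
    \<open>(\<delta> - t c) \<delta>\<close>, which is one step of the elimination.\<close>
  define \<Delta> where "\<Delta> \<delta> \<longleftrightarrow> (\<exists>c\<in>D. \<delta> = \<one> \<ominus> t \<otimes> c)" for \<delta>
  have \<Delta>D: "\<delta> \<in> D" if "\<Delta> \<delta>" for \<delta>
    using that tD unfolding \<Delta>_def a_minus_def
    by (auto intro!: generate_ring.eng_add generate_ring.a_inv generate_ring.one generate_ring.eng_mult)
  have \<Delta>m: "\<Delta> ((\<delta> \<ominus> t \<otimes> c) \<otimes> \<delta>)" if \<delta>: "\<Delta> \<delta>" and c: "c \<in> D" for \<delta> c
  proof -
    obtain e where e: "e \<in> D" "\<delta> = \<one> \<ominus> t \<otimes> e" using \<delta> by (auto simp: \<Delta>_def)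
    have cs: "e \<in> carrier R" "c \<in> carrier R" "\<delta> \<in> carrier R" using Dc e c \<Delta>D[OF \<delta>] by auto
    have "(\<delta> \<ominus> t \<otimes> c) \<otimes> \<delta> = \<delta> \<ominus> t \<otimes> (e \<otimes> \<delta>) \<ominus> t \<otimes> (c \<otimes> \<delta>)"
    proof -
      have "\<delta> \<otimes> \<delta> = \<delta> \<ominus> t \<otimes> (e \<otimes> \<delta>)"
        by (subst (1) e(2)) (use cs tc in \<open>simp add: a_minus_def l_distr l_minus m_assoc\<close>)
      then show ?thesis using cs tc by (simp add: a_minus_def l_distr l_minus m_assoc)
    qed
    also have "\<dots> = \<one> \<ominus> t \<otimes> (e \<oplus> (e \<otimes> \<delta> \<oplus> c \<otimes> \<delta>))"
      by (subst (1) e(2)) (use cs tc in \<open>simp add: a_minus_def r_distr minus_add a_assoc\<close>)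
    finally show ?thesis unfolding \<Delta>_def using e c \<Delta>D[OF \<delta>]
      by (intro bexI[of _ "e \<oplus> (e \<otimes> \<delta> \<oplus> c \<otimes> \<delta>)"] generate_ring.eng_add generate_ring.eng_mult)
  qed
  \<comment> \<open>Invariant: \<open>\<delta> R\<close> is contained in \<open>a R\<close> plus the
    \<open>D\<close>-span of the remaining generators. When none remains, the multiplier sends
    \<open>R\<close> into \<open>a R\<close>.\<close>
  have "\<exists>\<epsilon>. \<Delta> \<epsilon> \<and> (\<forall>p\<in>carrier R. \<exists>s\<in>carrier R. \<epsilon> \<otimes> p = a \<otimes> s)"
    if "set ws \<subseteq> carrier R" "\<Delta> \<delta>" "\<forall>p\<in>carrier R. \<exists>s\<in>carrier R. \<exists>l\<in>lspan D ws. \<delta> \<otimes> p = a \<otimes> s \<oplus> l" for ws \<delta>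
    using that
  proof (induction ws arbitrary: \<delta>)
    case Nil
    then have "\<forall>p\<in>carrier R. \<exists>s\<in>carrier R. \<delta> \<otimes> p = a \<otimes> s" using c by auto
    then show ?case using Nil by blast
  next
    case (Cons v ws)
    have vc: "v \<in> carrier R" "set ws \<subseteq> carrier R" using Cons.prems by auto
    have \<delta>D: "\<delta> \<in> D" using \<Delta>D Cons.prems by auto
    have \<delta>c: "\<delta> \<in> carrier R" using Dc[OF \<delta>D] .
    have yv: "y \<otimes> v \<in> carrier R" using vc c by simp
    obtain s l where sl: "s \<in> carrier R" "l \<in> lspan D (v # ws)" "\<delta> \<otimes> (y \<otimes> v) = a \<otimes> s \<oplus> l"
      using Cons.prems(3) yv by blast
    obtain b l1 where bl: "b \<in> D" "l1 \<in> lspan D ws" "l = b \<otimes> v \<oplus> l1" using sl(2) by auto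
    have cs: "b \<in> carrier R" "l1 \<in> carrier R" using Dc bl lspan_closed[OF D_subring vc(2)] by auto
    \<comment> \<open>Let \<open>b\<close> be the coefficient of \<open>v\<close> in
      \<open>\<delta> y v\<close>. Since \<open>v = a x v + t y v\<close>, the product
      \<open>\<delta> v\<close> equals \<open>t b v\<close> modulo \<open>a R\<close> and the span
      of the other generators, so \<open>\<delta> - t b\<close> eliminates \<open>v\<close>.\<close>
    define e where "e = \<delta> \<ominus> t \<otimes> b"
    have eD: "e \<in> D" unfolding e_def a_minus_def using \<delta>D tD bl
      by (intro generate_ring.eng_add generate_ring.a_inv generate_ring.eng_mult)
    have ec: "e \<in> carrier R" using Dc[OF eD] .
    have "v = (a \<otimes> x \<oplus> t \<otimes> y) \<otimes> v" using eq vc by (simp add: t_def)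
    then have "\<delta> \<otimes> v = \<delta> \<otimes> ((a \<otimes> x \<oplus> t \<otimes> y) \<otimes> v)" by simp
    also have "\<dots> = \<delta> \<otimes> a \<otimes> (x \<otimes> v) \<oplus> \<delta> \<otimes> t \<otimes> (y \<otimes> v)"
      using \<delta>c tc c vc by (simp add: l_distr r_distr m_assoc)
    also have "\<delta> \<otimes> a = a \<otimes> \<delta>" by (rule D_central[OF \<delta>D c(1)])
    also have "\<delta> \<otimes> t = t \<otimes> \<delta>" by (rule D_central[OF \<delta>D tc])
    also have "t \<otimes> \<delta> \<otimes> (y \<otimes> v) = t \<otimes> (a \<otimes> s \<oplus> (b \<otimes> v \<oplus> l1))"
      using sl bl tc \<delta>c yv by (simp add: m_assoc)
    also have "\<dots> = a \<otimes> (t \<otimes> s) \<oplus> (t \<otimes> b \<otimes> v \<oplus> t \<otimes> l1)"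
      using tc c sl(1) cs vc tz[OF c(1)] by (simp add: r_distr m_assoc[symmetric])
    finally have \<delta>v: "\<delta> \<otimes> v = a \<otimes> \<delta> \<otimes> (x \<otimes> v) \<oplus> (a \<otimes> (t \<otimes> s) \<oplus> (t \<otimes> b \<otimes> v \<oplus> t \<otimes> l1))" .
    define i where "i = \<delta> \<otimes> (x \<otimes> v) \<oplus> t \<otimes> s"
    have ic: "i \<in> carrier R" using \<delta>c c vc tc sl(1) by (simp add: i_def)
    have "\<delta> \<otimes> v = (a \<otimes> i \<oplus> t \<otimes> l1) \<oplus> t \<otimes> b \<otimes> v"
      unfolding \<delta>v i_def using \<delta>c c vc tc sl(1) cs by (simp add: r_distr m_assoc a_ac)
    then have ev: "e \<otimes> v = a \<otimes> i \<oplus> t \<otimes> l1"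
      unfolding e_def using \<delta>c tc cs vc ic c
      by (simp add: a_minus_def l_distr l_minus a_assoc r_neg)
    have "\<exists>s\<in>carrier R. \<exists>l\<in>lspan D ws. (e \<otimes> \<delta>) \<otimes> p = a \<otimes> s \<oplus> l" if p: "p \<in> carrier R" for p
    proof -
      obtain s' l' where sl': "s' \<in> carrier R" "l' \<in> lspan D (v # ws)" "\<delta> \<otimes> p = a \<otimes> s' \<oplus> l'"
        using Cons.prems(3) p by blast
      obtain b' l1' where bl': "b' \<in> D" "l1' \<in> lspan D ws" "l' = b' \<otimes> v \<oplus> l1'" using sl'(2) by auto
      have cs': "b' \<in> carrier R" "l1' \<in> carrier R" using Dc bl' lspan_closed[OF D_subring vc(2)] by auto
      have "e \<otimes> \<delta> \<otimes> p = e \<otimes> (a \<otimes> s' \<oplus> (b' \<otimes> v \<oplus> l1'))" using sl' bl' ec \<delta>c p by (simp add: m_assoc)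
      also have "\<dots> = (e \<otimes> a) \<otimes> s' \<oplus> ((e \<otimes> b') \<otimes> v \<oplus> e \<otimes> l1')"
        using ec c sl'(1) cs' vc by (simp add: r_distr m_assoc)
      also have "e \<otimes> a = a \<otimes> e" by (rule D_central[OF eD c(1)])
      also have "e \<otimes> b' = b' \<otimes> e" by (rule D_central[OF eD cs'(1)])
      also have "b' \<otimes> e \<otimes> v = b' \<otimes> (a \<otimes> i \<oplus> t \<otimes> l1)" using ec cs' vc ev by (simp add: m_assoc)
      also have "\<dots> = a \<otimes> (b' \<otimes> i) \<oplus> b' \<otimes> (t \<otimes> l1)"
        using cs cs' c ic tc D_central[OF bl'(1) c(1)] by (simp add: r_distr) (simp add: m_assoc[symmetric])
      also have "a \<otimes> e \<otimes> s' \<oplus> (a \<otimes> (b' \<otimes> i) \<oplus> b' \<otimes> (t \<otimes> l1) \<oplus> e \<otimes> l1') =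
          a \<otimes> (e \<otimes> s' \<oplus> b' \<otimes> i) \<oplus> (b' \<otimes> (t \<otimes> l1) \<oplus> e \<otimes> l1')"
        using c ec sl'(1) cs cs' ic tc by (simp add: r_distr m_assoc a_assoc)
      finally have "e \<otimes> \<delta> \<otimes> p = a \<otimes> (e \<otimes> s' \<oplus> b' \<otimes> i) \<oplus> (b' \<otimes> (t \<otimes> l1) \<oplus> e \<otimes> l1')" .
      moreover have "b' \<otimes> (t \<otimes> l1) \<oplus> e \<otimes> l1' \<in> lspan D ws"
        using bl bl' tD eD by (intro lspan_add[OF D_subring vc(2)] lspan_smult[OF D_subring vc(2)])
      moreover have "e \<otimes> s' \<oplus> b' \<otimes> i \<in> carrier R" using ec sl'(1) cs' ic by simp
      ultimately show ?thesis by blast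
    qed
    moreover have "\<Delta> (e \<otimes> \<delta>)" unfolding e_def using \<Delta>m Cons.prems(2) bl by simp
    ultimately show ?case using Cons.IH vc(2) by blast
  qed
  moreover have "\<Delta> \<one>" unfolding \<Delta>_def using tc subringE(2)[OF D_subring]
    by (intro bexI[of _ \<zero>]) (auto simp: a_minus_def)
  moreover have "\<exists>s\<in>carrier R. \<exists>l\<in>lspan D vs. \<one> \<otimes> p = a \<otimes> s \<oplus> l" if p: "p \<in> carrier R" for p
    using span p c by (intro bexI[of _ \<zero>] bexI[of _ p]) auto
  ultimately obtain \<epsilon> where \<epsilon>: "\<Delta> \<epsilon>" "\<forall>p\<in>carrier R. \<exists>s\<in>carrier R. \<epsilon> \<otimes> p = a \<otimes> s" using vs by blast
  obtain s where "s \<in> carrier R" "\<epsilon> \<otimes> \<one> = a \<otimes> s" using \<epsilon>(2) by blast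
  moreover obtain c where "c \<in> D" "\<epsilon> = \<one> \<ominus> (\<one> \<ominus> z) \<otimes> c" using \<epsilon>(1) by (auto simp: \<Delta>_def t_def)
  moreover from this have "\<epsilon> \<otimes> \<one> = \<epsilon>" using Dc[OF \<Delta>D[OF \<epsilon>(1)]] by simp
  ultimately show ?thesis by metis
qed

text \<open>The reduction modulo \<open>1 - z\<close> adds a multiple of
  \<open>b = a2 x2 + a3 x3\<close> to the first entry, while only multiples of \<open>a3\<close> are
  permitted. The part along \<open>a2\<close> is undone at the end by an elementary operation
  between the first two entries.\<close>

theorem two_row_reduction:
  assumes c: "a1 \<in> carrier R" "a2 \<in> carrier R" "a3 \<in> carrier R" "x1 \<in> carrier R" "x2 \<in> carrier R" "x3 \<in> carrier R"
    and eq: "a1 \<otimes> x1 \<oplus> a2 \<otimes> x2 \<oplus> a3 \<otimes> x3 = \<one>" and ne: "\<one> \<noteq> \<zero>"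
  shows "\<exists>r1\<in>carrier R. \<exists>r2\<in>carrier R. \<exists>w1\<in>carrier R. \<exists>w2\<in>carrier R.
    (a1 \<oplus> a3 \<otimes> r1) \<otimes> w1 \<oplus> (a2 \<oplus> a3 \<otimes> r2) \<otimes> w2 = \<one>"
proof -
  have m1: "\<ominus> \<one> \<in> K" using subringE(3,5)[OF K] by auto
  have K01: "\<one> \<in> K" "\<zero> \<in> K" using subringE(2,3)[OF K] by auto
  define b where "b = a2 \<otimes> x2 \<oplus> a3 \<otimes> x3"
  have bc: "b \<in> carrier R" using c by (simp add: b_def)
  have "a1 \<otimes> x1 \<oplus> b = \<one>" using eq c by (simp add: b_def a_assoc)
  from translate_mod_horner[of "[\<one>, \<ominus> \<one>]", OF _ _ c(1) bc c(4) this] obtain q w u where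
    q: "q \<in> carrier R" "w \<in> carrier R" "u \<in> carrier R"
    and qe: "(a1 \<oplus> b \<otimes> q) \<otimes> w \<oplus> horner z [\<one>, \<ominus> \<one>] \<otimes> u = \<one>"
    using m1 K01 ne by auto
  define a where "a = a1 \<oplus> b \<otimes> q"
  have ac: "a \<in> carrier R" using c bc q by (simp add: a_def)
  have "horner z [\<one>, \<ominus> \<one>] = \<one> \<ominus> z" using z by (simp add: a_minus_def r_minus)
  then have "a \<otimes> w \<oplus> (\<one> \<ominus> z) \<otimes> u = \<one>" using qe by (simp add: a_def)
  from nakayama[OF ac q(2,3) this] obtain d s where
    d: "d \<in> D" "s \<in> carrier R" "\<one> \<ominus> (\<one> \<ominus> z) \<otimes> d = a \<otimes> s" by blast
  have dc: "d \<in> carrier R" using Dc[OF d(1)] .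
  obtain m cs where cs: "set cs \<subseteq> K" "z [^] (m::nat) \<otimes> d = horner z cs"
    using laurent_normal_form[OF d(1)] by blast
  \<comment> \<open>\<open>es\<close> is \<open>X^m - (1 - X) cs(X)\<close>; it is not the zero polynomial because its value at \<open>1\<close> is \<open>1\<close>.\<close>
  define ms where "ms = replicate m \<zero> @ [\<one>]"
  define es where "es = padd ms (pmult [\<ominus> \<one>, \<one>] cs)"
  have ms: "set ms \<subseteq> K" using K01 by (auto simp: ms_def set_replicate_conv_if)
  have Kl: "set as \<subseteq> carrier R" if "set as \<subseteq> K" for as using that Kc by auto
  have l2: "set [\<ominus> \<one>, \<one>] \<subseteq> K" using m1 K01 by auto
  have es: "set es \<subseteq> K" unfolding es_def by (intro padd_set pmult_set K ms cs l2)
  have val: "horner v es = v [^] m \<oplus> (\<ominus> \<one> \<oplus> v) \<otimes> horner v cs" if v: "v \<in> carrier R" for v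
  proof -
    have "horner v (pmult [\<ominus> \<one>, \<one>] cs) = horner v [\<ominus> \<one>, \<one>] \<otimes> horner v cs"
    proof -
      have "a \<otimes> v = v \<otimes> a" if "a \<in> set [\<ominus> \<one>, \<one>]" for a
        using that v by (auto simp: l_minus r_minus)
      from horner_pmult[OF v Kl[OF l2] Kl[OF cs(1)] this] show ?thesis by blast
    qed
    moreover have "horner v [\<ominus> \<one>, \<one>] = \<ominus> \<one> \<oplus> v" using v by simp
    ultimately show ?thesis
      unfolding es_def horner_padd[OF v Kl[OF ms] Kl[OF pmult_set[OF K l2 cs(1)]]]
      using horner_monomial[OF v, of m] by (simp only: ms_def)
  qed
  have "horner \<one> es = \<one>"
    using val[OF one_closed] horner_closed[OF one_closed Kl[OF cs(1)]] by (simp add: l_neg)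
  then have es0: "\<exists>e\<in>set es. e \<noteq> \<zero>" using horner_zeros[OF one_closed, of es] ne by auto
  have "horner z es = z [^] m \<oplus> (\<ominus> \<one> \<oplus> z) \<otimes> (z [^] m \<otimes> d)" using val[OF z(1)] cs by simp
  also have "\<dots> = z [^] m \<otimes> (\<one> \<ominus> (\<one> \<ominus> z) \<otimes> d)"
  proof -
    have "(\<ominus> \<one> \<oplus> z) \<otimes> (z [^] m \<otimes> d) = ((\<ominus> \<one> \<oplus> z) \<otimes> z [^] m) \<otimes> d" using z dc by (simp add: m_assoc)
    also have "(\<ominus> \<one> \<oplus> z) \<otimes> z [^] m = z [^] m \<otimes> (\<ominus> \<one> \<oplus> z)"
      using z z_central[of "z [^] m"] by (simp add: l_distr r_distr l_minus r_minus)
    finally have "(\<ominus> \<one> \<oplus> z) \<otimes> (z [^] m \<otimes> d) = z [^] m \<otimes> ((\<ominus> \<one> \<oplus> z) \<otimes> d)" using z dc by (simp add: m_assoc)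
    moreover have "(\<ominus> \<one> \<oplus> z) \<otimes> d = \<ominus> ((\<one> \<ominus> z) \<otimes> d)"
      using z dc by (simp add: a_minus_def l_distr l_minus minus_add)
    ultimately show ?thesis using z dc by (simp add: a_minus_def r_distr)
  qed
  finally have hes: "horner z es = z [^] m \<otimes> (a \<otimes> s)" using d(3) by simp
  have zm: "z [^] m \<otimes> a = a \<otimes> z [^] m"
    by (induction m) (use z ac z_central[OF ac] in \<open>simp_all add: m_assoc\<close>, metis m_assoc nat_pow_closed z(1))
  have hes': "horner z es = a \<otimes> (z [^] m \<otimes> s)"
    unfolding hes using zm z ac d(2) by (simp add: m_assoc[symmetric])
  \<comment> \<open>These coefficients carry the relation from \<open>a1\<close> over to
    \<open>a = a1 + b q\<close>, by \<open>a x1 + b (1 - q x1) = 1\<close>.\<close>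
  define X2 where "X2 = x2 \<ominus> x2 \<otimes> q \<otimes> x1"
  define X3 where "X3 = x3 \<ominus> x3 \<otimes> q \<otimes> x1"
  have X: "X2 \<in> carrier R" "X3 \<in> carrier R" using c q by (auto simp: X2_def X3_def)
  have ax: "a \<otimes> x1 \<oplus> b = \<one> \<oplus> b \<otimes> q \<otimes> x1"
    using \<open>a1 \<otimes> x1 \<oplus> b = \<one>\<close>[symmetric] c bc q unfolding a_def by (simp add: l_distr a_ac)
  have "a2 \<otimes> X2 \<oplus> a3 \<otimes> X3 = b \<ominus> b \<otimes> q \<otimes> x1"
    unfolding X2_def X3_def b_def using c q by (simp add: a_minus_def l_distr r_distr r_minus minus_add m_assoc a_ac)
  moreover have "a2 \<otimes> X2 \<oplus> (a \<otimes> x1 \<oplus> a3 \<otimes> X3) = a \<otimes> x1 \<oplus> (a2 \<otimes> X2 \<oplus> a3 \<otimes> X3)"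
    using c X ac by (simp add: a_lcomm)
  ultimately have "a2 \<otimes> X2 \<oplus> (a \<otimes> x1 \<oplus> a3 \<otimes> X3) = (a \<otimes> x1 \<oplus> b) \<ominus> b \<otimes> q \<otimes> x1"
    using c q ac bc by (simp add: a_minus_def a_assoc)
  also have "\<dots> = \<one>" unfolding ax using bc q c by (simp add: add_minus_cancel)
  finally have e2: "a2 \<otimes> X2 \<oplus> (a \<otimes> x1 \<oplus> a3 \<otimes> X3) = \<one>" .
  have "a \<otimes> x1 \<oplus> a3 \<otimes> X3 \<in> carrier R" using ac c X by simp
  from translate_mod_horner[OF es es0 c(2) this X(1) e2] obtain p v y where
    p: "p \<in> carrier R" "v \<in> carrier R" "y \<in> carrier R"
    and pe: "(a2 \<oplus> (a \<otimes> x1 \<oplus> a3 \<otimes> X3) \<otimes> p) \<otimes> v \<oplus> horner z es \<otimes> y = \<one>" by blast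
  \<comment> \<open>Both the term \<open>a x1 p v\<close> and the multiple of
    \<open>horner z es\<close> are right multiples of \<open>a\<close>. They go into the coefficient
    \<open>W1\<close>, and what is left in the second entry is the translation
    \<open>a3 r2\<close>.\<close>
  define r2 where "r2 = X3 \<otimes> p"
  define W1 where "W1 = x1 \<otimes> p \<otimes> v \<oplus> z [^] m \<otimes> s \<otimes> y"
  \<comment> \<open>Chosen so that \<open>a = (a1 + a3 r1) + (a2 + a3 r2) (x2 q)\<close>; the last
    term is then absorbed by the second coefficient.\<close>
  define r1 where "r1 = x3 \<otimes> q \<ominus> r2 \<otimes> (x2 \<otimes> q)"
  have rc: "r2 \<in> carrier R" "W1 \<in> carrier R" "r1 \<in> carrier R"
    using X p c q z d(2) by (auto simp: r2_def W1_def r1_def)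
  have "a \<otimes> W1 \<oplus> (a2 \<oplus> a3 \<otimes> r2) \<otimes> v = \<one>"
    using pe unfolding hes' W1_def r2_def using ac c X p z d(2) by (simp add: l_distr r_distr m_assoc a_ac)
  moreover have "a = (a1 \<oplus> a3 \<otimes> r1) \<oplus> (a2 \<oplus> a3 \<otimes> r2) \<otimes> (x2 \<otimes> q)"
  proof -
    have "a3 \<otimes> r1 \<oplus> a3 \<otimes> r2 \<otimes> (x2 \<otimes> q) = a3 \<otimes> (r1 \<oplus> r2 \<otimes> (x2 \<otimes> q))" using c q rc by (simp add: r_distr m_assoc)
    also have "r1 \<oplus> r2 \<otimes> (x2 \<otimes> q) = x3 \<otimes> q" unfolding r1_def using c q rc by (simp add: add_minus_cancel)
    finally have "a = a1 \<oplus> (a3 \<otimes> r1 \<oplus> a3 \<otimes> r2 \<otimes> (x2 \<otimes> q)) \<oplus> a2 \<otimes> x2 \<otimes> q"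
      unfolding a_def b_def using c q by (simp add: l_distr m_assoc a_ac)
    then show ?thesis using c q rc by (simp add: l_distr m_assoc a_ac)
  qed
  ultimately have "((a1 \<oplus> a3 \<otimes> r1) \<oplus> (a2 \<oplus> a3 \<otimes> r2) \<otimes> (x2 \<otimes> q)) \<otimes> W1 \<oplus> (a2 \<oplus> a3 \<otimes> r2) \<otimes> v = \<one>" by simp
  moreover have "((A \<oplus> B \<otimes> Q) \<otimes> W) \<oplus> B \<otimes> V = A \<otimes> W \<oplus> B \<otimes> (Q \<otimes> W \<oplus> V)"
    if "A \<in> carrier R" "B \<in> carrier R" "Q \<in> carrier R" "W \<in> carrier R" "V \<in> carrier R" for A B Q W V
    using that by (simp add: l_distr r_distr m_assoc a_assoc)
  ultimately have "(a1 \<oplus> a3 \<otimes> r1) \<otimes> W1 \<oplus> (a2 \<oplus> a3 \<otimes> r2) \<otimes> ((x2 \<otimes> q) \<otimes> W1 \<oplus> v) = \<one>"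
    using c q rc p by simp
  then show ?thesis using rc c q p
    by (intro bexI[of _ r1] bexI[of _ r2] bexI[of _ W1] bexI[of _ "(x2 \<otimes> q) \<otimes> W1 \<oplus> v"]) auto
qed

end

section \<open>Linear functionals on the free algebra\<close>

context ring
begin

definition single :: "'x list \<Rightarrow> 'a \<Rightarrow> 'x list \<Rightarrow> 'a"
  where "single w k = (\<lambda>u. if u = w then k else \<zero>)"

lemma free_gen_eq_single: "free_gen R x = single [x] \<one>"
  by (auto simp: free_gen_def single_def)

lemma single_closed: "w \<in> lists X \<Longrightarrow> k \<in> carrier R \<Longrightarrow> single w k \<in> carrier (free_algebra R X)"
  by (rule free_algebra_carrierI[where A = "{w}"]) (auto simp: single_def)

lemma free_algebra_one_eq: "\<one>\<^bsub>free_algebra R X\<^esub> = single [] \<one>"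
  by (simp add: free_algebra_simps single_def)

lemma single_add:
  "k \<in> carrier R \<Longrightarrow> l \<in> carrier R \<Longrightarrow> single w k \<oplus>\<^bsub>free_algebra R X\<^esub> single w l = single w (k \<oplus> l)"
  by (auto simp: free_algebra_simps single_def)

lemma single_mult:
  assumes "k \<in> carrier R" "l \<in> carrier R"
  shows "single u k \<otimes>\<^bsub>free_algebra R X\<^esub> single v l = single (u @ v) (k \<otimes> l)"
proof
  fix w
  have "(single u k \<otimes>\<^bsub>free_algebra R X\<^esub> single v l) w =
      (\<Oplus>i\<in>{..length w}. single u k (take i w) \<otimes> single v l (drop i w))"
    by (simp add: free_algebra_simps)
  also have "\<dots> = (\<Oplus>i\<in>{..length w}. if length u = i then (if w = u @ v then k \<otimes> l else \<zero>) else \<zero>)"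
  proof (rule finsum_cong')
    fix i assume i: "i \<in> {..length w}"
    have "take i w = u \<and> drop i w = v \<longleftrightarrow> length u = i \<and> w = u @ v"
      using i by (metis append_eq_conv_conj append_take_drop_id atMost_iff length_take min.absorb2)
    then show "single u k (take i w) \<otimes> single v l (drop i w) =
        (if length u = i then (if w = u @ v then k \<otimes> l else \<zero>) else \<zero>)"
      using assms by (auto simp: single_def)
  qed (use assms in auto)
  also have "\<dots> = single (u @ v) (k \<otimes> l) w"
  proof (cases "w = u @ v")
    case True
    then have "length u \<in> {..length w}" by simp
    then have "(\<Oplus>i\<in>{..length w}. if length u = i then k \<otimes> l else \<zero>) = k \<otimes> l"
      using assms by (intro finsum_singleton[where f = "\<lambda>_. k \<otimes> l"]) auto
    then show ?thesis using True by (simp add: single_def)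
  next
    case False
    then show ?thesis by (simp add: single_def)
  qed
  finally show "(single u k \<otimes>\<^bsub>free_algebra R X\<^esub> single v l) w = single (u @ v) (k \<otimes> l) w" .
qed

text \<open>The step keeps \<open>f w\<close> nonzero: for an \<open>f\<close> without constant term
  this excludes the empty word.\<close>

lemma free_algebra_induct [consumes 1, case_names zero single]:
  assumes "f \<in> carrier (free_algebra R X)"
    and zero: "P \<zero>\<^bsub>free_algebra R X\<^esub>"
    and single: "\<And>w g. w \<in> lists X \<Longrightarrow> f w \<noteq> \<zero> \<Longrightarrow> g \<in> carrier (free_algebra R X) \<Longrightarrow> P g \<Longrightarrow>
      P (single w (f w) \<oplus>\<^bsub>free_algebra R X\<^esub> g)"
  shows "P f"
proof -
  note D = free_algebra_carrierD[OF assms(1)]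
  define restr where "restr A = (\<lambda>w. if w \<in> A then f w else \<zero>)" for A
  have "restr A \<in> carrier (free_algebra R X) \<and> P (restr A)" if "finite A" "A \<subseteq> {w. f w \<noteq> \<zero>}" for A
    using that
  proof (induction A)
    case empty
    have "restr {} = \<zero>\<^bsub>free_algebra R X\<^esub>" by (simp add: restr_def free_algebra_simps)
    then show ?case using zero ring.ring_simprules(2)[OF free_algebra_ring] by metis
  next
    case (insert w A)
    have "restr (insert w A) = single w (f w) \<oplus>\<^bsub>free_algebra R X\<^esub> restr A"
      using insert.hyps D(2) by (auto simp: restr_def single_def free_algebra_simps)
    moreover have w: "w \<in> lists X" "f w \<noteq> \<zero>" using insert.prems D(4) by auto
    moreover have "single w (f w) \<oplus>\<^bsub>free_algebra R X\<^esub> restr A \<in> carrier (free_algebra R X)"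
      using insert ring.ring_simprules(1)[OF free_algebra_ring] single_closed[OF w(1) D(2)] by auto
    ultimately show ?case using single[OF w] insert by auto
  qed
  moreover have "restr {w. f w \<noteq> \<zero>} = f" by (auto simp: restr_def)
  ultimately show ?thesis using D(3) by (metis order_refl)
qed

text \<open>The linear functional whose value on words is the indicator of \<open>Q\<close>. Such
  functionals take the place of the matrix coefficients of a representation.\<close>

definition coeff_sum :: "('x list \<Rightarrow> bool) \<Rightarrow> ('x list \<Rightarrow> 'a) \<Rightarrow> 'a"
  where "coeff_sum Q f = (\<Oplus>w\<in>{w. f w \<noteq> \<zero>}. if Q w then f w else \<zero>)"

lemma coeff_sum_superset:
  assumes "range f \<subseteq> carrier R" "finite A" "{w. f w \<noteq> \<zero>} \<subseteq> A"
  shows "coeff_sum Q f = (\<Oplus>w\<in>A. if Q w then f w else \<zero>)"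
  unfolding coeff_sum_def
  by (rule add.finprod_mono_neutral_cong_left) (use assms in \<open>auto simp: image_subset_iff\<close>)

lemma coeff_sum_closed: "f \<in> carrier (free_algebra R X) \<Longrightarrow> coeff_sum Q f \<in> carrier R"
  unfolding coeff_sum_def using free_algebra_carrierD by (intro finsum_closed) auto

lemma coeff_sum_add:
  assumes "f \<in> carrier (free_algebra R X)" "g \<in> carrier (free_algebra R X)"
  shows "coeff_sum Q (f \<oplus>\<^bsub>free_algebra R X\<^esub> g) = coeff_sum Q f \<oplus> coeff_sum Q g"
proof -
  note f = free_algebra_carrierD[OF assms(1)] and g = free_algebra_carrierD[OF assms(2)]
  define A where "A = {w. f w \<noteq> \<zero>} \<union> {w. g w \<noteq> \<zero>}"
  have A: "finite A" using f g by (simp add: A_def)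
  have fg: "range (\<lambda>w. f w \<oplus> g w) \<subseteq> carrier R" using f(2) g(2) by auto
  have "{w. f w \<oplus> g w \<noteq> \<zero>} \<subseteq> A" using f(2) g(2) by (auto simp: A_def)
  then have "coeff_sum Q (f \<oplus>\<^bsub>free_algebra R X\<^esub> g) = (\<Oplus>w\<in>A. if Q w then f w \<oplus> g w else \<zero>)"
    unfolding free_algebra_simps by (rule coeff_sum_superset[OF fg A])
  also have "\<dots> = (\<Oplus>w\<in>A. (if Q w then f w else \<zero>) \<oplus> (if Q w then g w else \<zero>))"
    using f(2) g(2) by (intro finsum_cong') auto
  also have "\<dots> = (\<Oplus>w\<in>A. if Q w then f w else \<zero>) \<oplus> (\<Oplus>w\<in>A. if Q w then g w else \<zero>)"
    using f(2) g(2) by (intro finsum_addf) auto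
  also have "(\<Oplus>w\<in>A. if Q w then f w else \<zero>) = coeff_sum Q f"
    by (rule coeff_sum_superset[OF f(1) A, symmetric]) (auto simp: A_def)
  also have "(\<Oplus>w\<in>A. if Q w then g w else \<zero>) = coeff_sum Q g"
    by (rule coeff_sum_superset[OF g(1) A, symmetric]) (auto simp: A_def)
  finally show ?thesis .
qed

lemma coeff_sum_single: "k \<in> carrier R \<Longrightarrow> coeff_sum Q (single w k) = (if Q w then k else \<zero>)"
  by (subst coeff_sum_superset[where A = "{w}"]) (auto simp: single_def)

lemma coeff_sum_zero: "coeff_sum Q \<zero>\<^bsub>free_algebra R X\<^esub> = \<zero>"
  by (simp add: coeff_sum_def free_algebra_simps)

lemma coeff_sum_minus:
  assumes "f \<in> carrier (free_algebra R X)" "g \<in> carrier (free_algebra R X)"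
  shows "coeff_sum Q (f \<ominus>\<^bsub>free_algebra R X\<^esub> g) = coeff_sum Q f \<ominus> coeff_sum Q g"
proof -
  interpret F: ring "free_algebra R X" by (rule free_algebra_ring)
  have "coeff_sum Q ((f \<ominus>\<^bsub>free_algebra R X\<^esub> g) \<oplus>\<^bsub>free_algebra R X\<^esub> g) = coeff_sum Q (f \<ominus>\<^bsub>free_algebra R X\<^esub> g) \<oplus> coeff_sum Q g"
    using assms by (intro coeff_sum_add) auto
  then show ?thesis
    using assms coeff_sum_closed[of _ X] F.add_minus_cancel by (simp add: add_minus_cancel)
qed

lemma coeff_sum_mult_single:
  assumes "f \<in> carrier (free_algebra R X)" "u \<in> lists X" "k \<in> carrier R"
  shows "coeff_sum Q (single u k \<otimes>\<^bsub>free_algebra R X\<^esub> f) = k \<otimes> coeff_sum (\<lambda>w. Q (u @ w)) f"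
    "coeff_sum Q (f \<otimes>\<^bsub>free_algebra R X\<^esub> single u k) = coeff_sum (\<lambda>w. Q (w @ u)) f \<otimes> k"
proof -
  interpret F: ring "free_algebra R X" by (rule free_algebra_ring)
  note D = free_algebra_carrierD(2)[OF assms(1)]
  note s = single_closed[OF assms(2,3)]
  show "coeff_sum Q (single u k \<otimes>\<^bsub>free_algebra R X\<^esub> f) = k \<otimes> coeff_sum (\<lambda>w. Q (u @ w)) f"
    using assms(1)
  proof (induction rule: free_algebra_induct)
    case zero
    then show ?case using s assms by (simp add: coeff_sum_zero)
  next
    case (single w g)
    note sw = single_closed[OF single(1) D[of w]]
    have uw: "single (u @ w) (k \<otimes> f w) \<in> carrier (free_algebra R X)"
      by (rule single_closed) (use assms single(1) D in auto)
    have "coeff_sum Q (single u k \<otimes>\<^bsub>free_algebra R X\<^esub> (single w (f w) \<oplus>\<^bsub>free_algebra R X\<^esub> g)) =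
        coeff_sum Q (single (u @ w) (k \<otimes> f w)) \<oplus> coeff_sum Q (single u k \<otimes>\<^bsub>free_algebra R X\<^esub> g)"
      using s sw single(3) uw by (simp add: F.r_distr coeff_sum_add[where X = X] single_mult[OF assms(3) D])
    then show ?case
      using single sw D assms coeff_sum_closed[OF single(3)]
      by (simp add: coeff_sum_add[where X = X] coeff_sum_single r_distr)
  qed
  show "coeff_sum Q (f \<otimes>\<^bsub>free_algebra R X\<^esub> single u k) = coeff_sum (\<lambda>w. Q (w @ u)) f \<otimes> k"
    using assms(1)
  proof (induction rule: free_algebra_induct)
    case zero
    then show ?case using s assms by (simp add: coeff_sum_zero)
  next
    case (single w g)
    note sw = single_closed[OF single(1) D[of w]]
    have uw: "single (w @ u) (f w \<otimes> k) \<in> carrier (free_algebra R X)"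
      by (rule single_closed) (use assms single(1) D in auto)
    have "coeff_sum Q ((single w (f w) \<oplus>\<^bsub>free_algebra R X\<^esub> g) \<otimes>\<^bsub>free_algebra R X\<^esub> single u k) =
        coeff_sum Q (single (w @ u) (f w \<otimes> k)) \<oplus> coeff_sum Q (g \<otimes>\<^bsub>free_algebra R X\<^esub> single u k)"
      using s sw single(3) uw by (simp add: F.l_distr coeff_sum_add[where X = X] single_mult[OF D assms(3)])
    then show ?case
      using single sw D assms coeff_sum_closed[OF single(3)]
      by (simp add: coeff_sum_add[where X = X] coeff_sum_single l_distr)
  qed
qed

text \<open>Multiplication by a word translates the predicate of a functional. The common kernel of
  a family that is closed under both translations therefore absorbs words on both sides, and by
  linearity the whole algebra.\<close>

lemma ideal_of_coeff_sums:
  fixes S :: "('x list \<Rightarrow> bool) set"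
  assumes S: "\<And>Q u. Q \<in> S \<Longrightarrow> u \<in> lists X \<Longrightarrow> (\<lambda>w. Q (u @ w)) \<in> S"
    "\<And>Q u. Q \<in> S \<Longrightarrow> u \<in> lists X \<Longrightarrow> (\<lambda>w. Q (w @ u)) \<in> S"
  shows "ideal {f \<in> carrier (free_algebra R X). \<forall>Q\<in>S. coeff_sum Q f = \<zero>} (free_algebra R X)"
    (is "ideal ?N ?F")
proof -
  interpret F: ring "free_algebra R X" by (rule free_algebra_ring)
  have N0: "\<zero>\<^bsub>?F\<^esub> \<in> ?N" by (auto simp: coeff_sum_zero)
  have Nadd: "f \<oplus>\<^bsub>?F\<^esub> g \<in> ?N" if "f \<in> ?N" "g \<in> ?N" for f g
    using that by (auto simp: coeff_sum_add[where X = X])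
  have Nsl: "single u k \<otimes>\<^bsub>?F\<^esub> f \<in> ?N" and Nsr: "f \<otimes>\<^bsub>?F\<^esub> single u k \<in> ?N"
    if f: "f \<in> ?N" and u: "u \<in> lists X" "k \<in> carrier R" for f u k
  proof -
    have fc: "f \<in> carrier ?F" "coeff_sum Q f = \<zero>" if "Q \<in> S" for Q using f that by auto
    show "single u k \<otimes>\<^bsub>?F\<^esub> f \<in> ?N" "f \<otimes>\<^bsub>?F\<^esub> single u k \<in> ?N"
      using single_closed[OF u] f coeff_sum_mult_single[OF _ u, of f] S[OF _ u(1)] u(2) by auto
  qed
  show ?thesis
  proof (rule idealI)
    show "subgroup ?N (add_monoid ?F)"
    proof (rule F.add.subgroupI)
      fix f assume "f \<in> ?N"
      then show "\<ominus>\<^bsub>?F\<^esub> f \<in> ?N"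
        using coeff_sum_minus[OF F.zero_closed, of f] by (auto simp: a_minus_def coeff_sum_zero)
    qed (use N0 Nadd in auto)
  next
    fix f a assume f: "f \<in> ?N" and a: "a \<in> carrier ?F"
    have fc: "f \<in> carrier ?F" using f by auto
    show "a \<otimes>\<^bsub>?F\<^esub> f \<in> ?N" using a
    proof (induction rule: free_algebra_induct)
      case zero
      then show ?case using N0 fc by simp
    next
      case (single w g)
      have "a w \<in> carrier R" using free_algebra_carrierD(2)[OF a] .
      then show ?case
        using single fc Nadd[OF Nsl[OF f single(1)]] single_closed[OF single(1)] by (simp add: F.l_distr)
    qed
    show "f \<otimes>\<^bsub>?F\<^esub> a \<in> ?N" using a
    proof (induction rule: free_algebra_induct)
      case zero
      then show ?case using N0 fc by simp
    next
      case (single w g)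
      have "a w \<in> carrier R" using free_algebra_carrierD(2)[OF a] .
      then show ?case
        using single fc Nadd[OF Nsr[OF f single(1)]] single_closed[OF single(1)] by (simp add: F.r_distr)
    qed
  qed (rule free_algebra_ring)
qed

end

lemma (in ring) coeff_sum_finsum:
  assumes "finite A" "g \<in> A \<rightarrow> carrier (free_algebra R X)"
  shows "coeff_sum Q (\<Oplus>\<^bsub>free_algebra R X\<^esub>e\<in>A. g e) = (\<Oplus>e\<in>A. coeff_sum Q (g e))"
  using assms
proof (induction A)
  case empty
  interpret F: ring "free_algebra R X" by (rule free_algebra_ring)
  show ?case by (simp add: coeff_sum_zero)
next
  case (insert e A)
  interpret F: ring "free_algebra R X" by (rule free_algebra_ring)
  have "(\<Oplus>\<^bsub>free_algebra R X\<^esub>e\<in>A. g e) \<in> carrier (free_algebra R X)"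
    using insert by (intro F.finsum_closed) auto
  moreover have "coeff_sum Q (g d) \<in> carrier R" if "d \<in> insert e A" for d
    by (rule coeff_sum_closed[OF Pi_mem[OF insert.prems that]])
  ultimately show ?case using insert by (simp add: coeff_sum_add[where X = X] Pi_def)
qed

section \<open>The Leavitt path algebra of a Hopf graph and its action on infinite paths\<close>

locale hopf_leavitt =
  fixes G :: "('g, 'm) monoid_scheme" and K :: "('k, 'n) ring_scheme" and r :: "'g set \<Rightarrow> nat"
    and U :: "(('g, 'g \<times> 'g \<times> nat) leavitt_gen list \<Rightarrow> 'k) set ring" (structure)
    and L :: "(('g, 'g \<times> 'g \<times> nat) leavitt_gen list \<Rightarrow> 'k) set set"
  assumes G: "group G" and K: "field K"
    and U: "U = leavitt_unitization K (hopf_graph G r)"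
    and L: "L = leavitt_path_algebra K (hopf_graph G r)"
begin

sublocale G: group G by (rule G)
sublocale K: field K by (rule K)

abbreviation "\<Gamma> \<equiv> hopf_graph G r"
abbreviation "gens \<equiv> leavitt_gens \<Gamma>"
abbreviation "F \<equiv> leavitt_free K \<Gamma>"

sublocale F: ring F by (rule K.free_algebra_ring)
sublocale L?: ideal L U
  unfolding U L by (rule K.leavitt_path_algebra_ideal[OF G.wf_digraph_hopf_graph])

text \<open>All vertices emit edges with the same labels, so an edge is a vertex with a label. The
  conjugacy class is not recorded, because \<open>c\<close> determines it.\<close>

definition labels :: "('g \<times> nat) set"
  where "labels = {(c, i). \<exists>C\<in>conj_classes G. c \<in> C \<and> i < r C}"

abbreviation target :: "'g \<Rightarrow> 'g \<times> nat \<Rightarrow> 'g"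
  where "target x l \<equiv> x \<otimes>\<^bsub>G\<^esub> fst l"

lemma label_closed: "l \<in> labels \<Longrightarrow> fst l \<in> carrier G"
  by (auto simp: labels_def conj_classes_def)

lemma arcs_iff: "(x, l) \<in> arcs \<Gamma> \<longleftrightarrow> x \<in> carrier G \<and> l \<in> labels"
  by (cases l) (auto simp: hopf_graph_def labels_def)

lemma tail_head [simp]: "tail \<Gamma> (x, l) = x" "head \<Gamma> (x, l) = target x l"
  by (cases l, simp add: hopf_graph_def)+

lemma verts_eq [simp]: "verts \<Gamma> = carrier G"
  by (simp add: hopf_graph_def)

lemma gens_iff [simp]:
  "Vert x \<in> gens \<longleftrightarrow> x \<in> carrier G"
  "Edge (x, l) \<in> gens \<longleftrightarrow> x \<in> carrier G \<and> l \<in> labels"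
  "Ghost (x, l) \<in> gens \<longleftrightarrow> x \<in> carrier G \<and> l \<in> labels"
  by (auto simp: leavitt_gens_def arcs_iff)

text \<open>
  \<open>L\<close> acts from the right on the space with basis the states \<open>(x, n, q)\<close>: \<open>q\<close> is the label sequence of an
  infinite path starting at \<open>x\<close>, and \<open>n\<close> counts the edges minus the ghost edges applied so far.
\<close>
type_synonym 'h state = "'h \<times> int \<times> (nat \<Rightarrow> 'h \<times> nat)"

primrec step :: "('g, 'g \<times> 'g \<times> nat) leavitt_gen \<Rightarrow> 'g state \<Rightarrow> 'g state option"
  where
    "step (Vert y) s = (if fst s = y then Some s else None)"
  | "step (Edge e) s = (case s of (x, n, q) \<Rightarrow>
      if e = (x, q 0) then Some (target x (q 0), n + 1, \<lambda>j. q (Suc j)) else None)"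
  | "step (Ghost e) s = (case s of (x, n, q) \<Rightarrow>
      if x = target (fst e) (snd e) then Some (fst e, n - 1, case_nat (snd e) q) else None)"

primrec run :: "('g, 'g \<times> 'g \<times> nat) leavitt_gen list \<Rightarrow> 'g state \<Rightarrow> 'g state option"
  where
    "run [] s = Some s"
  | "run (g # w) s = Option.bind (step g s) (run w)"

lemma run_append: "run (u @ v) s = Option.bind (run u s) (run v)"
  by (induction u arbitrary: s) (auto split: bind_split)

text \<open>Without labels there are no infinite paths, and the condition on \<open>q\<close> is
  then dropped; otherwise no state would be left to detect the vertices.\<close>

definition valid :: "'g state \<Rightarrow> bool"
  where "valid = (\<lambda>(x, n, q). x \<in> carrier G \<and> (labels \<noteq> {} \<longrightarrow> (\<forall>j. q j \<in> labels)))"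

lemma step_valid:
  assumes "g \<in> gens" "valid s" "step g s = Some s'"
  shows "valid s'"
proof (cases g)
  case (Vert y)
  then show ?thesis using assms by (auto split: if_splits)
next
  case (Edge e)
  obtain x l where e: "e = (x, l)" by (cases e)
  then have "l \<in> labels" "x \<in> carrier G" using assms(1) Edge by auto
  then show ?thesis using assms Edge e label_closed[of l] by (auto simp: valid_def split: if_splits)
next
  case (Ghost e)
  obtain x l where e: "e = (x, l)" by (cases e)
  then have l: "l \<in> labels" "x \<in> carrier G" using assms(1) Ghost by auto
  obtain y n q where s: "s = (y, n, q)" by (cases s)
  have "case_nat l q j \<in> labels" for j using assms(2) l s by (auto simp: valid_def split: nat.splits)
  then show ?thesis using assms Ghost e l s by (auto simp: valid_def split: if_splits)
qed

lemma run_valid: "w \<in> lists gens \<Longrightarrow> valid s \<Longrightarrow> run w s = Some s' \<Longrightarrow> valid s'"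
  by (induction w arbitrary: s) (auto simp: bind_eq_Some_conv dest: step_valid)

definition runs_to :: "'g state \<Rightarrow> ('g state \<Rightarrow> bool) \<Rightarrow> ('g, 'g \<times> 'g \<times> nat) leavitt_gen list \<Rightarrow> bool"
  where "runs_to s P w = (case run w s of None \<Rightarrow> False | Some s' \<Rightarrow> P s')"

definition vanishing :: "(('g, 'g \<times> 'g \<times> nat) leavitt_gen list \<Rightarrow> 'k) set"
  where "vanishing = {f \<in> carrier F. \<forall>Q\<in>{runs_to s P | s P. valid s}. K.coeff_sum Q f = \<zero>\<^bsub>K\<^esub>}"

text \<open>A word in front moves the initial state, and a word at the end changes the predicate on
  the final state. A word in front that is undefined at \<open>s\<close> yields the constantly false
  predicate.\<close>

lemma vanishing_ideal: "ideal vanishing F"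
  unfolding vanishing_def
proof (rule K.ideal_of_coeff_sums)
  fix Q u assume "Q \<in> {runs_to s P | s P. valid s}" and u: "u \<in> lists gens"
  then obtain s P where s: "Q = runs_to s P" "valid s" by auto
  show "(\<lambda>w. Q (u @ w)) \<in> {runs_to s P | s P. valid s}"
  proof (cases "run u s")
    case None
    then have "(\<lambda>w. Q (u @ w)) = runs_to s (\<lambda>_. False)"
      by (auto simp: s runs_to_def run_append split: option.splits)
    then show ?thesis using s by blast
  next
    case (Some s')
    then have "(\<lambda>w. Q (u @ w)) = runs_to s' P"
      by (auto simp: s runs_to_def run_append)
    then show ?thesis using run_valid[OF u s(2) Some] by blast
  qed
  have "(\<lambda>w. Q (w @ u)) = runs_to s (\<lambda>s'. runs_to s' P u)"
  proof
    fix w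
    show "Q (w @ u) = runs_to s (\<lambda>s'. runs_to s' P u) w"
      by (cases "run w s") (simp_all only: s(1) runs_to_def run_append bind.simps option.simps)
  qed
  then show "(\<lambda>w. Q (w @ u)) \<in> {runs_to s P | s P. valid s}" using s by blast
qed

lemma vanishingI:
  assumes "f \<in> carrier F" "g \<in> carrier F"
    "\<And>s P. valid s \<Longrightarrow> K.coeff_sum (runs_to s P) f = K.coeff_sum (runs_to s P) g"
  shows "f \<ominus>\<^bsub>F\<^esub> g \<in> vanishing"
  using assms K.coeff_sum_minus[OF assms(1,2)] K.coeff_sum_closed[OF assms(2)]
  by (auto simp: vanishing_def a_minus_def K.r_neg)

lemma single_closed: "w \<in> lists gens \<Longrightarrow> k \<in> carrier K \<Longrightarrow> K.single w k \<in> carrier F"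
  by (rule K.single_closed)

lemma out_arcs_eq: "x \<in> carrier G \<Longrightarrow> out_arcs \<Gamma> x = Pair x ` labels"
  by (auto simp: out_arcs_def image_iff arcs_iff)

lemma relations_vanishing: "leavitt_relations K \<Gamma> \<subseteq> vanishing"
proof -
  have coeff: "K.coeff_sum Q (K.single w \<one>\<^bsub>K\<^esub>) = (if Q w then \<one>\<^bsub>K\<^esub> else \<zero>\<^bsub>K\<^esub>)" for Q and w :: "('g, 'g \<times> 'g \<times> nat) leavitt_gen list"
    by (simp add: K.coeff_sum_single)
  have c: "K.single w \<one>\<^bsub>K\<^esub> \<in> carrier F" if "w \<in> lists gens" for w using that by (rule single_closed) simp
  have two: "K.single [x] \<one>\<^bsub>K\<^esub> \<otimes>\<^bsub>F\<^esub> K.single [y] \<one>\<^bsub>K\<^esub> = K.single [x, y] \<one>\<^bsub>K\<^esub>" for x y :: "('g, 'g \<times> 'g \<times> nat) leavitt_gen"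
    by (simp add: K.single_mult)
  note simps = two K.free_gen_eq_single
  have 1: "free_gen K (Vert v) \<otimes>\<^bsub>F\<^esub> free_gen K (Vert w) \<ominus>\<^bsub>F\<^esub> (if v = w then free_gen K (Vert w) else \<zero>\<^bsub>F\<^esub>) \<in> vanishing"
    if "v \<in> carrier G" "w \<in> carrier G" for v w
    using that unfolding simps by (intro vanishingI) (auto simp: coeff K.coeff_sum_zero runs_to_def intro!: c)
  have 2: "free_gen K (Vert x) \<otimes>\<^bsub>F\<^esub> free_gen K (Edge (x, l)) \<ominus>\<^bsub>F\<^esub> free_gen K (Edge (x, l)) \<in> vanishing"
    "free_gen K (Edge (x, l)) \<otimes>\<^bsub>F\<^esub> free_gen K (Vert (target x l)) \<ominus>\<^bsub>F\<^esub> free_gen K (Edge (x, l)) \<in> vanishing"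
    "free_gen K (Vert (target x l)) \<otimes>\<^bsub>F\<^esub> free_gen K (Ghost (x, l)) \<ominus>\<^bsub>F\<^esub> free_gen K (Ghost (x, l)) \<in> vanishing"
    "free_gen K (Ghost (x, l)) \<otimes>\<^bsub>F\<^esub> free_gen K (Vert x) \<ominus>\<^bsub>F\<^esub> free_gen K (Ghost (x, l)) \<in> vanishing"
    if "x \<in> carrier G" "l \<in> labels" for x l
    using that label_closed[OF that(2)] unfolding simps
    by (intro vanishingI; auto simp: coeff runs_to_def split: if_splits intro!: c)+
  have 3: "free_gen K (Ghost (x, l)) \<otimes>\<^bsub>F\<^esub> free_gen K (Edge (y, m)) \<ominus>\<^bsub>F\<^esub>
      (if (x, l) = (y, m) then free_gen K (Vert (target x l)) else \<zero>\<^bsub>F\<^esub>) \<in> vanishing"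
    if "x \<in> carrier G" "l \<in> labels" "y \<in> carrier G" "m \<in> labels" for x l y m
    using that label_closed[OF that(2)] unfolding simps
    by (intro vanishingI) (auto simp: coeff K.coeff_sum_zero runs_to_def split: if_splits intro!: c)
  have 4: "free_gen K (Vert v) \<ominus>\<^bsub>F\<^esub>
      (\<Oplus>\<^bsub>F\<^esub>e\<in>out_arcs \<Gamma> v. free_gen K (Edge e) \<otimes>\<^bsub>F\<^esub> free_gen K (Ghost e)) \<in> vanishing"
    if v: "v \<in> carrier G" and ne: "out_arcs \<Gamma> v \<noteq> {}" and fin: "finite (out_arcs \<Gamma> v)" for v
    unfolding simps
  proof (rule vanishingI)
    have e: "K.single [Edge e, Ghost e] \<one>\<^bsub>K\<^esub> \<in> carrier F" if "e \<in> out_arcs \<Gamma> v" for e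
      using that v unfolding out_arcs_eq[OF v] by (auto intro!: c)
    show "K.single [Vert v] \<one>\<^bsub>K\<^esub> \<in> carrier F" using v by (intro c) auto
    show "(\<Oplus>\<^bsub>F\<^esub>e\<in>out_arcs \<Gamma> v. K.single [Edge e, Ghost e] \<one>\<^bsub>K\<^esub>) \<in> carrier F"
      using e by (intro F.finsum_closed) auto
    fix s P assume s: "valid s"
    obtain x n q where sx: "s = (x, n, q)" by (cases s)
    \<comment> \<open>At a state based at \<open>v\<close> precisely the edge with label
      \<open>q 0\<close> acts, and its ghost restores the state, so exactly one term of the sum
      survives. This is why the states carry infinite paths.\<close>
    have "labels \<noteq> {}" using ne unfolding out_arcs_eq[OF v] by auto
    then have q0: "q 0 \<in> labels" using s by (auto simp: valid_def sx)
    have cn: "case_nat (q 0) (\<lambda>j. q (Suc j)) = q" by (auto simp: fun_eq_iff split: nat.splits)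
    have "K.coeff_sum (runs_to s P) (\<Oplus>\<^bsub>F\<^esub>e\<in>out_arcs \<Gamma> v. K.single [Edge e, Ghost e] \<one>\<^bsub>K\<^esub>) =
        (\<Oplus>\<^bsub>K\<^esub>e\<in>out_arcs \<Gamma> v. K.coeff_sum (runs_to s P) (K.single [Edge e, Ghost e] \<one>\<^bsub>K\<^esub>))"
      using e by (intro K.coeff_sum_finsum[OF fin]) auto
    also have "\<dots> = (\<Oplus>\<^bsub>K\<^esub>e\<in>out_arcs \<Gamma> v. if (v, q 0) = e then (if x = v \<and> P s then \<one>\<^bsub>K\<^esub> else \<zero>\<^bsub>K\<^esub>) else \<zero>\<^bsub>K\<^esub>)"
    proof (rule K.finsum_cong')
      fix e assume "e \<in> out_arcs \<Gamma> v"
      then obtain l where l: "e = (v, l)" unfolding out_arcs_eq[OF v] by auto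
      show "K.coeff_sum (runs_to s P) (K.single [Edge e, Ghost e] \<one>\<^bsub>K\<^esub>) =
          (if (v, q 0) = e then (if x = v \<and> P s then \<one>\<^bsub>K\<^esub> else \<zero>\<^bsub>K\<^esub>) else \<zero>\<^bsub>K\<^esub>)"
        by (auto simp: coeff runs_to_def sx l cn)
    qed auto
    also have "\<dots> = (if x = v \<and> P s then \<one>\<^bsub>K\<^esub> else \<zero>\<^bsub>K\<^esub>)"
      by (rule K.finsum_singleton[where f = "\<lambda>_. if x = v \<and> P s then \<one>\<^bsub>K\<^esub> else \<zero>\<^bsub>K\<^esub>"])
        (use q0 fin in \<open>auto simp: out_arcs_eq[OF v]\<close>)
    finally show "K.coeff_sum (runs_to s P) (K.single [Vert v] \<one>\<^bsub>K\<^esub>) =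
        K.coeff_sum (runs_to s P) (\<Oplus>\<^bsub>F\<^esub>e\<in>out_arcs \<Gamma> v. K.single [Edge e, Ghost e] \<one>\<^bsub>K\<^esub>)"
      by (auto simp: coeff runs_to_def sx)
  qed
  show ?thesis
  proof -
    have arc1: "free_gen K (Vert (tail \<Gamma> e)) \<otimes>\<^bsub>F\<^esub> free_gen K (Edge e) \<ominus>\<^bsub>F\<^esub> free_gen K (Edge e) \<in> vanishing"
      "free_gen K (Edge e) \<otimes>\<^bsub>F\<^esub> free_gen K (Vert (head \<Gamma> e)) \<ominus>\<^bsub>F\<^esub> free_gen K (Edge e) \<in> vanishing"
      "free_gen K (Vert (head \<Gamma> e)) \<otimes>\<^bsub>F\<^esub> free_gen K (Ghost e) \<ominus>\<^bsub>F\<^esub> free_gen K (Ghost e) \<in> vanishing"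
      "free_gen K (Ghost e) \<otimes>\<^bsub>F\<^esub> free_gen K (Vert (tail \<Gamma> e)) \<ominus>\<^bsub>F\<^esub> free_gen K (Ghost e) \<in> vanishing"
      if "e \<in> arcs \<Gamma>" for e
    proof -
      obtain x l where e: "e = (x, l)" by (cases e)
      note 2 = 2[of x l] that[unfolded e arcs_iff]
      show "free_gen K (Vert (tail \<Gamma> e)) \<otimes>\<^bsub>F\<^esub> free_gen K (Edge e) \<ominus>\<^bsub>F\<^esub> free_gen K (Edge e) \<in> vanishing"
        "free_gen K (Edge e) \<otimes>\<^bsub>F\<^esub> free_gen K (Vert (head \<Gamma> e)) \<ominus>\<^bsub>F\<^esub> free_gen K (Edge e) \<in> vanishing"
        "free_gen K (Vert (head \<Gamma> e)) \<otimes>\<^bsub>F\<^esub> free_gen K (Ghost e) \<ominus>\<^bsub>F\<^esub> free_gen K (Ghost e) \<in> vanishing"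
        "free_gen K (Ghost e) \<otimes>\<^bsub>F\<^esub> free_gen K (Vert (tail \<Gamma> e)) \<ominus>\<^bsub>F\<^esub> free_gen K (Ghost e) \<in> vanishing"
        using 2 unfolding e tail_head by blast+
    qed
    have arc2: "free_gen K (Ghost e) \<otimes>\<^bsub>F\<^esub> free_gen K (Edge f) \<ominus>\<^bsub>F\<^esub>
        (if e = f then free_gen K (Vert (head \<Gamma> e)) else \<zero>\<^bsub>F\<^esub>) \<in> vanishing"
      if "e \<in> arcs \<Gamma>" "f \<in> arcs \<Gamma>" for e f
    proof -
      obtain x l y m where e: "e = (x, l)" "f = (y, m)" by (cases e, cases f)
      then show ?thesis using 3[of x l y m] that unfolding e tail_head arcs_iff by blast
    qed
    show ?thesis
      unfolding leavitt_relations_def Let_def verts_eq using 1 arc1 arc2 4 by blast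
  qed
qed

lemma ideal_vanishing: "leavitt_ideal K \<Gamma> \<subseteq> vanishing"
  by (rule F.genideal_minimal[OF vanishing_ideal relations_vanishing])

abbreviation proj :: "(('g, 'g \<times> 'g \<times> nat) leavitt_gen list \<Rightarrow> 'k) \<Rightarrow> (('g, 'g \<times> 'g \<times> nat) leavitt_gen list \<Rightarrow> 'k) set"
  where "proj \<equiv> (+>\<^bsub>F\<^esub>) (leavitt_ideal K \<Gamma>)"

lemma leavitt_ideal_ideal: "ideal (leavitt_ideal K \<Gamma>) F"
  by (rule F.genideal_ideal) (use relations_vanishing in \<open>auto simp: vanishing_def\<close>)

sublocale J: ideal "leavitt_ideal K \<Gamma>" F by (rule leavitt_ideal_ideal)

sublocale h: ring_hom_ring F U proj
  unfolding U leavitt_unitization_def by (rule J.rcos_ring_hom_ring)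

lemma proj_surj: "u \<in> carrier U \<Longrightarrow> \<exists>f\<in>carrier F. u = proj f"
  unfolding U leavitt_unitization_def FactRing_def A_RCOSETS_def' by simp

lemma proj_relation:
  assumes "f \<ominus>\<^bsub>F\<^esub> g \<in> leavitt_relations K \<Gamma>" "f \<in> carrier F" "g \<in> carrier F"
  shows "proj f = proj g"
proof -
  have "leavitt_relations K \<Gamma> \<subseteq> carrier F" using relations_vanishing by (auto simp: vanishing_def)
  then have "f \<ominus>\<^bsub>F\<^esub> g \<in> leavitt_ideal K \<Gamma>" using assms(1) F.genideal_self by blast
  then have "f \<in> leavitt_ideal K \<Gamma> +>\<^bsub>F\<^esub> g"
    using J.a_rcos_module_rev[OF assms(3,2)] by (simp add: a_minus_def)
  then show ?thesis by (metis F.a_repr_independence J.a_subgroup assms(3))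
qed

lemma coeff_sum_proj:
  assumes "proj f = proj g" "f \<in> carrier F" "g \<in> carrier F" "valid s"
  shows "K.coeff_sum (runs_to s P) f = K.coeff_sum (runs_to s P) g"
proof -
  have "f \<in> leavitt_ideal K \<Gamma> +>\<^bsub>F\<^esub> g" using assms(1) J.a_rcos_self[OF assms(2)] by simp
  then have "f \<ominus>\<^bsub>F\<^esub> g \<in> vanishing"
    using J.a_rcos_module_imp[OF assms(3)] ideal_vanishing by (auto simp: a_minus_def)
  then have "K.coeff_sum (runs_to s P) f \<ominus>\<^bsub>K\<^esub> K.coeff_sum (runs_to s P) g = \<zero>\<^bsub>K\<^esub>"
    unfolding K.coeff_sum_minus[OF assms(2,3), symmetric] vanishing_def using assms(4) by blast
  then show ?thesis
    using K.coeff_sum_closed[OF assms(2)] K.coeff_sum_closed[OF assms(3)]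
    by (metis K.add_minus_cancel(3) K.l_zero)
qed

definition wd :: "('g, 'g \<times> 'g \<times> nat) leavitt_gen list \<Rightarrow> (('g, 'g \<times> 'g \<times> nat) leavitt_gen list \<Rightarrow> 'k) set"
  where "wd w = proj (K.single w \<one>\<^bsub>K\<^esub>)"

definition sc :: "'k \<Rightarrow> (('g, 'g \<times> 'g \<times> nat) leavitt_gen list \<Rightarrow> 'k) set"
  where "sc k = proj (K.single [] k)"

lemma wd_closed [simp, intro]: "w \<in> lists gens \<Longrightarrow> wd w \<in> carrier U"
  unfolding wd_def by (intro h.hom_closed single_closed) auto

lemma sc_closed [simp, intro]: "k \<in> carrier K \<Longrightarrow> sc k \<in> carrier U"
  unfolding sc_def by (intro h.hom_closed single_closed) auto

lemma wd_Nil: "wd [] = \<one>"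
  unfolding wd_def using K.free_algebra_one_eq[of gens] h.hom_one by metis

lemma wd_append: "u \<in> lists gens \<Longrightarrow> v \<in> lists gens \<Longrightarrow> wd (u @ v) = wd u \<otimes> wd v"
  unfolding wd_def using h.hom_mult[OF single_closed single_closed, of u "\<one>\<^bsub>K\<^esub>" v "\<one>\<^bsub>K\<^esub>"]
  by (simp add: K.single_mult)

lemma proj_single: "w \<in> lists gens \<Longrightarrow> k \<in> carrier K \<Longrightarrow> proj (K.single w k) = sc k \<otimes> wd w"
  unfolding wd_def sc_def using h.hom_mult[OF single_closed single_closed, of "[]" k w "\<one>\<^bsub>K\<^esub>"]
  by (simp add: K.single_mult)

lemma sc_add: "k \<in> carrier K \<Longrightarrow> l \<in> carrier K \<Longrightarrow> sc (k \<oplus>\<^bsub>K\<^esub> l) = sc k \<oplus> sc l"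
  unfolding sc_def using h.hom_add[OF single_closed single_closed, of "[]" k "[]" l]
  by (simp add: K.single_add)

lemma sc_mult: "k \<in> carrier K \<Longrightarrow> l \<in> carrier K \<Longrightarrow> sc (k \<otimes>\<^bsub>K\<^esub> l) = sc k \<otimes> sc l"
  unfolding sc_def using h.hom_mult[OF single_closed single_closed, of "[]" k "[]" l]
  by (simp add: K.single_mult)

lemma sc_one: "sc \<one>\<^bsub>K\<^esub> = \<one>"
  using wd_Nil by (simp add: sc_def wd_def)

lemma sc_zero: "sc \<zero>\<^bsub>K\<^esub> = \<zero>"
proof -
  have "sc \<zero>\<^bsub>K\<^esub> \<oplus> sc \<zero>\<^bsub>K\<^esub> = sc \<zero>\<^bsub>K\<^esub>" using sc_add[of "\<zero>\<^bsub>K\<^esub>" "\<zero>\<^bsub>K\<^esub>"] by simp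
  then show ?thesis using sc_closed[of "\<zero>\<^bsub>K\<^esub>"] by (metis K.zero_closed add.l_cancel_one)
qed

lemma U_induct [consumes 1, case_names zero add]:
  assumes "u \<in> carrier U" "P \<zero>"
    and add: "\<And>k w v. k \<in> carrier K \<Longrightarrow> w \<in> lists gens \<Longrightarrow> v \<in> carrier U \<Longrightarrow> P v \<Longrightarrow> P (sc k \<otimes> wd w \<oplus> v)"
  shows "P u"
proof -
  obtain f where f: "f \<in> carrier F" "u = proj f" using proj_surj assms(1) by blast
  have "P (proj f)" using f(1)
  proof (induction rule: K.free_algebra_induct)
    case zero
    then show ?case using assms(2) h.hom_zero by simp
  next
    case (single w g)
    have "f w \<in> carrier K" using K.free_algebra_carrierD(2)[OF f(1)] .
    then have "proj (K.single w (f w) \<oplus>\<^bsub>F\<^esub> g) = sc (f w) \<otimes> wd w \<oplus> proj g"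
      using single single_closed proj_single by simp
    then show ?case using add[of "f w" w "proj g"] single \<open>f w \<in> carrier K\<close> by simp
  qed
  then show ?thesis using f by simp
qed

lemma wd_in_L: "w \<in> lists gens \<Longrightarrow> w \<noteq> [] \<Longrightarrow> wd w \<in> L"
  unfolding L wd_def leavitt_path_algebra_def using single_closed[of w "\<one>\<^bsub>K\<^esub>"]
  by (auto simp: K.single_def intro!: exI[of _ "K.single w \<one>\<^bsub>K\<^esub>"])

text \<open>The induction is restricted to nonempty words because these have a source and a range
  vertex, which is what provides local units in \<open>L\<close>.\<close>

lemma L_induct [consumes 1, case_names zero add]:
  assumes "u \<in> L" "P \<zero>"
    and add: "\<And>k w v. k \<in> carrier K \<Longrightarrow> w \<in> lists gens \<Longrightarrow> w \<noteq> [] \<Longrightarrow> v \<in> carrier U \<Longrightarrow> P v \<Longrightarrow>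
      P (sc k \<otimes> wd w \<oplus> v)"
  shows "P u"
proof -
  obtain f where f: "f \<in> carrier F" "f [] = \<zero>\<^bsub>K\<^esub>" "u = proj f"
    using assms(1) unfolding L leavitt_path_algebra_def by blast
  have "P (proj f)" using f(1)
  proof (induction rule: K.free_algebra_induct)
    case zero
    then show ?case using assms(2) h.hom_zero by simp
  next
    case (single w g)
    have "f w \<in> carrier K" using K.free_algebra_carrierD(2)[OF f(1)] .
    then have "proj (K.single w (f w) \<oplus>\<^bsub>F\<^esub> g) = sc (f w) \<otimes> wd w \<oplus> proj g"
      using single single_closed proj_single by simp
    moreover have "w \<noteq> []" using single(2) f(2) by auto
    ultimately show ?case using add[of "f w" w "proj g"] single \<open>f w \<in> carrier K\<close> by simp
  qed
  then show ?thesis using f by simp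
qed

lemma sc_wd_comm: "w \<in> lists gens \<Longrightarrow> k \<in> carrier K \<Longrightarrow> wd w \<otimes> sc k = sc k \<otimes> wd w"
  unfolding wd_def sc_def using h.hom_mult[OF single_closed single_closed, of w "\<one>\<^bsub>K\<^esub>" "[]" k]
    h.hom_mult[OF single_closed single_closed, of "[]" k w "\<one>\<^bsub>K\<^esub>"]
  by (simp add: K.single_mult)

lemma sc_central: "u \<in> carrier U \<Longrightarrow> k \<in> carrier K \<Longrightarrow> sc k \<otimes> u = u \<otimes> sc k"
proof (induction u rule: U_induct)
  case (add l w v)
  have "sc k \<otimes> (sc l \<otimes> wd w) = sc l \<otimes> wd w \<otimes> sc k"
    using add sc_mult[of k l] sc_mult[of l k] sc_wd_comm[of w k]
    by (simp add: m_assoc) (simp add: m_assoc[symmetric] K.m_comm)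
  then show ?case using add by (simp add: l_distr r_distr)
qed simp

definition V where "V x = wd [Vert x]"
definition X where "X x l = wd [Edge (x, l)]"
definition Y where "Y x l = wd [Ghost (x, l)]"

lemma VXY_closed [simp, intro]:
  "x \<in> carrier G \<Longrightarrow> V x \<in> carrier U"
  "x \<in> carrier G \<Longrightarrow> l \<in> labels \<Longrightarrow> X x l \<in> carrier U"
  "x \<in> carrier G \<Longrightarrow> l \<in> labels \<Longrightarrow> Y x l \<in> carrier U"
  by (simp_all add: V_def X_def Y_def)

lemma VXY_in_L:
  "x \<in> carrier G \<Longrightarrow> V x \<in> L"
  "x \<in> carrier G \<Longrightarrow> l \<in> labels \<Longrightarrow> X x l \<in> L"
  "x \<in> carrier G \<Longrightarrow> l \<in> labels \<Longrightarrow> Y x l \<in> L"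
  by (auto simp: V_def X_def Y_def intro!: wd_in_L)

lemma gens_cases:
  assumes "g \<in> gens"
  obtains (V) x where "x \<in> carrier G" "wd [g] = V x" | (X) x l where "x \<in> carrier G" "l \<in> labels" "wd [g] = X x l"
    | (Y) x l where "x \<in> carrier G" "l \<in> labels" "wd [g] = Y x l"
proof (cases g)
  case (Vert x)
  then show ?thesis using assms that(1) by (auto simp: V_def)
next
  case (Edge e)
  obtain x l where "e = (x, l)" by (cases e)
  then show ?thesis using assms Edge that(2)[of x l] by (auto simp: X_def)
next
  case (Ghost e)
  obtain x l where "e = (x, l)" by (cases e)
  then show ?thesis using assms Ghost that(3)[of x l] by (auto simp: Y_def)
qed

lemma proj_free_gen: "proj (free_gen K g) = wd [g]"
  by (simp add: wd_def K.free_gen_eq_single)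

lemma free_gen_closed: "g \<in> gens \<Longrightarrow> free_gen K g \<in> carrier F"
  by (rule K.free_gen_closed)

lemma wd_mult_free_gen: "g \<in> gens \<Longrightarrow> g' \<in> gens \<Longrightarrow> proj (free_gen K g \<otimes>\<^bsub>F\<^esub> free_gen K g') = wd [g] \<otimes> wd [g']"
  using free_gen_closed by (simp add: proj_free_gen)

lemma V_V: "x \<in> carrier G \<Longrightarrow> y \<in> carrier G \<Longrightarrow> V x \<otimes> V y = (if x = y then V y else \<zero>)"
proof -
  assume xy: "x \<in> carrier G" "y \<in> carrier G"
  have "proj (free_gen K (Vert x) \<otimes>\<^bsub>F\<^esub> free_gen K (Vert y)) = proj (if x = y then free_gen K (Vert y) else \<zero>\<^bsub>F\<^esub>)"
    by (rule proj_relation) (use xy free_gen_closed in \<open>auto simp: leavitt_relations_def Let_def\<close>)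
  then show ?thesis using xy by (auto simp: wd_mult_free_gen V_def proj_free_gen h.hom_zero)
qed

lemma relations_memI:
  assumes "e \<in> arcs \<Gamma>" "f \<in> arcs \<Gamma>"
  shows "free_gen K (Vert (tail \<Gamma> e)) \<otimes>\<^bsub>F\<^esub> free_gen K (Edge e) \<ominus>\<^bsub>F\<^esub> free_gen K (Edge e) \<in> leavitt_relations K \<Gamma>"
    "free_gen K (Edge e) \<otimes>\<^bsub>F\<^esub> free_gen K (Vert (head \<Gamma> e)) \<ominus>\<^bsub>F\<^esub> free_gen K (Edge e) \<in> leavitt_relations K \<Gamma>"
    "free_gen K (Vert (head \<Gamma> e)) \<otimes>\<^bsub>F\<^esub> free_gen K (Ghost e) \<ominus>\<^bsub>F\<^esub> free_gen K (Ghost e) \<in> leavitt_relations K \<Gamma>"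
    "free_gen K (Ghost e) \<otimes>\<^bsub>F\<^esub> free_gen K (Vert (tail \<Gamma> e)) \<ominus>\<^bsub>F\<^esub> free_gen K (Ghost e) \<in> leavitt_relations K \<Gamma>"
    "free_gen K (Ghost e) \<otimes>\<^bsub>F\<^esub> free_gen K (Edge f) \<ominus>\<^bsub>F\<^esub>
      (if e = f then free_gen K (Vert (head \<Gamma> e)) else \<zero>\<^bsub>F\<^esub>) \<in> leavitt_relations K \<Gamma>"
  unfolding leavitt_relations_def Let_def using assms by blast+

lemma edge_relations:
  assumes x: "x \<in> carrier G" and l: "l \<in> labels"
  shows "V x \<otimes> X x l = X x l" "X x l \<otimes> V (target x l) = X x l"
    "V (target x l) \<otimes> Y x l = Y x l" "Y x l \<otimes> V x = Y x l"
proof -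
  have t: "target x l \<in> carrier G" using x label_closed[OF l] by simp
  have a: "(x, l) \<in> arcs \<Gamma>" using x l by (simp add: arcs_iff)
  note fg = free_gen_closed
  have "proj (free_gen K (Vert x) \<otimes>\<^bsub>F\<^esub> free_gen K (Edge (x, l))) = proj (free_gen K (Edge (x, l)))"
  proof (rule proj_relation)
    show "free_gen K (Vert x) \<otimes>\<^bsub>F\<^esub> free_gen K (Edge (x, l)) \<ominus>\<^bsub>F\<^esub> free_gen K (Edge (x, l)) \<in> leavitt_relations K \<Gamma>"
      using relations_memI[OF a a] by simp
  qed (use x l fg in auto)
  moreover have "proj (free_gen K (Edge (x, l)) \<otimes>\<^bsub>F\<^esub> free_gen K (Vert (target x l))) = proj (free_gen K (Edge (x, l)))"
  proof (rule proj_relation)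
    show "free_gen K (Edge (x, l)) \<otimes>\<^bsub>F\<^esub> free_gen K (Vert (target x l)) \<ominus>\<^bsub>F\<^esub> free_gen K (Edge (x, l)) \<in> leavitt_relations K \<Gamma>"
      using relations_memI[OF a a] by simp
  qed (use x l t fg in auto)
  moreover have "proj (free_gen K (Vert (target x l)) \<otimes>\<^bsub>F\<^esub> free_gen K (Ghost (x, l))) = proj (free_gen K (Ghost (x, l)))"
  proof (rule proj_relation)
    show "free_gen K (Vert (target x l)) \<otimes>\<^bsub>F\<^esub> free_gen K (Ghost (x, l)) \<ominus>\<^bsub>F\<^esub> free_gen K (Ghost (x, l)) \<in> leavitt_relations K \<Gamma>"
      using relations_memI[OF a a] by simp
  qed (use x l t fg in auto)
  moreover have "proj (free_gen K (Ghost (x, l)) \<otimes>\<^bsub>F\<^esub> free_gen K (Vert x)) = proj (free_gen K (Ghost (x, l)))"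
  proof (rule proj_relation)
    show "free_gen K (Ghost (x, l)) \<otimes>\<^bsub>F\<^esub> free_gen K (Vert x) \<ominus>\<^bsub>F\<^esub> free_gen K (Ghost (x, l)) \<in> leavitt_relations K \<Gamma>"
      using relations_memI[OF a a] by simp
  qed (use x l fg in auto)
  ultimately show "V x \<otimes> X x l = X x l" "X x l \<otimes> V (target x l) = X x l"
    "V (target x l) \<otimes> Y x l = Y x l" "Y x l \<otimes> V x = Y x l"
    using x l t by (simp_all add: wd_mult_free_gen proj_free_gen V_def X_def Y_def)
qed

lemma Y_X:
  assumes "x \<in> carrier G" "l \<in> labels" "y \<in> carrier G" "m \<in> labels"
  shows "Y x l \<otimes> X y m = (if x = y \<and> l = m then V (target x l) else \<zero>)"
proof -
  have t: "target x l \<in> carrier G" using assms label_closed by simp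
  have a: "(x, l) \<in> arcs \<Gamma>" "(y, m) \<in> arcs \<Gamma>" using assms by (simp_all add: arcs_iff)
  have "proj (free_gen K (Ghost (x, l)) \<otimes>\<^bsub>F\<^esub> free_gen K (Edge (y, m))) =
      proj (if (x, l) = (y, m) then free_gen K (Vert (target x l)) else \<zero>\<^bsub>F\<^esub>)"
  proof (rule proj_relation)
    show "free_gen K (Ghost (x, l)) \<otimes>\<^bsub>F\<^esub> free_gen K (Edge (y, m)) \<ominus>\<^bsub>F\<^esub>
        (if (x, l) = (y, m) then free_gen K (Vert (target x l)) else \<zero>\<^bsub>F\<^esub>) \<in> leavitt_relations K \<Gamma>"
      using relations_memI(5)[OF a] by (simp only: tail_head)
  qed (use assms t free_gen_closed in auto)
  then show ?thesis using assms t
    by (auto simp: wd_mult_free_gen proj_free_gen V_def X_def Y_def h.hom_zero split: if_splits)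
qed

lemma finsum_hom:
  assumes "finite A" "g \<in> A \<rightarrow> carrier F"
  shows "proj (\<Oplus>\<^bsub>F\<^esub>e\<in>A. g e) = (\<Oplus>e\<in>A. proj (g e))"
  using assms
proof (induction A)
  case (insert e A)
  then have "(\<Oplus>\<^bsub>F\<^esub>e\<in>A. g e) \<in> carrier F" by (intro F.finsum_closed) auto
  then show ?case using insert by (simp add: Pi_def)
qed (simp add: h.hom_zero)

lemma V_eq_sum:
  assumes x: "x \<in> carrier G" and fin: "finite labels" and ne: "labels \<noteq> {}"
  shows "V x = (\<Oplus>l\<in>labels. X x l \<otimes> Y x l)"
proof -
  have A: "out_arcs \<Gamma> x = Pair x ` labels" by (rule out_arcs_eq[OF x])
  have gc: "free_gen K (Edge e) \<otimes>\<^bsub>F\<^esub> free_gen K (Ghost e) \<in> carrier F" if "e \<in> Pair x ` labels" for e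
    using that x by (auto intro!: F.m_closed free_gen_closed)
  have "proj (free_gen K (Vert x)) = proj (\<Oplus>\<^bsub>F\<^esub>e\<in>out_arcs \<Gamma> x. free_gen K (Edge e) \<otimes>\<^bsub>F\<^esub> free_gen K (Ghost e))"
  proof (rule proj_relation)
    have "out_arcs \<Gamma> x \<noteq> {}" "finite (out_arcs \<Gamma> x)" using A fin ne by auto
    then show "free_gen K (Vert x) \<ominus>\<^bsub>F\<^esub> (\<Oplus>\<^bsub>F\<^esub>e\<in>out_arcs \<Gamma> x. free_gen K (Edge e) \<otimes>\<^bsub>F\<^esub> free_gen K (Ghost e))
        \<in> leavitt_relations K \<Gamma>"
      unfolding leavitt_relations_def Let_def verts_eq using x by blast
    show "(\<Oplus>\<^bsub>F\<^esub>e\<in>out_arcs \<Gamma> x. free_gen K (Edge e) \<otimes>\<^bsub>F\<^esub> free_gen K (Ghost e)) \<in> carrier F"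
      unfolding A using gc by (intro F.finsum_closed) auto
  qed (use x free_gen_closed in auto)
  also have "\<dots> = (\<Oplus>e\<in>Pair x ` labels. proj (free_gen K (Edge e) \<otimes>\<^bsub>F\<^esub> free_gen K (Ghost e)))"
    unfolding A using gc fin by (intro finsum_hom) auto
  also have "\<dots> = (\<Oplus>l\<in>labels. proj (free_gen K (Edge (x, l)) \<otimes>\<^bsub>F\<^esub> free_gen K (Ghost (x, l))))"
    using gc by (intro add.finprod_reindex) (auto simp: inj_on_def)
  also have "\<dots> = (\<Oplus>l\<in>labels. X x l \<otimes> Y x l)"
    using x by (intro finsum_cong') (auto simp: wd_mult_free_gen X_def Y_def)
  finally show ?thesis by (simp add: proj_free_gen V_def)
qed

text \<open>The functional descends to the quotient because it annihilates the ideal;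
  \<open>eval_functional_proj\<close> shows that at valid states the chosen representative does not
  matter.\<close>

definition eval_functional :: "'g state \<Rightarrow> ('g state \<Rightarrow> bool) \<Rightarrow> (('g, 'g \<times> 'g \<times> nat) leavitt_gen list \<Rightarrow> 'k) set \<Rightarrow> 'k"
  where "eval_functional s P u = K.coeff_sum (runs_to s P) (SOME f. f \<in> carrier F \<and> u = proj f)"

lemma eval_functional_proj:
  assumes "valid s" "f \<in> carrier F"
  shows "eval_functional s P (proj f) = K.coeff_sum (runs_to s P) f"
proof -
  have "\<exists>g. g \<in> carrier F \<and> proj f = proj g" using assms(2) by blast
  then have "(SOME g. g \<in> carrier F \<and> proj f = proj g) \<in> carrier F \<and>
      proj f = proj (SOME g. g \<in> carrier F \<and> proj f = proj g)" by (rule someI_ex)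
  then show ?thesis unfolding eval_functional_def
    using coeff_sum_proj[OF _ _ assms(2,1)] by (metis (no_types, lifting))
qed

lemma eval_functional_closed: "valid s \<Longrightarrow> u \<in> carrier U \<Longrightarrow> eval_functional s P u \<in> carrier K"
  using proj_surj eval_functional_proj K.coeff_sum_closed by metis

lemma eval_functional_add:
  assumes "valid s" "u \<in> carrier U" "v \<in> carrier U"
  shows "eval_functional s P (u \<oplus> v) = eval_functional s P u \<oplus>\<^bsub>K\<^esub> eval_functional s P v"
proof -
  obtain f g where "f \<in> carrier F" "u = proj f" "g \<in> carrier F" "v = proj g" using proj_surj assms by metis
  then show ?thesis
    using eval_functional_proj[OF assms(1)] K.coeff_sum_add[of f gens g] h.hom_add[of f g] F.a_closed[of f g] by metis
qed

lemma eval_functional_sc: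
  assumes "valid s" "u \<in> carrier U" "k \<in> carrier K"
  shows "eval_functional s P (sc k \<otimes> u) = k \<otimes>\<^bsub>K\<^esub> eval_functional s P u"
proof -
  obtain f where f: "f \<in> carrier F" "u = proj f" using proj_surj assms by metis
  have s: "K.single [] k \<in> carrier F" using assms by (intro single_closed) auto
  have "sc k \<otimes> u = proj (K.single [] k \<otimes>\<^bsub>F\<^esub> f)" using f s by (simp add: sc_def)
  moreover have "K.coeff_sum Q (K.single [] k \<otimes>\<^bsub>F\<^esub> f) = k \<otimes>\<^bsub>K\<^esub> K.coeff_sum Q f" for Q
    using K.coeff_sum_mult_single(1)[OF f(1) _ assms(3), of "[]"] by simp
  ultimately show ?thesis
    using f(2) by (simp only: eval_functional_proj[OF assms(1) F.m_closed[OF s f(1)]] eval_functional_proj[OF assms(1) f(1)])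
qed

lemma eval_functional_wd:
  "valid s \<Longrightarrow> w \<in> lists gens \<Longrightarrow> eval_functional s P (wd w) = (if runs_to s P w then \<one>\<^bsub>K\<^esub> else \<zero>\<^bsub>K\<^esub>)"
  unfolding wd_def using eval_functional_proj single_closed by (simp add: K.coeff_sum_single)

lemma valid_exists: "x \<in> carrier G \<Longrightarrow> \<exists>q. valid (x, n, q)"
  by (cases "labels = {}") (auto simp: valid_def)

text \<open>The functional with the constantly true predicate has the value \<open>1\<close> on
  \<open>V x\<close> at a state based at \<open>x\<close>.\<close>

lemma V_nonzero: "x \<in> carrier G \<Longrightarrow> V x \<noteq> \<zero>"
proof
  assume x: "x \<in> carrier G" and "V x = \<zero>"
  obtain q where v: "valid (x, 0, q)" using valid_exists x by blast
  have "eval_functional (x, 0, q) (\<lambda>_. True) (sc \<zero>\<^bsub>K\<^esub> \<otimes> V x) = \<zero>\<^bsub>K\<^esub>"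
    using eval_functional_sc[OF v, of "V x"] eval_functional_closed[OF v, of "V x"] x by simp
  moreover have "sc \<zero>\<^bsub>K\<^esub> \<otimes> V x = V x" using \<open>V x = \<zero>\<close> by (simp add: sc_zero)
  moreover have "eval_functional (x, 0, q) (\<lambda>_. True) (V x) = \<one>\<^bsub>K\<^esub>"
    unfolding V_def using eval_functional_wd[OF v, of "[Vert x]"] x by (simp add: runs_to_def)
  ultimately show False using K.one_not_zero by simp
qed

end

lemma (in ring) finsum_mult_orthogonal:
  assumes "finite A" "finite B" "\<And>i. i \<in> A \<Longrightarrow> f i \<in> carrier R" "\<And>j. j \<in> B \<Longrightarrow> g j \<in> carrier R"
    and orth: "\<And>i j. i \<in> A \<Longrightarrow> j \<in> B \<Longrightarrow> i \<noteq> j \<Longrightarrow> f i \<otimes> g j = \<zero>"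
  shows "(\<Oplus>i\<in>A. f i) \<otimes> (\<Oplus>j\<in>B. g j) = (\<Oplus>i\<in>A \<inter> B. f i \<otimes> g i)"
proof -
  have gB: "(\<Oplus>j\<in>B. g j) \<in> carrier R" using assms by (intro finsum_closed) auto
  have row: "f i \<otimes> (\<Oplus>j\<in>B. g j) = (if i \<in> B then f i \<otimes> g i else \<zero>)" if i: "i \<in> A" for i
  proof -
    have "f i \<otimes> (\<Oplus>j\<in>B. g j) = (\<Oplus>j\<in>B. f i \<otimes> g j)" using assms i by (intro finsum_rdistr) auto
    also have "\<dots> = (\<Oplus>j\<in>B. if i = j then f i \<otimes> g j else \<zero>)"
      using assms i by (intro finsum_cong') auto
    also have "\<dots> = (if i \<in> B then f i \<otimes> g i else \<zero>)"
    proof (cases "i \<in> B")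
      case True
      then show ?thesis using assms i by (subst finsum_singleton[where f = "\<lambda>j. f i \<otimes> g j"]) auto
    next
      case False
      then have "(\<Oplus>j\<in>B. if i = j then f i \<otimes> g j else \<zero>) = (\<Oplus>j\<in>B. \<zero>)"
        by (intro finsum_cong') auto
      then show ?thesis using False by simp
    qed
    finally show ?thesis .
  qed
  have "(\<Oplus>i\<in>A. f i) \<otimes> (\<Oplus>j\<in>B. g j) = (\<Oplus>i\<in>A. f i \<otimes> (\<Oplus>j\<in>B. g j))"
    using assms gB by (intro finsum_ldistr) auto
  also have "\<dots> = (\<Oplus>i\<in>A. if i \<in> B then f i \<otimes> g i else \<zero>)"
    using assms by (intro finsum_cong' row) auto
  also have "\<dots> = (\<Oplus>i\<in>A \<inter> B. if i \<in> B then f i \<otimes> g i else \<zero>)"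
    by (rule add.finprod_mono_neutral_cong_right) (use assms in auto)
  also have "\<dots> = (\<Oplus>i\<in>A \<inter> B. f i \<otimes> g i)" using assms by (intro finsum_cong') auto
  finally show ?thesis .
qed

context ideal
begin

lemma finsum_in_ideal:
  assumes "finite A" "\<And>i. i \<in> A \<Longrightarrow> f i \<in> I"
  shows "(\<Oplus>i\<in>A. f i) \<in> I"
  using assms
proof (induction A)
  case (insert i A)
  have "f j \<in> carrier R" if "j \<in> insert i A" for j using insert.prems that a_subset by auto
  then have "(\<Oplus>i\<in>insert i A. f i) = f i \<oplus> (\<Oplus>i\<in>A. f i)" using insert.hyps by (intro finsum_insert) auto
  moreover have "(\<Oplus>i\<in>A. f i) \<in> I" by (rule insert.IH) (simp add: insert.prems)
  moreover have "f i \<in> I" by (simp add: insert.prems)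
  ultimately show ?case using additive_subgroup.a_closed[OF is_additive_subgroup] by (simp only:)
qed simp

text \<open>Two isometries with orthogonal ranges yield infinitely many, \<open>x i = a^i b\<close>
  with adjoints \<open>y i = b' a'^i\<close>. The range of the one with index \<open>m + 1\<close>
  is orthogonal to those with indices \<open>1\<close> to \<open>m\<close>, so these ranges do not
  exhaust \<open>p\<close>.\<close>

lemma not_stable_range_cuntz:
  assumes m: "m \<ge> 1"
    and p: "p \<in> I" "p \<otimes> p = p" "p \<noteq> \<zero>" "\<And>u. u \<in> carrier R \<Longrightarrow> p \<otimes> u = u \<otimes> p"
    and a: "a \<in> I" "p \<otimes> a = a" "a' \<in> I" "p \<otimes> a' = a'" "a' \<otimes> a = p"
    and b: "b \<in> I" "p \<otimes> b = b" "b' \<in> I" "p \<otimes> b' = b'" "b' \<otimes> b = p"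
    and ab: "a' \<otimes> b = \<zero>" "b' \<otimes> a = \<zero>"
  shows "\<not> stable_range R I m"
proof -
  define x where "x = rec_nat b (\<lambda>i v. a \<otimes> v)"
  define y where "y = rec_nat b' (\<lambda>i v. v \<otimes> a')"
  have xS: "x 0 = b" "x (Suc i) = a \<otimes> x i" "y 0 = b'" "y (Suc i) = y i \<otimes> a'" for i
    by (simp_all add: x_def y_def)
  have c: "a \<in> carrier R" "a' \<in> carrier R" "b \<in> carrier R" "b' \<in> carrier R" "p \<in> carrier R"
    using a b p(1) a_subset by auto
  have x: "x i \<in> I \<and> p \<otimes> x i = x i" for i
  proof (induction i)
    case (Suc i)
    then have "x i \<in> carrier R" using a_subset by auto
    then show ?case using Suc c a I_l_closed[of "x i" a] by (auto simp: xS m_assoc[symmetric])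
  qed (use b xS in auto)
  have y: "y i \<in> I \<and> p \<otimes> y i = y i" for i
  proof (induction i)
    case (Suc i)
    then have "y i \<in> carrier R" using a_subset by auto
    then show ?case using Suc c I_r_closed[of "y i" a'] by (auto simp: xS m_assoc[symmetric])
  qed (use b xS in auto)
  have xc: "x i \<in> carrier R" "y i \<in> carrier R" for i using x y a_subset by auto
  have xp: "x i \<otimes> p = x i" "y i \<otimes> p = y i" for i using x y p(4) xc by metis+
  have yx: "y i \<otimes> x j = (if i = j then p else \<zero>)" for i j
  proof (induction i arbitrary: j)
    case 0
    then show ?case using b ab c xc by (cases j) (auto simp: xS m_assoc[symmetric])
  next
    case (Suc i)
    show ?case
    proof (cases j)
      case 0
      then show ?thesis using ab c xc by (simp add: xS m_assoc)
    next
      case (Suc k)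
      have "y (Suc i) \<otimes> x (Suc k) = y i \<otimes> ((a' \<otimes> a) \<otimes> x k)" using c xc by (simp add: xS m_assoc)
      then show ?thesis using Suc a x Suc.IH[of k] by simp
    qed
  qed
  have "(\<Oplus>i\<in>{1..m}. x i \<otimes> y i) \<noteq> p"
  proof
    assume eq: "(\<Oplus>i\<in>{1..m}. x i \<otimes> y i) = p"
    have "y (Suc m) = y (Suc m) \<otimes> (\<Oplus>i\<in>{1..m}. x i \<otimes> y i)" using eq xp by simp
    also have "\<dots> = (\<Oplus>i\<in>{1..m}. y (Suc m) \<otimes> (x i \<otimes> y i))" using xc by (intro finsum_rdistr) auto
    also have "\<dots> = (\<Oplus>i\<in>{1..m}. \<zero>)" using xc yx by (intro finsum_cong') (auto simp: m_assoc[symmetric])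
    finally have "y (Suc m) = \<zero>" by simp
    then show False using yx[of "Suc m" "Suc m"] p(3) xc by simp
  qed
  moreover have "m = 1 \<or> (\<forall>u\<in>carrier R. p \<otimes> u = u \<otimes> p)" using p(4) by blast
  ultimately show ?thesis
    by (intro not_stable_range_isometries[OF m p(1,2), of x y]) (simp_all only: x y xp yx simp_thms)
qed

end

section \<open>Local units, paths, and the two constructions from isometries\<close>

context hopf_leavitt
begin

lemma V_X: "x \<in> carrier G \<Longrightarrow> y \<in> carrier G \<Longrightarrow> l \<in> labels \<Longrightarrow> V y \<otimes> X x l = (if x = y then X x l else \<zero>)"
proof -
  assume *: "x \<in> carrier G" "y \<in> carrier G" "l \<in> labels"
  have "V y \<otimes> X x l = V y \<otimes> V x \<otimes> X x l" using * edge_relations by (simp add: m_assoc)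
  also have "\<dots> = (if x = y then X x l else \<zero>)" using * edge_relations(1)[of x l] by (auto simp: V_V)
  finally show ?thesis .
qed

lemma X_V: "x \<in> carrier G \<Longrightarrow> y \<in> carrier G \<Longrightarrow> l \<in> labels \<Longrightarrow> X x l \<otimes> V y = (if target x l = y then X x l else \<zero>)"
proof -
  assume *: "x \<in> carrier G" "y \<in> carrier G" "l \<in> labels"
  have t: "target x l \<in> carrier G" using * label_closed by simp
  have "X x l \<otimes> V y = X x l \<otimes> (V (target x l) \<otimes> V y)" using * t edge_relations by (simp add: m_assoc[symmetric])
  also have "\<dots> = (if target x l = y then X x l else \<zero>)" using * t edge_relations(2)[of x l] by (auto simp: V_V)
  finally show ?thesis .
qed

lemma V_Y: "x \<in> carrier G \<Longrightarrow> y \<in> carrier G \<Longrightarrow> l \<in> labels \<Longrightarrow> V y \<otimes> Y x l = (if target x l = y then Y x l else \<zero>)"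
proof -
  assume *: "x \<in> carrier G" "y \<in> carrier G" "l \<in> labels"
  have t: "target x l \<in> carrier G" using * label_closed by simp
  have "V y \<otimes> Y x l = V y \<otimes> V (target x l) \<otimes> Y x l" using * t edge_relations by (simp add: m_assoc)
  also have "\<dots> = (if target x l = y then Y x l else \<zero>)" using * t edge_relations(3)[of x l] by (auto simp: V_V)
  finally show ?thesis .
qed

lemma Y_V: "x \<in> carrier G \<Longrightarrow> y \<in> carrier G \<Longrightarrow> l \<in> labels \<Longrightarrow> Y x l \<otimes> V y = (if x = y then Y x l else \<zero>)"
proof -
  assume *: "x \<in> carrier G" "y \<in> carrier G" "l \<in> labels"
  have "Y x l \<otimes> V y = Y x l \<otimes> (V x \<otimes> V y)" using * edge_relations by (simp add: m_assoc[symmetric])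
  also have "\<dots> = (if x = y then Y x l else \<zero>)" using * edge_relations(4)[of x l] by (auto simp: V_V)
  finally show ?thesis .
qed

definition unit_on :: "'g set \<Rightarrow> (('g, 'g \<times> 'g \<times> nat) leavitt_gen list \<Rightarrow> 'k) set"
  where "unit_on A = (\<Oplus>x\<in>A. V x)"

lemma unit_on_in_L: "finite A \<Longrightarrow> A \<subseteq> carrier G \<Longrightarrow> unit_on A \<in> L"
  unfolding unit_on_def using VXY_in_L by (intro finsum_in_ideal) auto

lemma unit_on_closed: "finite A \<Longrightarrow> A \<subseteq> carrier G \<Longrightarrow> unit_on A \<in> carrier U"
  using unit_on_in_L a_subset by blast

lemma unit_on_V:
  assumes "finite A" "A \<subseteq> carrier G" "x \<in> carrier G"
  shows "unit_on A \<otimes> V x = (if x \<in> A then V x else \<zero>)" "V x \<otimes> unit_on A = (if x \<in> A then V x else \<zero>)"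
proof -
  have x: "(\<Oplus>y\<in>{x}. V y) = V x" using assms by simp
  have "unit_on A \<otimes> (\<Oplus>y\<in>{x}. V y) = (\<Oplus>y\<in>A \<inter> {x}. V y \<otimes> V y)"
    unfolding unit_on_def using assms V_V by (intro finsum_mult_orthogonal) auto
  then show "unit_on A \<otimes> V x = (if x \<in> A then V x else \<zero>)"
    unfolding x using assms V_V[of x x] by auto
  have "(\<Oplus>y\<in>{x}. V y) \<otimes> unit_on A = (\<Oplus>y\<in>{x} \<inter> A. V y \<otimes> V y)"
    unfolding unit_on_def using assms V_V by (intro finsum_mult_orthogonal) auto
  then show "V x \<otimes> unit_on A = (if x \<in> A then V x else \<zero>)"
    unfolding x using assms V_V[of x x] by auto
qed

lemma unit_on_absorb:
  assumes "finite A" "A \<subseteq> carrier G" "x \<in> carrier G" "u \<in> carrier U"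
  shows "V x \<otimes> u = u \<Longrightarrow> unit_on A \<otimes> u = (if x \<in> A then u else \<zero>)"
    "u \<otimes> V x = u \<Longrightarrow> u \<otimes> unit_on A = (if x \<in> A then u else \<zero>)"
proof -
  note c = unit_on_closed[OF assms(1,2)] VXY_closed(1)[OF assms(3)] assms(4)
  show "unit_on A \<otimes> u = (if x \<in> A then u else \<zero>)" if "V x \<otimes> u = u"
  proof -
    have "unit_on A \<otimes> u = unit_on A \<otimes> V x \<otimes> u" using that c by (simp add: m_assoc)
    then show ?thesis using that c unit_on_V[OF assms(1-3)] by (auto split: if_splits)
  qed
  show "u \<otimes> unit_on A = (if x \<in> A then u else \<zero>)" if "u \<otimes> V x = u"
  proof -
    have "u \<otimes> unit_on A = u \<otimes> (V x \<otimes> unit_on A)" using that c by (simp add: m_assoc[symmetric])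
    then show ?thesis using that c unit_on_V[OF assms(1-3)] by (auto split: if_splits)
  qed
qed

lemma unit_on_mult:
  assumes "finite A" "A \<subseteq> carrier G" "finite B" "B \<subseteq> carrier G"
  shows "unit_on A \<otimes> unit_on B = unit_on (A \<inter> B)"
proof -
  have AB: "x \<in> A \<Longrightarrow> x \<in> carrier G" "x \<in> B \<Longrightarrow> x \<in> carrier G" for x using assms by auto
  have "unit_on A \<otimes> unit_on B = (\<Oplus>y\<in>A \<inter> B. V y \<otimes> V y)"
    unfolding unit_on_def by (rule finsum_mult_orthogonal[OF assms(1,3)]) (simp_all add: AB V_V)
  also have "\<dots> = unit_on (A \<inter> B)"
    unfolding unit_on_def by (rule finsum_cong') (simp_all add: AB V_V)
  finally show ?thesis .
qed

lemma unit_on_idem: "finite A \<Longrightarrow> A \<subseteq> carrier G \<Longrightarrow> unit_on A \<otimes> unit_on A = unit_on A"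
  using unit_on_mult[of A A] by simp

lemma gen_ends:
  assumes "g \<in> gens"
  shows "\<exists>x\<in>carrier G. \<exists>y\<in>carrier G. V x \<otimes> wd [g] = wd [g] \<and> wd [g] \<otimes> V y = wd [g]"
  using assms
proof (cases rule: gens_cases)
  case (V x)
  then show ?thesis using V_V[of x x] by (intro bexI[of _ x]) auto
next
  case (X x l)
  then show ?thesis using edge_relations label_closed by (intro bexI[of _ x] bexI[of _ "target x l"]) auto
next
  case (Y x l)
  then show ?thesis using edge_relations label_closed by (intro bexI[of _ "target x l"] bexI[of _ x]) auto
qed

lemma wd_Cons: "g \<in> gens \<Longrightarrow> w \<in> lists gens \<Longrightarrow> wd (g # w) = wd [g] \<otimes> wd w"
  using wd_append[of "[g]" w] by simp

lemma wd_ends: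
  assumes "w \<in> lists gens" "w \<noteq> []"
  shows "\<exists>x\<in>carrier G. \<exists>y\<in>carrier G. V x \<otimes> wd w = wd w \<and> wd w \<otimes> V y = wd w"
proof -
  obtain g w' where w: "w = g # w'" using assms by (cases w) auto
  obtain v h where v: "w = v @ [h]" using assms by (cases w rule: rev_cases) auto
  have gh: "g \<in> gens" "w' \<in> lists gens" using assms w by auto
  have gh': "h \<in> gens" "v \<in> lists gens" using assms v by auto
  note gh = gh gh'
  obtain x where x: "x \<in> carrier G" "V x \<otimes> wd [g] = wd [g]" using gen_ends[OF gh(1)] by blast
  obtain y where y: "y \<in> carrier G" "wd [h] \<otimes> V y = wd [h]" using gen_ends[OF gh(3)] by blast
  have "V x \<otimes> wd w = wd w"
    using x gh unfolding w wd_Cons[OF gh(1,2)] by (simp add: m_assoc[symmetric])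
  moreover have "wd w \<otimes> V y = wd w"
    using y gh wd_append[of v "[h]"] unfolding v by (simp add: m_assoc)
  ultimately show ?thesis using x y by blast
qed

text \<open>Stated for all larger finite sets \<open>B\<close>, so that the supports of several
  elements can be united.\<close>

lemma local_unit:
  assumes "u \<in> L"
  shows "\<exists>A. finite A \<and> A \<subseteq> carrier G \<and> (\<forall>B. finite B \<longrightarrow> A \<subseteq> B \<longrightarrow> B \<subseteq> carrier G \<longrightarrow>
    unit_on B \<otimes> u = u \<and> u \<otimes> unit_on B = u)"
  using assms
proof (induction rule: L_induct)
  case zero
  show ?case using unit_on_closed by (intro exI[of _ "{}"]) auto
next
  case (add k w v)
  then obtain A where A: "finite A" "A \<subseteq> carrier G"
    "\<And>B. finite B \<Longrightarrow> A \<subseteq> B \<Longrightarrow> B \<subseteq> carrier G \<Longrightarrow> unit_on B \<otimes> v = v \<and> v \<otimes> unit_on B = v" by blast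
  obtain x y where xy: "x \<in> carrier G" "y \<in> carrier G" "V x \<otimes> wd w = wd w" "wd w \<otimes> V y = wd w"
    using wd_ends[OF add(2,3)] by blast
  have "unit_on B \<otimes> (sc k \<otimes> wd w \<oplus> v) = sc k \<otimes> wd w \<oplus> v \<and> (sc k \<otimes> wd w \<oplus> v) \<otimes> unit_on B = sc k \<otimes> wd w \<oplus> v"
    if B: "finite B" "insert x (insert y A) \<subseteq> B" "B \<subseteq> carrier G" for B
  proof -
    have c: "sc k \<in> carrier U" "wd w \<in> carrier U" "unit_on B \<in> carrier U" "v \<in> carrier U"
      using add unit_on_closed[OF B(1,3)] by auto
    have "unit_on B \<otimes> wd w = wd w" "wd w \<otimes> unit_on B = wd w"
      using unit_on_absorb[OF B(1,3) xy(1) c(2)] unit_on_absorb[OF B(1,3) xy(2) c(2)] xy B by auto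
    moreover have "unit_on B \<otimes> (sc k \<otimes> wd w) = sc k \<otimes> (unit_on B \<otimes> wd w)"
      using c sc_central[OF c(3) add(1)] by (simp add: m_assoc[symmetric])
    ultimately show ?thesis using A(3)[OF B(1) _ B(3)] B c by (simp add: l_distr r_distr m_assoc)
  qed
  then show ?case using A xy by (intro exI[of _ "insert x (insert y A)"]) auto
qed

lemma local_unit_finite:
  assumes "finite T" "T \<subseteq> L"
  shows "\<exists>A. finite A \<and> A \<subseteq> carrier G \<and> (\<forall>B u. finite B \<longrightarrow> A \<subseteq> B \<longrightarrow> B \<subseteq> carrier G \<longrightarrow> u \<in> T \<longrightarrow>
    unit_on B \<otimes> u = u \<and> u \<otimes> unit_on B = u)"
  using assms
proof (induction T)
  case empty
  show ?case by (intro exI[of _ "{}"]) auto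
next
  case (insert t T)
  then obtain A where A: "finite A" "A \<subseteq> carrier G"
    "\<And>B u. finite B \<Longrightarrow> A \<subseteq> B \<Longrightarrow> B \<subseteq> carrier G \<Longrightarrow> u \<in> T \<Longrightarrow> unit_on B \<otimes> u = u \<and> u \<otimes> unit_on B = u" by auto
  obtain A' where A': "finite A'" "A' \<subseteq> carrier G"
    "\<And>B. finite B \<Longrightarrow> A' \<subseteq> B \<Longrightarrow> B \<subseteq> carrier G \<Longrightarrow> unit_on B \<otimes> t = t \<and> t \<otimes> unit_on B = t"
    using local_unit[of t] insert.prems by auto
  show ?case using A A' by (intro exI[of _ "A \<union> A'"]) auto
qed

text \<open>\<open>inv\<close> says that no edge enters or leaves \<open>A\<close>, so each
  generator has both or none of its ends in \<open>A\<close>.\<close>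

lemma unit_on_central:
  assumes A: "finite A" "A \<subseteq> carrier G"
    and inv: "\<And>x l. x \<in> carrier G \<Longrightarrow> l \<in> labels \<Longrightarrow> target x l \<in> A \<longleftrightarrow> x \<in> A"
    and u: "u \<in> carrier U"
  shows "unit_on A \<otimes> u = u \<otimes> unit_on A"
proof -
  note c = unit_on_closed[OF A]
  have gen: "unit_on A \<otimes> wd [g] = wd [g] \<otimes> unit_on A" if "g \<in> gens" for g
    using that
  proof (cases rule: gens_cases)
    case (V x)
    then show ?thesis using unit_on_V[OF A] by simp
  next
    case (X x l)
    have t: "target x l \<in> carrier G" using X label_closed by simp
    have "X x l \<in> carrier U" using X by simp
    then show ?thesis
      using X unit_on_absorb(1)[OF A X(1)] unit_on_absorb(2)[OF A t] edge_relations[OF X(1,2)] inv[OF X(1,2)] by simp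
  next
    case (Y x l)
    have t: "target x l \<in> carrier G" using Y label_closed by simp
    have "Y x l \<in> carrier U" using Y by simp
    then show ?thesis
      using Y unit_on_absorb(1)[OF A t] unit_on_absorb(2)[OF A Y(1)] edge_relations[OF Y(1,2)] inv[OF Y(1,2)] by simp
  qed
  have word: "unit_on A \<otimes> wd w = wd w \<otimes> unit_on A" if "w \<in> lists gens" for w
    using that
  proof (induction w)
    case Nil
    then show ?case using c by (simp add: wd_Nil)
  next
    case (Cons g w)
    then have g: "g \<in> gens" and w: "w \<in> lists gens" "unit_on A \<otimes> wd w = wd w \<otimes> unit_on A" by auto
    have gc: "wd [g] \<in> carrier U" "wd w \<in> carrier U" using g w by auto
    have "unit_on A \<otimes> (wd [g] \<otimes> wd w) = wd [g] \<otimes> unit_on A \<otimes> wd w"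
      using gen[OF g] gc c by (simp add: m_assoc[symmetric])
    also have "\<dots> = wd [g] \<otimes> wd w \<otimes> unit_on A" using gc c w(2) by (simp add: m_assoc)
    finally show ?case by (simp only: wd_Cons[OF g w(1)])
  qed
  show ?thesis using u
  proof (induction rule: U_induct)
    case (add k w v)
    have kc: "sc k \<in> carrier U" "wd w \<in> carrier U" using add by auto
    have "unit_on A \<otimes> (sc k \<otimes> wd w) = unit_on A \<otimes> sc k \<otimes> wd w" using c kc by (simp add: m_assoc)
    also have "\<dots> = sc k \<otimes> unit_on A \<otimes> wd w" by (simp only: sc_central[OF c add(1)])
    also have "\<dots> = sc k \<otimes> (unit_on A \<otimes> wd w)" using c kc by (simp add: m_assoc)
    also have "\<dots> = sc k \<otimes> wd w \<otimes> unit_on A" using word[OF add(2)] c kc by (simp add: m_assoc)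
    finally have "unit_on A \<otimes> (sc k \<otimes> wd w) = sc k \<otimes> wd w \<otimes> unit_on A" .
    then show ?case using add c by (simp add: l_distr r_distr)
  qed (use c in simp)
qed

text \<open>With its ghost \<open>pathY\<close> this is an isometry: \<open>pathY x ls\<close> times
  \<open>pathX x ls\<close> is the end vertex. A list of labels describes a path from any start, as
  all vertices emit the same labels.\<close>

primrec pathX :: "'g \<Rightarrow> ('g \<times> nat) list \<Rightarrow> (('g, 'g \<times> 'g \<times> nat) leavitt_gen list \<Rightarrow> 'k) set"
  where
    "pathX x [] = V x"
  | "pathX x (l # ls) = X x l \<otimes> pathX (target x l) ls"

primrec pathY :: "'g \<Rightarrow> ('g \<times> nat) list \<Rightarrow> (('g, 'g \<times> 'g \<times> nat) leavitt_gen list \<Rightarrow> 'k) set"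
  where
    "pathY x [] = V x"
  | "pathY x (l # ls) = pathY (target x l) ls \<otimes> Y x l"

primrec path_end :: "'g \<Rightarrow> ('g \<times> nat) list \<Rightarrow> 'g"
  where
    "path_end x [] = x"
  | "path_end x (l # ls) = path_end (target x l) ls"

lemma path_props:
  assumes "x \<in> carrier G" "set ls \<subseteq> labels"
  shows "path_end x ls \<in> carrier G" "pathX x ls \<in> L" "pathY x ls \<in> L"
    "V x \<otimes> pathX x ls = pathX x ls" "pathX x ls \<otimes> V (path_end x ls) = pathX x ls"
    "V (path_end x ls) \<otimes> pathY x ls = pathY x ls" "pathY x ls \<otimes> V x = pathY x ls"
    "pathY x ls \<otimes> pathX x ls = V (path_end x ls)"
proof -
  have "path_end x ls \<in> carrier G \<and> pathX x ls \<in> L \<and> pathY x ls \<in> L \<and>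
    V x \<otimes> pathX x ls = pathX x ls \<and> pathX x ls \<otimes> V (path_end x ls) = pathX x ls \<and>
    V (path_end x ls) \<otimes> pathY x ls = pathY x ls \<and> pathY x ls \<otimes> V x = pathY x ls \<and>
    pathY x ls \<otimes> pathX x ls = V (path_end x ls)"
    using assms
  proof (induction ls arbitrary: x)
    case Nil
    then show ?case using V_V[of x x] VXY_in_L(1)[of x] by simp
  next
    case (Cons l ls)
    have l: "l \<in> labels" "target x l \<in> carrier G" using Cons.prems label_closed by auto
    let ?P = "pathX (target x l) ls" and ?Q = "pathY (target x l) ls" and ?e = "path_end (target x l) ls"
    have IH: "?e \<in> carrier G" "?P \<in> L" "?Q \<in> L" "V (target x l) \<otimes> ?P = ?P" "?P \<otimes> V ?e = ?P"
      "V ?e \<otimes> ?Q = ?Q" "?Q \<otimes> V (target x l) = ?Q" "?Q \<otimes> ?P = V ?e"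
      using Cons.IH[OF l(2)] Cons.prems by auto
    have c: "?P \<in> carrier U" "?Q \<in> carrier U" "X x l \<in> carrier U" "Y x l \<in> carrier U"
      using IH a_subset Cons.prems l by auto
    have "X x l \<otimes> ?P \<in> L" "?Q \<otimes> Y x l \<in> L" using IH I_l_closed I_r_closed c by auto
    moreover have "V x \<otimes> (X x l \<otimes> ?P) = X x l \<otimes> ?P" "X x l \<otimes> ?P \<otimes> V ?e = X x l \<otimes> ?P"
      using c IH Cons.prems l edge_relations(1)[of x l] by (simp_all add: m_assoc[symmetric]) (simp add: m_assoc)
    moreover have "V ?e \<otimes> (?Q \<otimes> Y x l) = ?Q \<otimes> Y x l" "?Q \<otimes> Y x l \<otimes> V x = ?Q \<otimes> Y x l"
      using c IH Cons.prems l edge_relations(4)[of x l] by (simp_all add: m_assoc) (simp add: m_assoc[symmetric])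
    moreover have "(?Q \<otimes> Y x l) \<otimes> (X x l \<otimes> ?P) = V ?e"
    proof -
      have "(?Q \<otimes> Y x l) \<otimes> (X x l \<otimes> ?P) = ?Q \<otimes> ((Y x l \<otimes> X x l) \<otimes> ?P)" using c by (simp add: m_assoc)
      then show ?thesis using Y_X[of x l x l] Cons.prems l IH by simp
    qed
    ultimately show ?case using IH by simp
  qed
  then show "path_end x ls \<in> carrier G" "pathX x ls \<in> L" "pathY x ls \<in> L"
    "V x \<otimes> pathX x ls = pathX x ls" "pathX x ls \<otimes> V (path_end x ls) = pathX x ls"
    "V (path_end x ls) \<otimes> pathY x ls = pathY x ls" "pathY x ls \<otimes> V x = pathY x ls"
    "pathY x ls \<otimes> pathX x ls = V (path_end x ls)" by blast+
qed

lemma path_closed: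
  assumes "x \<in> carrier G" "set ls \<subseteq> labels"
  shows "pathX x ls \<in> carrier U" "pathY x ls \<in> carrier U"
  using path_props[OF assms] a_subset by auto

abbreviation S :: "'g set"
  where "S \<equiv> ram_semigroup G r"

lemma S_eq: "S = subsemigroup_generated G (fst ` labels)"
proof -
  have "\<Union>(ram_supp G r) = fst ` labels"
    by (force simp: ram_supp_def labels_def image_iff)
  then show ?thesis by (simp add: ram_semigroup_def)
qed

lemma S_closed: "s \<in> S \<Longrightarrow> s \<in> carrier G"
  unfolding S_eq by (induction rule: subsemigroup_generated.induct) (use label_closed in auto)

lemma path_end_append: "path_end x (ls @ ms) = path_end (path_end x ls) ms"
  by (induction ls arbitrary: x) auto

lemma S_path:
  assumes "s \<in> S" "x \<in> carrier G"
  shows "\<exists>ls. ls \<noteq> [] \<and> set ls \<subseteq> labels \<and> path_end x ls = x \<otimes>\<^bsub>G\<^esub> s"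
  using assms(1)[unfolded S_eq] assms(2)
proof (induction arbitrary: x rule: subsemigroup_generated.induct)
  case (incl a)
  then obtain l where "l \<in> labels" "a = fst l" by auto
  then show ?case by (intro exI[of _ "[l]"]) auto
next
  case (mult a b)
  then have ab: "a \<in> carrier G" "b \<in> carrier G" using S_closed by (auto simp: S_eq)
  obtain ls where ls: "ls \<noteq> []" "set ls \<subseteq> labels" "path_end x ls = x \<otimes>\<^bsub>G\<^esub> a" using mult by blast
  obtain ms where "ms \<noteq> []" "set ms \<subseteq> labels" "path_end (x \<otimes>\<^bsub>G\<^esub> a) ms = x \<otimes>\<^bsub>G\<^esub> a \<otimes>\<^bsub>G\<^esub> b"
    using mult.IH(2)[of "x \<otimes>\<^bsub>G\<^esub> a"] mult.prems ab by auto
  then show ?case using ls ab mult.prems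
    by (intro exI[of _ "ls @ ms"]) (auto simp: path_end_append G.m_assoc)
qed

lemma path_end_in_S:
  assumes "ls \<noteq> []" "set ls \<subseteq> labels"
  shows "\<exists>s\<in>S. \<forall>x\<in>carrier G. path_end x ls = x \<otimes>\<^bsub>G\<^esub> s"
  using assms
proof (induction ls)
  case (Cons l ls)
  have l: "fst l \<in> S" "fst l \<in> carrier G" using Cons.prems label_closed unfolding S_eq
    by (auto intro: subsemigroup_generated.incl)
  show ?case
  proof (cases "ls = []")
    case True
    then show ?thesis using l by auto
  next
    case False
    then obtain s where s: "s \<in> S" "\<And>x. x \<in> carrier G \<Longrightarrow> path_end x ls = x \<otimes>\<^bsub>G\<^esub> s" using Cons by auto
    have "fst l \<otimes>\<^bsub>G\<^esub> s \<in> S" using l s unfolding S_eq by (auto intro: subsemigroup_generated.mult)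
    then show ?thesis using s l S_closed[OF s(1)] by (intro bexI[of _ "fst l \<otimes>\<^bsub>G\<^esub> s"]) (auto simp: G.m_assoc)
  qed
qed simp

lemma submonoid_iff: "submonoid S G \<longleftrightarrow> \<one>\<^bsub>G\<^esub> \<in> S"
proof
  assume "\<one>\<^bsub>G\<^esub> \<in> S"
  then show "submonoid S G"
    using S_closed by unfold_locales (auto simp: S_eq intro: subsemigroup_generated.mult)
qed (rule submonoid.one_closed)

text \<open>Left translation by \<open>a\<close> is an injection of the finite set \<open>S\<close>
  into itself, so it attains \<open>1\<close>.\<close>

lemma finite_subgroup:
  assumes "\<one>\<^bsub>G\<^esub> \<in> S" "finite S"
  shows "subgroup S G"
proof (rule G.subgroupI)
  show "S \<subseteq> carrier G" using S_closed by auto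
  show "S \<noteq> {}" using assms by auto
  show "a \<otimes>\<^bsub>G\<^esub> b \<in> S" if "a \<in> S" "b \<in> S" for a b
    using that unfolding S_eq by (rule subsemigroup_generated.mult)
  show "inv\<^bsub>G\<^esub> a \<in> S" if a: "a \<in> S" for a
  proof -
    have ac: "a \<in> carrier G" using S_closed a by auto
    have "inj_on (\<lambda>s. a \<otimes>\<^bsub>G\<^esub> s) S" using S_closed ac by (intro inj_onI) auto
    moreover have "(\<lambda>s. a \<otimes>\<^bsub>G\<^esub> s) ` S \<subseteq> S" using a unfolding S_eq by (auto intro: subsemigroup_generated.mult)
    ultimately have "(\<lambda>s. a \<otimes>\<^bsub>G\<^esub> s) ` S = S" using assms(2) by (simp add: endo_inj_surj)
    then obtain s where s: "s \<in> S" "a \<otimes>\<^bsub>G\<^esub> s = \<one>\<^bsub>G\<^esub>" using assms(1) by (metis imageE)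
    then have "inv\<^bsub>G\<^esub> a = s" using ac S_closed by (metis G.inv_comm G.inv_equality)
    then show ?thesis using s by simp
  qed
qed

text \<open>For a label \<open>l\<close> let \<open>a l\<close> be the sum of its edges over
  \<open>S\<close> and \<open>b l\<close> that of their ghosts. Right translation by
  \<open>fst l\<close> permutes the group \<open>S\<close>; hence \<open>b l a m\<close> is
  \<open>p\<close> for \<open>l = m\<close> and zero otherwise. Closure of \<open>S\<close> under
  edges in both directions makes \<open>p\<close> central.\<close>

theorem stable_rank_infinite:
  assumes S: "\<one>\<^bsub>G\<^esub> \<in> S" "finite S" and l: "l1 \<in> labels" "l2 \<in> labels" "l1 \<noteq> l2"
  shows "stable_rank U L = \<infinity>"
proof -
  note sub = finite_subgroup[OF S]
  have SG: "S \<subseteq> carrier G" by (rule subgroup.subset[OF sub])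
  have lS: "fst l \<in> S" if "l \<in> labels" for l using that unfolding S_eq by (auto intro: subsemigroup_generated.incl)
  have inv: "target x l \<in> S \<longleftrightarrow> x \<in> S" if "x \<in> carrier G" "l \<in> labels" for x l
  proof
    assume t: "target x l \<in> S"
    have "x = target x l \<otimes>\<^bsub>G\<^esub> inv\<^bsub>G\<^esub> fst l" using that label_closed by (simp add: G.m_assoc)
    then show "x \<in> S" using t lS[OF that(2)] subgroup.m_closed[OF sub] subgroup.m_inv_closed[OF sub] by metis
  qed (use lS[OF that(2)] subgroup.m_closed[OF sub] in auto)
  define p where "p = unit_on S"
  have pL: "p \<in> L" unfolding p_def by (rule unit_on_in_L[OF S(2) SG])
  have pc: "p \<in> carrier U" using pL a_subset by auto
  define a where "a l = (\<Oplus>x\<in>S. X x l)" for l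
  define b where "b l = (\<Oplus>x\<in>S. Y x l)" for l
  have xS: "X x l \<in> carrier U" "Y x l \<in> carrier U" if "x \<in> S" "l \<in> labels" for x l using that SG by auto
  have aL: "a l \<in> L" "b l \<in> L" if "l \<in> labels" for l
  proof -
    have "x \<in> carrier G" if "x \<in> S" for x using that SG by auto
    then show "a l \<in> L" "b l \<in> L"
      unfolding a_def b_def using VXY_in_L(2)[OF _ that] VXY_in_L(3)[OF _ that]
      by (simp_all add: finsum_in_ideal[OF S(2)])
  qed
  have pa: "p \<otimes> a l = a l" "p \<otimes> b l = b l" if l: "l \<in> labels" for l
  proof -
    have 1: "p \<otimes> X x l = X x l" "p \<otimes> Y x l = Y x l" if x: "x \<in> S" for x
    proof -
      have xG: "x \<in> carrier G" "target x l \<in> carrier G" "target x l \<in> S" using SG x label_closed[OF l] inv[OF _ l] by auto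
      show "p \<otimes> X x l = X x l" "p \<otimes> Y x l = Y x l"
        unfolding p_def
        using unit_on_absorb(1)[OF S(2) SG xG(1) xS(1)[OF x l]] unit_on_absorb(1)[OF S(2) SG xG(2) xS(2)[OF x l]]
          edge_relations[OF xG(1) l] x xG by auto
    qed
    have "p \<otimes> a l = (\<Oplus>x\<in>S. p \<otimes> X x l)"
      unfolding a_def by (rule finsum_rdistr[OF S(2) pc]) (simp add: xS l)
    moreover have "p \<otimes> b l = (\<Oplus>x\<in>S. p \<otimes> Y x l)"
      unfolding b_def by (rule finsum_rdistr[OF S(2) pc]) (simp add: xS l)
    moreover have "(\<Oplus>x\<in>S. p \<otimes> X x l) = a l"
      unfolding a_def by (rule finsum_cong') (simp_all add: 1 xS l)
    moreover have "(\<Oplus>x\<in>S. p \<otimes> Y x l) = b l"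
      unfolding b_def by (rule finsum_cong') (simp_all add: 1 xS l)
    ultimately show "p \<otimes> a l = a l" "p \<otimes> b l = b l" by simp_all
  qed
  have ba: "b l \<otimes> a m = (if l = m then p else \<zero>)" if "l \<in> labels" "m \<in> labels" for l m
  proof -
    have Sx: "x \<in> carrier G" "target x l \<in> carrier G" if "x \<in> S" for x
      using that SG label_closed[OF \<open>l \<in> labels\<close>] by auto
    have YX: "Y x l \<otimes> X y m = (if x = y \<and> l = m then V (target x l) else \<zero>)" if "x \<in> S" "y \<in> S" for x y
      by (rule Y_X[OF Sx(1)[OF that(1)] \<open>l \<in> labels\<close> Sx(1)[OF that(2)] \<open>m \<in> labels\<close>])
    have "b l \<otimes> a m = (\<Oplus>x\<in>S \<inter> S. Y x l \<otimes> X x m)"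
      unfolding a_def b_def
      by (rule finsum_mult_orthogonal[OF S(2) S(2)]) (simp_all add: xS that YX)
    also have "\<dots> = (\<Oplus>x\<in>S. if l = m then V (target x l) else \<zero>)"
    proof (rule finsum_cong')
      have "target x m \<in> carrier G" if "x \<in> S" for x
        using that SG label_closed[OF \<open>m \<in> labels\<close>] by auto
      then show "(\<lambda>x. if l = m then V (target x l) else \<zero>) \<in> S \<rightarrow> carrier U"
        by (simp add: Pi_def VXY_closed(1))
    qed (simp_all add: YX)
    also have "\<dots> = (if l = m then p else \<zero>)"
    proof (cases "l = m")
      case True
      have inj: "inj_on (\<lambda>x. target x l) S"
        using Sx label_closed[OF that(1)] by (intro inj_onI) simp
      have im: "(\<lambda>x. target x l) ` S = S"
      proof (rule endo_inj_surj[OF S(2)])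
        show "(\<lambda>x. target x l) ` S \<subseteq> S" using inv[OF Sx(1) that(1)] by auto
        show "inj_on (\<lambda>x. target x l) S" by (rule inj)
      qed
      have "(\<Oplus>x\<in>S. V (target x l)) = (\<Oplus>x\<in>(\<lambda>x. target x l) ` S. V x)"
      proof (rule add.finprod_reindex[symmetric])
        show "inj_on (\<lambda>x. target x l) S" by (rule inj)
      qed (use Sx in auto)
      then show ?thesis using True im by (simp add: p_def unit_on_def)
    qed simp
    finally show ?thesis .
  qed
  have "p \<noteq> \<zero>"
  proof
    assume "p = \<zero>"
    then have "V \<one>\<^bsub>G\<^esub> = \<zero>" using unit_on_V(1)[OF S(2) SG, of "\<one>\<^bsub>G\<^esub>"] S(1) by (simp add: p_def)
    then show False using V_nonzero by simp
  qed
  then have "\<not> stable_range U L m" if "m \<ge> 1" for m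
    using not_stable_range_cuntz[OF that pL _ _ _ aL(1)[OF l(1)] pa(1)[OF l(1)] aL(2)[OF l(1)] pa(2)[OF l(1)] _
        aL(1)[OF l(2)] pa(1)[OF l(2)] aL(2)[OF l(2)] pa(2)[OF l(2)]]
      unit_on_idem[OF S(2) SG] unit_on_central[OF S(2) SG inv] ba[OF l(1) l(1)] ba[OF l(1) l(2)] ba[OF l(2) l(1)] ba[OF l(2) l(2)] l
    by (simp add: p_def)
  then show ?thesis by (auto simp: stable_rank_def)
qed

text \<open>A closed path at \<open>1\<close> with first label \<open>k\<close> gives
  \<open>N M = V 1\<close>. An edge at \<open>1\<close> with a label other than \<open>k\<close> is
  an exit: \<open>N\<close> kills it, so \<open>M N\<close> differs from \<open>V 1\<close>. For
  rows of length 2, \<open>not_stable_range_isometries\<close> also accepts a vertex that is not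
  central.\<close>

theorem not_stable_range_1_of_exit:
  assumes S: "\<one>\<^bsub>G\<^esub> \<in> S" and l: "l1 \<in> labels" "l2 \<in> labels" "l1 \<noteq> l2"
  shows "\<not> stable_range U L 1"
proof -
  obtain k ks where ks: "set (k # ks) \<subseteq> labels" "path_end \<one>\<^bsub>G\<^esub> (k # ks) = \<one>\<^bsub>G\<^esub>"
    using S_path[OF S G.one_closed] by (metis G.l_one G.one_closed neq_Nil_conv)
  obtain l where l: "l \<in> labels" "l \<noteq> k" using l by metis
  define M where "M = pathX \<one>\<^bsub>G\<^esub> (k # ks)"
  define N where "N = pathY \<one>\<^bsub>G\<^esub> (k # ks)"
  note props = path_props[OF G.one_closed ks(1), folded M_def N_def, unfolded ks(2)]
  have c: "M \<in> carrier U" "N \<in> carrier U" "X \<one>\<^bsub>G\<^esub> l \<in> carrier U" "Y \<one>\<^bsub>G\<^esub> l \<in> carrier U"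
    using props a_subset l by auto
  have t: "target \<one>\<^bsub>G\<^esub> k \<in> carrier G" "target \<one>\<^bsub>G\<^esub> l \<in> carrier G" using ks l label_closed by auto
  have NX: "N \<otimes> X \<one>\<^bsub>G\<^esub> l = \<zero>"
    unfolding N_def using Y_X[of "\<one>\<^bsub>G\<^esub>" k "\<one>\<^bsub>G\<^esub>" l] ks l path_closed(2)[OF t(1), of ks] by (simp add: m_assoc)
  have "(\<Oplus>i\<in>{1..1::nat}. M \<otimes> N) \<noteq> V \<one>\<^bsub>G\<^esub>"
  proof
    assume "(\<Oplus>i\<in>{1..1::nat}. M \<otimes> N) = V \<one>\<^bsub>G\<^esub>"
    then have "V \<one>\<^bsub>G\<^esub> = M \<otimes> N" using c by simp
    then have "X \<one>\<^bsub>G\<^esub> l = M \<otimes> N \<otimes> X \<one>\<^bsub>G\<^esub> l" using edge_relations(1)[of "\<one>\<^bsub>G\<^esub>" l] l by simp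
    then have "X \<one>\<^bsub>G\<^esub> l = \<zero>" using NX c by (simp add: m_assoc)
    then have "V (target \<one>\<^bsub>G\<^esub> l) = \<zero>" using Y_X[of "\<one>\<^bsub>G\<^esub>" l "\<one>\<^bsub>G\<^esub>" l] l c by simp
    then show False using V_nonzero t by simp
  qed
  moreover have "V \<one>\<^bsub>G\<^esub> \<in> L" "V \<one>\<^bsub>G\<^esub> \<otimes> V \<one>\<^bsub>G\<^esub> = V \<one>\<^bsub>G\<^esub>"
    using VXY_in_L(1) V_V[of "\<one>\<^bsub>G\<^esub>" "\<one>\<^bsub>G\<^esub>"] by simp_all
  ultimately show ?thesis
    by (intro not_stable_range_isometries[where m = 1 and p = "V \<one>\<^bsub>G\<^esub>" and x = "\<lambda>_. M" and y = "\<lambda>_. N"])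
      (simp_all add: props)
qed

end

section \<open>Infinite semigroup: shortening rows of length 3\<close>

context ring
begin

lemma lspan_consistent: "subring A R \<Longrightarrow> ring.lspan (R\<lparr>carrier := A\<rparr>) D vs = lspan D vs"
  by (induction vs) (simp_all add: ring.lspan.simps[OF subring_is_ring])

lemma right_invertible_translate_subring:
  assumes A: "subring A R" and K: "subring K R" "K \<subseteq> A"
    and K_inv: "\<And>k. k \<in> K \<Longrightarrow> k \<noteq> \<zero> \<Longrightarrow> \<exists>k'\<in>K. k' \<otimes> k = \<one>"
    and K_central: "\<And>k u. k \<in> K \<Longrightarrow> u \<in> carrier R \<Longrightarrow> k \<otimes> u = u \<otimes> k"
    and vs: "set vs \<subseteq> A" and span: "A \<subseteq> lspan K vs"
    and c: "a \<in> A" "b \<in> A" "x \<in> A" "y \<in> A"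
    and eq: "a \<otimes> x \<oplus> b \<otimes> y = \<one>"
  shows "\<exists>z\<in>A. \<exists>w\<in>A. (a \<oplus> b \<otimes> (y \<otimes> z)) \<otimes> w = \<one>"
proof -
  let ?A = "R\<lparr>carrier := A\<rparr>"
  have ringA: "ring ?A" by (rule subring_is_ring[OF A])
  have KA: "subring K ?A"
    using ring.subring_iff[OF ringA, of K] K subring_is_ring[OF K(1)] by simp
  have AR: "A \<subseteq> carrier R" using subringE(1)[OF A] .
  have "finite_dim_algebra ?A K vs"
    by (intro finite_dim_algebra.intro finite_dim_algebra_axioms.intro ringA KA)
      (use K_inv K_central AR vs span in \<open>auto simp: lspan_consistent[OF A]\<close>)
  from finite_dim_algebra.right_invertible_translate[OF this, of a b x y] show ?thesis
    using c eq by simp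
qed

text \<open>Used with \<open>w = 1\<close>: an additive subgroup that contains \<open>1\<close> and
  is preserved by the generators contains the ring that they generate.\<close>

lemma generate_ring_stable:
  assumes H: "H \<subseteq> carrier R" and W: "W \<subseteq> carrier R"
    "\<And>u w. u \<in> W \<Longrightarrow> w \<in> W \<Longrightarrow> u \<oplus> w \<in> W" "\<And>u. u \<in> W \<Longrightarrow> \<ominus> u \<in> W"
    and stab: "\<And>h w. h \<in> H \<Longrightarrow> w \<in> W \<Longrightarrow> h \<otimes> w \<in> W"
    and d: "d \<in> generate_ring R H" and w: "w \<in> W"
  shows "d \<otimes> w \<in> W"
  using d w
proof (induction arbitrary: w rule: generate_ring.induct)
  case one
  then show ?case using W(1) by auto
next
  case (a_inv h)
  then have "h \<in> carrier R" "w \<in> carrier R" using generate_ring_in_carrier[OF H] W(1) by auto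
  then show ?case using a_inv W(3)[of "h \<otimes> w"] by (simp add: l_minus)
next
  case (eng_add h1 h2)
  then have "h1 \<in> carrier R" "h2 \<in> carrier R" "w \<in> carrier R" using generate_ring_in_carrier[OF H] W(1) by auto
  then show ?case using eng_add W(2)[of "h1 \<otimes> w" "h2 \<otimes> w"] by (simp add: l_distr)
next
  case (eng_mult h1 h2)
  then have "h1 \<in> carrier R" "h2 \<in> carrier R" "w \<in> carrier R" using generate_ring_in_carrier[OF H] W(1) by auto
  then show ?case using eng_mult by (simp add: m_assoc)
qed (use stab in auto)

end

text \<open>The values are picked one after another, each outside \<open>A\<close> and different
  from the earlier ones.\<close>

lemma infinite_choice_inj:
  assumes "finite F" "finite A" "\<And>x. x \<in> F \<Longrightarrow> infinite (C x)"
  shows "\<exists>f. inj_on f F \<and> (\<forall>x\<in>F. f x \<in> C x - A)"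
  using assms(1,3)
proof (induction F)
  case (insert x F)
  then obtain f where f: "inj_on f F" "\<forall>y\<in>F. f y \<in> C y - A" by auto
  have "infinite (C x - (A \<union> f ` F))" using insert assms(2) by (intro Diff_infinite_finite) auto
  then obtain z where z: "z \<in> C x" "z \<notin> A" "z \<notin> f ` F" using infinite_imp_nonempty by blast
  show ?case
  proof (intro exI[of _ "f(x := z)"] conjI)
    have "inj_on (f(x := z)) F \<longleftrightarrow> inj_on f F" by (rule inj_on_cong) (use insert.hyps in auto)
    moreover have "(f(x := z)) ` F = f ` F" using insert.hyps by (intro image_cong) auto
    ultimately show "inj_on (f(x := z)) (insert x F)" using f z insert.hyps by simp
    show "\<forall>y\<in>insert x F. (f(x := z)) y \<in> C y - A" using f z by auto
  qed
qed simp

context hopf_leavitt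
begin

text \<open>An element \<open>w\<close> with \<open>w' w = e\<close>, \<open>e w = 0\<close> and
  \<open>w' e = 0\<close> is a spare direction: \<open>a2 w = 0\<close>, so adding \<open>w\<close>
  to the second coefficient does not disturb \<open>a2\<close>, while \<open>w'\<close> recovers
  \<open>e\<close> from it. Translating \<open>a2\<close> by \<open>a3 x3 w'\<close> thus supplies
  the term \<open>a3 x3 e\<close>, with the first entry left as it is.\<close>

theorem stable_range_2_of_infinite:
  assumes inf: "infinite S"
  shows "stable_range U L 2"
proof (rule stable_range_2I)
  fix a1 a2 a3 x1 x2 x3
  assume a: "a1 \<in> carrier U" "a1 \<ominus> \<one> \<in> L" "a2 \<in> L" "a3 \<in> L"
    and x: "x1 \<in> carrier U" "x1 \<ominus> \<one> \<in> L" "x2 \<in> L" "x3 \<in> L"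
    and eq: "a1 \<otimes> x1 \<oplus> a2 \<otimes> x2 \<oplus> a3 \<otimes> x3 = \<one>"
  have c: "a2 \<in> carrier U" "a3 \<in> carrier U" "x2 \<in> carrier U" "x3 \<in> carrier U" "a1 \<ominus> \<one> \<in> carrier U"
    using a x a_subset by auto
  \<comment> \<open>The entries that get multiplied by \<open>w\<close>, \<open>w'\<close> or
    \<open>1 - e\<close> have to be supported on \<open>F\<close>; \<open>a3\<close> and
    \<open>x3\<close> occur in the final identity as left factors of \<open>e\<close> only.\<close>
  have "finite {a1 \<ominus> \<one>, a2, x2}" "{a1 \<ominus> \<one>, a2, x2} \<subseteq> L" using a x by auto
  from local_unit_finite[OF this] obtain F where F: "finite F" "F \<subseteq> carrier G"
    and F': "\<forall>B u. finite B \<longrightarrow> F \<subseteq> B \<longrightarrow> B \<subseteq> carrier G \<longrightarrow> u \<in> {a1 \<ominus> \<one>, a2, x2} \<longrightarrow>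
      unit_on B \<otimes> u = u \<and> u \<otimes> unit_on B = u" by (elim exE conjE)
  have unit: "unit_on F \<otimes> u = u \<and> u \<otimes> unit_on F = u" if "u \<in> {a1 \<ominus> \<one>, a2, x2}" for u
    using F'[rule_format, OF F(1) subset_refl F(2) that] .
  define e where "e = unit_on F"
  have ec: "e \<in> carrier U" unfolding e_def by (rule unit_on_closed[OF F])
  have FG: "x \<in> carrier G" if "x \<in> F" for x using that F by auto
  \<comment> \<open>From each of the infinitely many vertices \<open>x s^-1\<close> with
    \<open>s\<close> in \<open>S\<close> there is a path to \<open>x\<close>. For the
    \<open>x\<close> in \<open>F\<close>, distinct ones outside \<open>F\<close> are chosen:
    distinctness gives \<open>w' w = e\<close>, and avoiding \<open>F\<close> gives
    \<open>e w = 0\<close> and \<open>w' e = 0\<close>.\<close>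
  have "\<exists>f. inj_on f F \<and> (\<forall>x\<in>F. f x \<in> (\<lambda>s. x \<otimes>\<^bsub>G\<^esub> inv\<^bsub>G\<^esub> s) ` S - F)"
  proof (rule infinite_choice_inj[OF F(1) F(1)])
    fix x assume "x \<in> F"
    then have "inj_on (\<lambda>s. x \<otimes>\<^bsub>G\<^esub> inv\<^bsub>G\<^esub> s) S"
      using S_closed FG by (intro inj_on_inverseI[of S "\<lambda>y. inv\<^bsub>G\<^esub> y \<otimes>\<^bsub>G\<^esub> x"]) (simp add: G.inv_mult_group G.m_assoc)
    then show "infinite ((\<lambda>s. x \<otimes>\<^bsub>G\<^esub> inv\<^bsub>G\<^esub> s) ` S)" using inf finite_imageD by blast
  qed
  then obtain f where f: "inj_on f F" "\<And>x. x \<in> F \<Longrightarrow> f x \<in> (\<lambda>s. x \<otimes>\<^bsub>G\<^esub> inv\<^bsub>G\<^esub> s) ` S - F" by blast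
  have "\<exists>ls. f x \<in> carrier G \<and> set ls \<subseteq> labels \<and> path_end (f x) ls = x" if xF: "x \<in> F" for x
  proof -
    obtain s where s: "s \<in> S" "f x = x \<otimes>\<^bsub>G\<^esub> inv\<^bsub>G\<^esub> s" using f(2)[OF xF] by auto
    have sG: "s \<in> carrier G" "f x \<in> carrier G" using S_closed[OF s(1)] FG[OF xF] s(2) by auto
    have "f x \<otimes>\<^bsub>G\<^esub> s = x" using s sG FG[OF xF] by (simp add: G.m_assoc)
    then show ?thesis using S_path[OF s(1) sG(2)] sG by metis
  qed
  then obtain ls where ls: "\<And>x. x \<in> F \<Longrightarrow> f x \<in> carrier G" "\<And>x. x \<in> F \<Longrightarrow> set (ls x) \<subseteq> labels"
    "\<And>x. x \<in> F \<Longrightarrow> path_end (f x) (ls x) = x" by metis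
  define P where "P x = pathX (f x) (ls x)" for x
  define Q where "Q x = pathY (f x) (ls x)" for x
  have PQ: "P x \<in> L" "Q x \<in> L" "V (f x) \<otimes> P x = P x" "P x \<otimes> V x = P x" "V x \<otimes> Q x = Q x" "Q x \<otimes> V (f x) = Q x"
    "Q x \<otimes> P x = V x" if "x \<in> F" for x
    using path_props[OF ls(1,2)[OF that]] ls(3)[OF that] by (simp_all add: P_def Q_def)
  have PQc: "P x \<in> carrier U" "Q x \<in> carrier U" if "x \<in> F" for x using PQ that a_subset by auto
  define w where "w = (\<Oplus>x\<in>F. P x)"
  define w' where "w' = (\<Oplus>x\<in>F. Q x)"
  have wL: "w \<in> L" "w' \<in> L" unfolding w_def w'_def using PQ by (auto intro!: finsum_in_ideal[OF F(1)])
  have wc: "w \<in> carrier U" "w' \<in> carrier U" using wL a_subset by auto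
  have fx: "f x \<notin> F" if "x \<in> F" for x using f(2)[OF that] by auto
  have w'w: "w' \<otimes> w = e"
  proof -
    have "w' \<otimes> w = (\<Oplus>x\<in>F \<inter> F. Q x \<otimes> P x)"
      unfolding w_def w'_def
    proof (rule finsum_mult_orthogonal[OF F(1) F(1)])
      fix x y assume xy: "x \<in> F" "y \<in> F" "x \<noteq> y"
      have "f x \<noteq> f y" using f(1) xy by (auto dest: inj_onD)
      have "Q x \<otimes> P y = Q x \<otimes> V (f x) \<otimes> (V (f y) \<otimes> P y)" using PQ xy by simp
      also have "\<dots> = Q x \<otimes> (V (f x) \<otimes> V (f y)) \<otimes> P y"
        using PQc xy ls(1) by (simp add: m_assoc)
      also have "\<dots> = \<zero>" using V_V[of "f x" "f y"] ls(1) xy \<open>f x \<noteq> f y\<close> PQc by simp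
      finally show "Q x \<otimes> P y = \<zero>" .
    qed (use PQc in auto)
    also have "\<dots> = e" unfolding e_def unit_on_def using PQ FG by (intro finsum_cong') auto
    finally show ?thesis .
  qed
  have ew: "e \<otimes> w = \<zero>"
  proof -
    have "e \<otimes> w = (\<Oplus>x\<in>F. e \<otimes> P x)" unfolding w_def using PQc by (intro finsum_rdistr[OF F(1) ec]) auto
    also have "\<dots> = (\<Oplus>x\<in>F. \<zero>)"
    proof (rule finsum_cong')
      fix x assume x: "x \<in> F"
      show "e \<otimes> P x = \<zero>" unfolding e_def
        using unit_on_absorb(1)[OF F ls(1)[OF x] PQc(1)[OF x] PQ(3)[OF x]] fx[OF x] by simp
    qed auto
    finally show ?thesis by simp
  qed
  have w'e: "w' \<otimes> e = \<zero>"
  proof -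
    have "w' \<otimes> e = (\<Oplus>x\<in>F. Q x \<otimes> e)" unfolding w'_def using PQc by (intro finsum_ldistr[OF F(1) ec]) auto
    also have "\<dots> = (\<Oplus>x\<in>F. \<zero>)"
    proof (rule finsum_cong')
      fix x assume x: "x \<in> F"
      show "Q x \<otimes> e = \<zero>" unfolding e_def
        using unit_on_absorb(2)[OF F ls(1)[OF x] PQc(2)[OF x] PQ(6)[OF x]] fx[OF x] by simp
    qed auto
    finally show ?thesis by simp
  qed
  have a2w: "a2 \<otimes> w = \<zero>"
  proof -
    have "a2 \<otimes> w = a2 \<otimes> e \<otimes> w" using unit[of a2] by (simp add: e_def)
    then show ?thesis using ew c wc ec by (simp add: m_assoc)
  qed
  have w'x2: "w' \<otimes> x2 = \<zero>"
  proof -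
    have "w' \<otimes> x2 = w' \<otimes> (e \<otimes> x2)" using unit[of x2] by (simp add: e_def)
    then show ?thesis using w'e c wc ec by (simp add: m_assoc[symmetric])
  qed
  define g where "g = \<one> \<ominus> e"
  have gc: "g \<in> carrier U" "e \<oplus> g = \<one>" using ec by (auto simp: g_def add_minus_cancel)
  have a1g: "a1 \<otimes> g = g"
  proof -
    define a where "a = a1 \<ominus> \<one>"
    have ac: "a \<in> carrier U" "a \<otimes> e = a" using c unit[of a] by (auto simp: a_def e_def)
    have "a \<otimes> g = a \<ominus> a \<otimes> e" unfolding g_def using ac(1) ec by (simp add: a_minus_def r_distr r_minus)
    then have ag: "a \<otimes> g = \<zero>" using ac by (simp add: a_minus_def r_neg)
    have "a1 = \<one> \<oplus> a" using \<open>a1 \<in> carrier U\<close> by (simp add: a_def add_minus_cancel)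
    then show ?thesis using ag ac gc by (simp add: l_distr)
  qed
  \<comment> \<open>The original row solves the equation on \<open>e\<close>. On the complement,
    \<open>g = 1 - e\<close> satisfies \<open>a1 g = g\<close>, so \<open>b1\<close> supplies
    it.\<close>
  define b1 where "b1 = x1 \<otimes> e \<oplus> g"
  define b2 where "b2 = x2 \<otimes> e \<oplus> w"
  have b: "b1 \<in> carrier U" "b2 \<in> carrier U" using x c ec gc wc by (auto simp: b1_def b2_def)
  have t1: "a1 \<otimes> b1 = a1 \<otimes> x1 \<otimes> e \<oplus> g"
    unfolding b1_def using a x ec gc a1g by (simp add: r_distr m_assoc)
  have t2: "a2 \<otimes> b2 = a2 \<otimes> x2 \<otimes> e"
    unfolding b2_def using c wc ec a2w by (simp add: r_distr m_assoc)
  have t3: "w' \<otimes> b2 = e"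
  proof -
    have "w' \<otimes> b2 = w' \<otimes> x2 \<otimes> e \<oplus> w' \<otimes> w" unfolding b2_def using c wc ec by (simp add: r_distr m_assoc)
    then show ?thesis using w'x2 w'w ec by simp
  qed
  have "(a1 \<oplus> a3 \<otimes> \<zero>) \<otimes> b1 \<oplus> (a2 \<oplus> a3 \<otimes> (x3 \<otimes> w')) \<otimes> b2 =
      a1 \<otimes> b1 \<oplus> (a2 \<otimes> b2 \<oplus> a3 \<otimes> x3 \<otimes> (w' \<otimes> b2))"
    using a x c wc b by (simp add: l_distr m_assoc)
  also have "\<dots> = (a1 \<otimes> x1 \<otimes> e \<oplus> g) \<oplus> (a2 \<otimes> x2 \<otimes> e \<oplus> a3 \<otimes> x3 \<otimes> e)" by (simp only: t1 t2 t3)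
  also have "\<dots> = (a1 \<otimes> x1 \<oplus> a2 \<otimes> x2 \<oplus> a3 \<otimes> x3) \<otimes> e \<oplus> g"
    using a(1) x(1) c ec gc(1) by (simp add: l_distr a_ac)
  also have "\<dots> = \<one>" using eq ec gc by simp
  finally have "(a1 \<oplus> a3 \<otimes> \<zero>) \<otimes> b1 \<oplus> (a2 \<oplus> a3 \<otimes> (x3 \<otimes> w')) \<otimes> b2 = \<one>" .
  moreover have "x3 \<otimes> w' \<in> L" using I_r_closed[OF x(4) wc(2)] .
  moreover have "\<zero> \<in> L" by (rule additive_subgroup.zero_closed[OF is_additive_subgroup])
  ultimately show "\<exists>r1\<in>L. \<exists>r2\<in>L. \<exists>w1\<in>carrier U. \<exists>w2\<in>carrier U.
      (a1 \<oplus> a3 \<otimes> r1) \<otimes> w1 \<oplus> (a2 \<oplus> a3 \<otimes> r2) \<otimes> w2 = \<one>"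
    using b by blast
qed

section \<open>No closed paths: finite-dimensional subalgebras\<close>

abbreviation scalars where "scalars \<equiv> sc ` carrier K"

lemma scalars_subring: "subring scalars U"
proof (rule subringI)
  show "\<one> \<in> scalars" using sc_one by (metis K.one_closed imageI)
  show "\<ominus> h \<in> scalars" if h: "h \<in> scalars" for h
  proof -
    obtain k where k: "k \<in> carrier K" "h = sc k" using h by auto
    have "sc (\<ominus>\<^bsub>K\<^esub> k) \<oplus> sc k = \<zero>" using k sc_add[of "\<ominus>\<^bsub>K\<^esub> k" k] sc_zero by (simp add: K.l_neg)
    then have "\<ominus> h = sc (\<ominus>\<^bsub>K\<^esub> k)" unfolding k(2) by (rule minus_equality) (use k in auto)
    then show ?thesis using k by auto
  qed
  show "h1 \<otimes> h2 \<in> scalars" if "h1 \<in> scalars" "h2 \<in> scalars" for h1 h2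
    using that by (auto simp: sc_mult[symmetric])
  show "h1 \<oplus> h2 \<in> scalars" if "h1 \<in> scalars" "h2 \<in> scalars" for h1 h2
    using that by (auto simp: sc_add[symmetric])
qed auto

lemma scalars_inv: "k \<in> scalars \<Longrightarrow> k \<noteq> \<zero> \<Longrightarrow> \<exists>k'\<in>scalars. k' \<otimes> k = \<one>"
proof -
  assume "k \<in> scalars" "k \<noteq> \<zero>"
  then obtain l where l: "l \<in> carrier K" "k = sc l" "l \<noteq> \<zero>\<^bsub>K\<^esub>" using sc_zero by auto
  then have "l \<in> Units K" using K.field_Units by simp
  then have "sc (inv\<^bsub>K\<^esub> l) \<otimes> k = \<one>" using l sc_mult[of "inv\<^bsub>K\<^esub> l" l] sc_one by simp
  then show ?thesis using \<open>l \<in> Units K\<close> by auto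
qed

lemma scalars_central: "k \<in> scalars \<Longrightarrow> u \<in> carrier U \<Longrightarrow> k \<otimes> u = u \<otimes> k"
  using sc_central by auto

lemma finitely_generated:
  assumes "u \<in> carrier U"
  shows "\<exists>T. finite T \<and> T \<subseteq> gens \<and> u \<in> generate_ring U (scalars \<union> (\<lambda>g. wd [g]) ` T)"
  using assms
proof (induction rule: U_induct)
  case zero
  show ?case using zero_in_generate by (intro exI[of _ "{}"]) auto
next
  case (add k w v)
  then obtain T where T: "finite T" "T \<subseteq> gens" "v \<in> generate_ring U (scalars \<union> (\<lambda>g. wd [g]) ` T)" by blast
  define T' where "T' = T \<union> set w"
  let ?A = "generate_ring U (scalars \<union> (\<lambda>g. wd [g]) ` T')"
  have T': "finite T'" "T' \<subseteq> gens" using T add by (auto simp: T'_def)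
  have sub: "scalars \<union> (\<lambda>g. wd [g]) ` T' \<subseteq> carrier U" using T' by auto
  have "v \<in> ?A" using mono_generate_ring[OF _ sub, of "scalars \<union> (\<lambda>g. wd [g]) ` T"] T by (auto simp: T'_def)
  moreover have "sc k \<in> ?A" using add by (auto intro: generate_ring.incl)
  moreover have "wd ws \<in> ?A" if "set ws \<subseteq> T'" for ws
    using that
  proof (induction ws)
    case Nil
    then show ?case by (simp add: wd_Nil generate_ring.one)
  next
    case (Cons g ws)
    then have "g \<in> gens" "ws \<in> lists gens" "wd ws \<in> ?A" "wd [g] \<in> ?A" using T' by (auto intro: generate_ring.incl)
    then show ?case by (simp only: wd_Cons generate_ring.eng_mult)
  qed
  then have "wd w \<in> ?A" by (simp add: T'_def)
  ultimately have "sc k \<otimes> wd w \<oplus> v \<in> ?A" by (intro generate_ring.eng_add generate_ring.eng_mult)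
  then show ?case using T' by blast
qed

lemma labels_of_edges: "set es \<subseteq> carrier G \<times> labels \<Longrightarrow> set (map snd es) \<subseteq> labels"
  by (induction es) (simp_all add: mem_Times_iff)

text \<open>A word of edges that do not compose is zero, since the end vertex of one is then
  orthogonal to the source of the next. For the others the end is found by following the labels from
  the first source.\<close>

lemma edges_nonzero_end:
  assumes "es \<noteq> []" "set es \<subseteq> carrier G \<times> labels"
  shows "wd (map Edge es) = \<zero> \<or> wd (map Edge es) \<otimes> V (path_end (fst (hd es)) (map snd es)) = wd (map Edge es)"
  using assms
proof (induction es rule: rev_nonempty_induct)
  case (single e)
  obtain x l where "e = (x, l)" by (cases e)
  then show ?case using single edge_relations(2)[of x l] by (simp add: X_def)
next
  case (snoc e es)
  obtain y m where e: "e = (y, m)" by (cases e)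
  have ym: "y \<in> carrier G" "m \<in> labels" "target y m \<in> carrier G" using snoc.prems e label_closed by auto
  have es: "map Edge es \<in> lists gens" using snoc.prems by (auto simp: subset_iff split_paired_all)
  define z where "z = path_end (fst (hd es)) (map snd es)"
  have zG: "z \<in> carrier G"
  proof -
    have "hd es \<in> set (es @ [e])" using snoc.hyps by simp
    then have "hd es \<in> carrier G \<times> labels" using snoc.prems by blast
    then have "fst (hd es) \<in> carrier G" by (simp add: mem_Times_iff)
    moreover have "set (map snd es) \<subseteq> labels" using labels_of_edges[of es] snoc.prems by simp
    ultimately show ?thesis unfolding z_def by (rule path_props(1))
  qed
  have wc: "wd (map Edge es) \<in> carrier U" using es by simp
  have w: "wd (map Edge (es @ [e])) = wd (map Edge es) \<otimes> X y m"
    using wd_append[OF es, of "[Edge e]"] ym by (simp add: e X_def)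
  have IH: "wd (map Edge es) = \<zero> \<or> wd (map Edge es) \<otimes> V z = wd (map Edge es)"
    using snoc.IH snoc.prems by (simp add: z_def)
  have "wd (map Edge es) \<otimes> X y m = \<zero> \<or> z = y"
  proof (rule disjCI)
    assume zy: "z \<noteq> y"
    show "wd (map Edge es) \<otimes> X y m = \<zero>" using IH
    proof
      assume "wd (map Edge es) \<otimes> V z = wd (map Edge es)"
      then have "wd (map Edge es) \<otimes> X y m = wd (map Edge es) \<otimes> V z \<otimes> X y m" by simp
      also have "\<dots> = wd (map Edge es) \<otimes> (V z \<otimes> X y m)" using wc zG ym by (simp add: m_assoc)
      also have "\<dots> = \<zero>" using V_X[OF ym(1) zG ym(2)] zy wc by simp
      finally show ?thesis .
    qed (use ym in simp)
  qed
  moreover have "wd (map Edge es) \<otimes> X y m \<otimes> V (target y m) = wd (map Edge es) \<otimes> X y m"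
    using wc ym edge_relations(2)[OF ym(1,2)] by (simp add: m_assoc)
  moreover have "path_end (fst (hd (es @ [e]))) (map snd (es @ [e])) = target z m"
    using snoc.hyps by (simp add: path_end_append z_def e)
  ultimately show ?case unfolding w by auto
qed

text \<open>Mirror image for ghosts: the underlying path is read from right to left, hence
  \<open>last\<close> and \<open>rev\<close>.\<close>

lemma ghosts_nonzero_end:
  assumes "fs \<noteq> []" "set fs \<subseteq> carrier G \<times> labels"
  shows "wd (map Ghost fs) = \<zero> \<or> V (path_end (fst (last fs)) (map snd (rev fs))) \<otimes> wd (map Ghost fs) = wd (map Ghost fs)"
  using assms
proof (induction fs rule: list_nonempty_induct)
  case (single e)
  obtain x l where "e = (x, l)" by (cases e)
  then show ?case using single edge_relations(3)[of x l] by (simp add: Y_def)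
next
  case (cons e fs)
  obtain y m where e: "e = (y, m)" by (cases e)
  have ym: "y \<in> carrier G" "m \<in> labels" "target y m \<in> carrier G" using cons.prems e label_closed by auto
  have es: "map Ghost fs \<in> lists gens" using cons.prems by (auto simp: subset_iff split_paired_all)
  define z where "z = path_end (fst (last fs)) (map snd (rev fs))"
  have zG: "z \<in> carrier G"
  proof -
    have "last fs \<in> set (e # fs)" using cons.hyps by simp
    then have "last fs \<in> carrier G \<times> labels" using cons.prems by blast
    then have "fst (last fs) \<in> carrier G" by (simp add: mem_Times_iff)
    moreover have "set (map snd (rev fs)) \<subseteq> labels" using labels_of_edges[of "rev fs"] cons.prems by simp
    ultimately show ?thesis unfolding z_def by (rule path_props(1))
  qed
  have wc: "wd (map Ghost fs) \<in> carrier U" using es by simp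
  have w: "wd (map Ghost (e # fs)) = Y y m \<otimes> wd (map Ghost fs)"
    using wd_Cons[OF _ es, of "Ghost e"] ym by (simp add: e Y_def)
  have IH: "wd (map Ghost fs) = \<zero> \<or> V z \<otimes> wd (map Ghost fs) = wd (map Ghost fs)"
    using cons.IH cons.prems by (simp add: z_def)
  have "Y y m \<otimes> wd (map Ghost fs) = \<zero> \<or> z = y"
  proof (rule disjCI)
    assume zy: "z \<noteq> y"
    show "Y y m \<otimes> wd (map Ghost fs) = \<zero>" using IH
    proof
      assume "V z \<otimes> wd (map Ghost fs) = wd (map Ghost fs)"
      then have "Y y m \<otimes> wd (map Ghost fs) = Y y m \<otimes> (V z \<otimes> wd (map Ghost fs))" by simp
      also have "\<dots> = Y y m \<otimes> V z \<otimes> wd (map Ghost fs)" using wc zG ym by (simp add: m_assoc)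
      also have "\<dots> = \<zero>" using Y_V[OF ym(1) zG ym(2)] zy wc by simp
      finally show ?thesis .
    qed (use ym in simp)
  qed
  moreover have "V (target y m) \<otimes> (Y y m \<otimes> wd (map Ghost fs)) = Y y m \<otimes> wd (map Ghost fs)"
    using wc ym edge_relations(3)[OF ym(1,2)] by (simp add: m_assoc[symmetric])
  moreover have "path_end (fst (last (e # fs))) (map snd (rev (e # fs))) = target z m"
    using cons.hyps by (simp add: path_end_append z_def e)
  ultimately show ?case unfolding w by auto
qed

lemma wd_append4:
  assumes "u \<in> lists gens" "v \<in> lists gens" "v' \<in> lists gens" "w \<in> lists gens"
  shows "wd (u @ (v @ v') @ w) = wd u \<otimes> ((wd v \<otimes> wd v') \<otimes> wd w)"
proof -
  have "v @ v' \<in> lists gens" "(v @ v') @ w \<in> lists gens" using assms by auto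
  then show ?thesis using assms by (simp only: wd_append)
qed

text \<open>If the word were nonzero, the part between two occurrences of an edge would be a
  nonempty path back to its source, and \<open>1\<close> would be a product of labels.\<close>

lemma repeated_edges_zero:
  assumes S: "\<one>\<^bsub>G\<^esub> \<notin> S" and es: "set es \<subseteq> carrier G \<times> labels" "\<not> distinct es"
  shows "wd (map Edge es) = \<zero>" "wd (map Ghost es) = \<zero>"
proof -
  obtain us vs ws e where d: "es = us @ [e] @ vs @ [e] @ ws" using not_distinct_decomp[OF es(2)] by blast
  obtain x l where e: "e = (x, l)" by (cases e)
  have xl: "x \<in> carrier G" "l \<in> labels" using es d e by auto
  have sub: "set us \<subseteq> carrier G \<times> labels" "set (e # vs) \<subseteq> carrier G \<times> labels" "set (vs @ [e]) \<subseteq> carrier G \<times> labels"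
    "set ws \<subseteq> carrier G \<times> labels" using es d by auto
  have lst: "map Edge us \<in> lists gens \<and> map Ghost us \<in> lists gens" if "set us \<subseteq> carrier G \<times> labels" for us
    using that by (auto simp: subset_iff split_paired_all)
  note lsts = lst[OF sub(1)] lst[OF sub(2)] lst[OF sub(3)] lst[OF sub(4)]
  have ne: "path_end x ls \<noteq> x" if ls: "ls \<noteq> []" "set ls \<subseteq> labels" for ls
  proof
    assume eq: "path_end x ls = x"
    obtain s where "s \<in> S" "\<forall>x\<in>carrier G. path_end x ls = x \<otimes>\<^bsub>G\<^esub> s" using path_end_in_S[OF ls] by (elim bexE)
    then have s: "s \<in> S" "x \<otimes>\<^bsub>G\<^esub> s = x" using xl eq by auto
    have "s = inv\<^bsub>G\<^esub> x \<otimes>\<^bsub>G\<^esub> (x \<otimes>\<^bsub>G\<^esub> s)"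
      using S_closed[OF s(1)] xl by (simp only: G.m_assoc[symmetric] G.inv_closed G.l_inv G.l_one)
    also have "\<dots> = inv\<^bsub>G\<^esub> x \<otimes>\<^bsub>G\<^esub> x" by (simp only: s(2))
    also have "\<dots> = \<one>\<^bsub>G\<^esub>" using xl by simp
    finally show False using S s(1) by simp
  qed
  have zE: "wd (map Edge (e # vs)) \<otimes> X x l = \<zero>"
  proof -
    define z where "z = path_end x (map snd (e # vs))"
    have ls: "set (map snd (e # vs)) \<subseteq> labels" by (rule labels_of_edges[OF sub(2)])
    have zG: "z \<in> carrier G" "z \<noteq> x" unfolding z_def using path_props(1)[OF xl(1) ls] ne[OF _ ls] by auto
    have c: "wd (map Edge (e # vs)) \<in> carrier U" using lsts by (intro wd_closed) auto
    have "wd (map Edge (e # vs)) = \<zero> \<or> wd (map Edge (e # vs)) \<otimes> V z = wd (map Edge (e # vs))"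
      using edges_nonzero_end[OF _ sub(2)] by (simp add: z_def e)
    then show ?thesis
    proof
      assume "wd (map Edge (e # vs)) \<otimes> V z = wd (map Edge (e # vs))"
      then have "wd (map Edge (e # vs)) \<otimes> X x l = wd (map Edge (e # vs)) \<otimes> V z \<otimes> X x l" by simp
      also have "\<dots> = wd (map Edge (e # vs)) \<otimes> (V z \<otimes> X x l)" using c zG xl by (simp add: m_assoc)
      also have "\<dots> = \<zero>" using V_X[OF xl(1) zG(1) xl(2)] zG c by simp
      finally show ?thesis .
    qed (use xl in simp)
  qed
  have "wd (map Edge es) = wd (map Edge us) \<otimes> ((wd (map Edge (e # vs)) \<otimes> X x l) \<otimes> wd (map Edge ws))"
  proof -
    have "map Edge es = map Edge us @ (map Edge (e # vs) @ [Edge (x, l)]) @ map Edge ws" by (simp add: d e)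
    then have "wd (map Edge es) = wd (map Edge us @ (map Edge (e # vs) @ [Edge (x, l)]) @ map Edge ws)" by (rule arg_cong)
    also have "\<dots> = wd (map Edge us) \<otimes> ((wd (map Edge (e # vs)) \<otimes> wd [Edge (x, l)]) \<otimes> wd (map Edge ws))"
      by (rule wd_append4) (use lsts xl in auto)
    finally show ?thesis by (simp only: X_def)
  qed
  then show "wd (map Edge es) = \<zero>" using lsts zE by simp
  have zG: "Y x l \<otimes> wd (map Ghost (vs @ [e])) = \<zero>"
  proof -
    define z where "z = path_end x (map snd (rev (vs @ [e])))"
    have ls: "set (map snd (rev (vs @ [e]))) \<subseteq> labels" by (rule labels_of_edges) (use sub(3) in simp)
    have zG: "z \<in> carrier G" "z \<noteq> x" unfolding z_def using path_props(1)[OF xl(1) ls] ne[OF _ ls] by auto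
    have c: "wd (map Ghost (vs @ [e])) \<in> carrier U" using lsts by (intro wd_closed) auto
    have "wd (map Ghost (vs @ [e])) = \<zero> \<or> V z \<otimes> wd (map Ghost (vs @ [e])) = wd (map Ghost (vs @ [e]))"
      using ghosts_nonzero_end[OF _ sub(3)] by (simp add: z_def e)
    then show ?thesis
    proof
      assume "V z \<otimes> wd (map Ghost (vs @ [e])) = wd (map Ghost (vs @ [e]))"
      then have "Y x l \<otimes> wd (map Ghost (vs @ [e])) = Y x l \<otimes> (V z \<otimes> wd (map Ghost (vs @ [e])))" by simp
      also have "\<dots> = Y x l \<otimes> V z \<otimes> wd (map Ghost (vs @ [e]))" using c zG xl by (simp add: m_assoc)
      also have "\<dots> = \<zero>" using Y_V[OF xl(1) zG(1) xl(2)] zG c by simp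
      finally show ?thesis .
    qed (use xl in simp)
  qed
  have "wd (map Ghost es) = wd (map Ghost us) \<otimes> ((Y x l \<otimes> wd (map Ghost (vs @ [e]))) \<otimes> wd (map Ghost ws))"
  proof -
    have "map Ghost es = map Ghost us @ ([Ghost (x, l)] @ map Ghost (vs @ [e])) @ map Ghost ws" by (simp add: d e)
    then have "wd (map Ghost es) = wd (map Ghost us @ ([Ghost (x, l)] @ map Ghost (vs @ [e])) @ map Ghost ws)" by (rule arg_cong)
    also have "\<dots> = wd (map Ghost us) \<otimes> ((wd [Ghost (x, l)] \<otimes> wd (map Ghost (vs @ [e]))) \<otimes> wd (map Ghost ws))"
      by (rule wd_append4) (use lsts xl in auto)
    finally show ?thesis by (simp only: Y_def)
  qed
  then show "wd (map Ghost es) = \<zero>" using lsts zG by simp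
qed

text \<open>The spanning words consist of edges without repetition, a vertex, and ghosts without
  repetition. Words with a repeated edge or ghost vanish, and only finitely many others can be
  formed from a finite set of edges. The generators are first closed up so that left multiplication
  by them preserves this span.\<close>

lemma finite_span_of_no_cycles:
  assumes S: "\<one>\<^bsub>G\<^esub> \<notin> S" and T: "finite T" "T \<subseteq> gens"
  shows "\<exists>A zs. subring A U \<and> scalars \<subseteq> A \<and> generate_ring U (scalars \<union> (\<lambda>g. wd [g]) ` T) \<subseteq> A \<and>
    set zs \<subseteq> A \<and> A \<subseteq> lspan scalars zs"
proof -
  define E where "E = Edge -` T \<union> Ghost -` T"
  \<comment> \<open>A ghost followed by its edge gives the target vertex, so the targets have to be
    among the vertices; likewise \<open>E\<close> lists an edge as soon as it or its ghost occurs in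
    \<open>T\<close>.\<close>
  define N where "N = Vert -` T \<union> (\<lambda>e. target (fst e) (snd e)) ` E"
  have E: "finite E" unfolding E_def using T(1) by (auto intro!: finite_vimageI injI)
  have N: "finite N" unfolding N_def using T(1) E by (auto intro!: finite_vimageI injI)
  have EG: "E \<subseteq> carrier G \<times> labels"
  proof
    fix e assume e: "e \<in> E"
    obtain x l where xl: "e = (x, l)" by (cases e)
    have "Edge (x, l) \<in> gens \<or> Ghost (x, l) \<in> gens" using e T(2) by (auto simp: E_def xl)
    then show "e \<in> carrier G \<times> labels" by (auto simp: xl)
  qed
  have tE: "target (fst e) (snd e) \<in> carrier G" if "e \<in> E" for e
    using that EG label_closed[of "snd e"] by (auto simp: mem_Times_iff dest!: subsetD)
  have NG: "N \<subseteq> carrier G" unfolding N_def using T(2) tE by (auto dest: subsetD)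
  define T' where "T' = Vert ` N \<union> Edge ` E \<union> Ghost ` E"
  have TT': "T \<subseteq> T'"
  proof
    fix g assume "g \<in> T"
    then show "g \<in> T'" by (cases g) (auto simp: T'_def N_def E_def)
  qed
  have T'g: "T' \<subseteq> gens"
  proof
    fix g assume "g \<in> T'"
    then consider v where "v \<in> N" "g = Vert v" | e where "e \<in> E" "g = Edge e \<or> g = Ghost e" by (auto simp: T'_def)
    then show "g \<in> gens"
    proof cases
      case 2
      then show ?thesis using EG by (cases e) (auto dest!: subsetD)
    qed (use NG in auto)
  qed
  define H where "H = scalars \<union> (\<lambda>g. wd [g]) ` T'"
  have H: "H \<subseteq> carrier U" using T'g by (auto simp: H_def)
  define A where "A = generate_ring U H"
  have A: "subring A U" unfolding A_def by (rule generate_ring_is_subring[OF H])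
  have lst: "map Edge es \<in> lists gens" "map Ghost es \<in> lists gens" if "set es \<subseteq> E" for es
  proof -
    have "Edge ` E \<subseteq> gens" "Ghost ` E \<subseteq> gens" using T'g unfolding T'_def by blast+
    then have "Edge ` set es \<subseteq> gens" "Ghost ` set es \<subseteq> gens" using that by blast+
    then show "map Edge es \<in> lists gens" "map Ghost es \<in> lists gens" by (simp_all only: in_lists_conv_set set_map) blast+
  qed
  \<comment> \<open>A vertex is always present in the middle. An edge is then the case
    \<open>zz [e] (target x l) []\<close> and a ghost the case
    \<open>zz [] (target x l) [e]\<close>.\<close>
  define zz where "zz es y fs = wd (map Edge es @ Vert y # map Ghost fs)" for es y fs
  have zz: "zz es y fs = wd (map Edge es) \<otimes> (V y \<otimes> wd (map Ghost fs))"
    if "set es \<subseteq> E" "y \<in> N" "set fs \<subseteq> E" for es y fs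
  proof -
    have y: "Vert y \<in> gens" using that(2) NG by auto
    show ?thesis
      unfolding zz_def V_def using lst(1)[OF that(1)] lst(2)[OF that(3)] y
      by (simp only: wd_append wd_Cons[of _ "map Ghost fs"] in_lists_conv_set[symmetric] Cons_in_lists_iff simp_thms)
  qed
  define Ds where "Ds = {es. set es \<subseteq> E \<and> distinct es}"
  have Ds: "finite Ds" unfolding Ds_def by (rule finite_subset_distinct[OF E])
  define Z where "Z = (\<lambda>(es, y, fs). zz es y fs) ` (Ds \<times> N \<times> Ds)"
  \<comment> \<open>The empty word is not of the form \<open>zz\<close>, so the unit is listed
    separately.\<close>
  have Zfin: "finite (insert \<one> Z)" using Ds N by (simp add: Z_def)
  have zmem: "zz es y fs \<in> Z \<or> zz es y fs = \<zero>" if "set es \<subseteq> E" "y \<in> N" "set fs \<subseteq> E" for es y fs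
  proof (cases "distinct es \<and> distinct fs")
    case True
    then have "(es, y, fs) \<in> Ds \<times> N \<times> Ds" using that by (simp add: Ds_def)
    then show ?thesis unfolding Z_def by force
  next
    case False
    have c: "wd (map Edge es) \<in> carrier U" "wd (map Ghost fs) \<in> carrier U" "V y \<in> carrier U"
      using lst[OF that(1)] lst[OF that(3)] that NG by auto
    have "wd (map Edge es) = \<zero> \<or> wd (map Ghost fs) = \<zero>"
      using False repeated_edges_zero[OF S] that EG by (metis subset_trans)
    then show ?thesis using zz[OF that] c by auto
  qed
  obtain zs where zs: "set zs = insert \<one> Z" using finite_list[OF Zfin] by blast
  have wdA: "wd w \<in> A" if "set w \<subseteq> T'" for w
    using that
  proof (induction w)
    case Nil
    then show ?case by (simp add: wd_Nil A_def generate_ring.one)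
  next
    case (Cons g w)
    then have "g \<in> gens" "w \<in> lists gens" "wd w \<in> A" "wd [g] \<in> A" using T'g
      by (auto simp: A_def H_def intro: generate_ring.incl)
    then show ?case unfolding A_def by (simp only: wd_Cons generate_ring.eng_mult)
  qed
  have ZA: "Z \<subseteq> A"
  proof
    fix z assume "z \<in> Z"
    then obtain es y fs where z: "z = zz es y fs" "set es \<subseteq> E" "y \<in> N" "set fs \<subseteq> E"
      by (auto simp: Z_def Ds_def)
    have "Edge ` set es \<subseteq> T'" "Ghost ` set fs \<subseteq> T'" "Vert y \<in> T'" unfolding T'_def using z by blast+
    then show "z \<in> A" unfolding z(1) zz_def by (intro wdA) simp
  qed
  have zsA: "set zs \<subseteq> A" using ZA subringE(3)[OF A] by (simp add: zs)
  have zsU: "set zs \<subseteq> carrier U" using zsA subringE(1)[OF A] by auto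
  define W where "W = lspan scalars zs"
  note sp = lspan_closed[OF scalars_subring zsU] lspan_zero[OF scalars_subring zsU] lspan_add[OF scalars_subring zsU]
    lspan_smult[OF scalars_subring zsU] lspan_minus[OF scalars_subring zsU] lspan_incl[OF scalars_subring zsU]
  have ZW: "zz es y fs \<in> W" if "set es \<subseteq> E" "y \<in> N" "set fs \<subseteq> E" for es y fs
    using zmem[OF that] sp(2,6) zs by (auto simp: W_def)
  \<comment> \<open>An edge lengthens the list of edges. A ghost cancels against the first edge or
    kills the word, and if there is no edge it lengthens the list of ghosts or kills the word. A
    vertex fixes the word or kills it. Repetitions that arise are covered by \<open>ZW\<close>, as
    such words are zero.\<close>
  have gen_stab: "wd [g] \<otimes> w \<in> W" if g: "g \<in> T'" and w: "w \<in> W" for g w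
  proof -
    have gc: "wd [g] \<in> carrier U" using g T'g by auto
    define W' where "W' = {u \<in> carrier U. wd [g] \<otimes> u \<in> W}"
    have "submod scalars W'"
      unfolding submod_def[OF scalars_subring]
    proof (intro conjI ballI)
      fix k u assume k: "k \<in> scalars" and u: "u \<in> W'"
      have c: "k \<in> carrier U" "u \<in> carrier U" "wd [g] \<otimes> u \<in> W" using k u by (auto simp: W'_def)
      have "wd [g] \<otimes> (k \<otimes> u) = wd [g] \<otimes> k \<otimes> u" using c gc by (simp add: m_assoc)
      also have "\<dots> = k \<otimes> (wd [g] \<otimes> u)" using c gc by (simp add: scalars_central[OF k gc, symmetric] m_assoc)
      finally show "k \<otimes> u \<in> W'" using c sp(4)[OF k] by (simp add: W'_def W_def)
    qed (use gc sp(2,3) in \<open>auto simp: W'_def W_def r_distr\<close>)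
    moreover have "set zs \<subseteq> W'"
    proof
      fix u assume u: "u \<in> set zs"
      have uc: "u \<in> carrier U" using u zsU by auto
      have "wd [g] \<otimes> u \<in> W"
      proof (cases "u = \<one>")
        case True
        consider v where "v \<in> N" "g = Vert v" | e where "e \<in> E" "g = Edge e" | e where "e \<in> E" "g = Ghost e"
          using g by (auto simp: T'_def)
        then have "wd [g] \<in> W"
        proof cases
          case 1
          then show ?thesis using ZW[of "[]" v "[]"] by (simp add: zz_def)
        next
          case 2
          obtain x l where e: "e = (x, l)" by (cases e)
          have xl: "x \<in> carrier G" "l \<in> labels" "target x l \<in> N" using 2 EG e by (force simp: N_def)+
          have "zz [e] (target x l) [] = X x l \<otimes> V (target x l)"
            using zz[of "[e]" "target x l" "[]"] 2 xl NG by (auto simp: X_def e wd_Nil)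
          then have "zz [e] (target x l) [] = wd [g]" using edge_relations(2)[OF xl(1,2)] by (simp add: 2 e X_def)
          then show ?thesis using ZW[of "[e]" "target x l" "[]"] 2 xl by simp
        next
          case 3
          obtain x l where e: "e = (x, l)" by (cases e)
          have xl: "x \<in> carrier G" "l \<in> labels" "target x l \<in> N" using 3 EG e by (force simp: N_def)+
          have "zz [] (target x l) [e] = V (target x l) \<otimes> Y x l"
            using zz[of "[]" "target x l" "[e]"] 3 xl NG by (auto simp: Y_def e wd_Nil)
          then have "zz [] (target x l) [e] = wd [g]" using edge_relations(3)[OF xl(1,2)] by (simp add: 3 e Y_def)
          then show ?thesis using ZW[of "[]" "target x l" "[e]"] 3 xl by simp
        qed
        then show ?thesis using True gc by simp
      next
        case False
        then obtain es y fs where ey: "set es \<subseteq> E" "y \<in> N" "set fs \<subseteq> E" and ueq: "u = zz es y fs"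
          using u by (auto simp: zs Z_def Ds_def)
        have yG: "y \<in> carrier G" using ey NG by auto
        have c: "wd (map Edge es) \<in> carrier U" "wd (map Ghost fs) \<in> carrier U" "V y \<in> carrier U" "V y \<otimes> wd (map Ghost fs) \<in> carrier U"
          using lst[OF ey(1)] lst[OF ey(3)] yG by auto
        have 0: "\<zero> \<in> W" using sp(2) by (simp add: W_def)
        have vert: "V v \<otimes> zz es y fs \<in> W" if v: "v \<in> carrier G" and es: "set es \<subseteq> E" for v es
        proof (cases es)
          case Nil
          have "zz [] y fs = V y \<otimes> wd (map Ghost fs)" using zz[of "[]" y fs] ey c by (simp add: wd_Nil)
          then have "V v \<otimes> zz es y fs = (V v \<otimes> V y) \<otimes> wd (map Ghost fs)" using c v Nil by (simp add: m_assoc)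
          then have "V v \<otimes> zz es y fs = zz es y fs \<or> V v \<otimes> zz es y fs = \<zero>"
            using V_V[OF v yG] c Nil \<open>zz [] y fs = V y \<otimes> wd (map Ghost fs)\<close> by auto
          then show ?thesis using ZW[OF es ey(2,3)] 0 by auto
        next
          case (Cons e es')
          obtain x l where e: "e = (x, l)" by (cases e)
          have xl: "x \<in> carrier G" "l \<in> labels" using es EG Cons e by auto
          have c': "wd (map Edge es') \<in> carrier U" using lst[of es'] es Cons by auto
          have "wd (map Edge es) = X x l \<otimes> wd (map Edge es')"
            using wd_Cons[of "Edge (x, l)" "map Edge es'"] lst[of es'] es Cons xl by (simp add: e X_def)
          then have z: "zz es y fs = X x l \<otimes> (wd (map Edge es') \<otimes> (V y \<otimes> wd (map Ghost fs)))"
            using zz[OF es ey(2,3)] c c' xl by (simp add: m_assoc)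
          have "V v \<otimes> zz es y fs = (V v \<otimes> X x l) \<otimes> (wd (map Edge es') \<otimes> (V y \<otimes> wd (map Ghost fs)))"
            unfolding z using c c' xl v by (simp add: m_assoc)
          then have "V v \<otimes> zz es y fs = zz es y fs \<or> V v \<otimes> zz es y fs = \<zero>"
            unfolding V_X[OF xl(1) v xl(2)] using z c c' by (auto split: if_splits)
          then show ?thesis using ZW[OF es ey(2,3)] 0 by auto
        qed
        consider v where "v \<in> N" "g = Vert v" | e where "e \<in> E" "g = Edge e" | e where "e \<in> E" "g = Ghost e"
          using g by (auto simp: T'_def)
        then show ?thesis
        proof cases
          case 1
          then show ?thesis using vert[OF _ ey(1), of v] NG by (auto simp: ueq V_def)
        next
          case 2
          have "map Edge es @ Vert y # map Ghost fs \<in> lists gens" using lst[OF ey(1)] lst[OF ey(3)] yG by simp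
          then have "wd [g] \<otimes> zz es y fs = zz (e # es) y fs"
            using wd_Cons[of g "map Edge es @ Vert y # map Ghost fs"] subsetD[OF T'g g] by (simp add: zz_def 2)
          then show ?thesis using ZW[of "e # es" y fs] ey 2 by (simp add: ueq)
        next
          case 3
          obtain x l where e: "e = (x, l)" by (cases e)
          have xl: "x \<in> carrier G" "l \<in> labels" "target x l \<in> N" "target x l \<in> carrier G"
            using 3 EG e tE by (force simp: N_def)+
          have Yg: "wd [g] = Y x l" using 3 e by (simp add: Y_def)
          show ?thesis
          proof (cases es)
            case Nil
            have "zz [] y fs = V y \<otimes> wd (map Ghost fs)" using zz[of "[]" y fs] ey c by (simp add: wd_Nil)
            then have "wd [g] \<otimes> u = (Y x l \<otimes> V y) \<otimes> wd (map Ghost fs)"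
              using c xl Nil by (simp add: Yg ueq m_assoc)
            also have "\<dots> = (if x = y then zz [] (target x l) (e # fs) else \<zero>)"
            proof (cases "x = y")
              case True
              have "zz [] (target x l) (e # fs) = V (target x l) \<otimes> (Y x l \<otimes> wd (map Ghost fs))"
                using zz[of "[]" "target x l" "e # fs"] ey 3 xl wd_Cons[of "Ghost e" "map Ghost fs"] lst[OF ey(3)] c
                by (simp add: wd_Nil e Y_def)
              also have "\<dots> = Y x l \<otimes> wd (map Ghost fs)"
                using edge_relations(3)[OF xl(1,2)] xl c by (simp add: m_assoc[symmetric])
              finally show ?thesis using True Y_V[OF xl(1) yG xl(2)] by simp
            next
              case False
              then show ?thesis using Y_V[OF xl(1) yG xl(2)] c by simp
            qed
            also have "\<dots> \<in> W" using ZW[of "[]" "target x l" "e # fs"] ey 3 xl 0 by (cases "x = y") simp_all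
            finally show ?thesis .
          next
            case (Cons e' es')
            obtain x' l' where e': "e' = (x', l')" by (cases e')
            have es': "set es' \<subseteq> E" "e' \<in> E" using ey(1) Cons by simp_all
            have "(x', l') \<in> carrier G \<times> labels" using subsetD[OF EG es'(2)] by (simp only: e')
            then have xl': "x' \<in> carrier G" "l' \<in> labels" by simp_all
            have c': "wd (map Edge es') \<in> carrier U" by (rule wd_closed[OF lst(1)[OF es'(1)]])
            note zz' = zz[OF es'(1) ey(2,3)]
            have cz: "zz es' y fs \<in> carrier U" unfolding zz' using c c' by simp
            have "wd (map Edge es) = X x' l' \<otimes> wd (map Edge es')"
              using wd_Cons[of "Edge (x', l')" "map Edge es'"] lst(1)[OF es'(1)] xl' by (simp add: Cons e' X_def)
            then have "u = X x' l' \<otimes> zz es' y fs"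
              unfolding ueq zz[OF ey] zz' using c c' xl' by (simp add: m_assoc)
            then have "wd [g] \<otimes> u = (Y x l \<otimes> X x' l') \<otimes> zz es' y fs"
              using cz xl xl' by (simp add: Yg m_assoc)
            moreover have "(Y x l \<otimes> X x' l') \<otimes> zz es' y fs \<in> W"
            proof (cases "x = x' \<and> l = l'")
              case True
              then show ?thesis using vert[OF xl(4) es'(1)] Y_X[OF xl(1,2) xl'] by simp
            next
              case False
              then have "Y x l \<otimes> X x' l' = \<zero>" using Y_X[OF xl(1,2) xl'] by (simp only: if_False)
              then show ?thesis using cz 0 by simp
            qed
            ultimately show ?thesis by (simp only:)
          qed
        qed
      qed
      then show "u \<in> W'" using uc by (simp add: W'_def)
    qed
    ultimately have "w \<in> W'" using w unfolding W_def by (rule lspan_induct_submod[OF scalars_subring zsU])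
    then show ?thesis by (simp only: W'_def mem_Collect_eq)
  qed
  have stable: "d \<otimes> \<one> \<in> W" if "d \<in> A" for d
  proof (rule generate_ring_stable[OF H _ _ _ _ that[unfolded A_def]])
    show "W \<subseteq> carrier U" using sp(1) by (auto simp: W_def)
    show "h \<otimes> w \<in> W" if h: "h \<in> H" and w: "w \<in> W" for h w
    proof -
      consider "h \<in> scalars" | g where "g \<in> T'" "h = wd [g]" using h unfolding H_def by blast
      then show ?thesis
      proof cases
        case 1
        then show ?thesis using sp(4)[OF 1, of w] w by (simp only: W_def)
      next
        case 2
        then show ?thesis using gen_stab[OF 2(1) w] by (simp only:)
      qed
    qed
    show "\<one> \<in> W" using sp(6) zs by (simp add: W_def)
    show "w \<oplus> w' \<in> W" if "w \<in> W" "w' \<in> W" for w w'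
      using sp(3)[of w w'] that unfolding W_def by simp
    show "\<ominus> w \<in> W" if "w \<in> W" for w
      using sp(5)[of w] that unfolding W_def by simp
  qed
  have AW: "A \<subseteq> W"
  proof
    fix d assume d: "d \<in> A"
    then have "d \<in> carrier U" using subsetD[OF subringE(1)[OF A]] by blast
    then show "d \<in> W" using stable[OF d] by simp
  qed
  have "scalars \<subseteq> A" unfolding A_def H_def by (rule subsetI, rule generate_ring.incl, rule UnI1)
  moreover have "generate_ring U (scalars \<union> (\<lambda>g. wd [g]) ` T) \<subseteq> A"
    unfolding A_def by (rule mono_generate_ring[OF _ H]) (unfold H_def, rule Un_mono[OF order_refl image_mono[OF TT']])
  ultimately show ?thesis using A zsA AW unfolding W_def by (intro exI[of _ A] exI[of _ zs] conjI)
qed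

text \<open>The four elements lie in a common finite-dimensional subalgebra, which may contain the
  unit of \<open>U\<close>. The correction has the form \<open>y z\<close> with \<open>y\<close> in
  \<open>L\<close> and so lies in \<open>L\<close>.\<close>

theorem stable_range_1_of_no_cycles:
  assumes S: "\<one>\<^bsub>G\<^esub> \<notin> S"
  shows "stable_range U L 1"
proof (rule stable_range_1I)
  fix a b x y
  assume a: "a \<in> carrier U" "a \<ominus> \<one> \<in> L" "b \<in> L" and x: "x \<in> carrier U" "x \<ominus> \<one> \<in> L" "y \<in> L"
    and eq: "a \<otimes> x \<oplus> b \<otimes> y = \<one>"
  have c: "b \<in> carrier U" "y \<in> carrier U" using a x a_subset by auto
  let ?gr = "\<lambda>T. generate_ring U (scalars \<union> (\<lambda>g. wd [g]) ` T)"
  obtain Ta Tb Tx Ty where Ts: "finite Ta" "Ta \<subseteq> gens" "a \<in> ?gr Ta" "finite Tb" "Tb \<subseteq> gens" "b \<in> ?gr Tb"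
    "finite Tx" "Tx \<subseteq> gens" "x \<in> ?gr Tx" "finite Ty" "Ty \<subseteq> gens" "y \<in> ?gr Ty"
    using finitely_generated[OF a(1)] finitely_generated[OF c(1)] finitely_generated[OF x(1)] finitely_generated[OF c(2)]
    by blast
  define T where "T = Ta \<union> Tb \<union> Tx \<union> Ty"
  have T: "finite T" "T \<subseteq> gens" using Ts by (auto simp: T_def)
  obtain A zs where A: "subring A U" "scalars \<subseteq> A" "?gr T \<subseteq> A" "set zs \<subseteq> A" "A \<subseteq> lspan scalars zs"
    using finite_span_of_no_cycles[OF S T] by blast
  have sub: "scalars \<union> (\<lambda>g. wd [g]) ` T \<subseteq> carrier U" using T by auto
  have mono: "?gr T' \<subseteq> A" if "T' \<subseteq> T" for T'
  proof -
    have "?gr T' \<subseteq> ?gr T" by (rule mono_generate_ring[OF _ sub]) (use that in auto)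
    then show ?thesis using A(3) by blast
  qed
  have mem: "a \<in> A" "b \<in> A" "x \<in> A" "y \<in> A"
    using Ts mono[of Ta] mono[of Tb] mono[of Tx] mono[of Ty] by (auto simp: T_def)
  obtain z w where zw: "z \<in> A" "w \<in> A" "(a \<oplus> b \<otimes> (y \<otimes> z)) \<otimes> w = \<one>"
    using right_invertible_translate_subring[OF A(1) scalars_subring A(2) scalars_inv scalars_central A(4,5) mem eq] by blast
  have AU: "z \<in> carrier U" "w \<in> carrier U" using zw subringE(1)[OF A(1)] by auto
  have "y \<otimes> z \<in> L" using I_r_closed[OF x(3) AU(1)] .
  then show "\<exists>r\<in>L. \<exists>w\<in>carrier U. (a \<oplus> b \<otimes> r) \<otimes> w = \<one>" using zw AU by blast
qed

end

section \<open>Central corners and the upper bound for a single label\<close>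

context ring
begin

text \<open>Meant for central idempotents, for which the condition \<open>p u = u\<close> already
  describes the two-sided corner. Addition and multiplication are inherited, and the unit becomes
  \<open>p\<close>.\<close>

definition corner :: "'a \<Rightarrow> ('a, 'b) ring_scheme"
  where "corner p = R\<lparr>carrier := {u \<in> carrier R. p \<otimes> u = u}, one := p\<rparr>"

lemma corner_simps:
  "carrier (corner p) = {u \<in> carrier R. p \<otimes> u = u}" "\<one>\<^bsub>corner p\<^esub> = p" "\<zero>\<^bsub>corner p\<^esub> = \<zero>"
  "u \<otimes>\<^bsub>corner p\<^esub> v = u \<otimes> v" "u \<oplus>\<^bsub>corner p\<^esub> v = u \<oplus> v"
  by (simp_all add: corner_def)

context
  fixes p
  assumes p: "p \<in> carrier R" "p \<otimes> p = p" "\<And>u. u \<in> carrier R \<Longrightarrow> p \<otimes> u = u \<otimes> p"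
begin

lemma corner_ring: "ring (corner p)"
proof (rule ringI)
  show "abelian_group (corner p)"
  proof (rule abelian_groupI)
    fix u assume "u \<in> carrier (corner p)"
    then show "\<exists>v\<in>carrier (corner p). v \<oplus>\<^bsub>corner p\<^esub> u = \<zero>\<^bsub>corner p\<^esub>"
      using p(1) by (intro bexI[of _ "\<ominus> u"]) (simp_all add: corner_simps r_minus l_neg)
  qed (use p(1) in \<open>simp_all add: corner_simps r_distr a_ac\<close>)
  show "monoid (corner p)"
  proof (rule monoidI)
    fix u v assume "u \<in> carrier (corner p)" "v \<in> carrier (corner p)"
    then show "u \<otimes>\<^bsub>corner p\<^esub> v \<in> carrier (corner p)"
      using p(1) by (simp add: corner_simps m_assoc[symmetric])
  next
    fix u assume "u \<in> carrier (corner p)"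
    then show "u \<otimes>\<^bsub>corner p\<^esub> \<one>\<^bsub>corner p\<^esub> = u"
      using p(3)[of u] by (simp add: corner_simps)
  qed (use p(1,2) in \<open>simp_all add: corner_simps m_assoc\<close>)
qed (simp_all add: corner_simps l_distr r_distr)

lemma corner_minus:
  assumes "u \<in> carrier (corner p)"
  shows "\<ominus>\<^bsub>corner p\<^esub> u = \<ominus> u"
proof -
  interpret C: ring "corner p" by (rule corner_ring)
  show ?thesis
    by (rule C.minus_equality) (use assms p(1) in \<open>simp_all add: corner_simps r_minus l_neg\<close>)
qed

end

end

text \<open>A closed path of length \<open>n\<close> at \<open>1\<close> says
  \<open>c^n = 1\<close>, and then every element of \<open>S\<close> is one of
  \<open>c^0, ..., c^(n-1)\<close>.\<close>

lemma (in hopf_leavitt) one_label_finite_order: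
  assumes lab: "labels = {l}" and one: "\<one>\<^bsub>G\<^esub> \<in> S"
  shows "\<exists>n>0. fst l [^]\<^bsub>G\<^esub> (n::nat) = \<one>\<^bsub>G\<^esub> \<and> finite S"
proof -
  have c: "fst l \<in> carrier G" using label_closed lab by simp
  have pe: "path_end x ls = x \<otimes>\<^bsub>G\<^esub> fst l [^]\<^bsub>G\<^esub> length ls" if "x \<in> carrier G" "set ls \<subseteq> labels" for x ls
    using that
  proof (induction ls arbitrary: x)
    case (Cons m ls)
    then have "m = l" using lab by simp
    then show ?case using Cons c G.nat_pow_Suc2[OF c, of "length ls"] by (simp add: G.m_assoc del: G.nat_pow_Suc)
  qed simp
  obtain ls where ls: "ls \<noteq> []" "set ls \<subseteq> labels" "path_end \<one>\<^bsub>G\<^esub> ls = \<one>\<^bsub>G\<^esub> \<otimes>\<^bsub>G\<^esub> \<one>\<^bsub>G\<^esub>"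
    using S_path[OF one G.one_closed] by blast
  define n where "n = length ls"
  have n: "n > 0" "fst l [^]\<^bsub>G\<^esub> n = \<one>\<^bsub>G\<^esub>"
    using ls pe[OF G.one_closed ls(2)] c by (simp_all add: n_def)
  have "s \<in> (\<lambda>k. fst l [^]\<^bsub>G\<^esub> k) ` {..<n}" if s: "s \<in> S" for s
  proof -
    obtain ms where ms: "set ms \<subseteq> labels" "path_end \<one>\<^bsub>G\<^esub> ms = \<one>\<^bsub>G\<^esub> \<otimes>\<^bsub>G\<^esub> s"
      using S_path[OF s G.one_closed] by blast
    then have "s = fst l [^]\<^bsub>G\<^esub> length ms" using pe[OF G.one_closed ms(1)] c S_closed[OF s] by simp
    also have "\<dots> = (fst l [^]\<^bsub>G\<^esub> n) [^]\<^bsub>G\<^esub> (length ms div n) \<otimes>\<^bsub>G\<^esub> fst l [^]\<^bsub>G\<^esub> (length ms mod n)"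
      using c by (simp add: G.nat_pow_pow G.nat_pow_mult)
    also have "\<dots> = fst l [^]\<^bsub>G\<^esub> (length ms mod n)" using c n by simp
    finally show ?thesis using n(1) by auto
  qed
  then have "finite S" by (meson finite_imageI finite_lessThan finite_subset subsetI)
  then show ?thesis using n by blast
qed

text \<open>\<open>A\<close> is a finite union of left cosets of the subgroup generated by
  \<open>c\<close>, that is, of cycles of the graph. The exponent \<open>n\<close> may be a proper
  multiple of the order of \<open>c\<close>.\<close>

locale one_label_corner = hopf_leavitt +
  fixes l and n :: nat and A
  assumes labels: "labels = {l}" and n: "n > 0" "fst l [^]\<^bsub>G\<^esub> n = \<one>\<^bsub>G\<^esub>"
    and A: "finite A" "A \<subseteq> carrier G" "\<And>x. x \<in> carrier G \<Longrightarrow> target x l \<in> A \<longleftrightarrow> x \<in> A"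
begin

abbreviation c where "c \<equiv> fst l"

definition p where "p = unit_on A"
definition t where "t = (\<Oplus>x\<in>A. X x l)"
definition t' where "t' = (\<Oplus>x\<in>A. Y x l)"

lemma l: "l \<in> labels" using labels by simp
lemma cG [simp]: "c \<in> carrier G" using label_closed[OF l] .
lemma AG: "x \<in> A \<Longrightarrow> x \<in> carrier G" using A(2) by blast
lemma A_target: "x \<in> A \<Longrightarrow> target x l \<in> A" using A(3) AG by blast

lemma A_source:
  assumes "x \<in> A"
  obtains y where "y \<in> A" "x = target y l"
proof (rule that[of "x \<otimes>\<^bsub>G\<^esub> inv\<^bsub>G\<^esub> c"])
  show "x = target (x \<otimes>\<^bsub>G\<^esub> inv\<^bsub>G\<^esub> c) l" using AG[OF assms] by (simp add: G.m_assoc)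
  then show "x \<otimes>\<^bsub>G\<^esub> inv\<^bsub>G\<^esub> c \<in> A" using A(3)[of "x \<otimes>\<^bsub>G\<^esub> inv\<^bsub>G\<^esub> c"] AG[OF assms] assms by simp
qed

lemma p_in_L: "p \<in> L" unfolding p_def by (rule unit_on_in_L[OF A(1,2)])
lemma p_closed [simp]: "p \<in> carrier U" using p_in_L a_subset by blast
lemma p_idem: "p \<otimes> p = p" unfolding p_def by (rule unit_on_idem[OF A(1,2)])

lemma p_central: "u \<in> carrier U \<Longrightarrow> p \<otimes> u = u \<otimes> p"
  unfolding p_def by (rule unit_on_central[OF A(1,2)]) (use A(3) labels in auto)

lemma p_V: "x \<in> A \<Longrightarrow> p \<otimes> V x = V x" "x \<in> A \<Longrightarrow> V x \<otimes> p = V x"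
  unfolding p_def using unit_on_V[OF A(1,2) AG] by simp_all

lemma t_in_L: "t \<in> L" "t' \<in> L"
  unfolding t_def t'_def using VXY_in_L(2,3)[OF _ l] AG by (simp_all add: finsum_in_ideal[OF A(1)])

lemma t_closed [simp]: "t \<in> carrier U" "t' \<in> carrier U"
  using t_in_L a_subset by blast+

lemma VXY_A [simp]:
  "x \<in> A \<Longrightarrow> V x \<in> carrier U" "x \<in> A \<Longrightarrow> X x l \<in> carrier U" "x \<in> A \<Longrightarrow> Y x l \<in> carrier U"
  "x \<in> A \<Longrightarrow> target x l \<in> carrier G" "x \<in> A \<Longrightarrow> V (target x l) \<in> carrier U"
  using AG l by simp_all

lemma V_t: "x \<in> A \<Longrightarrow> V x \<otimes> t = X x l"
proof -
  assume x: "x \<in> A"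
  have "(\<Oplus>y\<in>{x}. V y) \<otimes> t = (\<Oplus>y\<in>{x} \<inter> A. V y \<otimes> X y l)"
    unfolding t_def by (rule finsum_mult_orthogonal) (use x A(1) V_X[OF AG AG l] in auto)
  then show ?thesis using x V_X[OF AG AG l] by simp
qed

lemma t_V: "x \<in> A \<Longrightarrow> t \<otimes> V (target x l) = X x l"
proof -
  assume x: "x \<in> A"
  have "t \<otimes> (\<Oplus>y\<in>{x}. V (target y l)) = (\<Oplus>y\<in>A \<inter> {x}. X y l \<otimes> V (target y l))"
    unfolding t_def by (rule finsum_mult_orthogonal) (use x A(1) X_V[OF AG _ l] AG in auto)
  then show ?thesis using x X_V[OF AG _ l] by simp
qed

lemma V_t': "x \<in> A \<Longrightarrow> V (target x l) \<otimes> t' = Y x l"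
proof -
  assume x: "x \<in> A"
  have "(\<Oplus>y\<in>{x}. V (target y l)) \<otimes> t' = (\<Oplus>y\<in>{x} \<inter> A. V (target y l) \<otimes> Y y l)"
    unfolding t'_def by (rule finsum_mult_orthogonal) (use x A(1) V_Y[OF AG _ l] AG in auto)
  then show ?thesis using x V_Y[OF AG _ l] by simp
qed

lemma t'_V: "x \<in> A \<Longrightarrow> t' \<otimes> V x = Y x l"
proof -
  assume x: "x \<in> A"
  have "t' \<otimes> (\<Oplus>y\<in>{x}. V y) = (\<Oplus>y\<in>A \<inter> {x}. Y y l \<otimes> V y)"
    unfolding t'_def by (rule finsum_mult_orthogonal) (use x A(1) Y_V[OF AG AG l] in auto)
  then show ?thesis using x Y_V[OF AG AG l] by simp
qed

lemma p_t: "p \<otimes> t = t" "p \<otimes> t' = t'"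
proof -
  have "p \<otimes> t = (\<Oplus>x\<in>A \<inter> A. V x \<otimes> X x l)"
    unfolding p_def unit_on_def t_def by (rule finsum_mult_orthogonal) (use A(1) V_X[OF AG AG l] in auto)
  also have "\<dots> = t" unfolding t_def by (rule finsum_cong') (use V_X[OF AG AG l] in auto)
  finally show "p \<otimes> t = t" .
  have "t' \<otimes> p = (\<Oplus>x\<in>A \<inter> A. Y x l \<otimes> V x)"
    unfolding p_def unit_on_def t'_def by (rule finsum_mult_orthogonal) (use A(1) Y_V[OF AG AG l] in auto)
  also have "\<dots> = t'" unfolding t'_def by (rule finsum_cong') (use Y_V[OF AG AG l] in auto)
  finally show "p \<otimes> t' = t'" using p_central[of t'] by simp
qed

lemma t_t': "t \<otimes> t' = p"
proof -
  have XY: "X x l \<otimes> Y y l = (if x = y then V x else \<zero>)" if "x \<in> A" "y \<in> A" for x y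
  proof -
    have "X x l \<otimes> Y y l = (X x l \<otimes> V (target x l)) \<otimes> Y y l" using that edge_relations(2)[OF AG l] by simp
    also have "\<dots> = X x l \<otimes> (V (target x l) \<otimes> Y y l)" using that by (simp add: m_assoc)
    also have "\<dots> = (if x = y then X x l \<otimes> Y x l else \<zero>)"
      using that V_Y[OF AG[OF that(2)] _ l, of "target x l"] AG by simp
    \<comment> \<open>With a single label the sum relation at a vertex has one term. This is what
      makes \<open>t\<close> invertible in the corner from both sides.\<close>
    also have "X x l \<otimes> Y x l = V x" using V_eq_sum[OF AG[OF that(1)]] that by (simp add: labels)
    finally show ?thesis .
  qed
  have "t \<otimes> t' = (\<Oplus>x\<in>A \<inter> A. X x l \<otimes> Y x l)"
    unfolding t_def t'_def by (rule finsum_mult_orthogonal) (use A(1) XY in auto)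
  also have "\<dots> = p" unfolding p_def unit_on_def by (rule finsum_cong') (use XY in auto)
  finally show ?thesis .
qed

lemma t'_t: "t' \<otimes> t = p"
proof -
  have "t' \<otimes> t = (\<Oplus>x\<in>A \<inter> A. Y x l \<otimes> X x l)"
    unfolding t_def t'_def by (rule finsum_mult_orthogonal) (use A(1) Y_X[OF AG l AG l] in auto)
  also have "\<dots> = (\<Oplus>x\<in>A. V (target x l))" by (rule finsum_cong') (use Y_X[OF AG l AG l] in auto)
  also have "\<dots> = (\<Oplus>x\<in>(\<lambda>x. target x l) ` A. V x)"
    by (rule add.finprod_reindex[symmetric]) (use AG in \<open>auto simp: inj_on_def\<close>)
  also have "(\<lambda>x. target x l) ` A = A"
    using A_target A_source by blast
  finally show ?thesis by (simp add: p_def unit_on_def)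
qed

text \<open>The integer power of \<open>t\<close> inside the corner. It is built by iteration on
  \<open>p\<close>, as the power function of \<open>U\<close> would start at
  \<open>1\<close>.\<close>

definition P :: "int \<Rightarrow> _"
  where "P i = (if i \<ge> 0 then ((\<otimes>) t ^^ nat i) p else ((\<otimes>) t' ^^ nat (- i)) p)"

lemma P_0: "P 0 = p" by (simp add: P_def)

lemma P_in_L: "P i \<in> L"
proof -
  have "((\<otimes>) u ^^ k) p \<in> L" if "u \<in> L" for u k
    using that a_subset p_in_L I_l_closed by (induction k) auto
  then show ?thesis using t_in_L by (simp add: P_def)
qed

lemma P_closed [simp]: "P i \<in> carrier U" using P_in_L a_subset by blast

lemma p_funpow:
  assumes "p \<otimes> u = u" "u \<in> carrier U"
  shows "((\<otimes>) u ^^ k) p \<in> carrier U" "p \<otimes> ((\<otimes>) u ^^ k) p = ((\<otimes>) u ^^ k) p"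
proof -
  show c: "((\<otimes>) u ^^ k) p \<in> carrier U" for k using assms by (induction k) simp_all
  show "p \<otimes> ((\<otimes>) u ^^ k) p = ((\<otimes>) u ^^ k) p"
    using assms by (cases k) (simp_all add: p_idem c m_assoc[symmetric])
qed

lemma p_P: "p \<otimes> P i = P i"
  using p_funpow(2)[OF p_t(1)] p_funpow(2)[OF p_t(2)] by (simp add: P_def)

lemma P_p: "P i \<otimes> p = P i" using p_P p_central[of "P i"] by simp

lemma P_succ: "P (i + 1) = t \<otimes> P i"
proof (cases "i \<ge> 0")
  case True
  then show ?thesis by (simp add: P_def nat_add_distrib)
next
  case False
  define k where "k = nat (- i - 1)"
  have k: "nat (- i) = Suc k" "nat (- (i + 1)) = k" using False by (auto simp: k_def)
  have "t \<otimes> (t' \<otimes> ((\<otimes>) t' ^^ k) p) = ((\<otimes>) t' ^^ k) p"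
    using p_funpow[OF p_t(2), of k] by (simp add: m_assoc[symmetric] t_t')
  moreover have "P (i + 1) = ((\<otimes>) t' ^^ k) p"
    using False k by (cases "i = -1") (auto simp: P_def)
  ultimately show ?thesis using False k(1) by (simp add: P_def)
qed

lemma P_pred: "P (i - 1) = t' \<otimes> P i"
proof -
  have "t' \<otimes> P i = t' \<otimes> t \<otimes> P (i - 1)" using P_succ[of "i - 1"] by (simp add: m_assoc)
  then show ?thesis by (simp add: t'_t p_P)
qed

lemma P_add: "P (i + j) = P i \<otimes> P j"
proof (induction i rule: int_induct[where k = 0])
  case base
  then show ?case by (simp add: P_0 p_P)
next
  case (step1 i)
  have "P (i + 1 + j) = t \<otimes> P (i + j)" using P_succ[of "i + j"] by (simp add: algebra_simps)
  then show ?case using step1 by (simp add: P_succ m_assoc)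
next
  case (step2 i)
  have "P (i - 1 + j) = t' \<otimes> P (i + j)" using P_pred[of "i + j"] by (simp add: algebra_simps)
  then show ?case using step2 by (simp add: P_pred m_assoc)
qed

lemma A_pow: "x \<in> A \<Longrightarrow> x \<otimes>\<^bsub>G\<^esub> c [^]\<^bsub>G\<^esub> (i::int) \<in> A"
proof (induction i rule: int_induct[where k = 0])
  case base
  then show ?case using AG by simp
next
  case (step1 i)
  have "x \<otimes>\<^bsub>G\<^esub> c [^]\<^bsub>G\<^esub> (i + 1) = target (x \<otimes>\<^bsub>G\<^esub> c [^]\<^bsub>G\<^esub> i) l"
    using AG[OF step1.prems] G.int_pow_mult[OF cG, of i 1] by (simp add: G.m_assoc G.int_pow_1)
  then show ?case using A_target[OF step1.IH[OF step1.prems]] by simp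
next
  case (step2 i)
  have "x \<otimes>\<^bsub>G\<^esub> c [^]\<^bsub>G\<^esub> i = target (x \<otimes>\<^bsub>G\<^esub> c [^]\<^bsub>G\<^esub> (i - 1)) l"
    using AG[OF step2.prems] G.int_pow_mult[OF cG, of "i - 1" 1] by (simp add: G.m_assoc G.int_pow_1)
  then show ?case using step2 A(3)[of "x \<otimes>\<^bsub>G\<^esub> c [^]\<^bsub>G\<^esub> (i - 1)"] AG[OF step2.prems] by simp
qed

text \<open>Every edge in \<open>t\<close> advances by \<open>c\<close>, so a vertex that is moved
  past the \<open>i\<close>-th power is shifted by \<open>c^i\<close>.\<close>

lemma V_P: "x \<in> A \<Longrightarrow> V x \<otimes> P i = P i \<otimes> V (x \<otimes>\<^bsub>G\<^esub> c [^]\<^bsub>G\<^esub> i)"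
proof (induction i arbitrary: x rule: int_induct[where k = 0])
  case base
  then show ?case using AG by (simp add: P_0 p_V)
next
  case (step1 i)
  note xc = A_target[OF step1.prems]
  have pw: "target x l \<otimes>\<^bsub>G\<^esub> c [^]\<^bsub>G\<^esub> i = x \<otimes>\<^bsub>G\<^esub> c [^]\<^bsub>G\<^esub> (i + 1)"
    using AG[OF step1.prems] G.int_pow_mult[OF cG, of 1 i] by (simp add: G.m_assoc G.int_pow_1 add.commute)
  have "V x \<otimes> P (i + 1) = X x l \<otimes> P i" using step1.prems by (simp add: P_succ m_assoc[symmetric] V_t)
  also have "\<dots> = t \<otimes> (V (target x l) \<otimes> P i)" using step1.prems by (simp add: m_assoc[symmetric] t_V)
  also have "\<dots> = P (i + 1) \<otimes> V (x \<otimes>\<^bsub>G\<^esub> c [^]\<^bsub>G\<^esub> (i + 1))"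
    using step1.IH[OF xc] A_pow[OF xc, of i] pw by (simp add: P_succ m_assoc)
  finally show ?case .
next
  case (step2 i)
  obtain y where y: "y \<in> A" "x = target y l" using A_source[OF step2.prems] .
  have pw: "y \<otimes>\<^bsub>G\<^esub> c [^]\<^bsub>G\<^esub> i = x \<otimes>\<^bsub>G\<^esub> c [^]\<^bsub>G\<^esub> (i - 1)"
    using AG[OF y(1)] G.int_pow_mult[OF cG, of 1 "i - 1"] by (simp add: y G.m_assoc G.int_pow_1)
  have "V x \<otimes> P (i - 1) = Y y l \<otimes> P i" using y by (simp add: P_pred m_assoc[symmetric] V_t')
  also have "\<dots> = t' \<otimes> (V y \<otimes> P i)" using y by (simp add: m_assoc[symmetric] t'_V)
  also have "\<dots> = P (i - 1) \<otimes> V (x \<otimes>\<^bsub>G\<^esub> c [^]\<^bsub>G\<^esub> (i - 1))"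
    using step2.IH[OF y(1)] A_pow[OF y(1), of i] pw by (simp add: P_pred m_assoc)
  finally show ?case .
qed

text \<open>At each vertex there is one edge to follow and one ghost to go back along, so a nonzero
  word is determined by its start and its degree, the number of edges minus the number of
  ghosts.\<close>

lemma corner_word:
  assumes "w \<in> lists gens" "x \<in> A"
  shows "V x \<otimes> wd w \<otimes> p = \<zero> \<or> (\<exists>i. V x \<otimes> wd w \<otimes> p = V x \<otimes> P i)"
  using assms
proof (induction w arbitrary: x)
  case Nil
  show ?case using Nil by (intro disjI2 exI[of _ 0]) (simp add: wd_Nil P_0)
next
  case (Cons g w)
  then have g: "g \<in> gens" and w: "w \<in> lists gens" and x: "x \<in> A" by auto
  have wc: "wd w \<in> carrier U" using w by simp
  \<comment> \<open>One letter moves the start from \<open>x\<close> to \<open>y\<close> and leaves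
    a factor \<open>u\<close> in front, which is \<open>p\<close>, \<open>t\<close> or
    \<open>t'\<close> for \<open>j\<close> equal to \<open>0\<close>, \<open>1\<close> or
    \<open>-1\<close>.\<close>
  have step: ?case if u: "u \<in> carrier U" "y \<in> A" "V x \<otimes> wd [g] = u \<otimes> V y" "\<And>i. u \<otimes> (V y \<otimes> P i) = V x \<otimes> P (i + j)" for u y j
  proof -
    have "V x \<otimes> wd (g # w) \<otimes> p = V x \<otimes> wd [g] \<otimes> wd w \<otimes> p"
      using g wc x by (simp add: wd_Cons[OF g w] m_assoc)
    also have "\<dots> = u \<otimes> (V y \<otimes> wd w \<otimes> p)" unfolding u(3) using u(1,2) wc by (simp add: m_assoc)
    finally have eq: "V x \<otimes> wd (g # w) \<otimes> p = u \<otimes> (V y \<otimes> wd w \<otimes> p)" .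
    from Cons.IH[OF u(2)] show ?thesis
    proof
      assume "V y \<otimes> wd w \<otimes> p = \<zero>"
      then show ?thesis unfolding eq using u(1) by simp
    next
      assume "\<exists>i. V y \<otimes> wd w \<otimes> p = V y \<otimes> P i"
      then obtain i where "V y \<otimes> wd w \<otimes> p = V y \<otimes> P i" ..
      then show ?thesis unfolding eq using u(4)[of i] by auto
    qed
  qed
  have zero: ?case if u: "V x \<otimes> wd [g] = \<zero>"
  proof -
    have "V x \<otimes> wd (g # w) \<otimes> p = V x \<otimes> wd [g] \<otimes> wd w \<otimes> p"
      using g wc x by (simp add: wd_Cons[OF g w] m_assoc)
    then show ?thesis using u wc by simp
  qed
  from g show ?case
  proof (cases rule: gens_cases)
    case (V y)
    show ?thesis
    proof (cases "x = y")
      case True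
      then show ?thesis using V x by (intro step[of p x 0]) (simp_all add: p_V V_V AG m_assoc[symmetric])
    next
      case False
      then show ?thesis using V x by (intro zero) (simp add: V_V AG)
    qed
  next
    case (X y m)
    then have m: "m = l" using labels by simp
    show ?thesis
    proof (cases "x = y")
      case True
      have "t \<otimes> (V (target x l) \<otimes> P i) = V x \<otimes> P (i + 1)" for i
        using x by (simp add: m_assoc[symmetric] t_V P_succ V_t)
      then show ?thesis using X x m True
        by (intro step[of t "target x l" 1]) (simp_all add: A_target V_X[OF AG AG l] t_V)
    next
      case False
      then show ?thesis using X x m by (intro zero) (simp add: V_X AG)
    qed
  next
    case (Y y m)
    then have m: "m = l" using labels by simp
    show ?thesis
    proof (cases "x = target y l")
      case True
      have y: "y \<in> A" using A(3)[OF Y(1)] True x by simp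
      have "t' \<otimes> (V y \<otimes> P i) = V x \<otimes> P (i + - 1)" for i
      proof -
        have "V x \<otimes> P (i + - 1) = V (target y l) \<otimes> t' \<otimes> P i" using y True P_pred[of i] by (simp add: m_assoc)
        also have "\<dots> = t' \<otimes> V y \<otimes> P i" using y by (simp add: V_t' t'_V)
        finally show ?thesis using y by (simp add: m_assoc)
      qed
      then show ?thesis using Y m y True x
        by (intro step[of t' y "- 1"]) (simp_all add: V_Y[OF AG _ l] t'_V)
    next
      case False
      then show ?thesis using Y x m by (intro zero) (simp add: V_Y AG)
    qed
  qed
qed

text \<open>Here \<open>c^j = 1\<close>, so \<open>V_P\<close> gives commutation with the vertices
  of \<open>A\<close>. Powers of \<open>t\<close> commute with \<open>t\<close> and
  \<open>t'\<close>, which together with the vertices produce the edges and ghosts of the corner;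
  whatever \<open>p\<close> kills is annihilated on both sides.\<close>

lemma P_n_central:
  assumes j: "int n dvd j" and u: "u \<in> carrier U"
  shows "P j \<otimes> u = u \<otimes> P j"
proof -
  have cj: "c [^]\<^bsub>G\<^esub> j = \<one>\<^bsub>G\<^esub>"
  proof -
    obtain k where "j = int n * k" using j by (elim dvdE)
    then have "c [^]\<^bsub>G\<^esub> j = (c [^]\<^bsub>G\<^esub> int n) [^]\<^bsub>G\<^esub> k" using G.int_pow_pow[OF cG, of "int n" k] by simp
    then show ?thesis using n(2) by (simp add: int_pow_int)
  qed
  have Vj: "V x \<otimes> P j = P j \<otimes> V x" if "x \<in> A" for x using V_P[OF that, of j] AG[OF that] cj by simp
  have tj: "P j \<otimes> t = t \<otimes> P j" "P j \<otimes> t' = t' \<otimes> P j"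
  proof -
    have "P 1 = t" "P (- 1) = t'" using P_succ[of 0] P_pred[of 0] p_central[of t] p_central[of t'] p_t by (simp_all add: P_0)
    then show "P j \<otimes> t = t \<otimes> P j" "P j \<otimes> t' = t' \<otimes> P j"
      using P_add[of j 1] P_add[of 1 j] P_add[of j "- 1"] P_add[of "- 1" j] by (simp_all add: add.commute)
  qed
  have out: "P j \<otimes> u = u \<otimes> P j" if "u \<in> carrier U" "p \<otimes> u = \<zero>" for u
  proof -
    have "P j \<otimes> u = P j \<otimes> p \<otimes> u" by (simp only: P_p)
    also have "\<dots> = \<zero>" using that by (simp add: m_assoc)
    finally have 1: "P j \<otimes> u = \<zero>" .
    have "u \<otimes> P j = u \<otimes> (p \<otimes> P j)" by (simp only: p_P)
    also have "\<dots> = p \<otimes> u \<otimes> P j" using that(1) by (simp add: p_central[OF that(1)] m_assoc)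
    also have "\<dots> = \<zero>" using that(2) by simp
    finally show ?thesis using 1 by simp
  qed
  have gen: "P j \<otimes> wd [g] = wd [g] \<otimes> P j" if "g \<in> gens" for g
    using that
  proof (cases rule: gens_cases)
    case (V x)
    show ?thesis
    proof (cases "x \<in> A")
      case True
      then show ?thesis using V Vj by simp
    next
      case False
      then show ?thesis using V out[of "V x"] unit_on_V[OF A(1,2) V(1)] by (simp add: p_def)
    qed
  next
    case (X x m)
    then have m: "m = l" using labels by simp
    show ?thesis
    proof (cases "x \<in> A")
      case True
      have "P j \<otimes> (V x \<otimes> t) = V x \<otimes> P j \<otimes> t" using True by (simp add: Vj[OF True] m_assoc[symmetric])
      then have "P j \<otimes> (V x \<otimes> t) = V x \<otimes> t \<otimes> P j" using True by (simp add: m_assoc tj)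
      then show ?thesis using X m True by (simp add: V_t)
    next
      case False
      then show ?thesis using X m out[of "X x l"] unit_on_absorb(1)[OF A(1,2) X(1), of "X x l"] edge_relations(1)[OF X(1) l]
        by (simp add: p_def)
    qed
  next
    case (Y x m)
    then have m: "m = l" using labels by simp
    show ?thesis
    proof (cases "x \<in> A")
      case True
      have "P j \<otimes> (t' \<otimes> V x) = t' \<otimes> P j \<otimes> V x" using True by (simp add: tj m_assoc[symmetric])
      then have "P j \<otimes> (t' \<otimes> V x) = t' \<otimes> V x \<otimes> P j" using True by (simp add: m_assoc Vj[OF True])
      then show ?thesis using Y m True by (simp add: t'_V)
    next
      case False
      then show ?thesis using Y m out[of "Y x l"] unit_on_absorb(2)[OF A(1,2) Y(1), of "Y x l"] edge_relations(4)[OF Y(1) l] p_central[of "Y x l"]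
        by (simp add: p_def)
    qed
  qed
  have word: "P j \<otimes> wd w = wd w \<otimes> P j" if "w \<in> lists gens" for w
    using that
  proof (induction w)
    case Nil
    then show ?case by (simp add: wd_Nil)
  next
    case (Cons g w)
    then have g: "g \<in> gens" and w: "w \<in> lists gens" "P j \<otimes> wd w = wd w \<otimes> P j" by auto
    have gc: "wd [g] \<in> carrier U" "wd w \<in> carrier U" using g w by auto
    have "P j \<otimes> (wd [g] \<otimes> wd w) = wd [g] \<otimes> P j \<otimes> wd w"
      using gen[OF g] gc by (simp add: m_assoc[symmetric])
    also have "\<dots> = wd [g] \<otimes> wd w \<otimes> P j" using gc w(2) by (simp add: m_assoc)
    finally show ?case by (simp only: wd_Cons[OF g w(1)])
  qed
  show ?thesis using u
  proof (induction rule: U_induct)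
    case (add k w v)
    have cc: "sc k \<in> carrier U" "wd w \<in> carrier U" using add by auto
    have "P j \<otimes> (sc k \<otimes> wd w) = sc k \<otimes> (P j \<otimes> wd w)"
      using cc sc_central[OF P_closed add(1), of j] by (simp add: m_assoc[symmetric])
    also have "\<dots> = sc k \<otimes> wd w \<otimes> P j" using word[OF add(2)] cc by (simp add: m_assoc)
    finally show ?case using cc add by (simp add: r_distr l_distr)
  qed simp
qed

end

lemma (in ring) finsum_mem:
  assumes "finite B" "\<And>i. i \<in> B \<Longrightarrow> f i \<in> W" and W: "W \<subseteq> carrier R" "\<zero> \<in> W" "\<And>u v. u \<in> W \<Longrightarrow> v \<in> W \<Longrightarrow> u \<oplus> v \<in> W"
  shows "(\<Oplus>i\<in>B. f i) \<in> W"
  using assms(1,2)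
proof (induction B)
  case (insert i B)
  have "f j \<in> carrier R" if "j \<in> insert i B" for j using insert.prems that W by blast
  then have "(\<Oplus>i\<in>insert i B. f i) = f i \<oplus> (\<Oplus>i\<in>B. f i)" using insert.hyps by (intro finsum_insert) auto
  then show ?case using insert W(3) by simp
qed (use W in simp)

context one_label_corner
begin

lemma finsum_V_mult:
  assumes "u \<in> carrier U"
  shows "p \<otimes> u = (\<Oplus>x\<in>A. V x \<otimes> u)"
  unfolding p_def unit_on_def using A(1) assms by (intro finsum_ldistr) auto

text \<open>Division of exponents by \<open>n\<close> writes every \<open>V x P i\<close> as a power
  of the central element \<open>P n\<close> times one of the finitely many elements with exponent
  below \<open>n\<close>. The scalars are multiplied by \<open>p\<close> to lie in the
  corner.\<close>

lemma corner_laurent_algebra: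
  assumes vs: "set vs = (\<lambda>(x, i). V x \<otimes> P (int i)) ` (A \<times> {..<n})"
  shows "laurent_algebra (corner p) ((\<otimes>) p ` scalars) (P (int n)) (P (- int n)) vs"
proof -
  note cp = p_closed p_idem p_central
  interpret C: ring "corner p" by (rule corner_ring[OF cp])
  have scU: "k \<in> carrier U" if "k \<in> scalars" for k using that by auto
  have pk: "p \<otimes> k \<in> carrier (corner p)" if "k \<in> scalars" for k
    using scU[OF that] by (simp add: corner_simps m_assoc[symmetric] p_idem)
  have pkk: "(p \<otimes> k) \<otimes> (p \<otimes> k') = p \<otimes> (k \<otimes> k')" if "k \<in> scalars" "k' \<in> scalars" for k k'
  proof -
    have "(p \<otimes> k) \<otimes> (p \<otimes> k') = p \<otimes> (k \<otimes> p) \<otimes> k'" using that scU by (simp add: m_assoc)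
    also have "k \<otimes> p = p \<otimes> k" using p_central[OF scU[OF that(1)]] by (simp only:)
    also have "p \<otimes> (p \<otimes> k) \<otimes> k' = (p \<otimes> p) \<otimes> (k \<otimes> k')" using that scU by (simp add: m_assoc)
    finally show ?thesis by (simp only: p_idem)
  qed
  have K: "subring ((\<otimes>) p ` scalars) (corner p)"
  proof (rule C.subringI)
    show "(\<otimes>) p ` scalars \<subseteq> carrier (corner p)" using pk by blast
    have "p = p \<otimes> \<one>" by simp
    then show "\<one>\<^bsub>corner p\<^esub> \<in> (\<otimes>) p ` scalars"
      using subringE(3)[OF scalars_subring] unfolding corner_simps by blast
    show "\<ominus>\<^bsub>corner p\<^esub> h \<in> (\<otimes>) p ` scalars" if h: "h \<in> (\<otimes>) p ` scalars" for h
    proof -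
      obtain k where k: "k \<in> scalars" "h = p \<otimes> k" using h by blast
      have "\<ominus>\<^bsub>corner p\<^esub> h = \<ominus> (p \<otimes> k)" unfolding k(2) by (rule corner_minus[OF cp pk[OF k(1)]])
      also have "\<dots> = p \<otimes> \<ominus> k" using scU[OF k(1)] by (simp add: r_minus)
      finally show ?thesis using subringE(5)[OF scalars_subring k(1)] by blast
    qed
    fix h1 h2 assume h: "h1 \<in> (\<otimes>) p ` scalars" "h2 \<in> (\<otimes>) p ` scalars"
    obtain k1 k2 where k: "k1 \<in> scalars" "h1 = p \<otimes> k1" "k2 \<in> scalars" "h2 = p \<otimes> k2" using h by blast
    show "h1 \<otimes>\<^bsub>corner p\<^esub> h2 \<in> (\<otimes>) p ` scalars"
      unfolding corner_simps k(2,4) pkk[OF k(1,3)] by (rule imageI[OF subringE(6)[OF scalars_subring k(1,3)]])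
    have "p \<otimes> k1 \<oplus> p \<otimes> k2 = p \<otimes> (k1 \<oplus> k2)" using scU[OF k(1)] scU[OF k(3)] by (simp add: r_distr)
    then show "h1 \<oplus>\<^bsub>corner p\<^esub> h2 \<in> (\<otimes>) p ` scalars"
      unfolding corner_simps k(2,4) using subringE(7)[OF scalars_subring k(1,3)] by blast
  qed
  have Pc: "P i \<in> carrier (corner p)" for i by (simp add: corner_simps p_P)
  let ?H = "insert (P (int n)) (insert (P (- int n)) ((\<otimes>) p ` scalars))"
  define D where "D = generate_ring (corner p) ?H"
  have H: "?H \<subseteq> carrier (corner p)" using Pc pk by blast
  have D: "subring D (corner p)" unfolding D_def by (rule C.generate_ring_is_subring[OF H])
  have vsC: "set vs \<subseteq> carrier (corner p)"
    unfolding vs by (auto simp: corner_simps m_assoc[symmetric] p_V)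
  note sp = C.lspan_zero[OF D vsC] C.lspan_add[OF D vsC] C.lspan_smult[OF D vsC] C.lspan_incl[OF D vsC] C.lspan_closed[OF D vsC]
  define W where "W = C.lspan D vs"
  have WU: "W \<subseteq> carrier U" unfolding W_def using sp(5) by (auto simp: corner_simps)
  have W0: "\<zero> \<in> W" using sp(1) by (simp add: W_def corner_simps)
  have Wadd: "u \<oplus> v \<in> W" if "u \<in> W" "v \<in> W" for u v using sp(2)[of u v] that by (simp add: W_def corner_simps)
  have Wsm: "d \<otimes> u \<in> W" if "d \<in> D" "u \<in> W" for d u using sp(3)[of d u] that by (simp add: W_def corner_simps)
  have PD: "P (int n * k) \<in> D" for k
  proof (induction k rule: int_induct[where k = 0])
    case base
    show ?case using subringE(3)[OF D] by (simp add: P_0 corner_simps)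
  next
    case (step1 k)
    have "P (int n * (k + 1)) = P (int n) \<otimes> P (int n * k)" by (simp add: P_add[symmetric] algebra_simps)
    moreover have "P (int n) \<in> D" unfolding D_def by (rule generate_ring.incl) simp
    ultimately show ?case using subringE(6)[OF D _ step1(2)] by (simp add: corner_simps)
  next
    case (step2 k)
    have "P (int n * (k - 1)) = P (- int n) \<otimes> P (int n * k)" by (simp add: P_add[symmetric] algebra_simps)
    moreover have "P (- int n) \<in> D" unfolding D_def by (rule generate_ring.incl) simp
    ultimately show ?case using subringE(6)[OF D _ step2(2)] by (simp add: corner_simps)
  qed
  have VP: "V x \<otimes> P i \<in> W" if x: "x \<in> A" for x i
  proof -
    have i: "i = int n * (i div int n) + int (nat (i mod int n))" "nat (i mod int n) < n"
      using n(1) by (simp_all add: nat_less_iff)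
    have "V x \<otimes> P i = V x \<otimes> (P (int n * (i div int n)) \<otimes> P (int (nat (i mod int n))))"
      using i(1) by (simp only: P_add[symmetric])
    also have "\<dots> = P (int n * (i div int n)) \<otimes> (V x \<otimes> P (int (nat (i mod int n))))"
      using x P_n_central[of "int n * (i div int n)" "V x"] by (simp add: m_assoc[symmetric])
    also have "\<dots> \<in> W"
    proof (rule Wsm[OF PD])
      have "V x \<otimes> P (int (nat (i mod int n))) \<in> set vs" unfolding vs using x i(2) by force
      then show "V x \<otimes> P (int (nat (i mod int n))) \<in> W" using sp(4) unfolding W_def by blast
    qed
    finally show ?thesis .
  qed
  have word: "p \<otimes> wd w \<in> W" if w: "w \<in> lists gens" for w
  proof -
    have wc: "wd w \<in> carrier U" using w by simp
    have "p \<otimes> wd w = p \<otimes> (p \<otimes> wd w)" using wc by (simp add: m_assoc[symmetric] p_idem)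
    also have "\<dots> = p \<otimes> (wd w \<otimes> p)" by (simp only: p_central[OF wc])
    also have "\<dots> = (\<Oplus>x\<in>A. V x \<otimes> (wd w \<otimes> p))" by (rule finsum_V_mult) (use wc in simp)
    also have "\<dots> \<in> W"
    proof (rule finsum_mem[OF A(1) _ WU W0 Wadd])
      fix x assume x: "x \<in> A"
      have "V x \<otimes> (wd w \<otimes> p) = V x \<otimes> wd w \<otimes> p" using x wc by (simp add: m_assoc)
      then show "V x \<otimes> (wd w \<otimes> p) \<in> W" using corner_word[OF w x] VP[OF x] W0 by auto
    qed
    finally show ?thesis .
  qed
  have all: "p \<otimes> u \<in> W" if "u \<in> carrier U" for u
    using that
  proof (induction rule: U_induct)
    case zero
    then show ?case using W0 by simp
  next
    case (add k w v)
    have c: "sc k \<in> carrier U" "wd w \<in> carrier U" using add by auto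
    have "p \<otimes> (sc k \<otimes> wd w) = (p \<otimes> p) \<otimes> (sc k \<otimes> wd w)" by (simp only: p_idem)
    also have "\<dots> = p \<otimes> (p \<otimes> sc k) \<otimes> wd w" using c by (simp add: m_assoc)
    also have "p \<otimes> sc k = sc k \<otimes> p" by (rule p_central[OF c(1)])
    also have "p \<otimes> (sc k \<otimes> p) \<otimes> wd w = (p \<otimes> sc k) \<otimes> (p \<otimes> wd w)" using c by (simp add: m_assoc)
    also have "\<dots> \<in> W"
      by (rule Wsm[OF _ word[OF add(2)]]) (use add(1) in \<open>auto simp: D_def intro: generate_ring.incl\<close>)
    finally show ?case using Wadd add c by (simp add: r_distr)
  qed
  show ?thesis
  proof (intro laurent_algebra.intro laurent_algebra_axioms.intro C.ring_axioms K)
    show "\<exists>k'\<in>(\<otimes>) p ` scalars. k' \<otimes>\<^bsub>corner p\<^esub> k = \<one>\<^bsub>corner p\<^esub>"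
      if k: "k \<in> (\<otimes>) p ` scalars" "k \<noteq> \<zero>\<^bsub>corner p\<^esub>" for k
    proof -
      obtain s where s: "s \<in> scalars" "k = p \<otimes> s" using k by blast
      have "s \<noteq> \<zero>"
      proof
        assume "s = \<zero>"
        then have "k = \<zero>" unfolding s(2) using r_null[OF p_closed] by (simp only:)
        then show False using k(2) by (simp only: corner_simps)
      qed
      then obtain s' where s': "s' \<in> scalars" "s' \<otimes> s = \<one>" using scalars_inv s by blast
      have "(p \<otimes> s') \<otimes> k = p" unfolding s(2) pkk[OF s'(1) s(1)] s'(2) by simp
      then show ?thesis using s'(1) unfolding corner_simps by blast
    qed
    show "k \<otimes>\<^bsub>corner p\<^esub> u = u \<otimes>\<^bsub>corner p\<^esub> k" if k: "k \<in> (\<otimes>) p ` scalars" and u: "u \<in> carrier (corner p)" for k u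
    proof -
      obtain s where s: "s \<in> scalars" "k = p \<otimes> s" using k by blast
      have uc: "u \<in> carrier U" using u by (simp add: corner_simps)
      have "p \<otimes> s \<otimes> u = p \<otimes> (s \<otimes> u)" using uc scU[OF s(1)] by (simp add: m_assoc)
      also have "s \<otimes> u = u \<otimes> s" by (rule scalars_central[OF s(1) uc])
      also have "p \<otimes> (u \<otimes> s) = (p \<otimes> u) \<otimes> s" using uc scU[OF s(1)] by (simp add: m_assoc)
      also have "p \<otimes> u = u \<otimes> p" by (rule p_central[OF uc])
      also have "u \<otimes> p \<otimes> s = u \<otimes> (p \<otimes> s)" using uc scU[OF s(1)] by (simp add: m_assoc)
      finally show ?thesis by (simp add: s(2) corner_simps)
    qed
    show "P (int n) \<otimes>\<^bsub>corner p\<^esub> P (- int n) = \<one>\<^bsub>corner p\<^esub>"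
      by (simp add: corner_simps P_add[symmetric] P_0)
    show "P (int n) \<otimes>\<^bsub>corner p\<^esub> u = u \<otimes>\<^bsub>corner p\<^esub> P (int n)" if "u \<in> carrier (corner p)" for u
      using that P_n_central[of "int n" u] by (simp add: corner_simps)
    show "carrier (corner p) \<subseteq> C.lspan (generate_ring (corner p) ?H) vs"
    proof
      fix u assume "u \<in> carrier (corner p)"
      then have "u \<in> carrier U" "p \<otimes> u = u" by (simp_all add: corner_simps)
      then show "u \<in> C.lspan (generate_ring (corner p) ?H) vs" using all[of u] by (simp add: W_def D_def)
    qed
  qed (use Pc vsC in auto)
qed

text \<open>\<open>U\<close> is the product of the corners at \<open>p\<close> and
  \<open>q = 1 - p\<close>. In the second one \<open>a2\<close> and \<open>a3\<close> vanish and
  \<open>a1\<close> is the unit, so the problem is solved in the first corner and \<open>q\<close>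
  is added to the first coefficient.\<close>

lemma row_reduction:
  assumes ne: "A \<noteq> {}"
    and a: "a1 \<in> carrier U" "p \<otimes> (a1 \<ominus> \<one>) = a1 \<ominus> \<one>" "a2 \<in> carrier U" "p \<otimes> a2 = a2" "a3 \<in> carrier U" "p \<otimes> a3 = a3"
    and x: "x1 \<in> carrier U" "x2 \<in> carrier U" "p \<otimes> x2 = x2" "x3 \<in> carrier U" "p \<otimes> x3 = x3"
    and eq: "a1 \<otimes> x1 \<oplus> a2 \<otimes> x2 \<oplus> a3 \<otimes> x3 = \<one>"
  shows "\<exists>r1\<in>L. \<exists>r2\<in>L. \<exists>w1\<in>carrier U. \<exists>w2\<in>carrier U.
    (a1 \<oplus> a3 \<otimes> r1) \<otimes> w1 \<oplus> (a2 \<oplus> a3 \<otimes> r2) \<otimes> w2 = \<one>"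
proof -
  have "finite ((\<lambda>(x, i). V x \<otimes> P (int i)) ` (A \<times> {..<n}))" using A(1) by simp
  then obtain vs where vs: "set vs = (\<lambda>(x, i). V x \<otimes> P (int i)) ` (A \<times> {..<n})" using finite_list by blast
  note LA = corner_laurent_algebra[OF vs]
  have pp: "p \<otimes> (p \<otimes> u) = p \<otimes> u" if "u \<in> carrier U" for u using that by (simp add: m_assoc[symmetric] p_idem)
  have "p \<noteq> \<zero>"
  proof
    assume "p = \<zero>"
    obtain y where y: "y \<in> A" using ne by blast
    have "V y = \<zero>" using p_V(1)[OF y] y by (simp add: \<open>p = \<zero>\<close>)
    then show False using V_nonzero[OF AG[OF y]] by simp
  qed
  moreover have "(p \<otimes> a1) \<otimes> (p \<otimes> x1) \<oplus> a2 \<otimes> x2 \<oplus> a3 \<otimes> x3 = p"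
  proof -
    have "(p \<otimes> a1) \<otimes> (p \<otimes> x1) = p \<otimes> (a1 \<otimes> p) \<otimes> x1" using a x by (simp add: m_assoc)
    also have "a1 \<otimes> p = p \<otimes> a1" using p_central[OF a(1)] by simp
    also have "p \<otimes> (p \<otimes> a1) \<otimes> x1 = p \<otimes> (a1 \<otimes> x1)" using a x by (simp add: pp m_assoc)
    finally have 1: "(p \<otimes> a1) \<otimes> (p \<otimes> x1) = p \<otimes> (a1 \<otimes> x1)" .
    have 2: "a2 \<otimes> x2 = p \<otimes> (a2 \<otimes> x2)" "a3 \<otimes> x3 = p \<otimes> (a3 \<otimes> x3)" using a x by (simp_all add: m_assoc[symmetric])
    have "p \<otimes> (a1 \<otimes> x1) \<oplus> p \<otimes> (a2 \<otimes> x2) \<oplus> p \<otimes> (a3 \<otimes> x3) = p \<otimes> (a1 \<otimes> x1 \<oplus> a2 \<otimes> x2 \<oplus> a3 \<otimes> x3)"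
      using a x by (simp add: r_distr)
    then show ?thesis unfolding 1 2[symmetric] eq by simp
  qed
  ultimately have "\<exists>r1\<in>carrier (corner p). \<exists>r2\<in>carrier (corner p). \<exists>w1\<in>carrier (corner p). \<exists>w2\<in>carrier (corner p).
      (p \<otimes> a1 \<oplus> a3 \<otimes> r1) \<otimes> w1 \<oplus> (a2 \<oplus> a3 \<otimes> r2) \<otimes> w2 = p"
    using laurent_algebra.two_row_reduction[OF LA, of "p \<otimes> a1" a2 a3 "p \<otimes> x1" x2 x3] a x pp
    unfolding corner_simps by simp
  then obtain r1 r2 w1 w2 where rw: "r1 \<in> carrier (corner p)" "r2 \<in> carrier (corner p)"
      "w1 \<in> carrier (corner p)" "w2 \<in> carrier (corner p)"
      "(p \<otimes> a1 \<oplus> a3 \<otimes> r1) \<otimes> w1 \<oplus> (a2 \<oplus> a3 \<otimes> r2) \<otimes> w2 = p" by blast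
  have rc: "r1 \<in> carrier U" "r2 \<in> carrier U" "w1 \<in> carrier U" "w2 \<in> carrier U"
    and pr: "p \<otimes> r1 = r1" "p \<otimes> r2 = r2" "p \<otimes> w1 = w1"
    using rw(1-4) by (simp_all add: corner_simps)
  have rL: "r1 \<in> L" "r2 \<in> L"
    using I_r_closed[OF p_in_L rc(1)] I_r_closed[OF p_in_L rc(2)] by (simp_all only: pr)
  define q where "q = \<one> \<ominus> p"
  have qc: "q \<in> carrier U" by (simp add: q_def)
  have q0: "u \<otimes> q = \<zero>" if u: "u \<in> carrier U" "p \<otimes> u = u" for u
  proof -
    have "u \<otimes> p = u" using p_central[OF u(1)] u(2) by simp
    then show ?thesis using u by (simp add: q_def a_minus_def r_distr r_minus r_neg)
  qed
  have "a1 \<otimes> q \<ominus> q = (a1 \<ominus> \<one>) \<otimes> q" using a qc by (simp add: a_minus_def l_distr l_minus)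
  also have "\<dots> = \<zero>" by (rule q0) (use a in simp_all)
  finally have aq: "a1 \<otimes> q = q" using a qc by simp
  have "r1 \<otimes> q = \<zero>" by (rule q0[OF rc(1) pr(1)])
  then have "(a1 \<oplus> a3 \<otimes> r1) \<otimes> q = q" using a rc qc aq by (simp add: l_distr m_assoc)
  moreover have "a1 \<otimes> w1 = p \<otimes> a1 \<otimes> w1"
  proof -
    have "a1 \<otimes> w1 = a1 \<otimes> p \<otimes> w1" using a rc pr by (simp add: m_assoc)
    then show ?thesis by (simp only: p_central[OF a(1)])
  qed
  ultimately have "(a1 \<oplus> a3 \<otimes> r1) \<otimes> (w1 \<oplus> q) = (p \<otimes> a1 \<oplus> a3 \<otimes> r1) \<otimes> w1 \<oplus> q"
    using a rc qc by (simp add: r_distr l_distr)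
  then have "(a1 \<oplus> a3 \<otimes> r1) \<otimes> (w1 \<oplus> q) \<oplus> (a2 \<oplus> a3 \<otimes> r2) \<otimes> w2 =
      ((p \<otimes> a1 \<oplus> a3 \<otimes> r1) \<otimes> w1 \<oplus> (a2 \<oplus> a3 \<otimes> r2) \<otimes> w2) \<oplus> q"
    using a rc qc by (simp add: a_ac)
  also have "\<dots> = \<one>" unfolding rw(5) by (simp add: q_def a_minus_def a_ac r_neg2 r_neg)
  finally show ?thesis using rL rc(4) a_closed[OF rc(3) qc] by blast
qed

end

theorem (in hopf_leavitt) stable_range_2_of_one_label:
  assumes lab: "labels = {l}" and one: "\<one>\<^bsub>G\<^esub> \<in> S"
  shows "stable_range U L 2"
proof (rule stable_range_2I)
  fix a1 a2 a3 x1 x2 x3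
  assume a: "a1 \<in> carrier U" "a1 \<ominus> \<one> \<in> L" "a2 \<in> L" "a3 \<in> L"
    and x: "x1 \<in> carrier U" "x1 \<ominus> \<one> \<in> L" "x2 \<in> L" "x3 \<in> L"
    and eq: "a1 \<otimes> x1 \<oplus> a2 \<otimes> x2 \<oplus> a3 \<otimes> x3 = \<one>"
  obtain n :: nat where n: "n > 0" "fst l [^]\<^bsub>G\<^esub> n = \<one>\<^bsub>G\<^esub>" "finite S"
    using one_label_finite_order[OF lab one] by blast
  note sub = finite_subgroup[OF one n(3)]
  have lS: "fst l \<in> S" "fst l \<in> carrier G" "l \<in> labels"
    using lab label_closed[of l] unfolding S_eq by (auto intro: subsemigroup_generated.incl)
  have "finite {a1 \<ominus> \<one>, a2, a3, x2, x3}" "{a1 \<ominus> \<one>, a2, a3, x2, x3} \<subseteq> L" using a x by auto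
  from local_unit_finite[OF this] obtain F where F: "finite F" "F \<subseteq> carrier G"
    and F': "\<forall>B u. finite B \<longrightarrow> F \<subseteq> B \<longrightarrow> B \<subseteq> carrier G \<longrightarrow> u \<in> {a1 \<ominus> \<one>, a2, a3, x2, x3} \<longrightarrow>
      unit_on B \<otimes> u = u \<and> u \<otimes> unit_on B = u" by (elim exE conjE)
  \<comment> \<open>Multiplying by the group \<open>S\<close> closes \<open>F\<close> under edges in
    both directions. Inserting \<open>1\<close> keeps \<open>A\<close> nonempty, so that the unit of
    the corner is nonzero even for empty \<open>F\<close>.\<close>
  define A where "A = (\<lambda>(y, s). y \<otimes>\<^bsub>G\<^esub> s) ` (insert \<one>\<^bsub>G\<^esub> F \<times> S)"
  have A: "finite A" "A \<subseteq> carrier G" using F n(3) S_closed by (auto simp: A_def)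
  have FA: "F \<subseteq> A" "A \<noteq> {}"
  proof -
    have "y = (\<lambda>(y, s). y \<otimes>\<^bsub>G\<^esub> s) (y, \<one>\<^bsub>G\<^esub>)" if "y \<in> F" for y using that F by auto
    then show "F \<subseteq> A" "A \<noteq> {}" unfolding A_def using one by blast+
  qed
  have closed: "target y l \<in> A \<longleftrightarrow> y \<in> A" if y: "y \<in> carrier G" for y
  proof
    assume "target y l \<in> A"
    then obtain f s where fs: "f \<in> insert \<one>\<^bsub>G\<^esub> F" "s \<in> S" "target y l = f \<otimes>\<^bsub>G\<^esub> s" unfolding A_def by auto
    have fc: "f \<in> carrier G" "s \<in> carrier G" using fs F S_closed by auto
    have "y = target y l \<otimes>\<^bsub>G\<^esub> inv\<^bsub>G\<^esub> fst l" using y lS by (simp add: G.m_assoc)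
    also have "\<dots> = f \<otimes>\<^bsub>G\<^esub> (s \<otimes>\<^bsub>G\<^esub> inv\<^bsub>G\<^esub> fst l)" unfolding fs(3) using fc lS by (simp add: G.m_assoc)
    finally have "y = (\<lambda>(y, s). y \<otimes>\<^bsub>G\<^esub> s) (f, s \<otimes>\<^bsub>G\<^esub> inv\<^bsub>G\<^esub> fst l)" by simp
    moreover have "s \<otimes>\<^bsub>G\<^esub> inv\<^bsub>G\<^esub> fst l \<in> S"
      by (intro subgroup.m_closed[OF sub] subgroup.m_inv_closed[OF sub] fs lS)
    ultimately show "y \<in> A" unfolding A_def using fs(1) by blast
  next
    assume "y \<in> A"
    then obtain f s where fs: "f \<in> insert \<one>\<^bsub>G\<^esub> F" "s \<in> S" "y = f \<otimes>\<^bsub>G\<^esub> s" unfolding A_def by auto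
    have fc: "f \<in> carrier G" "s \<in> carrier G" using fs F S_closed by auto
    have "target y l = (\<lambda>(y, s). y \<otimes>\<^bsub>G\<^esub> s) (f, s \<otimes>\<^bsub>G\<^esub> fst l)" using fs fc lS by (simp add: G.m_assoc)
    moreover have "s \<otimes>\<^bsub>G\<^esub> fst l \<in> S" by (intro subgroup.m_closed[OF sub] fs lS)
    ultimately show "target y l \<in> A" unfolding A_def using fs(1) by blast
  qed
  have C: "one_label_corner G K r U L l n A"
    by (intro one_label_corner.intro one_label_corner_axioms.intro hopf_leavitt_axioms lab n(1,2) A closed)
  have unit: "unit_on A \<otimes> u = u" if "u \<in> {a1 \<ominus> \<one>, a2, a3, x2, x3}" for u
    using F' A FA(1) that by blast
  have c: "a2 \<in> carrier U" "a3 \<in> carrier U" "x2 \<in> carrier U" "x3 \<in> carrier U" using a x a_subset by auto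
  show "\<exists>r1\<in>L. \<exists>r2\<in>L. \<exists>w1\<in>carrier U. \<exists>w2\<in>carrier U.
      (a1 \<oplus> a3 \<otimes> r1) \<otimes> w1 \<oplus> (a2 \<oplus> a3 \<otimes> r2) \<otimes> w2 = \<one>"
    by (rule one_label_corner.row_reduction[OF C FA(2) a(1) _ c(1) _ c(2) _ x(1) c(3) _ c(4) _ eq])
      (unfold one_label_corner.p_def[OF C], use unit in simp_all)
qed

section \<open>One label: degree functionals and units of the vertex corner\<close>

context hopf_leavitt
begin

text \<open>Left multiplication by a word amounts to moving the initial state along the
  word.\<close>

lemma eval_functional_wd_mult:
  assumes s: "valid s" and w: "w \<in> lists gens" and u: "u \<in> carrier U"
  shows "eval_functional s Q (wd w \<otimes> u) =
    (case run w s of None \<Rightarrow> \<zero>\<^bsub>K\<^esub> | Some s' \<Rightarrow> eval_functional s' Q u)"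
proof -
  obtain f where f: "f \<in> carrier F" "u = proj f" using proj_surj u by blast
  have sw: "K.single w \<one>\<^bsub>K\<^esub> \<in> carrier F" by (rule single_closed) (use w in auto)
  have "wd w \<otimes> u = proj (K.single w \<one>\<^bsub>K\<^esub> \<otimes>\<^bsub>F\<^esub> f)" using f sw by (simp add: wd_def)
  then have "eval_functional s Q (wd w \<otimes> u) = K.coeff_sum (runs_to s Q) (K.single w \<one>\<^bsub>K\<^esub> \<otimes>\<^bsub>F\<^esub> f)"
    using eval_functional_proj[OF s F.m_closed[OF sw f(1)]] by simp
  also have "\<dots> = K.coeff_sum (\<lambda>v. runs_to s Q (w @ v)) f"
    using K.coeff_sum_mult_single(1)[OF f(1) w K.one_closed] K.coeff_sum_closed[OF f(1)] by simp
  also have "\<dots> = (case run w s of None \<Rightarrow> \<zero>\<^bsub>K\<^esub> | Some s' \<Rightarrow> eval_functional s' Q u)"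
  proof (cases "run w s")
    case None
    then show ?thesis by (simp add: runs_to_def run_append K.coeff_sum_def)
  next
    case (Some s')
    then have "(\<lambda>v. runs_to s Q (w @ v)) = runs_to s' Q" by (simp add: runs_to_def run_append fun_eq_iff)
    then show ?thesis using Some eval_functional_proj[OF run_valid[OF w s Some] f(1)] f(2) by simp
  qed
  finally show ?thesis .
qed

text \<open>The counter is changed by \<open>step\<close> but never tested, so shifting its initial
  value shifts the final one.\<close>

lemma run_shift:
  "run w (x, m + k, q) = map_option (\<lambda>(y, j, q'). (y, j + k, q')) (run w (x, m, q))"
proof (induction w arbitrary: x m q)
  case (Cons g w)
  show ?case
  proof (cases g)
    case (Edge e)
    then show ?thesis using Cons.IH[of _ "m + 1"] by (simp add: algebra_simps)
  next
    case (Ghost e)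
    then show ?thesis using Cons.IH[of _ "m - 1"] by (simp add: algebra_simps)
  qed (simp add: Cons.IH)
qed simp

lemma eval_functional_shift:
  "eval_functional (x, m + k, q) Q u = eval_functional (x, m, q) (\<lambda>(y, j, q'). Q (y, j + k, q')) u"
proof -
  have "runs_to (x, m + k, q) Q = runs_to (x, m, q) (\<lambda>(y, j, q'). Q (y, j + k, q'))"
    by (auto simp: runs_to_def run_shift fun_eq_iff split: option.splits)
  then show ?thesis by (simp add: eval_functional_def)
qed

lemma eval_functional_zero: "valid s \<Longrightarrow> eval_functional s Q \<zero> = \<zero>\<^bsub>K\<^esub>"
  using eval_functional_sc[of s \<zero> "\<zero>\<^bsub>K\<^esub>"] eval_functional_closed[of s \<zero>] by simp

end

locale one_label_corner_one = one_label_corner +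
  assumes one_A: "\<one>\<^bsub>G\<^esub> \<in> A"
begin

text \<open>With a single label the infinite path is constant, so a state is a vertex with a degree.
  The functional starts at \<open>x\<close> in degree \<open>m\<close> and adds the coefficients of
  those words whose final degree satisfies \<open>Q\<close>, whatever the final vertex.\<close>

definition chi :: "'a \<Rightarrow> (int \<Rightarrow> bool) \<Rightarrow> int \<Rightarrow> _ \<Rightarrow> 'c"
  where "chi x Q m u = eval_functional (x, m, \<lambda>_. l) (\<lambda>s. Q (fst (snd s))) u"

lemma valid_l [simp]: "x \<in> carrier G \<Longrightarrow> valid (x, m, \<lambda>_. l)"
  using l by (simp add: valid_def)

lemma chi_closed [simp]: "x \<in> carrier G \<Longrightarrow> u \<in> carrier U \<Longrightarrow> chi x Q m u \<in> carrier K"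
  unfolding chi_def by (rule eval_functional_closed[OF valid_l])

lemma chi_add: "x \<in> carrier G \<Longrightarrow> u \<in> carrier U \<Longrightarrow> v \<in> carrier U \<Longrightarrow>
    chi x Q m (u \<oplus> v) = chi x Q m u \<oplus>\<^bsub>K\<^esub> chi x Q m v"
  unfolding chi_def by (rule eval_functional_add[OF valid_l])

lemma chi_sc: "x \<in> carrier G \<Longrightarrow> u \<in> carrier U \<Longrightarrow> k \<in> carrier K \<Longrightarrow>
    chi x Q m (sc k \<otimes> u) = k \<otimes>\<^bsub>K\<^esub> chi x Q m u"
  unfolding chi_def by (rule eval_functional_sc[OF valid_l])

lemma chi_zero: "x \<in> carrier G \<Longrightarrow> chi x Q m \<zero> = \<zero>\<^bsub>K\<^esub>"
  unfolding chi_def by (rule eval_functional_zero[OF valid_l])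

lemma chi_shift: "chi x Q (m + k) u = chi x (\<lambda>i. Q (i + k)) m u"
  unfolding chi_def eval_functional_shift by (rule arg_cong2[of _ _ _ _ "eval_functional _"]) auto

lemma chi_V:
  "x \<in> carrier G \<Longrightarrow> y \<in> carrier G \<Longrightarrow> u \<in> carrier U \<Longrightarrow>
    chi x Q m (V y \<otimes> u) = (if x = y then chi x Q m u else \<zero>\<^bsub>K\<^esub>)"
  unfolding chi_def V_def by (subst eval_functional_wd_mult) auto

lemma chi_X: "x \<in> carrier G \<Longrightarrow> u \<in> carrier U \<Longrightarrow> chi x Q m (X x l \<otimes> u) = chi (target x l) Q (m + 1) u"
  unfolding chi_def X_def using l by (subst eval_functional_wd_mult) auto

lemma chi_Y: "x \<in> carrier G \<Longrightarrow> u \<in> carrier U \<Longrightarrow> chi (target x l) Q m (Y x l \<otimes> u) = chi x Q (m - 1) u"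
proof -
  assume x: "x \<in> carrier G" "u \<in> carrier U"
  have q: "case_nat l (\<lambda>_. l) = (\<lambda>_. l)" by (auto simp: fun_eq_iff split: nat.splits)
  show ?thesis unfolding chi_def Y_def using l x by (subst eval_functional_wd_mult) (auto simp: q)
qed

lemma chi_V_self: "x \<in> carrier G \<Longrightarrow> chi x Q m (V x) = (if Q m then \<one>\<^bsub>K\<^esub> else \<zero>\<^bsub>K\<^esub>)"
  unfolding chi_def V_def by (subst eval_functional_wd) (auto simp: runs_to_def)

lemma chi_t:
  assumes x: "x \<in> A" and u: "u \<in> carrier U"
  shows "chi x Q m (t \<otimes> u) = chi (target x l) Q (m + 1) u"
proof -
  have "chi x Q m (t \<otimes> u) = chi x Q m (V x \<otimes> (t \<otimes> u))" using x u chi_V[OF AG AG, of x x] by simp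
  also have "V x \<otimes> (t \<otimes> u) = X x l \<otimes> u" using x u by (simp add: m_assoc[symmetric] V_t)
  finally show ?thesis using chi_X[OF AG[OF x] u] by simp
qed

lemma chi_t':
  assumes x: "x \<in> A" and u: "u \<in> carrier U"
  shows "chi (target x l) Q m (t' \<otimes> u) = chi x Q (m - 1) u"
proof -
  have "chi (target x l) Q m (t' \<otimes> u) = chi (target x l) Q m (V (target x l) \<otimes> (t' \<otimes> u))"
    using x u chi_V[of "target x l" "target x l"] by simp
  also have "V (target x l) \<otimes> (t' \<otimes> u) = Y x l \<otimes> u" using x u by (simp add: m_assoc[symmetric] V_t')
  finally show ?thesis using chi_Y[OF AG[OF x] u] by simp
qed

lemma chi_P:
  assumes "x \<in> A" and u: "u \<in> carrier U"
  shows "chi x Q m (P i \<otimes> u) = chi (x \<otimes>\<^bsub>G\<^esub> c [^]\<^bsub>G\<^esub> i) Q (m + i) u"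
  using assms(1)
proof (induction i arbitrary: x m rule: int_induct[where k = 0])
  case base
  have "chi x Q m (p \<otimes> u) = chi x Q m (V x \<otimes> (p \<otimes> u))" using base u chi_V[OF AG AG, of x x] by simp
  also have "V x \<otimes> (p \<otimes> u) = V x \<otimes> u" using base u by (simp add: m_assoc[symmetric] p_V)
  also have "chi x Q m (V x \<otimes> u) = chi x Q m u" using base u chi_V[OF AG AG, of x x] by simp
  finally show ?case using AG[OF base] by (simp add: P_0)
next
  case (step1 i)
  have pw: "target x l \<otimes>\<^bsub>G\<^esub> c [^]\<^bsub>G\<^esub> i = x \<otimes>\<^bsub>G\<^esub> c [^]\<^bsub>G\<^esub> (i + 1)"
    using AG[OF step1.prems] G.int_pow_mult[OF cG, of 1 i] by (simp add: G.m_assoc G.int_pow_1 add.commute)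
  have "chi x Q m (P (i + 1) \<otimes> u) = chi x Q m (t \<otimes> (P i \<otimes> u))" using u by (simp add: P_succ m_assoc)
  also have "\<dots> = chi (target x l) Q (m + 1) (P i \<otimes> u)" using chi_t step1.prems u by simp
  also have "\<dots> = chi (x \<otimes>\<^bsub>G\<^esub> c [^]\<^bsub>G\<^esub> (i + 1)) Q (m + 1 + i) u"
    unfolding step1.IH[OF A_target[OF step1.prems]] pw ..
  finally show ?case by (simp add: add.assoc add.commute[of 1])
next
  case (step2 i)
  obtain y where y: "y \<in> A" "x = target y l" using A_source[OF step2.prems] .
  have pw: "y \<otimes>\<^bsub>G\<^esub> c [^]\<^bsub>G\<^esub> i = x \<otimes>\<^bsub>G\<^esub> c [^]\<^bsub>G\<^esub> (i - 1)"
    using AG[OF y(1)] G.int_pow_mult[OF cG, of 1 "i - 1"] by (simp add: y G.m_assoc G.int_pow_1)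
  have "chi x Q m (P (i - 1) \<otimes> u) = chi x Q m (t' \<otimes> (P i \<otimes> u))" using u by (simp add: P_pred m_assoc)
  also have "\<dots> = chi y Q (m - 1) (P i \<otimes> u)" using chi_t' y u by simp
  also have "\<dots> = chi (x \<otimes>\<^bsub>G\<^esub> c [^]\<^bsub>G\<^esub> (i - 1)) Q (m - 1 + i) u"
    unfolding step2.IH[OF y(1)] pw ..
  finally show ?case by (simp add: algebra_simps)
qed

abbreviation e where "e \<equiv> V \<one>\<^bsub>G\<^esub>"

text \<open>The degrees of closed walks at \<open>1\<close>. All multiples of \<open>n\<close>
  belong to it, and further ones if \<open>n\<close> is not the order of \<open>c\<close>.\<close>

definition Z :: "int set" where "Z = {i. c [^]\<^bsub>G\<^esub> i = \<one>\<^bsub>G\<^esub>}"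
definition T where "T i = e \<otimes> P i"

abbreviation psi where "psi \<equiv> chi \<one>\<^bsub>G\<^esub>"

lemma e_closed: "e \<in> carrier U" by simp
lemma e_idem: "e \<otimes> e = e" using V_V[OF G.one_closed G.one_closed] by simp
lemma T_closed [simp]: "T i \<in> carrier U" by (simp add: T_def)
lemma T_in_L: "T i \<in> L" unfolding T_def by (rule I_l_closed[OF P_in_L e_closed])
lemma T_0: "T 0 = e" unfolding T_def P_0 by (rule p_V(2)[OF one_A])

lemma T_e: "T i \<otimes> e = (if i \<in> Z then T i else \<zero>)"
proof -
  have ci: "c [^]\<^bsub>G\<^esub> i \<in> carrier G" by simp
  have eP: "e \<otimes> P i = P i \<otimes> V (c [^]\<^bsub>G\<^esub> i)" using V_P[OF one_A, of i] ci by (simp only: G.l_one)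
  have "T i \<otimes> e = P i \<otimes> (V (c [^]\<^bsub>G\<^esub> i) \<otimes> e)" unfolding T_def eP using VXY_closed(1)[OF ci] by (simp add: m_assoc)
  also have "\<dots> = (if i \<in> Z then P i \<otimes> e else \<zero>)" using V_V[OF ci G.one_closed] by (simp add: Z_def)
  also have "\<dots> = (if i \<in> Z then T i else \<zero>)" by (simp add: T_def eP Z_def)
  finally show ?thesis .
qed

lemma T_mult: "i \<in> Z \<Longrightarrow> T i \<otimes> T j = T (i + j)"
proof -
  assume i: "i \<in> Z"
  have "T i \<otimes> T j = (T i \<otimes> e) \<otimes> P j" unfolding T_def[of j] by (simp add: m_assoc)
  also have "\<dots> = e \<otimes> (P i \<otimes> P j)" unfolding T_e using i by (simp add: T_def m_assoc)
  finally show ?thesis by (simp add: T_def P_add)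
qed

lemma psi_T_mult: "i \<in> Z \<Longrightarrow> u \<in> carrier U \<Longrightarrow> psi Q m (T i \<otimes> u) = psi Q (m + i) u"
  using chi_V[OF G.one_closed G.one_closed, of "P i \<otimes> u"] chi_P[OF one_A, of u]
  by (simp add: T_def m_assoc Z_def)

lemma psi_T: "i \<in> Z \<Longrightarrow> psi Q m (T i) = (if Q (m + i) then \<one>\<^bsub>K\<^esub> else \<zero>\<^bsub>K\<^esub>)"
  using psi_T_mult[of i e Q m] chi_V_self[OF G.one_closed] by (simp add: T_e)

lemma Z_mult_n: "int n dvd i \<Longrightarrow> i \<in> Z"
proof -
  assume "int n dvd i"
  then obtain k where "i = int n * k" by (elim dvdE)
  then have "c [^]\<^bsub>G\<^esub> i = (c [^]\<^bsub>G\<^esub> int n) [^]\<^bsub>G\<^esub> k" using G.int_pow_pow[OF cG, of "int n" k] by simp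
  then show ?thesis using n(2) by (simp add: int_pow_int Z_def)
qed

lemma psi_finsum:
  assumes "finite B" "\<And>i. i \<in> B \<Longrightarrow> a i \<in> carrier K" "\<And>i. i \<in> B \<Longrightarrow> f i \<in> carrier U"
  shows "psi Q m (\<Oplus>i\<in>B. sc (a i) \<otimes> f i) = (\<Oplus>\<^bsub>K\<^esub>i\<in>B. a i \<otimes>\<^bsub>K\<^esub> psi Q m (f i))"
  using assms
proof (induction B)
  case (insert i B)
  have "(\<Oplus>i\<in>B. sc (a i) \<otimes> f i) \<in> carrier U" using insert.prems by (intro finsum_closed) auto
  then show ?case using insert by (simp add: chi_add chi_sc Pi_def)
qed (simp add: chi_zero)

text \<open>Starting in degree \<open>- i\<close> and testing for \<open>0\<close> reads off the
  coefficient of \<open>T i\<close>.\<close>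

abbreviation coef :: "_ \<Rightarrow> int \<Rightarrow> 'c"
  where "coef u i \<equiv> psi (\<lambda>j. j = 0) (- i) u"

lemma coef_closed: "u \<in> carrier U \<Longrightarrow> coef u i \<in> carrier K" by simp

text \<open>The expansion is claimed over every finite set of exponents that contains
  \<open>B\<close>, so that two expansions can be added over a common set. By
  \<open>corner_word\<close> each word contributes a single \<open>T j\<close> or nothing.\<close>

lemma corner_expansion_aux:
  assumes "u \<in> carrier U"
  shows "\<exists>B. finite B \<and> B \<subseteq> Z \<and> (\<forall>C. finite C \<longrightarrow> B \<subseteq> C \<longrightarrow> C \<subseteq> Z \<longrightarrow>
    e \<otimes> u \<otimes> e = (\<Oplus>i\<in>C. sc (coef (e \<otimes> u \<otimes> e) i) \<otimes> T i))"
  using assms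
proof (induction rule: U_induct)
  case zero
  have "(\<Oplus>i\<in>C. sc (coef \<zero> i) \<otimes> T i) = \<zero>" for C
    using finsum_cong'[of C C "\<lambda>_. \<zero>" "\<lambda>i. sc (coef \<zero> i) \<otimes> T i"] by (simp add: chi_zero sc_zero)
  then show ?case by (intro exI[of _ "{}"]) simp
next
  case (add k w v)
  define v' where "v' = e \<otimes> v \<otimes> e"
  have v'c: "v' \<in> carrier U" using add by (simp add: v'_def)
  obtain B where B: "finite B" "B \<subseteq> Z"
    "\<And>C. finite C \<Longrightarrow> B \<subseteq> C \<Longrightarrow> C \<subseteq> Z \<Longrightarrow> v' = (\<Oplus>i\<in>C. sc (coef v' i) \<otimes> T i)"
    using add.IH unfolding v'_def by blast
  have wc: "wd w \<in> carrier U" "sc k \<in> carrier U" using add by auto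
  have split: "e \<otimes> (sc k \<otimes> wd w \<oplus> v) \<otimes> e = sc k \<otimes> (e \<otimes> wd w \<otimes> e) \<oplus> v'"
  proof -
    have "e \<otimes> (sc k \<otimes> wd w) = sc k \<otimes> (e \<otimes> wd w)"
      using wc sc_central[OF e_closed add(1)] by (simp add: m_assoc[symmetric])
    then show ?thesis using wc add by (simp add: v'_def r_distr l_distr m_assoc)
  qed
  have "e \<otimes> wd w \<otimes> e = \<zero> \<or> (\<exists>j\<in>Z. e \<otimes> wd w \<otimes> e = T j)"
  proof -
    have "e \<otimes> wd w \<otimes> e = (e \<otimes> wd w \<otimes> p) \<otimes> e" using wc p_V(1)[OF one_A] by (simp add: m_assoc)
    moreover have "e \<otimes> wd w \<otimes> p = \<zero> \<or> (\<exists>j. e \<otimes> wd w \<otimes> p = T j)"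
      using corner_word[OF add(2) one_A] by (simp add: T_def)
    ultimately show ?thesis using T_e by (auto split: if_splits)
  qed
  then show ?case
  proof
    assume "e \<otimes> wd w \<otimes> e = \<zero>"
    then have "e \<otimes> (sc k \<otimes> wd w \<oplus> v) \<otimes> e = v'" unfolding split using wc v'c by simp
    then show ?thesis using B by auto
  next
    assume "\<exists>j\<in>Z. e \<otimes> wd w \<otimes> e = T j"
    then obtain j where j: "j \<in> Z" "e \<otimes> wd w \<otimes> e = T j" by blast
    define f where "f = sc k \<otimes> T j \<oplus> v'"
    have f: "e \<otimes> (sc k \<otimes> wd w \<oplus> v) \<otimes> e = f" unfolding split f_def j(2) ..
    have coef_f: "coef f i = (if j = i then k else \<zero>\<^bsub>K\<^esub>) \<oplus>\<^bsub>K\<^esub> coef v' i" for i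
      unfolding f_def using wc v'c add(1) psi_T[OF j(1)] by (simp add: chi_add chi_sc)
    have "f = (\<Oplus>i\<in>C. sc (coef f i) \<otimes> T i)" if C: "finite C" "insert j B \<subseteq> C" "C \<subseteq> Z" for C
    proof -
      have "(\<Oplus>i\<in>C. sc (coef f i) \<otimes> T i) = (\<Oplus>i\<in>C. (if j = i then sc k \<otimes> T i else \<zero>) \<oplus> sc (coef v' i) \<otimes> T i)"
      proof (rule finsum_cong')
        fix i
        have "sc (coef f i) = sc (if j = i then k else \<zero>\<^bsub>K\<^esub>) \<oplus> sc (coef v' i)"
          unfolding coef_f using v'c add(1) by (intro sc_add) auto
        then show "sc (coef f i) \<otimes> T i = (if j = i then sc k \<otimes> T i else \<zero>) \<oplus> sc (coef v' i) \<otimes> T i"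
          using v'c wc by (simp add: l_distr sc_zero)
      qed (use v'c wc in auto)
      also have "\<dots> = (\<Oplus>i\<in>C. if j = i then sc k \<otimes> T i else \<zero>) \<oplus> (\<Oplus>i\<in>C. sc (coef v' i) \<otimes> T i)"
        using v'c wc by (intro finsum_addf) auto
      also have "(\<Oplus>i\<in>C. if j = i then sc k \<otimes> T i else \<zero>) = sc k \<otimes> T j"
        using C wc by (intro finsum_singleton[where f = "\<lambda>i. sc k \<otimes> T i"]) auto
      also have "(\<Oplus>i\<in>C. sc (coef v' i) \<otimes> T i) = v'" using B(3)[OF C(1)] C by simp
      finally show ?thesis by (simp add: f_def)
    qed
    then show ?thesis unfolding f using B j(1) by (intro exI[of _ "insert j B"]) auto
  qed
qed

lemma corner_expansion:
  assumes u: "u \<in> carrier U" "e \<otimes> u \<otimes> e = u"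
  shows "finite {i. coef u i \<noteq> \<zero>\<^bsub>K\<^esub>}" "{i. coef u i \<noteq> \<zero>\<^bsub>K\<^esub>} \<subseteq> Z"
    "u = (\<Oplus>i\<in>{i. coef u i \<noteq> \<zero>\<^bsub>K\<^esub>}. sc (coef u i) \<otimes> T i)"
proof -
  obtain B where B: "finite B" "B \<subseteq> Z" and BC: "\<forall>C. finite C \<longrightarrow> B \<subseteq> C \<longrightarrow> C \<subseteq> Z \<longrightarrow>
      u = (\<Oplus>i\<in>C. sc (coef u i) \<otimes> T i)"
    using corner_expansion_aux[OF u(1)] unfolding u(2) by (elim exE conjE)
  have B3: "u = (\<Oplus>i\<in>B. sc (coef u i) \<otimes> T i)" by (rule BC[rule_format, OF B(1) order_refl B(2)])
  have "coef u m = \<zero>\<^bsub>K\<^esub>" if m: "m \<notin> B" for m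
  proof -
    have "coef u m = psi (\<lambda>j. j = 0) (- m) (\<Oplus>i\<in>B. sc (coef u i) \<otimes> T i)"
      by (rule arg_cong[OF B3, of "psi (\<lambda>j. j = 0) (- m)"])
    also have "\<dots> = (\<Oplus>\<^bsub>K\<^esub>i\<in>B. coef u i \<otimes>\<^bsub>K\<^esub> psi (\<lambda>j. j = 0) (- m) (T i))"
      by (rule psi_finsum[OF B(1)]) (use u(1) in auto)
    also have "\<dots> = (\<Oplus>\<^bsub>K\<^esub>i\<in>B. \<zero>\<^bsub>K\<^esub>)"
    proof (rule K.finsum_cong')
      fix i assume i: "i \<in> B"
      then have "psi (\<lambda>j. j = 0) (- m) (T i) = \<zero>\<^bsub>K\<^esub>" using psi_T[of i] B(2) m by auto
      then show "coef u i \<otimes>\<^bsub>K\<^esub> psi (\<lambda>j. j = 0) (- m) (T i) = \<zero>\<^bsub>K\<^esub>" using u(1) by simp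
    qed auto
    finally show ?thesis by simp
  qed
  then have sub: "{i. coef u i \<noteq> \<zero>\<^bsub>K\<^esub>} \<subseteq> B" by blast
  show "finite {i. coef u i \<noteq> \<zero>\<^bsub>K\<^esub>}" "{i. coef u i \<noteq> \<zero>\<^bsub>K\<^esub>} \<subseteq> Z"
    using sub B finite_subset by blast+
  have "(\<Oplus>i\<in>B. sc (coef u i) \<otimes> T i) = (\<Oplus>i\<in>{i. coef u i \<noteq> \<zero>\<^bsub>K\<^esub>}. sc (coef u i) \<otimes> T i)"
    by (rule add.finprod_mono_neutral_cong_right[OF B(1) sub]) (use u(1) in \<open>auto simp: sc_zero\<close>)
  then show "u = (\<Oplus>i\<in>{i. coef u i \<noteq> \<zero>\<^bsub>K\<^esub>}. sc (coef u i) \<otimes> T i)" by (rule trans[OF B3])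
qed

text \<open>\<open>ext\<close> says that degree \<open>i + j\<close> arises from the two supports in
  one way only. Nothing can cancel, and the coefficient is a product of two nonzero elements of a
  field.\<close>

lemma coef_mult_extreme:
  assumes f: "f \<in> carrier U" "e \<otimes> f \<otimes> e = f" and g: "g \<in> carrier U"
    and i: "coef f i \<noteq> \<zero>\<^bsub>K\<^esub>" and j: "coef g j \<noteq> \<zero>\<^bsub>K\<^esub>"
    and ext: "\<And>k. coef f k \<noteq> \<zero>\<^bsub>K\<^esub> \<Longrightarrow> k \<noteq> i \<Longrightarrow> coef g (i + j - k) = \<zero>\<^bsub>K\<^esub>"
  shows "coef (f \<otimes> g) (i + j) \<noteq> \<zero>\<^bsub>K\<^esub>"
proof -
  let ?B = "{i. coef f i \<noteq> \<zero>\<^bsub>K\<^esub>}"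
  note B = corner_expansion[OF f]
  have "f \<otimes> g = (\<Oplus>k\<in>?B. sc (coef f k) \<otimes> T k) \<otimes> g"
    by (rule arg_cong[OF B(3), of "\<lambda>u. u \<otimes> g"])
  also have "\<dots> = (\<Oplus>k\<in>?B. sc (coef f k) \<otimes> T k \<otimes> g)"
    using f(1) g by (intro finsum_ldistr[OF B(1)]) auto
  also have "\<dots> = (\<Oplus>k\<in>?B. sc (coef f k) \<otimes> (T k \<otimes> g))"
    using f(1) g by (intro finsum_cong') (auto simp: m_assoc)
  finally have "coef (f \<otimes> g) (i + j) = psi (\<lambda>j. j = 0) (- (i + j)) (\<Oplus>k\<in>?B. sc (coef f k) \<otimes> (T k \<otimes> g))"
    by (rule arg_cong[where f = "psi (\<lambda>j. j = 0) (- (i + j))"])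
  also have "\<dots> = (\<Oplus>\<^bsub>K\<^esub>k\<in>?B. coef f k \<otimes>\<^bsub>K\<^esub> psi (\<lambda>j. j = 0) (- (i + j)) (T k \<otimes> g))"
    by (rule psi_finsum[OF B(1)]) (use f(1) g in auto)
  also have "\<dots> = (\<Oplus>\<^bsub>K\<^esub>k\<in>?B. if i = k then coef f k \<otimes>\<^bsub>K\<^esub> coef g j else \<zero>\<^bsub>K\<^esub>)"
  proof (rule K.finsum_cong')
    fix k assume k: "k \<in> ?B"
    then have "psi (\<lambda>j. j = 0) (- (i + j)) (T k \<otimes> g) = coef g (i + j - k)"
      using psi_T_mult[of k g "\<lambda>j. j = 0" "- (i + j)"] B(2) g by (auto simp: algebra_simps)
    then show "coef f k \<otimes>\<^bsub>K\<^esub> psi (\<lambda>j. j = 0) (- (i + j)) (T k \<otimes> g) = (if i = k then coef f k \<otimes>\<^bsub>K\<^esub> coef g j else \<zero>\<^bsub>K\<^esub>)"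
      using ext[of k] k f(1) by auto
  qed (use f(1) g in auto)
  also have "\<dots> = coef f i \<otimes>\<^bsub>K\<^esub> coef g j"
    by (rule K.finsum_singleton[where f = "\<lambda>k. coef f k \<otimes>\<^bsub>K\<^esub> coef g j"]) (use B(1) i f(1) g in auto)
  finally have "coef (f \<otimes> g) (i + j) = coef f i \<otimes>\<^bsub>K\<^esub> coef g j" .
  then show ?thesis
    using K.integral[of "coef f i" "coef g j"] coef_closed[OF f(1)] coef_closed[OF g] i j by metis
qed

text \<open>As for Laurent polynomials, highest degrees add and lowest degrees add. Since the
  product \<open>e\<close> lives in degree \<open>0\<close> alone, the highest and the lowest degree
  of \<open>f\<close> coincide.\<close>

lemma corner_unit_monomial:
  assumes f: "f \<in> carrier U" "e \<otimes> f \<otimes> e = f" and g: "g \<in> carrier U" "e \<otimes> g \<otimes> e = g"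
    and fg: "f \<otimes> g = e"
  shows "\<exists>j\<in>Z. \<exists>k\<in>carrier K. f = sc k \<otimes> T j"
proof -
  let ?B = "{i. coef f i \<noteq> \<zero>\<^bsub>K\<^esub>}" and ?C = "{i. coef g i \<noteq> \<zero>\<^bsub>K\<^esub>}"
  note B = corner_expansion[OF f] and C = corner_expansion[OF g]
  have e0: "e \<noteq> \<zero>" by (rule V_nonzero) simp
  have ne: "?B \<noteq> {}" "?C \<noteq> {}"
  proof -
    have "f \<noteq> \<zero>"
    proof
      assume "f = \<zero>"
      have "e = \<zero>" unfolding fg[symmetric] \<open>f = \<zero>\<close> by (rule l_null[OF g(1)])
      then show False using e0 by (rule notE[rotated])
    qed
    moreover have "g \<noteq> \<zero>"
    proof
      assume "g = \<zero>"
      have "e = \<zero>" unfolding fg[symmetric] \<open>g = \<zero>\<close> by (rule r_null[OF f(1)])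
      then show False using e0 by (rule notE[rotated])
    qed
    moreover have "f = \<zero>" if "?B = {}" using B(3) unfolding that finsum_empty .
    moreover have "g = \<zero>" if "?C = {}" using C(3) unfolding that finsum_empty .
    ultimately show "?B \<noteq> {}" "?C \<noteq> {}" by blast+
  qed
  have e_coef: "m = 0" if "coef e m \<noteq> \<zero>\<^bsub>K\<^esub>" for m
    using that chi_V_self[OF G.one_closed] by (auto split: if_splits)
  have mm: "Max ?B \<in> ?B" "Max ?C \<in> ?C" "Min ?B \<in> ?B" "Min ?C \<in> ?C"
    using Max_in[OF B(1) ne(1)] Max_in[OF C(1) ne(2)] Min_in[OF B(1) ne(1)] Min_in[OF C(1) ne(2)] by blast+
  have le: "Min ?B \<le> k" "k \<le> Max ?B" if "coef f k \<noteq> \<zero>\<^bsub>K\<^esub>" for k using that B(1) by auto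
  have leC: "Min ?C \<le> k" "k \<le> Max ?C" if "coef g k \<noteq> \<zero>\<^bsub>K\<^esub>" for k using that C(1) by auto
  have "coef (f \<otimes> g) (Max ?B + Max ?C) \<noteq> \<zero>\<^bsub>K\<^esub>"
  proof (rule coef_mult_extreme[OF f g(1)])
    fix k assume k: "coef f k \<noteq> \<zero>\<^bsub>K\<^esub>" "k \<noteq> Max ?B"
    then show "coef g (Max ?B + Max ?C - k) = \<zero>\<^bsub>K\<^esub>"
      using le(2)[OF k(1)] leC(2)[of "Max ?B + Max ?C - k"] by linarith
  qed (use mm in blast)+
  then have 1: "Max ?B + Max ?C = 0" unfolding fg by (rule e_coef)
  have "coef (f \<otimes> g) (Min ?B + Min ?C) \<noteq> \<zero>\<^bsub>K\<^esub>"
  proof (rule coef_mult_extreme[OF f g(1)])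
    fix k assume k: "coef f k \<noteq> \<zero>\<^bsub>K\<^esub>" "k \<noteq> Min ?B"
    then show "coef g (Min ?B + Min ?C - k) = \<zero>\<^bsub>K\<^esub>"
      using le(1)[OF k(1)] leC(1)[of "Min ?B + Min ?C - k"] by linarith
  qed (use mm in blast)+
  then have 2: "Min ?B + Min ?C = 0" unfolding fg by (rule e_coef)
  have "Min ?B \<le> Max ?B" "Min ?C \<le> Max ?C" using le(1)[of "Max ?B"] leC(1)[of "Max ?C"] mm by blast+
  then have "Min ?B = Max ?B" using 1 2 by linarith
  define m where "m = Max ?B"
  have uniq: "k = m" if "coef f k \<noteq> \<zero>\<^bsub>K\<^esub>" for k
    using le[OF that] \<open>Min ?B = Max ?B\<close> unfolding m_def by linarith
  have m: "?B = {m}"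
  proof
    show "{m} \<subseteq> ?B" using mm(1) unfolding m_def by simp
    show "?B \<subseteq> {m}"
    proof
      fix k assume "k \<in> ?B"
      then have "coef f k \<noteq> \<zero>\<^bsub>K\<^esub>" by (rule CollectD)
      then have "k = m" by (rule uniq)
      then show "k \<in> {m}" by (rule singleton_iff[THEN iffD2])
    qed
  qed
  have "f = (\<Oplus>i\<in>{m}. sc (coef f i) \<otimes> T i)" using B(3) unfolding m .
  also have "\<dots> = sc (coef f m) \<otimes> T m" using f(1) by simp
  finally have "f = sc (coef f m) \<otimes> T m" .
  moreover have "m \<in> Z" using B(2) unfolding m by blast
  moreover have "coef f m \<in> carrier K" using f(1) by simp
  ultimately show ?thesis by (intro bexI[of _ m] bexI[of _ "coef f m"])
qed

end

context one_label_corner_one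
begin

text \<open>A shortening would turn \<open>(1 + z) + b u\<close> into a unit of the corner at
  \<open>e\<close>, hence into a monomial. Coefficients are summed over residue classes of degrees:
  the multiple \<open>b u\<close> contributes the same amount to each of five classes, whereas
  \<open>1 + z\<close> occupies two of them and a monomial at most one.\<close>

theorem not_stable_range_1: "\<not> stable_range U L 1"
proof
  assume sr: "stable_range U L 1"
  define z where "z k = T (int n * k)" for k :: int
  have zZ: "int n * k \<in> Z" for k by (rule Z_mult_n) simp
  have zc [simp]: "z k \<in> carrier U" for k by (simp add: z_def)
  have zL: "z k \<in> L" for k unfolding z_def by (rule T_in_L)
  have zm: "z i \<otimes> z k = z (i + k)" for i k unfolding z_def T_mult[OF zZ] by (simp add: algebra_simps)
  have z0: "z 0 = e" by (simp add: z_def T_0)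
  define q where "q = \<one> \<ominus> e"
  have qc [simp]: "q \<in> carrier U" by (simp add: q_def)
  have qz: "q \<otimes> z k = \<zero>" "z k \<otimes> q = \<zero>" for k
  proof -
    have "e \<otimes> z k = z k" "z k \<otimes> e = z k" using zm[of 0 k] zm[of k 0] by (simp_all add: z0)
    then show "q \<otimes> z k = \<zero>" "z k \<otimes> q = \<zero>"
      by (simp_all add: q_def a_minus_def l_distr l_minus r_distr r_minus r_neg)
  qed
  have one: "q \<oplus> z 0 = \<one>" by (simp add: q_def z0 a_minus_def a_assoc l_neg)
  have qq: "q \<otimes> q = q"
  proof -
    have "q \<otimes> q = q \<otimes> q \<oplus> q \<otimes> z 0" by (simp add: qz)
    also have "\<dots> = q \<otimes> (q \<oplus> z 0)" by (simp add: r_distr)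
    finally show ?thesis by (simp add: one)
  qed
  define b where "b = z 0 \<oplus> z 1 \<oplus> z 2 \<oplus> z 3 \<oplus> z 4"
  \<comment> \<open>The row is unimodular since \<open>(1 + z) (z^-5 + z^-3 + z^-1) = 1 + z^-5 (1 +
    z + z^2 + z^3 + z^4)\<close>.\<close>
  define v where "v = z (- 5) \<oplus> z (- 3) \<oplus> z (- 1)"
  \<comment> \<open>With \<open>q = 1 - e\<close> this is \<open>q + (z 0 + z 1)\<close>: the
    element \<open>1 + z\<close> of the corner, completed by the unit of its complement. The same
    completion turns \<open>v\<close> into \<open>x\<close>.\<close>
  define a where "a = z 1 \<oplus> \<one>"
  define x where "x = (v \<ominus> e) \<oplus> \<one>"
  define y where "y = \<ominus> (z (- 5))"
  have c: "a \<in> carrier U" "b \<in> carrier U" "v \<in> carrier U" "x \<in> carrier U" "y \<in> carrier U"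
    by (simp_all add: a_def b_def v_def x_def y_def)
  have Ladd: "s \<oplus> t \<in> L" if "s \<in> L" "t \<in> L" for s t
    by (rule additive_subgroup.a_closed[OF is_additive_subgroup that])
  have Lneg: "\<ominus> s \<in> L" if "s \<in> L" for s
    by (rule additive_subgroup.a_inv_closed[OF is_additive_subgroup that])
  have eL: "e \<in> L" using zL[of 0] by (simp only: z0)
  have plus1: "(s \<oplus> \<one>) \<ominus> \<one> = s" if "s \<in> carrier U" for s
    using that by (simp add: a_minus_def a_assoc r_neg)
  have bL: "b \<in> L" unfolding b_def by (intro Ladd zL)
  have yL: "y \<in> L" unfolding y_def by (intro Lneg zL)
  have aL: "a \<ominus> \<one> \<in> L" unfolding a_def plus1[OF zc] by (rule zL)
  have ve: "v \<ominus> e \<in> L" unfolding a_minus_def v_def by (intro Ladd Lneg zL eL)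
  have xL: "x \<ominus> \<one> \<in> L"
  proof -
    have "v \<ominus> e \<in> carrier U" using c by simp
    then show ?thesis unfolding x_def using plus1[of "v \<ominus> e"] ve by (simp only:)
  qed
  have a_eq: "a = q \<oplus> (z 0 \<oplus> z 1)"
  proof -
    have "a = z 1 \<oplus> (q \<oplus> z 0)" by (simp only: a_def one)
    then show ?thesis by (simp add: a_ac)
  qed
  have x_eq: "x = q \<oplus> v" unfolding x_def q_def a_minus_def using c by (simp add: a_ac)
  define w' where "w' = z (- 5) \<oplus> z (- 4) \<oplus> z (- 3) \<oplus> z (- 2) \<oplus> z (- 1)"
  have w'c: "w' \<in> carrier U" by (simp add: w'_def)
  have "a \<otimes> x = (q \<oplus> z 0) \<oplus> w'"
    unfolding a_eq x_eq v_def w'_def by (simp add: l_distr r_distr qz qq zm a_ac)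
  moreover have "b \<otimes> z (- 5) = w'"
    unfolding b_def w'_def by (simp add: l_distr zm a_ac)
  then have "b \<otimes> y = \<ominus> w'" unfolding y_def using c by (simp add: r_minus)
  ultimately have eq: "a \<otimes> x \<oplus> b \<otimes> y = \<one>" using w'c by (simp add: one a_assoc r_neg)
  obtain r w where rw: "r \<in> L" "w \<in> carrier U" "(a \<oplus> b \<otimes> r) \<otimes> w = \<one>"
    using stable_range_1D[OF sr c(1) aL bL c(4) xL yL eq] by blast
  have rc: "r \<in> carrier U" using rw(1) a_subset by blast
  define M where "M = a \<oplus> b \<otimes> r"
  have Mc: "M \<in> carrier U" using c rc by (simp add: M_def)
  have qM: "q \<otimes> M = q"
  proof -
    have "q \<otimes> b = \<zero>" by (simp add: b_def r_distr qz)
    then have "q \<otimes> (b \<otimes> r) = \<zero>" using c rc by (simp add: m_assoc[symmetric])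
    moreover have "q \<otimes> a = q" unfolding a_eq by (simp add: r_distr qz qq)
    ultimately show ?thesis using c rc by (simp add: M_def r_distr)
  qed
  have "q \<otimes> w = (q \<otimes> M) \<otimes> w" by (simp only: qM)
  also have "\<dots> = q \<otimes> (M \<otimes> w)" using Mc rw(2) by (simp add: m_assoc)
  also have "\<dots> = q" unfolding M_def rw(3) by simp
  finally have qw: "q \<otimes> w = q" .
  \<comment> \<open>From \<open>q w = q\<close> it follows that \<open>q w e = 0\<close>, so
    \<open>w\<close> is triangular with respect to \<open>e\<close> and \<open>q\<close>.
    Compressing \<open>M\<close> and \<open>w\<close> by \<open>e\<close> then preserves their
    product.\<close>
  have we: "w \<otimes> e = e \<otimes> w \<otimes> e"
  proof -
    have "w \<otimes> e = ((q \<oplus> z 0) \<otimes> w) \<otimes> e" unfolding one using rw(2) by simp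
    also have "\<dots> = (q \<otimes> w) \<otimes> e \<oplus> z 0 \<otimes> w \<otimes> e" using rw(2) by (simp add: l_distr)
    also have "(q \<otimes> w) \<otimes> e = \<zero>" unfolding qw using qz(1)[of 0] by (simp only: z0)
    finally show ?thesis using rw(2) by (simp add: z0)
  qed
  define f where "f = e \<otimes> M \<otimes> e"
  define g where "g = e \<otimes> w \<otimes> e"
  have fgc: "f \<in> carrier U" "g \<in> carrier U" using Mc rw(2) by (simp_all add: f_def g_def)
  have ee: "e \<otimes> (e \<otimes> s) = e \<otimes> s" if "s \<in> carrier U" for s
    using that by (simp add: m_assoc[symmetric] e_idem)
  have fe: "e \<otimes> f \<otimes> e = f" "e \<otimes> g \<otimes> e = g"
    unfolding f_def g_def using Mc rw(2) by (simp_all add: m_assoc ee e_idem)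
  have "f \<otimes> g = e \<otimes> M \<otimes> (e \<otimes> (e \<otimes> w \<otimes> e))" unfolding f_def g_def using Mc rw(2) by (simp add: m_assoc)
  also have "e \<otimes> (e \<otimes> w \<otimes> e) = w \<otimes> e" using we rw(2) by (simp add: m_assoc ee)
  also have "e \<otimes> M \<otimes> (w \<otimes> e) = e \<otimes> (M \<otimes> w) \<otimes> e" using Mc rw(2) by (simp add: m_assoc)
  also have "\<dots> = e" unfolding M_def rw(3) by (simp add: e_idem)
  finally have fg: "f \<otimes> g = e" .
  obtain j k where jk: "j \<in> Z" "k \<in> carrier K" "f = sc k \<otimes> T j"
    using corner_unit_monomial[OF fgc(1) fe(1) fgc(2) fe(2) fg] by blast
  define u where "u = r \<otimes> e"
  have uc: "u \<in> carrier U" using rc by (simp add: u_def)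
  have f_eq: "f = (z 0 \<oplus> z 1) \<oplus> b \<otimes> u"
  proof -
    have 1: "e \<otimes> a = z 0 \<oplus> z 1" unfolding a_eq z0[symmetric] by (simp add: r_distr qz zm)
    have 2: "(z 0 \<oplus> z 1) \<otimes> e = z 0 \<oplus> z 1" unfolding z0[symmetric] by (simp add: l_distr zm)
    have 3: "e \<otimes> b = b" unfolding b_def z0[symmetric] by (simp add: r_distr zm)
    have "f = (e \<otimes> a) \<otimes> e \<oplus> (e \<otimes> b) \<otimes> (r \<otimes> e)"
      unfolding f_def M_def using c rc by (simp add: l_distr r_distr m_assoc)
    then show ?thesis by (simp only: 1 2 3 u_def)
  qed
  \<comment> \<open>The element \<open>z\<close> has degree \<open>n\<close>, so residues modulo
    \<open>5\<close> of its exponents correspond to degrees modulo \<open>5 n\<close>.\<close>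
  define Q where "Q i \<longleftrightarrow> int n * 5 dvd i" for i
  define h where "h s = psi Q (int n * s) u" for s
  have hc: "h s \<in> carrier K" for s using uc by (simp add: h_def)
  have h5: "h (s + 5) = h s" for s
  proof -
    have "(\<lambda>i. Q (i + int n * 5)) = Q" by (simp add: Q_def fun_eq_iff dvd_add_left_iff)
    then show ?thesis using chi_shift[of "\<one>\<^bsub>G\<^esub>" Q "int n * s" "int n * 5" u] by (simp add: h_def algebra_simps)
  qed
  have hz: "psi Q (int n * s) (z i \<otimes> u) = h (s + i)" for s i
    unfolding z_def h_def psi_T_mult[OF zZ uc] by (simp add: algebra_simps)
  define \<beta> where "\<beta> s = psi Q (int n * s) (b \<otimes> u)" for s
  have \<beta>: "\<beta> s = h s \<oplus>\<^bsub>K\<^esub> h (s + 1) \<oplus>\<^bsub>K\<^esub> h (s + 2) \<oplus>\<^bsub>K\<^esub> h (s + 3) \<oplus>\<^bsub>K\<^esub> h (s + 4)" for s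
    unfolding \<beta>_def b_def using uc by (simp add: l_distr chi_add hz)
  have \<beta>c: "\<beta> s \<in> carrier K" for s using hc by (simp add: \<beta>)
  \<comment> \<open>Five consecutive values of the 5-periodic \<open>h\<close> run through all
    classes, so their sum \<open>\<beta> s\<close> does not depend on \<open>s\<close>.\<close>
  have \<beta>1: "\<beta> (s + 1) = \<beta> s" for s
  proof -
    have "\<beta> (s + 1) = h (s + 1) \<oplus>\<^bsub>K\<^esub> h (s + 2) \<oplus>\<^bsub>K\<^esub> h (s + 3) \<oplus>\<^bsub>K\<^esub> h (s + 4) \<oplus>\<^bsub>K\<^esub> h (s + 5)"
      unfolding \<beta> by (simp add: add.assoc)
    then show ?thesis unfolding h5 \<beta> using hc by (simp add: K.a_ac)
  qed
  have \<beta>s: "\<beta> 1 = \<beta> 0" "\<beta> 2 = \<beta> 0" "\<beta> 4 = \<beta> 0"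
    using \<beta>1[of 0] \<beta>1[of 1] \<beta>1[of 2] \<beta>1[of 3] by simp_all
  define d where "d s \<longleftrightarrow> Q (int n * s + j)" for s
  define ind where "ind P = (if P then \<one>\<^bsub>K\<^esub> else \<zero>\<^bsub>K\<^esub>)" for P
  have ind_c: "ind P \<in> carrier K" for P by (simp add: ind_def)
  have key: "k \<otimes>\<^bsub>K\<^esub> ind (d s) = (ind (5 dvd s) \<oplus>\<^bsub>K\<^esub> ind (5 dvd s + 1)) \<oplus>\<^bsub>K\<^esub> \<beta> s" for s
  proof -
    have Qs: "Q (int n * i) \<longleftrightarrow> 5 dvd i" for i using n(1) by (simp add: Q_def)
    have pz: "psi Q (int n * s) (z i) = ind (5 dvd s + i)" for i
      using psi_T[OF zZ[of i], of Q "int n * s"] Qs[of "s + i"] by (simp add: z_def ind_def algebra_simps)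
    have "psi Q (int n * s) f = k \<otimes>\<^bsub>K\<^esub> ind (d s)"
      unfolding jk(3) d_def ind_def using jk(1,2) by (simp add: chi_sc psi_T)
    moreover have "psi Q (int n * s) f = (ind (5 dvd s) \<oplus>\<^bsub>K\<^esub> ind (5 dvd s + 1)) \<oplus>\<^bsub>K\<^esub> \<beta> s"
      unfolding f_eq using uc c pz[of 0] pz[of 1] by (simp add: chi_add \<beta>_def)
    ultimately show ?thesis by simp
  qed
  have dd: "5 dvd s - s'" if "d s" "d s'" for s s'
  proof -
    have "int n * 5 dvd (int n * s + j) - (int n * s' + j)"
      using that unfolding d_def Q_def by (rule dvd_diff)
    then have "int n * 5 dvd int n * (s - s')" by (simp add: algebra_simps)
    then show ?thesis using n(1) by simp
  qed
  \<comment> \<open>Neither \<open>s = 1\<close> nor \<open>s = 2\<close> sees \<open>1 + z\<close>,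
    and by \<open>dd\<close> the monomial is missed by at least one of them. There only the common
    value of \<open>\<beta>\<close> is left.\<close>
  have "\<beta> 0 = \<zero>\<^bsub>K\<^esub>"
  proof (cases "d 1")
    case False
    then show ?thesis using key[of 1] jk(2) \<beta>c[of 0] by (simp add: ind_def \<beta>s)
  next
    case True
    then have "\<not> d 2" using dd[of 2 1] by auto
    then show ?thesis using key[of 2] jk(2) \<beta>c[of 0] by (simp add: ind_def \<beta>s)
  qed
  \<comment> \<open>The terms \<open>1\<close> and \<open>z\<close> are seen at \<open>s = 0\<close>
    and \<open>s = 4\<close>. With \<open>\<beta>\<close> zero, the monomial would have to be seen
    at both.\<close>
  then have "d 0" "d 4"
    using key[of 0] key[of 4] jk(2) K.one_not_zero by (auto simp: ind_def \<beta>s split: if_splits)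
  then show False using dd[of 4 0] by simp
qed

end

section \<open>Counting labels, and the case distinction\<close>

context hopf_leavitt
begin

theorem not_stable_range_1_of_one_label:
  assumes lab: "labels = {l}" and one: "\<one>\<^bsub>G\<^esub> \<in> S"
  shows "\<not> stable_range U L 1"
proof -
  obtain n :: nat where n: "n > 0" "fst l [^]\<^bsub>G\<^esub> n = \<one>\<^bsub>G\<^esub>" "finite S"
    using one_label_finite_order[OF lab one] by blast
  note sub = finite_subgroup[OF one n(3)]
  have lS: "fst l \<in> S" "fst l \<in> carrier G"
    using lab label_closed[of l] unfolding S_eq by (auto intro: subsemigroup_generated.incl)
  have closed: "target y l \<in> S \<longleftrightarrow> y \<in> S" if y: "y \<in> carrier G" for y
  proof
    assume t: "target y l \<in> S"
    have "y = target y l \<otimes>\<^bsub>G\<^esub> inv\<^bsub>G\<^esub> fst l" using y lS by (simp add: G.m_assoc)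
    then show "y \<in> S" using subgroup.m_closed[OF sub t subgroup.m_inv_closed[OF sub lS(1)]] by (simp only:)
  next
    assume "y \<in> S"
    then show "target y l \<in> S" by (rule subgroup.m_closed[OF sub _ lS(1)])
  qed
  have "one_label_corner_one G K r U L l n S"
    by (intro one_label_corner_one.intro one_label_corner.intro one_label_corner_axioms.intro
        one_label_corner_one_axioms.intro hopf_leavitt_axioms lab n closed one subgroup.subset[OF sub])
  then show ?thesis by (rule one_label_corner_one.not_stable_range_1)
qed

lemma conj_class_unique:
  assumes "C \<in> conj_classes G" "D \<in> conj_classes G" "x \<in> C" "x \<in> D"
  shows "C = D"
proof -
  have sub: "A \<subseteq> B" if AB: "A \<in> conj_classes G" "B \<in> conj_classes G" "x \<in> A" "x \<in> B" for A B
  proof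
    fix y assume y: "y \<in> A"
    obtain a where a: "a \<in> carrier G" "A = {g \<otimes>\<^bsub>G\<^esub> a \<otimes>\<^bsub>G\<^esub> inv\<^bsub>G\<^esub> g | g. g \<in> carrier G}"
      using AB(1) unfolding conj_classes_def by blast
    obtain b where b: "b \<in> carrier G" "B = {g \<otimes>\<^bsub>G\<^esub> b \<otimes>\<^bsub>G\<^esub> inv\<^bsub>G\<^esub> g | g. g \<in> carrier G}"
      using AB(2) unfolding conj_classes_def by blast
    obtain g where g: "g \<in> carrier G" "x = g \<otimes>\<^bsub>G\<^esub> a \<otimes>\<^bsub>G\<^esub> inv\<^bsub>G\<^esub> g" using AB(3) a(2) by blast
    obtain h where h: "h \<in> carrier G" "x = h \<otimes>\<^bsub>G\<^esub> b \<otimes>\<^bsub>G\<^esub> inv\<^bsub>G\<^esub> h" using AB(4) b(2) by blast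
    obtain k where k: "k \<in> carrier G" "y = k \<otimes>\<^bsub>G\<^esub> a \<otimes>\<^bsub>G\<^esub> inv\<^bsub>G\<^esub> k" using y a(2) by blast
    have "inv\<^bsub>G\<^esub> g \<otimes>\<^bsub>G\<^esub> x \<otimes>\<^bsub>G\<^esub> g = a"
      unfolding g(2) using g(1) a(1) by (simp add: G.m_assoc) (simp add: G.m_assoc[symmetric])
    then have "a = inv\<^bsub>G\<^esub> g \<otimes>\<^bsub>G\<^esub> (h \<otimes>\<^bsub>G\<^esub> b \<otimes>\<^bsub>G\<^esub> inv\<^bsub>G\<^esub> h) \<otimes>\<^bsub>G\<^esub> g" using h(2) by simp
    then have "y = (k \<otimes>\<^bsub>G\<^esub> inv\<^bsub>G\<^esub> g \<otimes>\<^bsub>G\<^esub> h) \<otimes>\<^bsub>G\<^esub> b \<otimes>\<^bsub>G\<^esub> inv\<^bsub>G\<^esub> (k \<otimes>\<^bsub>G\<^esub> inv\<^bsub>G\<^esub> g \<otimes>\<^bsub>G\<^esub> h)"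
      unfolding k(2) using g(1) h(1) k(1) b(1) by (simp add: G.m_assoc G.inv_mult_group)
    moreover have "k \<otimes>\<^bsub>G\<^esub> inv\<^bsub>G\<^esub> g \<otimes>\<^bsub>G\<^esub> h \<in> carrier G" using g(1) h(1) k(1) by simp
    ultimately show "y \<in> B" unfolding b(2) by blast
  qed
  show ?thesis using sub[of C D] sub[of D C] assms by blast
qed

text \<open>An element of \<open>G\<close> lies in one conjugacy class only, so the disjoint union
  behind \<open>ram_total\<close> corresponds to the set of labels; \<open>ctwo\<close> is the
  cardinality of \<open>bool\<close>.\<close>

lemma ctwo_le_ram_total_iff: "ctwo \<le>o ram_total G r \<longleftrightarrow> (\<exists>l1\<in>labels. \<exists>l2\<in>labels. l1 \<noteq> l2)"
proof -
  let ?B = "SIGMA C : conj_classes G. {..<r C} \<times> C"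
  have "ctwo \<le>o ram_total G r \<longleftrightarrow> (\<exists>f :: bool \<Rightarrow> _. inj_on f UNIV \<and> f ` UNIV \<subseteq> ?B)"
    unfolding ctwo_def ram_total_def by (rule card_of_ordLeq[symmetric])
  also have "\<dots> \<longleftrightarrow> (\<exists>l1\<in>labels. \<exists>l2\<in>labels. l1 \<noteq> l2)"
  proof
    assume "\<exists>f :: bool \<Rightarrow> _. inj_on f UNIV \<and> f ` UNIV \<subseteq> ?B"
    then obtain f :: "bool \<Rightarrow> _" where f: "inj_on f UNIV" "f ` UNIV \<subseteq> ?B" by blast
    obtain C i x where 1: "f True = (C, i, x)" by (cases "f True")
    obtain D j y where 2: "f False = (D, j, y)" by (cases "f False")
    have "f True \<in> ?B" "f False \<in> ?B" using f(2) by blast+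
    then have m: "C \<in> conj_classes G" "i < r C" "x \<in> C" "D \<in> conj_classes G" "j < r D" "y \<in> D"
      by (simp_all add: 1 2)
    have ne: "f True \<noteq> f False" using inj_onD[OF f(1), of True False] by auto
    have "(x, i) \<noteq> (y, j)"
    proof
      assume "(x, i) = (y, j)"
      then have "C = D" using conj_class_unique[OF m(1,4)] m(3,6) by simp
      then show False using ne \<open>(x, i) = (y, j)\<close> by (simp add: 1 2)
    qed
    moreover have "(x, i) \<in> labels" "(y, j) \<in> labels" using m by (auto simp: labels_def)
    ultimately show "\<exists>l1\<in>labels. \<exists>l2\<in>labels. l1 \<noteq> l2" by blast
  next
    assume "\<exists>l1\<in>labels. \<exists>l2\<in>labels. l1 \<noteq> l2"
    then obtain x i y j where l: "(x, i) \<in> labels" "(y, j) \<in> labels" "(x, i) \<noteq> (y, j)" by auto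
    obtain C where C: "C \<in> conj_classes G" "x \<in> C" "i < r C" using l(1) by (auto simp: labels_def)
    obtain D where D: "D \<in> conj_classes G" "y \<in> D" "j < r D" using l(2) by (auto simp: labels_def)
    show "\<exists>f :: bool \<Rightarrow> _. inj_on f UNIV \<and> f ` UNIV \<subseteq> ?B"
    proof (intro exI conjI)
      let ?f = "\<lambda>t :: bool. if t then (C, i, x) else (D, j, y)"
      show "inj_on ?f UNIV" using l(3) by (auto simp: inj_on_def)
      show "?f ` UNIV \<subseteq> ?B" using C D by auto
    qed
  qed
  finally show ?thesis .
qed

theorem stable_rank_hopf:
  "stable_rank U L =
    (if \<not> submonoid S G then 1
     else if ctwo \<le>o ram_total G r \<and> subgroup S G \<and> finite S then \<infinity>
     else 2)"
proof (cases "\<one>\<^bsub>G\<^esub> \<in> S")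
  case False
  then show ?thesis using stable_rank_eq_1[OF stable_range_1_of_no_cycles] by (simp add: submonoid_iff)
next
  case one: True
  show ?thesis
  proof (cases "\<exists>l1\<in>labels. \<exists>l2\<in>labels. l1 \<noteq> l2")
    case True
    then obtain l1 l2 where l: "l1 \<in> labels" "l2 \<in> labels" "l1 \<noteq> l2" by blast
    show ?thesis
    proof (cases "finite S")
      case fin: True
      then show ?thesis
        using stable_rank_infinite[OF one fin l] finite_subgroup[OF one fin] one True
        by (simp add: submonoid_iff ctwo_le_ram_total_iff)
    next
      case False
      then show ?thesis
        using stable_rank_eq_2[OF not_stable_range_1_of_exit[OF one l] stable_range_2_of_infinite[OF False]] one
        by (simp add: submonoid_iff)
    qed
  next
    case False
    \<comment> \<open>\<open>1\<close> is the end of a nonempty path, so there is a label; as no two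
      are distinct, there is exactly one.\<close>
    obtain ls where "ls \<noteq> []" "set ls \<subseteq> labels" using S_path[OF one G.one_closed] by blast
    then obtain l where "l \<in> labels" by (cases ls) auto
    then have lab: "labels = {l}" using False by blast
    then show ?thesis
      using stable_rank_eq_2[OF not_stable_range_1_of_one_label[OF lab one] stable_range_2_of_one_label[OF lab one]] one False
      by (simp add: submonoid_iff ctwo_le_ram_total_iff)
  qed
qed

end

theorem theorem3p7:
  fixes G :: "('g, 'm) monoid_scheme"
    and r :: "'g set \<Rightarrow> nat"
    and K :: "('k, 'n) ring_scheme"
  assumes "group G" and "field K"
  shows "stable_rank (leavitt_unitization K (hopf_graph G r)) (leavitt_path_algebra K (hopf_graph G r)) =
    (if \<not> submonoid (ram_semigroup G r) G then 1
     else if ctwo \<le>o ram_total G r \<and> subgroup (ram_semigroup G r) G \<and> finite (ram_semigroup G r) then \<infinity>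
     else 2)"
  by (rule hopf_leavitt.stable_rank_hopf[OF hopf_leavitt.intro[OF assms refl refl]])

end
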